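(* Let $G$ be a locally compact group and $1<p<\infty$. Then $FS_p(G)=\mathcal M_{cb}(A_p(G))$ as sets of functions on $G$, with equal norms.
   Context: Let $1<p<\infty$, $p'=p/(p-1)$. For an index set $I$, a function $\psi:I\times I\to\mathbb C$ is in $V_p(I)$ if for every $T\in\mathcal B(\ell_p(I))$ the matrix $\psi\cdot T$ defined by $\langle\delta_i^*,(\psi\cdot T)\delta_j\rangle=\psi(i,j)\langle\delta_i^*,T\delta_j\rangle$ defines a bounded operator on $\ell_p(I)$; then $T\mapsto\psi\cdot T$ is bounded on $\mathcal B(\ell_p(I))$ and $\|\psi\|_{V_p}$ is its norm. For a locally compact group $G$, $V_p(G)$ is the set of continuous $\psi:G\times G\to\mathbb C$ belonging to $V_p(G_d)$, $G_d$ being $G$ as a discrete index set. $FS_p(G)$ is the set of $u:G\to\mathbb C$ such that $\psi(s,t)=u(st^{-1})$ lies in $V_p(G)$, with $\|u\|_{FS_p}=\|\psi\|_{V_p}$. $\lambda_p(s)f(t)=f(s^{-1}t)$; $A_p(G)$ is the image of $\Lambda_p:L_{p'}(G)\hat\otimes L_p(G)\to C_0(G)$, $\Lambda_p(g\otimes f)(s)=\langle g,\lambda_p(s)f\rangle$, with quotient norm; its dual $PM_p(G)\subseteq\mathcal B(L_p(G))$ is the weak$^*$-closure of $\mathrm{span}\,\lambda_p(G)$. $\mathcal B(L_p(G))$ has matrix norms $\mathbb M_n(\mathcal B(L_p(G)))\subseteq\mathcal B(\ell_p^n\otimes_pL_p(G))$, and $A_p(G)$ has the dual $p$-operator space structure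 $\|\tau\|_n=\sup\{\|(\langle T_{kl},\tau_{ij}\rangle)\|_{\mathcal B(\ell_p^{nm})}:m,T\in\mathbb M_m(PM_p(G)),\|T\|_m\le1\}$. $\mathcal M_{cb}(A_p(G))$ is the set of functions $u$ on $G$ with $ua\in A_p(G)$ for all $a\in A_p(G)$ and such that $a\mapsto ua$ is $p$-completely bounded (entrywise amplifications uniformly bounded) on $A_p(G)$, normed by that $pcb$-norm. *)

theory Defs
  imports "HOL-Analysis.Analysis"
begin

text \<open>A locally compact group is modelled by a type of class topological_group_add
  (group written additively, not necessarily commutative: s t^{-1} is written s + - t)
  which is Hausdorff and locally compact.  A left Haar measure is a nonzero left invariant
  Radon measure on the Borel sets.\<close>

definition left_haar_measure :: "'g::{topological_group_add,t2_space} measure \<Rightarrow> bool" where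
  "left_haar_measure \<mu> \<longleftrightarrow>
     sets \<mu> = sets borel \<and>
     (\<forall>s. \<forall>A\<in>sets borel. emeasure \<mu> ((\<lambda>x. s + x) ` A) = emeasure \<mu> A) \<and>
     (\<forall>K. compact K \<longrightarrow> emeasure \<mu> K < \<infinity>) \<and>
     (\<forall>U. open U \<and> U \<noteq> {} \<longrightarrow> emeasure \<mu> U > 0) \<and>
     (\<forall>A\<in>sets borel. emeasure \<mu> A = (INF U\<in>{U. open U \<and> A \<subseteq> U}. emeasure \<mu> U)) \<and>
     (\<forall>U. open U \<longrightarrow> emeasure \<mu> U = (SUP K\<in>{K. compact K \<and> K \<subseteq> U}. emeasure \<mu> K))"

definition conj_exp :: "real \<Rightarrow> real" where
  "conj_exp p = p / (p - 1)"

definition Lp_mem :: "'a measure \<Rightarrow> real \<Rightarrow> ('a \<Rightarrow> complex) \<Rightarrow> bool" where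
  "Lp_mem \<mu> p f \<longleftrightarrow> f \<in> borel_measurable \<mu> \<and> integrable \<mu> (\<lambda>x. (cmod (f x)) powr p)"

definition Lp_norm :: "'a measure \<Rightarrow> real \<Rightarrow> ('a \<Rightarrow> complex) \<Rightarrow> real" where
  "Lp_norm \<mu> p f = (\<integral>x. (cmod (f x)) powr p \<partial>\<mu>) powr (1 / p)"

definition pairing :: "'a measure \<Rightarrow> ('a \<Rightarrow> complex) \<Rightarrow> ('a \<Rightarrow> complex) \<Rightarrow> complex" where
  "pairing \<mu> g f = (\<integral>x. g x * f x \<partial>\<mu>)"

text \<open>Bounded operators on L_p(mu), represented on representatives (functions),
  compatible with equality almost everywhere.\<close>
definition Lp_bdd_op :: "'a measure \<Rightarrow> real \<Rightarrow> (('a \<Rightarrow> complex) \<Rightarrow> ('a \<Rightarrow> complex)) \<Rightarrow> bool" where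
  "Lp_bdd_op \<mu> p T \<longleftrightarrow>
     (\<forall>f. Lp_mem \<mu> p f \<longrightarrow> Lp_mem \<mu> p (T f)) \<and>
     (\<forall>f g. Lp_mem \<mu> p f \<and> Lp_mem \<mu> p g \<and> (AE x in \<mu>. f x = g x) \<longrightarrow> (AE x in \<mu>. T f x = T g x)) \<and>
     (\<forall>f g c. Lp_mem \<mu> p f \<and> Lp_mem \<mu> p g \<longrightarrow>
         (AE x in \<mu>. T (\<lambda>y. f y + c * g y) x = T f x + c * T g x)) \<and>
     (\<exists>C. \<forall>f. Lp_mem \<mu> p f \<longrightarrow> Lp_norm \<mu> p (T f) \<le> C * Lp_norm \<mu> p f)"

text \<open>Norm of an m x m matrix (T k l) of operators on L_p, acting on l_p^m (x)_p L_p.\<close>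
definition Lp_mat_norm :: "'a measure \<Rightarrow> real \<Rightarrow> nat \<Rightarrow>
    (nat \<Rightarrow> nat \<Rightarrow> ('a \<Rightarrow> complex) \<Rightarrow> ('a \<Rightarrow> complex)) \<Rightarrow> ereal" where
  "Lp_mat_norm \<mu> p m T = Sup {ereal ((\<Sum>k<m. (Lp_norm \<mu> p (\<lambda>x. \<Sum>l<m. T k l (f l) x)) powr p) powr (1 / p))
      | f. (\<forall>l<m. Lp_mem \<mu> p (f l)) \<and> (\<Sum>l<m. (Lp_norm \<mu> p (f l)) powr p) \<le> 1}"

definition scal_mat_norm :: "real \<Rightarrow> nat \<Rightarrow> (nat \<Rightarrow> nat \<Rightarrow> complex) \<Rightarrow> ereal" where
  "scal_mat_norm p N A = Sup {ereal ((\<Sum>a<N. (cmod (\<Sum>b<N. A a b * x b)) powr p) powr (1 / p))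
      | x. (\<Sum>b<N. (cmod (x b)) powr p) \<le> 1}"

text \<open>An element of L_{p'}(G) projective-tensor L_p(G) is represented by sequences
  (g_n), (f_n) with sum of ||g_n||_{p'} ||f_n||_p finite, i.e. sum_n g_n (x) f_n.\<close>
definition ptensor :: "'a measure \<Rightarrow> real \<Rightarrow> (nat \<Rightarrow> 'a \<Rightarrow> complex) \<Rightarrow> (nat \<Rightarrow> 'a \<Rightarrow> complex) \<Rightarrow> bool" where
  "ptensor \<mu> p gs fs \<longleftrightarrow>
     (\<forall>n. Lp_mem \<mu> (conj_exp p) (gs n) \<and> Lp_mem \<mu> p (fs n)) \<and>
     summable (\<lambda>n. Lp_norm \<mu> (conj_exp p) (gs n) * Lp_norm \<mu> p (fs n))"

text \<open>The duality B(L_p) = (L_{p'} (x) L_p)^*.\<close>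
definition tfun :: "'a measure \<Rightarrow> (nat \<Rightarrow> 'a \<Rightarrow> complex) \<Rightarrow> (nat \<Rightarrow> 'a \<Rightarrow> complex) \<Rightarrow>
    (('a \<Rightarrow> complex) \<Rightarrow> ('a \<Rightarrow> complex)) \<Rightarrow> complex" where
  "tfun \<mu> gs fs T = (\<Sum>n. pairing \<mu> (gs n) (T (fs n)))"

definition lambda_p :: "'g::group_add \<Rightarrow> ('g \<Rightarrow> complex) \<Rightarrow> ('g \<Rightarrow> complex)" where
  "lambda_p s f = (\<lambda>t. f (- s + t))"

definition lambda_span :: "(('g::group_add \<Rightarrow> complex) \<Rightarrow> ('g \<Rightarrow> complex)) set" where
  "lambda_span = {(\<lambda>f t. \<Sum>j<k. c j * lambda_p (s j) f t) | (k::nat) c s. True}"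

text \<open>PM_p(G): the weak*-closure of span lambda_p(G) in B(L_p(G)), i.e. its closure in the
  initial topology of the functionals tfun gs fs (gs, fs ranging over L_{p'} (x) L_p).\<close>
definition PMp :: "'g::group_add measure \<Rightarrow> real \<Rightarrow> (('g \<Rightarrow> complex) \<Rightarrow> ('g \<Rightarrow> complex)) set" where
  "PMp \<mu> p = {T. Lp_bdd_op \<mu> p T \<and>
     (\<forall>(k::nat) (gs :: nat \<Rightarrow> nat \<Rightarrow> 'g \<Rightarrow> complex) fs (\<epsilon>::real).
        (\<forall>i<k. ptensor \<mu> p (gs i) (fs i)) \<and> \<epsilon> > 0 \<longrightarrow>
        (\<exists>S\<in>lambda_span. \<forall>i<k. cmod (tfun \<mu> (gs i) (fs i) S - tfun \<mu> (gs i) (fs i) T) < \<epsilon>))}"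

definition Ap_rep :: "'g::group_add measure \<Rightarrow> real \<Rightarrow> ('g \<Rightarrow> complex) \<Rightarrow>
    (nat \<Rightarrow> 'g \<Rightarrow> complex) \<Rightarrow> (nat \<Rightarrow> 'g \<Rightarrow> complex) \<Rightarrow> bool" where
  "Ap_rep \<mu> p u gs fs \<longleftrightarrow> ptensor \<mu> p gs fs \<and>
     (\<forall>s. u s = (\<Sum>n. pairing \<mu> (gs n) (lambda_p s (fs n))))"

definition Ap :: "'g::group_add measure \<Rightarrow> real \<Rightarrow> ('g \<Rightarrow> complex) set" where
  "Ap \<mu> p = {u. \<exists>gs fs. Ap_rep \<mu> p u gs fs}"

definition pm_pair :: "'g::group_add measure \<Rightarrow> real \<Rightarrow> (('g \<Rightarrow> complex) \<Rightarrow> ('g \<Rightarrow> complex)) \<Rightarrow>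
    ('g \<Rightarrow> complex) \<Rightarrow> complex" where
  "pm_pair \<mu> p T u = (SOME z. \<exists>gs fs. Ap_rep \<mu> p u gs fs \<and> z = tfun \<mu> gs fs T)"

text \<open>Dual p-operator space matrix norm of tau in M_n(A_p(G)); the nm x nm scalar matrix has
  row index (i,k) ~ i*m+k, column index (j,l) ~ j*m+l and entry <T_kl, tau_ij>.\<close>
definition Ap_mat_norm :: "'g::group_add measure \<Rightarrow> real \<Rightarrow> nat \<Rightarrow> (nat \<Rightarrow> nat \<Rightarrow> 'g \<Rightarrow> complex) \<Rightarrow> ereal" where
  "Ap_mat_norm \<mu> p n \<tau> = Sup {scal_mat_norm p (n * m)
        (\<lambda>a b. pm_pair \<mu> p (T (a mod m) (b mod m)) (\<tau> (a div m) (b div m)))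
      | m T. m > 0 \<and> (\<forall>k<m. \<forall>l<m. T k l \<in> PMp \<mu> p) \<and> Lp_mat_norm \<mu> p m T \<le> 1}"

definition Mcb_norm :: "'g::group_add measure \<Rightarrow> real \<Rightarrow> ('g \<Rightarrow> complex) \<Rightarrow> ereal" where
  "Mcb_norm \<mu> p u = Sup {Ap_mat_norm \<mu> p n (\<lambda>i j s. u s * \<tau> i j s)
      | n \<tau>. n > 0 \<and> (\<forall>i<n. \<forall>j<n. \<tau> i j \<in> Ap \<mu> p) \<and> Ap_mat_norm \<mu> p n \<tau> \<le> 1}"

definition Mcb :: "'g::group_add measure \<Rightarrow> real \<Rightarrow> ('g \<Rightarrow> complex) set" where
  "Mcb \<mu> p = {u. (\<forall>a\<in>Ap \<mu> p. (\<lambda>s. u s * a s) \<in> Ap \<mu> p) \<and> Mcb_norm \<mu> p u < \<infinity>}"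

definition lp_mem :: "real \<Rightarrow> ('i \<Rightarrow> complex) \<Rightarrow> bool" where
  "lp_mem p x \<longleftrightarrow> (\<lambda>i. (cmod (x i)) powr p) summable_on UNIV"

definition lp_norm :: "real \<Rightarrow> ('i \<Rightarrow> complex) \<Rightarrow> real" where
  "lp_norm p x = (\<Sum>\<^sub>\<infinity>i. (cmod (x i)) powr p) powr (1 / p)"

definition lp_bdd_op :: "real \<Rightarrow> (('i \<Rightarrow> complex) \<Rightarrow> ('i \<Rightarrow> complex)) \<Rightarrow> bool" where
  "lp_bdd_op p T \<longleftrightarrow>
     (\<forall>x. lp_mem p x \<longrightarrow> lp_mem p (T x)) \<and>
     (\<forall>x y c. lp_mem p x \<and> lp_mem p y \<longrightarrow> T (\<lambda>i. x i + c * y i) = (\<lambda>i. T x i + c * T y i)) \<and>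
     (\<exists>C. \<forall>x. lp_mem p x \<longrightarrow> lp_norm p (T x) \<le> C * lp_norm p x)"

definition lp_opnorm :: "real \<Rightarrow> (('i \<Rightarrow> complex) \<Rightarrow> ('i \<Rightarrow> complex)) \<Rightarrow> ereal" where
  "lp_opnorm p T = Sup {ereal (lp_norm p (T x)) | x. lp_mem p x \<and> lp_norm p x \<le> 1}"

definition delta :: "'i \<Rightarrow> 'i \<Rightarrow> complex" where
  "delta j = (\<lambda>i. if i = j then 1 else 0)"

definition schur_op :: "real \<Rightarrow> ('i \<times> 'i \<Rightarrow> complex) \<Rightarrow> (('i \<Rightarrow> complex) \<Rightarrow> ('i \<Rightarrow> complex)) \<Rightarrow>
    (('i \<Rightarrow> complex) \<Rightarrow> ('i \<Rightarrow> complex)) \<Rightarrow> bool" where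
  "schur_op p \<psi> T S \<longleftrightarrow> lp_bdd_op p S \<and> (\<forall>i j. S (delta j) i = \<psi> (i, j) * T (delta j) i)"

definition Vp_discrete :: "real \<Rightarrow> ('i \<times> 'i \<Rightarrow> complex) \<Rightarrow> bool" where
  "Vp_discrete p \<psi> \<longleftrightarrow> (\<forall>T. lp_bdd_op p T \<longrightarrow> (\<exists>S. schur_op p \<psi> T S))"

definition Vp_norm :: "real \<Rightarrow> ('i \<times> 'i \<Rightarrow> complex) \<Rightarrow> ereal" where
  "Vp_norm p \<psi> = Sup {lp_opnorm p (SOME S. schur_op p \<psi> T S) | T. lp_bdd_op p T \<and> lp_opnorm p T \<le> 1}"

definition Vp_group :: "real \<Rightarrow> ('g::topological_space \<times> 'g \<Rightarrow> complex) \<Rightarrow> bool" where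
  "Vp_group p \<psi> \<longleftrightarrow> continuous_on UNIV \<psi> \<and> Vp_discrete p \<psi>"

definition FSp :: "real \<Rightarrow> ('g::{group_add,topological_space} \<Rightarrow> complex) set" where
  "FSp p = {u. Vp_group p (\<lambda>(s, t). u (s + - t))}"

definition FSp_norm :: "real \<Rightarrow> ('g::group_add \<Rightarrow> complex) \<Rightarrow> ereal" where
  "FSp_norm p u = Vp_norm p (\<lambda>(s, t). u (s + - t))"

end

theory Submission
  imports Defs
begin

text \<open>The two sides are linked by one finite-dimensional condition, \<open>schur_bd\<close>:
  with \<psi>(s,t) = u(s + - t), entrywise multiplication by \<psi> increases the norm of matrices
  on l_p(F) by a factor of at most C, for all finite sets F of group elements.

  Between V_p and \<open>schur_bd\<close>. An operator on l_p over the whole index set is bounded by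
  C exactly when all its finite sections are, which gives \<open>schur_bd_imp_Vp\<close> and
  \<open>Vp_norm_imp_schur_bd\<close>. That membership in V_p provides any constant at all is a
  gliding hump argument: \<psi> is invariant under simultaneous right translation, so if no C
  worked, ever worse finite matrices could be moved to disjoint translates and combined into one
  block-diagonal contraction with unbounded Schur product
  (\<open>translation_invariant_schur_bd\<close>).

  From \<open>schur_bd\<close> to multipliers. With r = - s + t one has t + - r = s, so u(s) <g,
  lambda(s) f> is the integral of g(t) \<psi>(t,r) f(r) over t. An expansion of \<psi>(t,r) into
  products G_i(t) F_i(r) therefore turns u <g, lambda(.) f> into the sum of the coefficients <G_i g,
  lambda(.) F_i f>. What is needed is an expansion with sum of ||G_i g|| ||F_i f|| at most ||g||
  ||f|| + e, that is, a bound on the projective tensor norm of \<psi> in L_q(|g|^q) and L_p(|f|^p).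
  For step kernels the bound is finite-dimensional Hahn-Banach duality
  (\<open>projective_duality\<close>), the dual functional being a matrix to which the Schur bound
  applies (\<open>sample_decomposition\<close>). On compact supports \<psi> is a uniform limit of
  step kernels, but uniform convergence does not imply convergence in the projective norm. The
  remedy is to average in r over a nested sequence of finite partitions. At a fixed level the
  kernels have bounded rank, so uniform convergence suffices there. Across levels, uniform convexity
  of L_p bounds the number of large jumps of the averages (\<open>E_jump\<close>,
  \<open>R_V_jump\<close>). The outcome is a series of kernels with controlled total cost
  (\<open>kernel_series\<close>). Weighting by the sum of |f_l|^p treats all entries of a matrix of
  coefficients at once, which gives \<open>REP_compact\<close> and, after splitting into compactly
  supported pieces, \<open>REP_mult\<close>. Dually, multiplication by u has an adjoint
  \<open>MT\<close> on PM_p that is contractive on all matrix levels when C = 1, and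
  \<open>schur_bd_imp_Mcb\<close> follows by rescaling.

  From multipliers to \<open>schur_bd\<close>. Continuity of u follows by dividing u a by an a in
  A_p that does not vanish at the given point. Given distinct points s_1, ..., s_n, choose a
  neighbourhood W of 0 with disjoint translates s_i + W. Their normalised indicators embed l_p^n
  isometrically into L_p, so the coefficient matrix tau_ij = <g_i, lambda(.) f_j> has norm at most
  1, and tau_ij(s_i + - s_j) = 1. For a contractive scalar matrix t the matrix of operators t_kl
  lambda(s_k + - s_l) is contractive as well. Pairing it with u tau and keeping only the entries
  with k = i and l = j leaves u(s_i + - s_j) t_ij, whose norm is thus at most the multiplier norm
  (\<open>Mcb_imp_bilinear_bound\<close>).\<close>

section \<open>Conjugate exponents and strict convexity of the p-th power\<close>

definition conj_pair :: "real \<Rightarrow> real \<Rightarrow> bool" where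
  "conj_pair p q \<longleftrightarrow> 1 < p \<and> 1 < q \<and> 1 / p + 1 / q = 1"

lemma conj_pair_conj_exp: "1 < p \<Longrightarrow> conj_pair p (conj_exp p)"
  by (auto simp: conj_pair_def conj_exp_def field_simps)

lemma conj_pair_sym: "conj_pair p q \<Longrightarrow> conj_pair q p"
  by (auto simp: conj_pair_def)

lemma conj_pairD:
  assumes "conj_pair p q"
  shows "1 < p" "1 < q" "0 < p" "0 < q"
  using assms unfolding conj_pair_def by auto

lemma conj_pair_eqs:
  assumes "conj_pair p q"
  shows "1 / q + 1 / p = 1" "1 / p + 1 / q = 1" "(p - 1) * q = p" "q = conj_exp p" "p / q = p - 1"
  using assms unfolding conj_pair_def conj_exp_def
      apply (auto simp: field_simps)
  done

text \<open>The mean value theorem on either side of 1 gives strictness. The weak form of this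
  inequality yields convexity and hence Minkowski; the strict form yields uniform convexity.\<close>

lemma powr_strict_tangent:
  fixes u p :: real
  assumes "0 \<le> u" "u \<noteq> 1" "1 < p"
  shows "1 + p * (u - 1) < u powr p"
proof (cases "u = 0")
  case True
  then show ?thesis using assms by simp
next
  case False
  then have u: "0 < u" using assms by simp
  consider "u < 1" | "1 < u" using assms by linarith
  then show ?thesis
  proof cases
    case 1
    have "\<exists>z. u < z \<and> z < 1 \<and> 1 powr p - u powr p = (1 - u) * (p * z powr (p - 1))"
      by (rule MVT2) (use 1 u in \<open>auto intro!: derivative_eq_intros\<close>)
    then obtain z where z: "u < z" "z < 1" "1 - u powr p = (1 - u) * (p * z powr (p - 1))" by auto
    have "z powr (p - 1) < 1 powr (p - 1)" using z u assms by (intro powr_less_mono2) auto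
    then have "(1 - u) * (p * z powr (p - 1)) < (1 - u) * (p * 1)" using 1 assms by (intro mult_strict_left_mono) auto
    then show ?thesis using z by (simp add: algebra_simps)
  next
    case 2
    have "\<exists>z. 1 < z \<and> z < u \<and> u powr p - 1 powr p = (u - 1) * (p * z powr (p - 1))"
      by (rule MVT2) (use 2 in \<open>auto intro!: derivative_eq_intros\<close>)
    then obtain z where z: "1 < z" "z < u" "u powr p - 1 = (u - 1) * (p * z powr (p - 1))" by auto
    have "1 powr (p - 1) < z powr (p - 1)" using z assms by (intro powr_less_mono2) auto
    then have "(u - 1) * (p * 1) < (u - 1) * (p * z powr (p - 1))" using 2 assms by (intro mult_strict_left_mono) auto
    then show ?thesis using z by (simp add: algebra_simps)
  qed
qed

lemma powr_tangent:
  fixes u p :: real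
  assumes "0 \<le> u" "1 < p"
  shows "1 + p * (u - 1) \<le> u powr p"
  using powr_strict_tangent[of u p] assms by (cases "u = 1") auto

text \<open>Add the tangent inequalities at a/c and b/c with weights s and 1 - s, where c is the
  weighted mean: the linear terms cancel, and homogeneity does the rest.\<close>

lemma powr_convex_combination:
  fixes a b s p :: real
  assumes "0 \<le> a" "0 \<le> b" "0 \<le> s" "s \<le> 1" "1 < p"
  shows "(s * a + (1 - s) * b) powr p \<le> s * a powr p + (1 - s) * b powr p"
proof -
  define c where "c = s * a + (1 - s) * b"
  have c0: "0 \<le> c" using assms by (simp add: c_def)
  show ?thesis
  proof (cases "c = 0")
    case True
    then show ?thesis using assms unfolding c_def[symmetric] by (simp add: add_nonneg_nonneg)
  next
    case False
    then have c: "c > 0" using c0 by simp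
    have "1 + p * (a / c - 1) \<le> (a / c) powr p" "1 + p * (b / c - 1) \<le> (b / c) powr p"
      using powr_tangent c assms by auto
    then have "s * (1 + p * (a / c - 1)) + (1 - s) * (1 + p * (b / c - 1))
        \<le> s * (a / c) powr p + (1 - s) * (b / c) powr p"
      using assms by (intro add_mono mult_left_mono) auto
    also have "s * (1 + p * (a / c - 1)) + (1 - s) * (1 + p * (b / c - 1)) = 1 - p + p * (s * a + (1 - s) * b) / c"
      using c by (simp add: field_simps)
    also have "\<dots> = 1" using c by (simp add: c_def[symmetric])
    finally have "1 \<le> (s * a powr p + (1 - s) * b powr p) / c powr p"
      using c assms by (simp add: powr_divide add_divide_distrib)
    then show ?thesis using c unfolding c_def[symmetric] by (simp add: field_simps)
  qed
qed

lemma powr_sum_le: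
  fixes a b p :: real
  assumes "0 \<le> a" "0 \<le> b" "1 < p"
  shows "(a + b) powr p \<le> 2 powr p * (a powr p + b powr p)"
proof -
  have "(a + b) powr p = 2 powr p * ((1/2) * a + (1 - 1/2) * b) powr p"
    using assms by (subst powr_mult[symmetric]) (auto simp: algebra_simps)
  also have "\<dots> \<le> 2 powr p * ((1/2) * a powr p + (1 - 1/2) * b powr p)"
    using assms by (intro mult_left_mono powr_convex_combination) auto
  also have "\<dots> \<le> 2 powr p * (a powr p + b powr p)"
    by (intro mult_left_mono add_mono) (auto simp: mult_left_le_one_le)
  finally show ?thesis .
qed

text \<open>The defect in the midpoint inequality for the p-th power of the modulus. Uniform
  convexity is expressed below as control of |a - b| by this quantity.\<close>

definition convexity_gap :: "real \<Rightarrow> complex \<Rightarrow> complex \<Rightarrow> real" where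
  "convexity_gap p a b = (cmod a powr p + cmod b powr p) / 2 - cmod ((a + b) / 2) powr p"

text \<open>If the moduli agree, a vanishing gap would mean equality in the triangle inequality and
  so a = b. If they differ, the strict tangent inequality at x/c and y/c, c being the mean modulus,
  already separates the two sides.\<close>

lemma convexity_gap_pos:
  assumes "a \<noteq> b" "1 < p"
  shows "0 < convexity_gap p a b"
proof -
  define x y where "x = cmod a" and "y = cmod b"
  define c where "c = (x + y) / 2"
  have xy: "0 \<le> x" "0 \<le> y" by (auto simp: x_def y_def)
  have "x + y \<noteq> 0" using assms xy by (auto simp: x_def y_def add_nonneg_eq_0_iff)
  then have cpos: "c > 0" using xy by (simp add: c_def)
  have m: "cmod ((a + b) / 2) \<le> c" by (simp add: c_def x_def y_def norm_divide norm_triangle_ineq)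
  show ?thesis
  proof (cases "x = y")
    case True
    have "cmod ((a + b) / 2) < c"
    proof (rule ccontr)
      assume "\<not> ?thesis"
      then have "cmod (a + b) = cmod a + cmod b" using m by (simp add: c_def x_def y_def norm_divide)
      then have "cmod a *\<^sub>R b = cmod b *\<^sub>R a" by (simp add: norm_triangle_eq)
      then show False using True assms cpos by (auto simp: x_def y_def c_def)
    qed
    then have "cmod ((a + b) / 2) powr p < c powr p" using assms by (intro powr_less_mono2) auto
    then show ?thesis using True by (simp add: convexity_gap_def c_def x_def y_def)
  next
    case False
    then have "x / c \<noteq> 1" "y / c \<noteq> 1" using cpos by (auto simp: c_def)
    then have "1 + p * (x / c - 1) < (x / c) powr p" "1 + p * (y / c - 1) < (y / c) powr p"
      using powr_strict_tangent xy cpos assms by auto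
    then have "(1 + p * (x / c - 1)) + (1 + p * (y / c - 1)) < (x / c) powr p + (y / c) powr p" by linarith
    also have "(1 + p * (x / c - 1)) + (1 + p * (y / c - 1)) = 2 - 2 * p + p * (x + y) / c"
      using cpos by (simp add: field_simps)
    also have "\<dots> = 2" using cpos by (simp add: c_def)
    finally have "2 < (x powr p + y powr p) / c powr p" using xy cpos by (simp add: powr_divide add_divide_distrib)
    then have "c powr p < (x powr p + y powr p) / 2" using cpos by (simp add: field_simps)
    moreover have "cmod ((a + b) / 2) powr p \<le> c powr p" using m assms by (intro powr_mono2) auto
    ultimately show ?thesis by (simp add: convexity_gap_def x_def y_def)
  qed
qed

lemma convexity_gap_nonneg: "1 < p \<Longrightarrow> 0 \<le> convexity_gap p a b"
  using convexity_gap_pos[of a b p] by (cases "a = b") (auto simp: convexity_gap_def)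

lemma convexity_gap_scale:
  assumes "0 \<le> r"
  shows "convexity_gap p (of_real r * a) (of_real r * b) = r powr p * convexity_gap p a b"
proof -
  have "cmod ((of_real r * a + of_real r * b) / 2) = r * cmod ((a + b) / 2)"
    using assms by (simp add: norm_mult norm_divide flip: distrib_left)
  then have "cmod ((of_real r * a + of_real r * b) / 2) powr p = r powr p * cmod ((a + b) / 2) powr p"
    using assms by (simp only: powr_mult norm_ge_zero)
  then show ?thesis using assms unfolding convexity_gap_def
    by (simp only: norm_mult) (simp add: powr_mult algebra_simps)
qed

text \<open>Compactness: on the set where |a|^p + |b|^p = 1 and |a - b|^p is at least \<epsilon>,
  the gap has a positive minimum; homogeneity removes the normalisation. The form is linear in p-th
  powers so that it can be integrated without further work.\<close>

lemma uniform_convexity_scalar: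
  assumes p: "1 < p" and e: "0 < \<epsilon>"
  obtains K where "0 \<le> K"
    "\<And>a b :: complex. cmod (a - b) powr p \<le> \<epsilon> * (cmod a powr p + cmod b powr p) + K * convexity_gap p a b"
proof -
  define f where "f = (\<lambda>z::complex\<times>complex. cmod (fst z) powr p + cmod (snd z) powr p)"
  define g where "g = (\<lambda>z::complex\<times>complex. cmod (fst z - snd z) powr p)"
  define h where "h = (\<lambda>z::complex\<times>complex. convexity_gap p (fst z) (snd z))"
  have cf: "continuous_on UNIV f" "continuous_on UNIV g" "continuous_on UNIV h"
    unfolding f_def g_def h_def convexity_gap_def using p
    by (auto intro!: continuous_intros continuous_on_powr')
  define S where "S = {z. f z = 1} \<inter> {z. \<epsilon> \<le> g z}"
  have clS: "closed S" unfolding S_def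
    using cf by (intro closed_Int closed_Collect_eq closed_Collect_le) (auto intro: continuous_intros)
  have bd: "cmod (fst z) \<le> 1 \<and> cmod (snd z) \<le> 1" if "f z = 1" for z
  proof -
    have "cmod (fst z) powr p \<le> 1 powr p" "cmod (snd z) powr p \<le> 1 powr p"
      using that unfolding f_def by (smt (verit) powr_ge_zero powr_one_eq_one)+
    then show ?thesis using p by (metis linorder_not_less norm_ge_zero powr_less_mono2 zero_le_one less_trans zero_less_one)
  qed
  have "bounded S"
  proof (rule boundedI)
    fix z assume "z \<in> S"
    then have "cmod (fst z) \<le> 1 \<and> cmod (snd z) \<le> 1" using bd by (simp add: S_def)
    then show "norm z \<le> 2" using norm_Pair_le[of "fst z" "snd z"] by simp
  qed
  then have cS: "compact S" using clS by (simp add: compact_eq_bounded_closed)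
  have g2: "g z \<le> 2 powr p" if "f z = 1" for z
    unfolding g_def using bd[OF that] norm_triangle_ineq4[of "fst z" "snd z"] p by (intro powr_mono2) auto
  have "\<exists>K\<ge>0. \<forall>z. f z = 1 \<longrightarrow> g z \<le> \<epsilon> + K * h z"
  proof (cases "S = {}")
    case True
    then have "\<forall>z. f z = 1 \<longrightarrow> g z \<le> \<epsilon>" by (auto simp: S_def not_le intro: less_imp_le)
    then show ?thesis by (intro exI[of _ 0]) auto
  next
    case False
    obtain z0 where z0: "z0 \<in> S" "\<And>z. z \<in> S \<Longrightarrow> h z0 \<le> h z"
      using continuous_attains_inf[OF cS False continuous_on_subset[OF cf(3)]] by auto
    have "fst z0 \<noteq> snd z0" using z0(1) e by (auto simp: S_def g_def)
    then have d: "0 < h z0" unfolding h_def using convexity_gap_pos p by auto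
    show ?thesis
    \<comment> \<open>K is an upper bound of |a - b|^p on the normalised set divided by the minimum
      of the gap on S.\<close>
    proof (intro exI[of _ "2 powr p / h z0"] conjI allI impI)
      show "0 \<le> 2 powr p / h z0" using d by simp
      fix z assume z: "f z = 1"
      show "g z \<le> \<epsilon> + 2 powr p / h z0 * h z"
      proof (cases "z \<in> S")
        case True
        then have "h z0 \<le> h z" using z0 by simp
        then have "2 powr p \<le> 2 powr p / h z0 * h z" using d by (simp add: field_simps)
        then show ?thesis using g2[OF z] e by linarith
      next
        case False
        then have "g z < \<epsilon>" using z by (simp add: S_def)
        moreover have "0 \<le> 2 powr p / h z0 * h z" using d convexity_gap_nonneg[OF p] by (simp add: h_def)
        ultimately show ?thesis by linarith
      qed
    qed
  qed
  then obtain K where K: "K \<ge> 0" "\<And>z. f z = 1 \<Longrightarrow> g z \<le> \<epsilon> + K * h z" by blast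
  show ?thesis
  proof (rule that[OF K(1)])
    fix a b :: complex
    define s where "s = cmod a powr p + cmod b powr p"
    show "cmod (a - b) powr p \<le> \<epsilon> * (cmod a powr p + cmod b powr p) + K * convexity_gap p a b"
    proof (cases "s = 0")
      case True
      then have "a = 0" "b = 0" by (auto simp: s_def add_nonneg_eq_0_iff)
      then show ?thesis by (simp add: convexity_gap_def)
    next
      case False
      then have s: "s > 0" by (simp add: s_def order_less_le add_nonneg_nonneg)
      \<comment> \<open>Both sides are homogeneous of degree p, so dividing by r reduces to the
        normalised case f = 1.\<close>
      define r where "r = s powr (1 / p)"
      have r: "r > 0" "r powr p = s" using s p by (auto simp: r_def powr_powr)
      define a' b' where "a' = a / of_real r" and "b' = b / of_real r"
      have ab: "a = of_real r * a'" "b = of_real r * b'" using r by (auto simp: a'_def b'_def)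
      have 1: "f (a', b') = 1" using r s by (simp add: f_def a'_def b'_def norm_divide powr_divide flip: add_divide_distrib s_def)
      have "cmod (a - b) powr p = r powr p * g (a', b')"
        unfolding ab g_def using r by (simp add: norm_mult powr_mult flip: right_diff_distrib)
      also have "\<dots> \<le> r powr p * (\<epsilon> + K * h (a', b'))" using K(2)[OF 1] by (intro mult_left_mono) auto
      also have "\<dots> = \<epsilon> * s + K * (r powr p * h (a', b'))" using r by (simp add: algebra_simps)
      also have "r powr p * h (a', b') = convexity_gap p a b"
        unfolding ab h_def using convexity_gap_scale[of r p a' b'] r by simp
      finally show ?thesis by (simp add: s_def)
    qed
  qed
qed

section \<open>L_p spaces: Hoelder, Minkowski and the duality map\<close>

lemma Lp_memD:
  assumes "Lp_mem M p f"
  shows "f \<in> borel_measurable M" "integrable M (\<lambda>x. cmod (f x) powr p)"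
  using assms by (auto simp: Lp_mem_def)

lemma Lp_norm_nonneg [simp]: "0 \<le> Lp_norm M p f"
  by (simp add: Lp_norm_def)

lemma Lp_norm_powr: "p \<noteq> 0 \<Longrightarrow> Lp_norm M p f powr p = (\<integral>x. cmod (f x) powr p \<partial>M)"
  by (simp add: Lp_norm_def powr_powr integral_nonneg_AE)

lemma Lp_mem_zero [simp]: "Lp_mem M p (\<lambda>x. 0)"
  by (simp add: Lp_mem_def)

lemma Lp_norm_zero [simp]: "Lp_norm M p (\<lambda>x. 0) = 0"
  by (simp add: Lp_norm_def)

lemma Lp_mem_bound:
  assumes "Lp_mem M p f" "g \<in> borel_measurable M" "0 < p" "AE x in M. cmod (g x) \<le> cmod (f x)"
  shows "Lp_mem M p g"
  unfolding Lp_mem_def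
proof (intro conjI assms(2) Bochner_Integration.integrable_bound[OF Lp_memD(2)[OF assms(1)]])
  show "AE x in M. norm (cmod (g x) powr p) \<le> norm (cmod (f x) powr p)"
    using assms(4) by eventually_elim (use assms(3) in \<open>auto intro: powr_mono2\<close>)
qed (use assms in measurable)

lemma Lp_norm_mono:
  assumes "Lp_mem M p f" "0 < p" "g \<in> borel_measurable M" "AE x in M. cmod (g x) \<le> cmod (f x)"
  shows "Lp_norm M p g \<le> Lp_norm M p f"
  unfolding Lp_norm_def
proof (intro powr_mono2 integral_mono_AE)
  show "integrable M (\<lambda>x. cmod (g x) powr p)" "integrable M (\<lambda>x. cmod (f x) powr p)"
    using Lp_mem_bound[OF assms(1,3,2,4)] assms(1) by (auto simp: Lp_mem_def)
  show "AE x in M. cmod (g x) powr p \<le> cmod (f x) powr p"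
    using assms(4) by eventually_elim (use assms(2) in \<open>auto intro: powr_mono2\<close>)
qed (use assms in \<open>auto intro!: integral_nonneg_AE\<close>)

lemma Lp_mem_cmult: "Lp_mem M p f \<Longrightarrow> Lp_mem M p (\<lambda>x. c * f x)"
  unfolding Lp_mem_def by (auto simp: norm_mult powr_mult)

lemma Lp_norm_cmult: "0 < p \<Longrightarrow> Lp_norm M p (\<lambda>x. c * f x) = cmod c * Lp_norm M p f"
  unfolding Lp_norm_def by (simp add: norm_mult powr_mult powr_powr integral_nonneg_AE)

lemma Lp_mem_add:
  assumes "Lp_mem M p f" "Lp_mem M p g" "1 < p"
  shows "Lp_mem M p (\<lambda>x. f x + g x)"
  unfolding Lp_mem_def
proof
  note [measurable] = Lp_memD(1)[OF assms(1)] Lp_memD(1)[OF assms(2)]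
  show m: "(\<lambda>x. f x + g x) \<in> borel_measurable M" by measurable
  have b: "cmod (f x + g x) powr p \<le> 2 powr p * (cmod (f x) powr p + cmod (g x) powr p)" for x
  proof -
    have "cmod (f x + g x) powr p \<le> (cmod (f x) + cmod (g x)) powr p"
      using assms(3) norm_triangle_ineq by (intro powr_mono2) auto
    also have "\<dots> \<le> 2 powr p * (cmod (f x) powr p + cmod (g x) powr p)"
      using assms(3) by (intro powr_sum_le) auto
    finally show ?thesis .
  qed
  show "integrable M (\<lambda>x. cmod (f x + g x) powr p)"
    by (rule Bochner_Integration.integrable_bound[of M "\<lambda>x. 2 powr p * (cmod (f x) powr p + cmod (g x) powr p)"])
       (use assms b in \<open>auto simp: Lp_mem_def\<close>)
qed

lemma Lp_mem_diff:
  assumes "Lp_mem M p f" "Lp_mem M p g" "1 < p"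
  shows "Lp_mem M p (\<lambda>x. f x - g x)"
  using Lp_mem_add[OF assms(1) Lp_mem_cmult[OF assms(2), of "-1"] assms(3)] by simp

lemma Lp_mem_sum:
  assumes "\<And>i. i \<in> I \<Longrightarrow> Lp_mem M p (f i)" "1 < p"
  shows "Lp_mem M p (\<lambda>x. \<Sum>i\<in>I. f i x)"
  using assms by (induction I rule: infinite_finite_induct) (auto intro: Lp_mem_add)

lemma Lp_mem_mult_bounded:
  assumes "Lp_mem M p f" "h \<in> borel_measurable M" "\<And>x. x \<in> space M \<Longrightarrow> cmod (h x) \<le> B" "0 < p"
  shows "Lp_mem M p (\<lambda>x. h x * f x)"
proof (rule Lp_mem_bound[OF Lp_mem_cmult[OF assms(1), of "of_real \<bar>B\<bar>"]])
  show "(\<lambda>x. h x * f x) \<in> borel_measurable M" using assms by (auto simp: Lp_mem_def)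
  show "AE x in M. cmod (h x * f x) \<le> cmod (complex_of_real \<bar>B\<bar> * f x)"
  proof (rule AE_I2)
    fix x assume "x \<in> space M"
    then have "cmod (h x) \<le> \<bar>B\<bar>" using assms(3) by force
    then show "cmod (h x * f x) \<le> cmod (complex_of_real \<bar>B\<bar> * f x)" by (simp add: norm_mult mult_right_mono)
  qed
qed fact

lemma Lp_mem_indicator_mult:
  "\<lbrakk>Lp_mem M p f; A \<in> sets M; 0 < p\<rbrakk> \<Longrightarrow> Lp_mem M p (\<lambda>x. indicator A x * f x)"
  by (rule Lp_mem_mult_bounded[where B = 1]) (auto simp: indicator_def)

lemma Lp_norm_cong_AE:
  "\<lbrakk>AE x in M. f x = g x; f \<in> borel_measurable M; g \<in> borel_measurable M\<rbrakk> \<Longrightarrow> Lp_norm M p f = Lp_norm M p g"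
  unfolding Lp_norm_def by (subst integral_cong_AE[where g = "\<lambda>x. cmod (g x) powr p"]) auto

lemma Lp_norm_eq_0:
  assumes "Lp_mem M p f" "0 < p"
  shows "Lp_norm M p f = 0 \<longleftrightarrow> (AE x in M. f x = 0)"
  using integral_nonneg_eq_0_iff_AE[OF Lp_memD(2)[OF assms(1)]]
  by (auto simp: Lp_norm_def)

lemma Lp_norm_minus_commute: "Lp_norm M p (\<lambda>x. f x - g x) = Lp_norm M p (\<lambda>x. g x - f x)"
  by (simp add: Lp_norm_def norm_minus_commute)

lemma young_complex:
  assumes "conj_pair p q"
  shows "cmod (g * f) \<le> cmod g powr q / q + cmod f powr p / p"
  using Youngs_inequality[of q p "cmod g" "cmod f"] conj_pairD[OF assms] conj_pair_eqs(1)[OF assms] by (simp add: norm_mult add.commute)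

lemma Holder_integrable:
  assumes pq: "conj_pair p q" and g: "Lp_mem M q g" and f: "Lp_mem M p f"
  shows "integrable M (\<lambda>x. g x * f x)"
proof (rule Bochner_Integration.integrable_bound[of M "\<lambda>x. cmod (g x) powr q / q + cmod (f x) powr p / p"])
  show "AE x in M. norm (g x * f x) \<le> norm (cmod (g x) powr q / q + cmod (f x) powr p / p)"
    using young_complex[OF pq] by (intro AE_I2) (smt (verit) real_norm_def)
qed (use Lp_memD[OF f] Lp_memD[OF g] in auto)

lemma Holder_norm_integral:
  assumes pq: "conj_pair p q" and g: "Lp_mem M q g" and f: "Lp_mem M p f"
  shows "(\<integral>x. cmod (g x * f x) \<partial>M) \<le> Lp_norm M q g * Lp_norm M p f"
proof -
  note P = conj_pairD[OF pq]
  define a b where "a = Lp_norm M q g" and "b = Lp_norm M p f"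
  have ab: "0 \<le> a" "0 \<le> b" by (auto simp: a_def b_def)
  show ?thesis
  proof (cases "a = 0 \<or> b = 0")
    case True
    then have "AE x in M. cmod (g x * f x) = 0"
      using Lp_norm_eq_0[OF f] Lp_norm_eq_0[OF g] P by (auto simp: a_def b_def)
    then have "(\<integral>x. cmod (g x * f x) \<partial>M) = 0" by (rule integral_eq_zero_AE)
    then show ?thesis by simp
  next
    case False
    then have ab': "0 < a" "0 < b" using ab by auto
    have "(\<integral>x. cmod (g x * f x) \<partial>M) = a * b * (\<integral>x. cmod (g x / of_real a * (f x / of_real b)) \<partial>M)"
      using ab' by (simp add: norm_mult norm_divide)
    also have "(\<integral>x. cmod (g x / of_real a * (f x / of_real b)) \<partial>M) \<le>
        (\<integral>x. (cmod (g x) powr q / a powr q) / q + (cmod (f x) powr p / b powr p) / p \<partial>M)"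
    proof (rule integral_mono)
      have "integrable M (\<lambda>x. g x * f x)" by (rule Holder_integrable[OF assms])
      then show "integrable M (\<lambda>x. cmod (g x / of_real a * (f x / of_real b)))"
        by (simp add: norm_divide flip: norm_mult)
      show "cmod (g x / of_real a * (f x / of_real b)) \<le> (cmod (g x) powr q / a powr q) / q + (cmod (f x) powr p / b powr p) / p" for x
        using young_complex[OF pq, of "g x / of_real a" "f x / of_real b"] ab' by (simp add: norm_divide powr_divide)
    qed (use Lp_memD[OF f] Lp_memD[OF g] in auto)
    also have "\<dots> = (\<integral>x. cmod (g x) powr q \<partial>M) / a powr q / q + (\<integral>x. cmod (f x) powr p \<partial>M) / b powr p / p"
      using Lp_memD[OF f] Lp_memD[OF g] by simp
    also have "\<dots> = 1 / q + 1 / p"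
    proof -
      have "(\<integral>x. cmod (g x) powr q \<partial>M) = a powr q" "(\<integral>x. cmod (f x) powr p \<partial>M) = b powr p"
        using P by (auto simp: a_def b_def Lp_norm_powr)
      then show ?thesis using ab' by simp
    qed
    also have "\<dots> = 1" by (rule conj_pair_eqs(1)[OF pq])
    finally show ?thesis using ab' by (simp flip: a_def b_def)
  qed
qed

lemma Holder_pairing:
  assumes pq: "conj_pair p q" and g: "Lp_mem M q g" and f: "Lp_mem M p f"
  shows "cmod (pairing M g f) \<le> Lp_norm M q g * Lp_norm M p f"
  unfolding pairing_def
  using integral_norm_bound[of M "\<lambda>x. g x * f x"] Holder_norm_integral[OF assms] by linarith

lemma Minkowski:
  assumes f: "Lp_mem M p f" and g: "Lp_mem M p g" and p: "1 < p"
  shows "Lp_norm M p (\<lambda>x. f x + g x) \<le> Lp_norm M p f + Lp_norm M p g"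
proof -
  define a b where "a = Lp_norm M p f" and "b = Lp_norm M p g"
  have ab: "0 \<le> a" "0 \<le> b" by (auto simp: a_def b_def)
  note [measurable] = Lp_memD(1)[OF f] Lp_memD(1)[OF g]
  consider "a = 0" | "b = 0" | "0 < a" "0 < b" using ab by linarith
  then show ?thesis
  proof cases
    case 1
    then have "AE x in M. f x = 0" using Lp_norm_eq_0[OF f] p by (simp add: a_def)
    then have "Lp_norm M p (\<lambda>x. f x + g x) = Lp_norm M p g" by (intro Lp_norm_cong_AE) auto
    then show ?thesis by simp
  next
    case 2
    then have "AE x in M. g x = 0" using Lp_norm_eq_0[OF g] p by (simp add: b_def)
    then have "Lp_norm M p (\<lambda>x. f x + g x) = Lp_norm M p f" by (intro Lp_norm_cong_AE) auto
    then show ?thesis by simp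
  next
    case 3
    \<comment> \<open>With this weight |f| + |g| is a + b times a convex combination of the
      normalised functions |f|/a and |g|/b, to which pointwise convexity of the p-th power
      applies.\<close>
    define s where "s = a / (a + b)"
    have s: "0 \<le> s" "s \<le> 1" "1 - s = b / (a + b)" using 3 by (auto simp: s_def field_simps)
    have pw: "cmod (f x + g x) powr p \<le> (a + b) powr p * (s * (cmod (f x) powr p / a powr p) + (1 - s) * (cmod (g x) powr p / b powr p))" for x
    proof -
      have "cmod (f x + g x) powr p \<le> (cmod (f x) + cmod (g x)) powr p"
        using p norm_triangle_ineq by (intro powr_mono2) auto
      also have "cmod (f x) + cmod (g x) = (a + b) * (s * (cmod (f x) / a) + (1 - s) * (cmod (g x) / b))"
      proof -
        have "(a + b) * (s * (cmod (f x) / a)) = cmod (f x)" "(a + b) * ((1 - s) * (cmod (g x) / b)) = cmod (g x)"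
          using 3 unfolding s(3) unfolding s_def by auto
        then show ?thesis by (simp only: distrib_left)
      qed
      also have "\<dots> powr p = (a + b) powr p * (s * (cmod (f x) / a) + (1 - s) * (cmod (g x) / b)) powr p"
        by (rule powr_mult)
      also have "\<dots> \<le> (a + b) powr p * (s * (cmod (f x) / a) powr p + (1 - s) * (cmod (g x) / b) powr p)"
        using 3 s p by (intro mult_left_mono powr_convex_combination) auto
      finally show ?thesis using 3 by (simp add: powr_divide)
    qed
    have "(\<integral>x. cmod (f x + g x) powr p \<partial>M) \<le> (\<integral>x. (a + b) powr p * (s * (cmod (f x) powr p / a powr p) + (1 - s) * (cmod (g x) powr p / b powr p)) \<partial>M)"
      by (rule integral_mono) (use pw Lp_memD[OF f] Lp_memD[OF g] Lp_memD[OF Lp_mem_add[OF f g p]] in auto)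
    also have "\<dots> = (a + b) powr p * (s * ((\<integral>x. cmod (f x) powr p \<partial>M) / a powr p) + (1 - s) * ((\<integral>x. cmod (g x) powr p \<partial>M) / b powr p))"
      using Lp_memD[OF f] Lp_memD[OF g] by simp
    also have "\<dots> = (a + b) powr p"
    proof -
      have "(\<integral>x. cmod (f x) powr p \<partial>M) = a powr p" "(\<integral>x. cmod (g x) powr p \<partial>M) = b powr p"
        using p by (auto simp: a_def b_def Lp_norm_powr)
      then show ?thesis using 3 by simp
    qed
    finally have "(\<integral>x. cmod (f x + g x) powr p \<partial>M) powr (1/p) \<le> ((a + b) powr p) powr (1/p)"
      using p by (intro powr_mono2) (auto intro!: integral_nonneg_AE)
    also have "\<dots> = a + b" using p ab by (simp add: powr_powr)
    finally show ?thesis by (simp add: a_def b_def Lp_norm_def)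
  qed
qed

lemma Lp_norm_sum_le:
  assumes "\<And>i. i \<in> I \<Longrightarrow> Lp_mem M p (f i)" "1 < p"
  shows "Lp_norm M p (\<lambda>x. \<Sum>i\<in>I. f i x) \<le> (\<Sum>i\<in>I. Lp_norm M p (f i))"
  using assms
proof (induction I rule: infinite_finite_induct)
  case (insert i I)
  have "Lp_norm M p (\<lambda>x. f i x + (\<Sum>i\<in>I. f i x)) \<le> Lp_norm M p (f i) + Lp_norm M p (\<lambda>x. \<Sum>i\<in>I. f i x)"
    using insert by (intro Minkowski Lp_mem_sum) auto
  then show ?case using insert by force
qed auto

lemma Lp_norm_triangle_diff:
  assumes "Lp_mem M p f" "Lp_mem M p g" "Lp_mem M p h" "1 < p"
  shows "Lp_norm M p (\<lambda>x. f x - h x) \<le> Lp_norm M p (\<lambda>x. f x - g x) + Lp_norm M p (\<lambda>x. g x - h x)"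
  using Minkowski[of M p "\<lambda>x. f x - g x" "\<lambda>x. g x - h x"] assms by (simp add: Lp_mem_diff)

lemma Lp_norm_diff_le:
  assumes "Lp_mem M p f" "Lp_mem M p g" "1 < p"
  shows "\<bar>Lp_norm M p f - Lp_norm M p g\<bar> \<le> Lp_norm M p (\<lambda>x. f x - g x)"
  using Minkowski[of M p "\<lambda>x. f x - g x" g] Minkowski[of M p "\<lambda>x. g x - f x" f] assms
    Lp_norm_minus_commute[of M p f g]
  by (simp add: Lp_mem_diff)

text \<open>The duality map of L_p: applied pointwise to f it gives, up to scaling, the element of
  L_q that norms f. At 0 the value is 0 for every p, because of the factor
  \<open>cnj z\<close>.\<close>

definition conj_map :: "real \<Rightarrow> complex \<Rightarrow> complex" where
  "conj_map p z = cnj z * of_real (cmod z powr (p - 2))"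

lemma conj_map_mult: "conj_map p z * z = of_real (cmod z powr p)"
proof (cases "z = 0")
  case False
  have "conj_map p z * z = of_real ((cmod z)\<^sup>2 * cmod z powr (p - 2))"
    by (simp add: conj_map_def complex_norm_square[symmetric] mult_ac flip: of_real_power)
  also have "(cmod z)\<^sup>2 * cmod z powr (p - 2) = cmod z powr 2 * cmod z powr (p - 2)"
    using False by simp
  also have "\<dots> = cmod z powr p" unfolding powr_add[symmetric] by simp
  finally show ?thesis .
qed (simp add: conj_map_def)

lemma cmod_conj_map: "cmod (conj_map p z) = cmod z powr (p - 1)"
proof (cases "z = 0")
  case False
  then have "cmod (conj_map p z) = cmod z powr 1 * cmod z powr (p - 2)" by (simp add: conj_map_def norm_mult)
  then show ?thesis unfolding powr_add[symmetric] by simp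
qed (simp add: conj_map_def)

lemma conj_map_measurable [measurable]: "conj_map p \<in> borel_measurable borel"
proof -
  have [measurable]: "cnj \<in> borel_measurable borel"
    by (intro borel_measurable_continuous_onI continuous_intros)
  have "(\<lambda>z::complex. cmod z powr (p - 2)) \<in> borel_measurable borel" by measurable
  then have [measurable]: "(\<lambda>z::complex. complex_of_real (cmod z powr (p - 2))) \<in> borel_measurable borel"
    by simp
  show ?thesis unfolding conj_map_def by measurable
qed

lemma
  assumes pq: "conj_pair p q" and f: "Lp_mem M p f"
  shows Lp_mem_conj_map: "Lp_mem M q (\<lambda>x. conj_map p (f x))"
    and Lp_norm_conj_map: "Lp_norm M q (\<lambda>x. conj_map p (f x)) = Lp_norm M p f powr (p - 1)"
    and pairing_conj_map: "pairing M (\<lambda>x. conj_map p (f x)) f = of_real (Lp_norm M p f powr p)"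
proof -
  note P = conj_pairD[OF pq]
  note [measurable] = Lp_memD(1)[OF f]
  have *: "cmod (conj_map p z) powr q = cmod z powr p" for z
    using conj_pair_eqs(3)[OF pq] by (simp add: cmod_conj_map powr_powr)
  show "Lp_mem M q (\<lambda>x. conj_map p (f x))" using Lp_memD(2)[OF f] by (simp add: Lp_mem_def *)
  have e: "1 / q = 1 / p * (p - 1)" using conj_pair_eqs(2)[OF pq] P by (simp add: field_simps)
  show "Lp_norm M q (\<lambda>x. conj_map p (f x)) = Lp_norm M p f powr (p - 1)"
    using P by (simp only: Lp_norm_def * e) (simp add: powr_powr integral_nonneg_AE)
  show "pairing M (\<lambda>x. conj_map p (f x)) f = of_real (Lp_norm M p f powr p)"
    using P by (simp add: pairing_def conj_map_mult Lp_norm_powr)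
qed

text \<open>Test on \<open>conj_map p\<close> applied to f: the pairing is ||f||^p, while the test
  function has norm ||f||^(p - 1).\<close>

lemma Lp_norm_le_dual:
  assumes pq: "conj_pair p q" and f: "Lp_mem M p f" and C: "0 \<le> C"
    and b: "\<And>g. Lp_mem M q g \<Longrightarrow> cmod (pairing M g f) \<le> C * Lp_norm M q g"
  shows "Lp_norm M p f \<le> C"
proof (cases "Lp_norm M p f = 0")
  case False
  then have n: "Lp_norm M p f > 0" using Lp_norm_nonneg[of M p f] by linarith
  have "Lp_norm M p f powr p \<le> C * Lp_norm M p f powr (p - 1)"
    using b[OF Lp_mem_conj_map[OF pq f]] Lp_norm_conj_map[OF pq f] pairing_conj_map[OF pq f] by simp
  moreover have "Lp_norm M p f powr p = Lp_norm M p f * Lp_norm M p f powr (p - 1)"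
    using n by (simp add: powr_diff field_simps)
  ultimately show ?thesis using n by simp
qed (use C in simp)

lemma Lp_zero_dual:
  assumes pq: "conj_pair p q" and f: "Lp_mem M p f"
    and b: "\<And>g. Lp_mem M q g \<Longrightarrow> pairing M g f = 0"
  shows "AE x in M. f x = 0"
  using Lp_norm_le_dual[OF pq f, of 0] b Lp_norm_eq_0[OF f] conj_pairD[OF pq] Lp_norm_nonneg[of M p f] by force

lemma pairing_add_right:
  assumes "conj_pair p q" "Lp_mem M q g" "Lp_mem M p f" "Lp_mem M p h"
  shows "pairing M g (\<lambda>x. f x + c * h x) = pairing M g f + c * pairing M g h"
proof -
  have "integrable M (\<lambda>x. g x * f x)" "integrable M (\<lambda>x. g x * h x)"
    using assms Holder_integrable by blast+
  then have "(\<integral>x. g x * f x + c * (g x * h x) \<partial>M) = pairing M g f + c * pairing M g h"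
    unfolding pairing_def by simp
  then show ?thesis by (simp add: pairing_def algebra_simps)
qed

lemma pairing_commute: "pairing M g f = pairing M f g"
  by (simp add: pairing_def mult.commute)

lemma pairing_sum_right:
  assumes "conj_pair p q" "Lp_mem M q g" "\<And>i. i \<in> I \<Longrightarrow> Lp_mem M p (f i)"
  shows "pairing M g (\<lambda>x. \<Sum>i\<in>I. f i x) = (\<Sum>i\<in>I. pairing M g (f i))"
  using assms Holder_integrable[OF assms(1,2)]
  by (simp add: pairing_def sum_distrib_left Bochner_Integration.integral_sum)

lemma pairing_cmult_right: "pairing M g (\<lambda>x. c * f x) = c * pairing M g f"
  by (simp add: pairing_def mult.left_commute)

section \<open>Completeness, uniform convexity and the dual of L_p\<close>

lemma powr_le_imp_le:
  fixes a b p :: real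
  assumes "a powr p \<le> b powr p" "0 < p" "0 \<le> b"
  shows "a \<le> b"
proof (rule ccontr)
  assume "\<not> a \<le> b"
  then have "b powr p < a powr p" using assms by (intro powr_less_mono2) auto
  then show False using assms by linarith
qed

lemma nn_integral_Lp:
  assumes "Lp_mem M p f" "p \<noteq> 0"
  shows "(\<integral>\<^sup>+x. ennreal (cmod (f x) powr p) \<partial>M) = ennreal (Lp_norm M p f powr p)"
  using nn_integral_eq_integral[OF Lp_memD(2)[OF assms(1)]] assms(2) by (simp add: Lp_norm_powr)

lemma
  assumes "f \<in> borel_measurable M" "(\<integral>\<^sup>+x. ennreal (cmod (f x) powr p) \<partial>M) \<le> ennreal (c powr p)" "0 < p" "0 \<le> c"
  shows Lp_mem_nn_integral_le: "Lp_mem M p f" and Lp_norm_nn_integral_le: "Lp_norm M p f \<le> c"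
proof -
  show m: "Lp_mem M p f" unfolding Lp_mem_def
  proof (intro conjI assms(1) integrableI_bounded)
    show "(\<integral>\<^sup>+x. ennreal (norm (cmod (f x) powr p)) \<partial>M) < \<infinity>"
      using assms(2) by (simp add: le_less_trans)
  qed (use assms in measurable)
  have "Lp_norm M p f powr p \<le> c powr p"
    using assms nn_integral_Lp[OF m] by simp
  then show "Lp_norm M p f \<le> c"
    using assms(3,4) by (rule powr_le_imp_le)
qed

text \<open>Riesz-Fischer: a subsequence with geometrically small gaps has a sum of absolute
  differences that is finite almost everywhere by monotone convergence, hence converges almost
  everywhere; Fatou transfers the Cauchy estimate to the limit.\<close>

theorem Lp_complete:
  assumes p: "1 < p" and mem: "\<And>n. Lp_mem M p (f n)"
    and cauchy: "\<And>e. 0 < e \<Longrightarrow> \<exists>N. \<forall>m\<ge>N. \<forall>n\<ge>N. Lp_norm M p (\<lambda>x. f m x - f n x) < e"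
  obtains h where "Lp_mem M p h" "(\<lambda>n. Lp_norm M p (\<lambda>x. f n x - h x)) \<longlonglongrightarrow> 0"
proof -
  note [measurable] = Lp_memD(1)[OF mem]
  have "\<exists>r. \<forall>n. (\<forall>m\<ge>r n. Lp_norm M p (\<lambda>x. f m x - f (r n) x) < (1/2) ^ n) \<and> r n < r (Suc n)"
  proof (rule dependent_nat_choice)
    show "\<exists>k. \<forall>m\<ge>k. Lp_norm M p (\<lambda>x. f m x - f k x) < (1/2) ^ 0"
      using cauchy[of 1] by auto
    fix k n :: nat
    have "\<exists>N. \<forall>m\<ge>N. \<forall>l\<ge>N. Lp_norm M p (\<lambda>x. f m x - f l x) < (1/2) ^ Suc n"
      by (rule cauchy) simp
    then obtain N where N: "\<forall>m\<ge>N. \<forall>l\<ge>N. Lp_norm M p (\<lambda>x. f m x - f l x) < (1/2) ^ Suc n" ..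
    show "\<exists>y. (\<forall>m\<ge>y. Lp_norm M p (\<lambda>x. f m x - f y x) < (1/2) ^ Suc n) \<and> k < y"
      by (rule exI[of _ "max N (Suc k)"]) (use N in auto)
  qed
  then obtain r where r: "\<And>n m. r n \<le> m \<Longrightarrow> Lp_norm M p (\<lambda>x. f m x - f (r n) x) < (1/2) ^ n" "\<And>n. r n < r (Suc n)"
    by blast
  have sm: "strict_mono r" using r(2) by (simp add: strict_mono_Suc_iff)
  define D where "D i x = cmod (f (r (Suc i)) x - f (r i) x)" for i x
  define G where "G n x = (\<Sum>i<n. D i x)" for n x
  have D0: "0 \<le> D i x" for i x by (simp add: D_def)
  have G0: "0 \<le> G n x" for n x by (simp add: G_def sum_nonneg D0)
  have [measurable]: "D i \<in> borel_measurable M" "G i \<in> borel_measurable M" for i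
    unfolding D_def G_def by measurable
  have Dmem: "Lp_mem M p (\<lambda>x. of_real (D i x))" for i
    by (rule Lp_mem_bound[OF Lp_mem_diff[OF mem[of "r (Suc i)"] mem[of "r i"] p]]) (use p in \<open>auto simp: D_def\<close>)
  have Dn: "Lp_norm M p (\<lambda>x. of_real (D i x)) = Lp_norm M p (\<lambda>x. f (r (Suc i)) x - f (r i) x)" for i
    by (simp add: Lp_norm_def D_def)
  have Gn: "(\<integral>\<^sup>+x. ennreal (G n x powr p) \<partial>M) \<le> ennreal (2 powr p)" for n
  proof -
    have m: "Lp_mem M p (\<lambda>x. \<Sum>i<n. of_real (D i x))" using Dmem p by (intro Lp_mem_sum)
    have "Lp_norm M p (\<lambda>x. \<Sum>i<n. of_real (D i x)) \<le> (\<Sum>i<n. Lp_norm M p (\<lambda>x. of_real (D i x)))"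
      using Dmem p by (intro Lp_norm_sum_le)
    also have "\<dots> \<le> (\<Sum>i<n. (1/2) ^ i)" unfolding Dn using r(1)[of _ "r (Suc _)"] r(2) by (intro sum_mono) (simp add: less_imp_le)
    also have "\<dots> \<le> (\<Sum>i. (1/2) ^ i)" by (rule sum_le_suminf) (auto intro: summable_geometric)
    also have "\<dots> = 2" by (simp add: suminf_geometric)
    finally have le: "Lp_norm M p (\<lambda>x. \<Sum>i<n. of_real (D i x)) \<le> 2" .
    have "(\<integral>\<^sup>+x. ennreal (G n x powr p) \<partial>M) = (\<integral>\<^sup>+x. ennreal (cmod (\<Sum>i<n. of_real (D i x)) powr p) \<partial>M)"
      using G0 by (simp add: G_def flip: of_real_sum)
    also have "\<dots> = ennreal (Lp_norm M p (\<lambda>x. \<Sum>i<n. of_real (D i x)) powr p)"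
      using p by (intro nn_integral_Lp[OF m]) auto
    also have "\<dots> \<le> ennreal (2 powr p)" using le p by (intro ennreal_leI powr_mono2) auto
    finally show ?thesis .
  qed
  have "(\<integral>\<^sup>+x. (SUP n. ennreal (G n x powr p)) \<partial>M) = (SUP n. \<integral>\<^sup>+x. ennreal (G n x powr p) \<partial>M)"
  proof (rule nn_integral_monotone_convergence_SUP)
    show "incseq (\<lambda>n x. ennreal (G n x powr p))"
      using p G0 D0 by (auto simp: incseq_def le_fun_def G_def intro!: ennreal_leI powr_mono2 sum_mono2)
  qed measurable
  also have "\<dots> \<le> ennreal (2 powr p)" using Gn by (intro SUP_least)
  finally have "(\<integral>\<^sup>+x. (SUP n. ennreal (G n x powr p)) \<partial>M) \<noteq> \<infinity>"
    by (metis ennreal_neq_top infinity_ennreal_def neq_top_trans)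
  then have "AE x in M. (SUP n. ennreal (G n x powr p)) \<noteq> \<infinity>"
    by (intro nn_integral_PInf_AE) auto
  then have conv: "AE x in M. convergent (\<lambda>n. f (r n) x)"
  proof eventually_elim
    case (elim x)
    then obtain B where B: "(SUP n. ennreal (G n x powr p)) = ennreal B" "B \<ge> 0"
      by (cases "SUP n. ennreal (G n x powr p)") auto
    have "G n x powr p \<le> B" for n
      using SUP_upper[of n UNIV "\<lambda>n. ennreal (G n x powr p)"] B by (simp add: B(1))
    then have "(G n x powr p) powr (1/p) \<le> B powr (1/p)" for n using p by (intro powr_mono2) auto
    then have "G n x \<le> B powr (1/p)" for n using p G0 by (simp add: powr_powr)
    then have "(\<Sum>i\<le>n. D i x) \<le> B powr (1/p)" for n
      unfolding G_def lessThan_Suc_atMost[symmetric] .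
    then have "summable (\<lambda>i. D i x)" using D0 by (intro bounded_imp_summable)
    then have "summable (\<lambda>i. f (r (Suc i)) x - f (r i) x)"
      unfolding D_def by (rule summable_norm_cancel)
    then have "convergent (\<lambda>n. \<Sum>i<n. f (r (Suc i)) x - f (r i) x)" by (simp add: summable_iff_convergent)
    then have "convergent (\<lambda>n. (\<Sum>i<n. f (r (Suc i)) x - f (r i) x) + f (r 0) x)"
      by (intro convergent_add convergent_const)
    then show ?case by (simp add: sum_lessThan_telescope[of "\<lambda>i. f (r i) x"])
  qed
  define h where "h x = lim (\<lambda>n. f (r n) x)" for x
  have [measurable]: "h \<in> borel_measurable M" unfolding h_def by measurable
  have lim: "AE x in M. (\<lambda>n. f (r n) x) \<longlonglongrightarrow> h x"
    using conv by eventually_elim (simp add: h_def convergent_LIMSEQ_iff)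
  \<comment> \<open>Letting the second index run through the subsequence, a strict Cauchy bound e
    for differences becomes the bound e for the distance to the limit.\<close>
  have fatou: "(\<integral>\<^sup>+x. ennreal (cmod (f m x - h x) powr p) \<partial>M) \<le> ennreal (e powr p)"
    if N: "\<forall>m\<ge>N. \<forall>n\<ge>N. Lp_norm M p (\<lambda>x. f m x - f n x) < e" and m: "m \<ge> N" for N m e
  proof -
    have "(\<integral>\<^sup>+x. ennreal (cmod (f m x - h x) powr p) \<partial>M) = (\<integral>\<^sup>+x. liminf (\<lambda>i. ennreal (cmod (f m x - f (r i) x) powr p)) \<partial>M)"
    proof (rule nn_integral_cong_AE)
      show "AE x in M. ennreal (cmod (f m x - h x) powr p) = liminf (\<lambda>i. ennreal (cmod (f m x - f (r i) x) powr p))"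
        using lim
      proof eventually_elim
        case (elim x)
        then have "(\<lambda>i. ennreal (cmod (f m x - f (r i) x) powr p)) \<longlonglongrightarrow> ennreal (cmod (f m x - h x) powr p)"
          using p by (intro tendsto_ennrealI tendsto_powr' tendsto_norm tendsto_diff tendsto_const) auto
        then show ?case by (intro lim_imp_Liminf[symmetric]) simp
      qed
    qed
    also have "\<dots> \<le> liminf (\<lambda>i. \<integral>\<^sup>+x. ennreal (cmod (f m x - f (r i) x) powr p) \<partial>M)"
      by (rule nn_integral_liminf) measurable
    also have "\<dots> \<le> limsup (\<lambda>i. \<integral>\<^sup>+x. ennreal (cmod (f m x - f (r i) x) powr p) \<partial>M)"
      by (rule Liminf_le_Limsup) auto
    also have "\<dots> \<le> ennreal (e powr p)"
    proof (rule Limsup_bounded)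
      have "\<forall>\<^sub>F i in sequentially. N \<le> r i"
        using filterlim_subseq[OF sm] by (simp add: filterlim_at_top)
      then show "\<forall>\<^sub>F i in sequentially. (\<integral>\<^sup>+x. ennreal (cmod (f m x - f (r i) x) powr p) \<partial>M) \<le> ennreal (e powr p)"
      proof eventually_elim
        case (elim i)
        then have "Lp_norm M p (\<lambda>x. f m x - f (r i) x) \<le> e" using N m by (simp add: less_imp_le)
        then show ?case using p by (subst nn_integral_Lp[OF Lp_mem_diff[OF mem mem p]]) (auto intro!: ennreal_leI powr_mono2)
      qed
    qed
    finally show ?thesis .
  qed
  obtain N1 where N1: "\<forall>m\<ge>N1. \<forall>n\<ge>N1. Lp_norm M p (\<lambda>x. f m x - f n x) < 1" using cauchy[of 1] by auto
  have d: "Lp_mem M p (\<lambda>x. f N1 x - h x)"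
    by (rule Lp_mem_nn_integral_le[OF _ fatou[OF N1]]) (use p in auto)
  show ?thesis
  proof
    show "Lp_mem M p h" using Lp_mem_diff[OF mem[of N1] d p] by simp
    show "(\<lambda>n. Lp_norm M p (\<lambda>x. f n x - h x)) \<longlonglongrightarrow> 0"
    proof (rule LIMSEQ_I)
      fix e :: real assume "0 < e"
      then obtain N where N: "\<forall>m\<ge>N. \<forall>n\<ge>N. Lp_norm M p (\<lambda>x. f m x - f n x) < e/2" using cauchy[of "e/2"] by auto
      have "Lp_norm M p (\<lambda>x. f n x - h x) \<le> e/2" if "n \<ge> N" for n
        by (rule Lp_norm_nn_integral_le[OF _ fatou[OF N that]]) (use p \<open>0 < e\<close> in auto)
      then show "\<exists>N. \<forall>n\<ge>N. norm (Lp_norm M p (\<lambda>x. f n x - h x) - 0) < e"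
        using \<open>0 < e\<close> by (intro exI[of _ N]) force
    qed
  qed
qed

text \<open>The scalar inequality is linear in the p-th powers involved, so it integrates term by
  term.\<close>

lemma uniform_convexity_Lp:
  assumes K: "\<And>a b :: complex. cmod (a - b) powr p \<le> \<epsilon> * (cmod a powr p + cmod b powr p) + K * convexity_gap p a b"
    and p: "1 < p" and f: "Lp_mem M p f" and g: "Lp_mem M p g"
  shows "Lp_norm M p (\<lambda>x. f x - g x) powr p \<le> \<epsilon> * (Lp_norm M p f powr p + Lp_norm M p g powr p) +
    K * ((Lp_norm M p f powr p + Lp_norm M p g powr p) / 2 - Lp_norm M p (\<lambda>x. (f x + g x) / 2) powr p)"
proof -
  have m: "Lp_mem M p (\<lambda>x. (f x + g x) / 2)"
    using Lp_mem_cmult[OF Lp_mem_add[OF f g p], of "1/2"] by simp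
  note I = Lp_memD(2)[OF f] Lp_memD(2)[OF g] Lp_memD(2)[OF m] Lp_memD(2)[OF Lp_mem_diff[OF f g p]]
  have "(\<integral>x. cmod (f x - g x) powr p \<partial>M) \<le> (\<integral>x. \<epsilon> * (cmod (f x) powr p + cmod (g x) powr p) + K * convexity_gap p (f x) (g x) \<partial>M)"
    using I K unfolding convexity_gap_def by (intro integral_mono) auto
  also have "\<dots> = \<epsilon> * ((\<integral>x. cmod (f x) powr p \<partial>M) + (\<integral>x. cmod (g x) powr p \<partial>M)) +
      K * (((\<integral>x. cmod (f x) powr p \<partial>M) + (\<integral>x. cmod (g x) powr p \<partial>M)) / 2 - (\<integral>x. cmod ((f x + g x) / 2) powr p \<partial>M))"
    using I unfolding convexity_gap_def by (simp del: norm_divide norm_divide_numeral)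
  finally show ?thesis using p by (simp add: Lp_norm_powr)
qed

lemma isCont_conj_map:
  assumes "1 < p" shows "isCont (conj_map p) z"
proof (cases "z = 0")
  case True
  have "((\<lambda>y::complex. cmod y powr (p - 1)) \<longlongrightarrow> cmod 0 powr (p - 1)) (at 0)"
    by (intro tendsto_powr' tendsto_norm tendsto_ident_at tendsto_const) (use assms in auto)
  then have "((\<lambda>y. cmod (conj_map p y)) \<longlongrightarrow> 0) (at 0)" by (simp add: cmod_conj_map)
  then have "(conj_map p \<longlongrightarrow> 0) (at 0)" by (rule tendsto_norm_zero_cancel)
  then show ?thesis unfolding isCont_def True by (simp add: conj_map_def)
next
  case False
  then show ?thesis unfolding conj_map_def by (intro continuous_intros) auto
qed

text \<open>Young's inequality for \<open>conj_map q a\<close> against a + b. It says that q times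
  \<open>conj_map q a\<close> is a subgradient of the q-th power of the modulus at a.\<close>

lemma powr_norm_subgradient:
  assumes "conj_pair p q"
  shows "cmod a powr q + q * Re (conj_map q a * b) \<le> cmod (a + b) powr q"
proof -
  note P = conj_pairD[OF assms]
  have e: "(q - 1) * p = q" by (rule conj_pair_eqs(3)[OF conj_pair_sym[OF assms]])
  have "Re (conj_map q a * (a + b)) \<le> cmod (conj_map q a * (a + b))" by (rule complex_Re_le_cmod)
  also have "\<dots> \<le> cmod (conj_map q a) powr p / p + cmod (a + b) powr q / q"
    by (rule young_complex[OF conj_pair_sym[OF assms]])
  also have "cmod (conj_map q a) powr p = cmod a powr q" using e by (simp add: cmod_conj_map powr_powr)
  finally have "q * (cmod a powr q + Re (conj_map q a * b)) \<le> q * (cmod a powr q / p + cmod (a + b) powr q / q)"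
    using P by (intro mult_left_mono) (simp_all add: distrib_left conj_map_mult)
  moreover have "q / p = q - 1" by (rule conj_pair_eqs(5)[OF conj_pair_sym[OF assms]])
  then have "q * (cmod a powr q / p) = (q - 1) * cmod a powr q" by (metis times_divide_eq_left times_divide_eq_right mult.commute)
  ultimately show ?thesis using P by (simp add: algebra_simps)
qed

text \<open>A norming vector replaces the Radon-Nikodym theorem, so the representation is available
  for a Haar measure that is not sigma-finite. Uniform convexity makes a maximising sequence of unit
  vectors Cauchy; its limit g attains the norm d, and differentiating the norm at g identifies the
  functional as d times pairing with \<open>conj_map q\<close> of g.\<close>

theorem Lp_dual:
  fixes \<phi> :: "('a \<Rightarrow> complex) \<Rightarrow> complex"
  assumes pq: "conj_pair p q"
    and lin: "\<And>g h c. \<lbrakk>Lp_mem M q g; Lp_mem M q h\<rbrakk> \<Longrightarrow> \<phi> (\<lambda>x. g x + c * h x) = \<phi> g + c * \<phi> h"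
    and bd: "\<And>g. Lp_mem M q g \<Longrightarrow> cmod (\<phi> g) \<le> C * Lp_norm M q g"
  obtains f where "Lp_mem M p f" "\<And>g. Lp_mem M q g \<Longrightarrow> \<phi> g = pairing M g f"
proof -
  note P = conj_pairD[OF pq]
  have phi0: "\<phi> (\<lambda>x. 0) = 0" using bd[OF Lp_mem_zero] by simp
  have hom: "\<phi> (\<lambda>x. c * h x) = c * \<phi> h" if "Lp_mem M q h" for c h
    using lin[OF Lp_mem_zero that, of c] phi0 by simp
  have dif: "\<phi> (\<lambda>x. g x - h x) = \<phi> g - \<phi> h" if "Lp_mem M q g" "Lp_mem M q h" for g h
    using lin[OF that, of "-1"] by simp
  define S where "S = {cmod (\<phi> g) | g. Lp_mem M q g \<and> Lp_norm M q g \<le> 1}"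
  define d where "d = Sup S"
  have "cmod (\<phi> g) \<le> \<bar>C\<bar>" if "Lp_mem M q g" "Lp_norm M q g \<le> 1" for g
  proof -
    have "C * Lp_norm M q g \<le> \<bar>C\<bar> * 1" using that by (intro mult_mono) auto
    then show ?thesis using bd[OF that(1)] by simp
  qed
  then have bdd: "bdd_above S" unfolding S_def by (intro bdd_aboveI[of _ "\<bar>C\<bar>"]) auto
  have ne: "0 \<in> S" unfolding S_def using phi0 by (auto intro!: exI[of _ "\<lambda>x. 0"])
  have d0: "0 \<le> d" unfolding d_def using cSup_upper[OF ne bdd] by simp
  have bd_d: "cmod (\<phi> g) \<le> d * Lp_norm M q g" if g: "Lp_mem M q g" for g
  proof (cases "Lp_norm M q g = 0")
    case True
    then show ?thesis using bd[OF g] by simp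
  next
    case False
    then have n: "0 < Lp_norm M q g" using Lp_norm_nonneg[of M q g] by linarith
    define k where "k = (\<lambda>x. of_real (1 / Lp_norm M q g) * g x)"
    have k: "Lp_mem M q k" "Lp_norm M q k = 1" using g n P by (auto simp: k_def Lp_mem_cmult Lp_norm_cmult simp del: of_real_divide)
    have "cmod (\<phi> k) \<le> d" unfolding d_def using k by (intro cSup_upper bdd) (auto simp: S_def)
    moreover have "\<phi> k = of_real (1 / Lp_norm M q g) * \<phi> g" unfolding k_def by (rule hom[OF g])
    ultimately show ?thesis using n by (simp add: norm_mult norm_divide field_simps)
  qed
  show ?thesis
  proof (cases "d = 0")
    case True
    then have "\<phi> g = 0" if "Lp_mem M q g" for g using bd_d[OF that] by simp
    then show ?thesis using that[of "\<lambda>x. 0"] by (simp add: pairing_def)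
  next
    case False
    then have d: "0 < d" using d0 by simp
    \<comment> \<open>A maximising sequence, with phases rotated so that the functional takes real
      values close to d.\<close>
    have "\<exists>g. Lp_mem M q g \<and> Lp_norm M q g \<le> 1 \<and> \<phi> g \<in> \<real> \<and> d * (1 - 1 / real (Suc n)) \<le> Re (\<phi> g)" for n
    proof -
      have "d * (1 - 1 / real (Suc n)) < d" using d by (simp add: field_simps)
      then obtain s where "s \<in> S" "d * (1 - 1 / real (Suc n)) < s"
        using less_cSup_iff[OF _ bdd] ne unfolding d_def by blast
      then obtain g where g: "Lp_mem M q g" "Lp_norm M q g \<le> 1" "d * (1 - 1 / real (Suc n)) < cmod (\<phi> g)"
        by (auto simp: S_def)
      define z where "z = (if \<phi> g = 0 then 1 else cnj (\<phi> g) / cmod (\<phi> g))"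
      have z: "cmod z = 1" "z * \<phi> g = of_real (cmod (\<phi> g))"
        by (auto simp: z_def norm_divide complex_norm_square[symmetric] power2_eq_square mult.commute)
      show ?thesis
        by (rule exI[of _ "\<lambda>x. z * g x"]) (use g z P in \<open>auto simp: hom Lp_mem_cmult Lp_norm_cmult\<close>)
    qed
    then obtain G where G: "\<And>n. Lp_mem M q (G n)" "\<And>n. Lp_norm M q (G n) \<le> 1"
        "\<And>n. \<phi> (G n) \<in> \<real>" "\<And>n. d * (1 - 1 / real (Suc n)) \<le> Re (\<phi> (G n))" by metis
    have cauchy: "\<exists>N. \<forall>m\<ge>N. \<forall>n\<ge>N. Lp_norm M q (\<lambda>x. G m x - G n x) < e" if e: "0 < e" for e
    proof -
      \<comment> \<open>The two p-th power terms then contribute at most half of e^q; N is chosen so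
        that the gap term stays below a quarter of it.\<close>
      define \<epsilon> where "\<epsilon> = e powr q / 4"
      have eps: "0 < \<epsilon>" using e by (simp add: \<epsilon>_def)
      obtain K where K: "0 \<le> K" "\<And>a b :: complex. cmod (a - b) powr q \<le> \<epsilon> * (cmod a powr q + cmod b powr q) + K * convexity_gap q a b"
        using uniform_convexity_scalar[OF P(2) eps] by blast
      obtain N :: nat where N: "4 * K * q / e powr q < real N" using reals_Archimedean2 by blast
      have "Lp_norm M q (\<lambda>x. G m x - G n x) < e" if mn: "m \<ge> N" "n \<ge> N" for m n
      proof -
        have one: "Lp_norm M q (G k) powr q \<le> 1" for k
          using G(2)[of k] P powr_mono2[of q "Lp_norm M q (G k)" 1] by simp
        have mid: "Lp_mem M q (\<lambda>x. (G m x + G n x) / 2)"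
          using Lp_mem_cmult[OF Lp_mem_add[OF G(1)[of m] G(1)[of n] P(2)], of "1/2"] by simp
        have "\<phi> (\<lambda>x. (G m x + G n x) / 2) = (\<phi> (G m) + \<phi> (G n)) / 2"
          using hom[OF Lp_mem_add[OF G(1)[of m] G(1)[of n] P(2)], of "1/2"] lin[OF G(1)[of m] G(1)[of n], of 1] by simp
        then have "Re (\<phi> (\<lambda>x. (G m x + G n x) / 2)) = (Re (\<phi> (G m)) + Re (\<phi> (G n))) / 2"
          by (metis Re_divide_numeral plus_complex.sel(1))
        then have "(Re (\<phi> (G m)) + Re (\<phi> (G n))) / 2 \<le> cmod (\<phi> (\<lambda>x. (G m x + G n x) / 2))"
          using complex_Re_le_cmod[of "\<phi> (\<lambda>x. (G m x + G n x) / 2)"] by simp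
        also have "\<dots> \<le> d * Lp_norm M q (\<lambda>x. (G m x + G n x) / 2)" by (rule bd_d[OF mid])
        finally have 1: "(Re (\<phi> (G m)) + Re (\<phi> (G n))) / 2 \<le> d * Lp_norm M q (\<lambda>x. (G m x + G n x) / 2)" .
        have re: "d * (1 - 1 / real (Suc N)) \<le> Re (\<phi> (G k))" if "k \<ge> N" for k
        proof -
          have "1 / real (Suc k) \<le> 1 / real (Suc N)" using that by (simp add: frac_le)
          then have "d * (1 - 1 / real (Suc N)) \<le> d * (1 - 1 / real (Suc k))" using d by (intro mult_left_mono) auto
          then show ?thesis using G(4)[of k] by linarith
        qed
        have "d * (1 - 1 / real (Suc N)) \<le> d * Lp_norm M q (\<lambda>x. (G m x + G n x) / 2)"
        proof -
          have avg: "c \<le> (a + b) / 2" if "c \<le> a" "c \<le> b" for a b c :: real using that by simp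
          show ?thesis by (rule order_trans[OF avg[OF re[OF mn(1)] re[OF mn(2)]] 1])
        qed
        then have 2: "1 - 1 / real (Suc N) \<le> Lp_norm M q (\<lambda>x. (G m x + G n x) / 2)" using d by simp
        have "1 - q / real (Suc N) \<le> (1 - 1 / real (Suc N)) powr q"
          using powr_tangent[of "1 - 1 / real (Suc N)" q] P by (simp add: field_simps)
        also have "\<dots> \<le> Lp_norm M q (\<lambda>x. (G m x + G n x) / 2) powr q"
          using 2 P by (intro powr_mono2) auto
        finally have 3: "1 - q / real (Suc N) \<le> Lp_norm M q (\<lambda>x. (G m x + G n x) / 2) powr q" .
        have "Lp_norm M q (\<lambda>x. G m x - G n x) powr q \<le> \<epsilon> * (Lp_norm M q (G m) powr q + Lp_norm M q (G n) powr q) +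
          K * ((Lp_norm M q (G m) powr q + Lp_norm M q (G n) powr q) / 2 - Lp_norm M q (\<lambda>x. (G m x + G n x) / 2) powr q)"
          by (rule uniform_convexity_Lp[OF K(2) P(2) G(1) G(1)])
        also have "\<dots> \<le> \<epsilon> * (1 + 1) + K * ((1 + 1) / 2 - (1 - q / real (Suc N)))"
          using one 3 eps K(1) by (intro add_mono mult_left_mono diff_mono divide_right_mono) auto
        also have "\<dots> = e powr q / 2 + K * q / real (Suc N)" by (simp add: \<epsilon>_def)
        also have "\<dots> < e powr q"
        proof -
          have "4 * K * q < real N * e powr q" using N e by (simp add: field_simps)
          also have "\<dots> \<le> real (Suc N) * e powr q" by (intro mult_right_mono) auto
          finally have "K * q / real (Suc N) < e powr q / 4" by (simp add: field_simps)
          moreover have "0 < e powr q" using e by simp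
          ultimately show ?thesis by linarith
        qed
        finally have lt: "Lp_norm M q (\<lambda>x. G m x - G n x) powr q < e powr q" .
        show ?thesis
        proof (rule ccontr)
          assume "\<not> ?thesis"
          then have "e powr q \<le> Lp_norm M q (\<lambda>x. G m x - G n x) powr q" using P e by (intro powr_mono2) auto
          then show False using lt by linarith
        qed
      qed
      then show ?thesis by blast
    qed
    obtain g where g: "Lp_mem M q g" "(\<lambda>n. Lp_norm M q (\<lambda>x. G n x - g x)) \<longlonglongrightarrow> 0"
      using Lp_complete[OF P(2) G(1) cauchy] by blast
    have n1: "Lp_norm M q g \<le> 1"
    proof (rule LIMSEQ_le_const)
      show "(\<lambda>n. 1 + Lp_norm M q (\<lambda>x. G n x - g x)) \<longlonglongrightarrow> 1" using tendsto_add[OF tendsto_const[of 1] g(2)] by simp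
      show "\<exists>N. \<forall>n\<ge>N. Lp_norm M q g \<le> 1 + Lp_norm M q (\<lambda>x. G n x - g x)"
      proof (intro exI allI impI)
        fix n
        show "Lp_norm M q g \<le> 1 + Lp_norm M q (\<lambda>x. G n x - g x)"
          using Lp_norm_diff_le[OF G(1)[of n] g(1) P(2)] G(2)[of n] by linarith
      qed
    qed
    have "(\<lambda>n. Re (\<phi> (G n)) - Re (\<phi> g)) \<longlonglongrightarrow> 0"
    proof (rule Lim_null_comparison[where g = "\<lambda>n. d * Lp_norm M q (\<lambda>x. G n x - g x)"])
      show "\<forall>\<^sub>F n in sequentially. norm (Re (\<phi> (G n)) - Re (\<phi> g)) \<le> d * Lp_norm M q (\<lambda>x. G n x - g x)"
      proof (intro always_eventually allI)
        fix n
        have "norm (Re (\<phi> (G n)) - Re (\<phi> g)) \<le> cmod (\<phi> (G n) - \<phi> g)"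
          using abs_Re_le_cmod[of "\<phi> (G n) - \<phi> g"] by simp
        also have "\<phi> (G n) - \<phi> g = \<phi> (\<lambda>x. G n x - g x)" by (rule dif[OF G(1) g(1), symmetric])
        also have "cmod \<dots> \<le> d * Lp_norm M q (\<lambda>x. G n x - g x)" by (rule bd_d[OF Lp_mem_diff[OF G(1) g(1) P(2)]])
        finally show "norm (Re (\<phi> (G n)) - Re (\<phi> g)) \<le> d * Lp_norm M q (\<lambda>x. G n x - g x)" .
      qed
      show "(\<lambda>n. d * Lp_norm M q (\<lambda>x. G n x - g x)) \<longlonglongrightarrow> 0" using tendsto_mult_right_zero[OF g(2)] by simp
    qed
    then have "(\<lambda>n. Re (\<phi> (G n))) \<longlonglongrightarrow> Re (\<phi> g)" by (rule LIM_zero_cancel)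
    moreover have "(\<lambda>n. d * (1 - 1 / real (Suc n))) \<longlonglongrightarrow> d * (1 - 0)"
      by (intro tendsto_mult tendsto_const tendsto_diff) (rule LIMSEQ_Suc[OF lim_1_over_n])
    ultimately have phig: "d \<le> Re (\<phi> g)" using G(4) by (intro LIMSEQ_le[of _ d]) auto
    \<comment> \<open>One-sided derivative at the maximiser g: perturb to g + t h with t = 1/(n+1),
      compare norm and functional by the subgradient inequality at the perturbed point, and let n
      tend to infinity by dominated convergence.\<close>
    have key: "Re (\<phi> h) / d \<le> Re (pairing M (\<lambda>x. conj_map q (g x)) h)" if h: "Lp_mem M q h" for h
    proof -
      define A where "A = Re (\<phi> h) / d"
      define t where "t n = 1 / real (Suc n)" for n
      define k where "k n x = g x + of_real (t n) * h x" for n x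
      have t: "0 < t n" "t n \<le> 1" for n by (auto simp: t_def)
      have k: "Lp_mem M q (k n)" for n unfolding k_def using Lp_mem_add[OF g(1) Lp_mem_cmult[OF h] P(2)] .
      have qp: "conj_pair q p" by (rule conj_pair_sym[OF pq])
      have ck: "Lp_mem M p (\<lambda>x. conj_map q (k n x))" for n by (rule Lp_mem_conj_map[OF qp k])
      have le: "A \<le> Re (pairing M (\<lambda>x. conj_map q (k n x)) h)" for n
      proof -
        have "Re (\<phi> (k n)) = Re (\<phi> g) + t n * Re (\<phi> h)" unfolding k_def using lin[OF g(1) h] by simp
        then have "d * (1 + t n * A) \<le> Re (\<phi> (k n))" using phig d by (simp add: A_def field_simps)
        also have "\<dots> \<le> d * Lp_norm M q (k n)" using bd_d[OF k] complex_Re_le_cmod order_trans by blast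
        finally have 1: "1 + t n * A \<le> Lp_norm M q (k n)" using d by simp
        have 2: "1 + q * (t n * A) \<le> Lp_norm M q (k n) powr q"
          using powr_tangent[of "Lp_norm M q (k n)" q] mult_left_mono[OF 1, of q] P by (simp add: algebra_simps)
        have "Lp_norm M q (k n) powr q + q * (- t n * Re (pairing M (\<lambda>x. conj_map q (k n x)) h))
            = (\<integral>x. cmod (k n x) powr q + q * (- t n * Re (conj_map q (k n x) * h x)) \<partial>M)"
        proof -
          have i: "integrable M (\<lambda>x. conj_map q (k n x) * h x)" by (rule Holder_integrable[OF qp ck h])
          then have "Re (pairing M (\<lambda>x. conj_map q (k n x)) h) = (\<integral>x. Re (conj_map q (k n x) * h x) \<partial>M)"
            by (simp only: pairing_def integral_Re)
          then show ?thesis using i Lp_memD[OF k, of n] P integrable_Re[OF i] by (simp add: Lp_norm_powr)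
        qed
        also have "\<dots> \<le> (\<integral>x. cmod (g x) powr q \<partial>M)"
        proof (rule integral_mono)
          show "integrable M (\<lambda>x. cmod (k n x) powr q + q * (- t n * Re (conj_map q (k n x) * h x)))"
            using integrable_Re[OF Holder_integrable[OF qp ck[of n] h]] Lp_memD[OF k, of n] by simp
          show "cmod (k n x) powr q + q * (- t n * Re (conj_map q (k n x) * h x)) \<le> cmod (g x) powr q" for x
            using powr_norm_subgradient[OF pq, of "k n x" "- of_real (t n) * h x"]
            by (simp add: k_def algebra_simps)
        qed (use Lp_memD[OF g(1)] in auto)
        also have "\<dots> = Lp_norm M q g powr q" using P by (simp add: Lp_norm_powr)
        also have "\<dots> \<le> 1" using n1 P powr_mono2[of q "Lp_norm M q g" 1] by simp
        finally have "q * (t n * A) \<le> q * (t n * Re (pairing M (\<lambda>x. conj_map q (k n x)) h))" using 2 by simp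
        then show ?thesis using P t[of n] by simp
      qed
      have "(\<lambda>n. pairing M (\<lambda>x. conj_map q (k n x)) h) \<longlonglongrightarrow> pairing M (\<lambda>x. conj_map q (g x)) h"
        unfolding pairing_def
      proof (rule integral_dominated_convergence[where w = "\<lambda>x. cmod (conj_map q (of_real (cmod (g x) + cmod (h x))) * h x)"])
        note [measurable] = Lp_memD(1)[OF g(1)] Lp_memD(1)[OF h] Lp_memD(1)[OF k]
        show "(\<lambda>x. conj_map q (g x) * h x) \<in> borel_measurable M" "\<And>n. (\<lambda>x. conj_map q (k n x) * h x) \<in> borel_measurable M" by measurable
        have "Lp_mem M q (\<lambda>x. of_real (cmod (g x)))" "Lp_mem M q (\<lambda>x. of_real (cmod (h x)))"
          using g(1) h by (auto simp: Lp_mem_def)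
        from Lp_mem_add[OF this P(2)] have "Lp_mem M q (\<lambda>x. of_real (cmod (g x) + cmod (h x)))" by simp
        from Holder_integrable[OF qp Lp_mem_conj_map[OF qp this] h]
        show "integrable M (\<lambda>x. cmod (conj_map q (of_real (cmod (g x) + cmod (h x))) * h x))" by simp
        show "AE x in M. (\<lambda>n. conj_map q (k n x) * h x) \<longlonglongrightarrow> conj_map q (g x) * h x"
        proof (rule AE_I2)
          fix x
          have "(\<lambda>n. k n x) \<longlonglongrightarrow> g x + of_real 0 * h x" unfolding k_def t_def
            by (intro tendsto_intros LIMSEQ_Suc[OF lim_1_over_n])
          then show "(\<lambda>n. conj_map q (k n x) * h x) \<longlonglongrightarrow> conj_map q (g x) * h x"
            using isCont_tendsto_compose[OF isCont_conj_map[OF P(2)]] by (intro tendsto_mult tendsto_const) auto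
        qed
        show "AE x in M. norm (conj_map q (k n x) * h x) \<le> cmod (conj_map q (of_real (cmod (g x) + cmod (h x))) * h x)" for n
        proof (rule AE_I2)
          fix x
          have "cmod (k n x) \<le> cmod (g x) + cmod (of_real (t n) * h x)" unfolding k_def by (rule norm_triangle_ineq)
          also have "\<dots> \<le> cmod (g x) + cmod (h x)" using t[of n] by (simp add: norm_mult mult_left_le_one_le)
          finally have "cmod (k n x) \<le> cmod (of_real (cmod (g x) + cmod (h x)) :: complex)" by (simp add: abs_of_nonneg del: of_real_add)
          then show "norm (conj_map q (k n x) * h x) \<le> cmod (conj_map q (of_real (cmod (g x) + cmod (h x))) * h x)"
            using P by (simp add: norm_mult cmod_conj_map del: of_real_add) (intro mult_right_mono powr_mono2, auto)
        qed
      qed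
      then have "(\<lambda>n. Re (pairing M (\<lambda>x. conj_map q (k n x)) h)) \<longlonglongrightarrow> Re (pairing M (\<lambda>x. conj_map q (g x)) h)" by (rule tendsto_Re)
      then show ?thesis using le unfolding A_def[symmetric] by (intro LIMSEQ_le_const) auto
    qed
    \<comment> \<open>Using - h in place of h turns the inequality into an equality of real
      parts.\<close>
    have eq: "Re (\<phi> h) = d * Re (pairing M (\<lambda>x. conj_map q (g x)) h)" if h: "Lp_mem M q h" for h
    proof -
      have "\<phi> (\<lambda>x. -1 * h x) = -1 * \<phi> h" by (rule hom[OF h])
      then have "- Re (\<phi> h) / d \<le> - Re (pairing M (\<lambda>x. conj_map q (g x)) h)"
        using key[OF Lp_mem_cmult[OF h, of "-1"]] by (simp add: pairing_def)
      then show ?thesis using key[OF h] d by (simp add: field_simps)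
    qed
    show ?thesis
    proof
      show "Lp_mem M p (\<lambda>x. of_real d * conj_map q (g x))"
        by (rule Lp_mem_cmult[OF Lp_mem_conj_map[OF conj_pair_sym[OF pq] g(1)]])
      fix h assume h: "Lp_mem M q h"
      have *: "pairing M h (\<lambda>x. of_real d * conj_map q (g x)) = of_real d * pairing M (\<lambda>x. conj_map q (g x)) h"
        by (simp add: pairing_cmult_right pairing_commute)
      \<comment> \<open>The real parts at i h supply the imaginary parts at h.\<close>
      have "Re (\<phi> (\<lambda>x. \<i> * h x)) = d * Re (pairing M (\<lambda>x. conj_map q (g x)) (\<lambda>x. \<i> * h x))"
        by (rule eq[OF Lp_mem_cmult[OF h]])
      then have "Im (\<phi> h) = d * Im (pairing M (\<lambda>x. conj_map q (g x)) h)"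
        by (simp add: hom[OF h] pairing_cmult_right)
      then show "\<phi> h = pairing M h (\<lambda>x. of_real d * conj_map q (g x))"
        unfolding * using eq[OF h] by (simp add: complex_eq_iff)
    qed
  qed
qed

lemma Lp_simple_dense:
  assumes p: "1 < p" and f: "Lp_mem M p f"
  obtains s where "\<And>i. simple_function M (s i)" "\<And>i. Lp_mem M p (s i)"
    "(\<lambda>i. Lp_norm M p (\<lambda>x. s i x - f x)) \<longlonglongrightarrow> 0"
proof -
  note [measurable] = Lp_memD(1)[OF f]
  obtain s where s': "\<forall>i. simple_function M (s i)" "\<forall>x\<in>space M. (\<lambda>i. s i x) \<longlonglongrightarrow> f x"
     "\<forall>i. \<forall>x\<in>space M. dist (s i x) 0 \<le> 2 * dist (f x) 0"
    using borel_measurable_implies_sequence_metric[OF Lp_memD(1)[OF f], of 0] by (elim exE conjE) (rule that)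
  have s: "\<And>i. simple_function M (s i)" "\<And>x. x \<in> space M \<Longrightarrow> (\<lambda>i. s i x) \<longlonglongrightarrow> f x"
     "\<And>i x. x \<in> space M \<Longrightarrow> cmod (s i x) \<le> 2 * cmod (f x)"
    using s' by auto
  have [measurable]: "s i \<in> borel_measurable M" for i using borel_measurable_simple_function[OF s(1)] .
  have m: "Lp_mem M p (s i)" for i
    by (rule Lp_mem_bound[OF Lp_mem_cmult[OF f, of 2]]) (use s p in \<open>auto simp: norm_mult\<close>)
  have "(\<lambda>i. \<integral>x. cmod (s i x - f x) powr p \<partial>M) \<longlonglongrightarrow> (\<integral>x. 0 \<partial>M)"
  proof (rule integral_dominated_convergence[where w = "\<lambda>x. 3 powr p * cmod (f x) powr p"])
    show "AE x in M. (\<lambda>i. cmod (s i x - f x) powr p) \<longlonglongrightarrow> 0"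
    proof (rule AE_I2)
      fix x assume "x \<in> space M"
      then have "(\<lambda>i. cmod (s i x - f x)) \<longlonglongrightarrow> 0" using s(2) tendsto_norm_zero LIM_zero by blast
      then have "(\<lambda>i. cmod (s i x - f x) powr p) \<longlonglongrightarrow> 0 powr p" using p by (intro tendsto_powr' tendsto_const) auto
      then show "(\<lambda>i. cmod (s i x - f x) powr p) \<longlonglongrightarrow> 0" by simp
    qed
    show "AE x in M. norm (cmod (s i x - f x) powr p) \<le> 3 powr p * cmod (f x) powr p" for i
    proof (rule AE_I2)
      fix x assume x: "x \<in> space M"
      have "cmod (s i x - f x) \<le> cmod (s i x) + cmod (f x)" by (rule norm_triangle_ineq4)
      then have "cmod (s i x - f x) \<le> 3 * cmod (f x)" using s(3)[OF x, of i] by linarith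
      then have "cmod (s i x - f x) powr p \<le> (3 * cmod (f x)) powr p" using p by (intro powr_mono2) auto
      then show "norm (cmod (s i x - f x) powr p) \<le> 3 powr p * cmod (f x) powr p" by (simp add: powr_mult)
    qed
  qed (use Lp_memD[OF f] in auto)
  then have "(\<lambda>i. (\<integral>x. cmod (s i x - f x) powr p \<partial>M) powr (1/p)) \<longlonglongrightarrow> 0 powr (1/p)"
    using p by (intro tendsto_powr' tendsto_const) (auto intro!: always_eventually integral_nonneg_AE)
  then show ?thesis using that[OF s(1) m] by (simp add: Lp_norm_def)
qed

section \<open>Finite l_p norms, bilinear bounds and finite Schur multipliers\<close>

definition fin_norm :: "real \<Rightarrow> 'i set \<Rightarrow> ('i \<Rightarrow> complex) \<Rightarrow> real" where
  "fin_norm p F x = (\<Sum>i\<in>F. cmod (x i) powr p) powr (1 / p)"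

lemma fin_norm_eq_Lp_norm: "finite F \<Longrightarrow> fin_norm p F x = Lp_norm (count_space F) p x"
  by (simp add: fin_norm_def Lp_norm_def lebesgue_integral_count_space_finite)

lemma Lp_mem_count_space: "finite F \<Longrightarrow> Lp_mem (count_space F) p x"
  by (simp add: Lp_mem_def integrable_count_space)

lemma fin_norm_nonneg [simp]: "0 \<le> fin_norm p F x"
  by (simp add: fin_norm_def)

lemma fin_norm_powr: "p \<noteq> 0 \<Longrightarrow> fin_norm p F x powr p = (\<Sum>i\<in>F. cmod (x i) powr p)"
  by (simp add: fin_norm_def powr_powr sum_nonneg)

lemma fin_norm_cmult: "finite F \<Longrightarrow> 0 < p \<Longrightarrow> fin_norm p F (\<lambda>i. c * x i) = cmod c * fin_norm p F x"
  by (simp add: fin_norm_eq_Lp_norm Lp_norm_cmult)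

lemma fin_norm_eq_0: "finite F \<Longrightarrow> 0 < p \<Longrightarrow> fin_norm p F x = 0 \<longleftrightarrow> (\<forall>i\<in>F. x i = 0)"
  by (simp add: fin_norm_eq_Lp_norm Lp_norm_eq_0[OF Lp_mem_count_space] AE_count_space)

lemma fin_norm_cong: "(\<And>i. i \<in> F \<Longrightarrow> cmod (x i) = cmod (y i)) \<Longrightarrow> fin_norm p F x = fin_norm p F y"
  by (simp add: fin_norm_def)

lemma fin_norm_mono:
  "0 < p \<Longrightarrow> (\<And>i. i \<in> F \<Longrightarrow> cmod (x i) \<le> cmod (y i)) \<Longrightarrow> fin_norm p F x \<le> fin_norm p F y"
  unfolding fin_norm_def by (intro powr_mono2 sum_mono) (auto intro: sum_nonneg)

lemma fin_norm_add:
  assumes "finite F" "1 < p"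
  shows "fin_norm p F (\<lambda>i. x i + y i) \<le> fin_norm p F x + fin_norm p F y"
  using Minkowski[of "count_space F" p x y] assms by (simp add: fin_norm_eq_Lp_norm Lp_mem_count_space)

lemma Holder_fin:
  assumes "finite F" "conj_pair p q"
  shows "cmod (\<Sum>i\<in>F. y i * x i) \<le> fin_norm q F y * fin_norm p F x"
  using Holder_pairing[OF assms(2), of "count_space F" y x] assms(1)
  by (simp add: fin_norm_eq_Lp_norm Lp_mem_count_space pairing_def lebesgue_integral_count_space_finite)

lemma Holder_fin_real:
  assumes "finite F" "conj_pair p q" "\<And>i. i \<in> F \<Longrightarrow> 0 \<le> a i" "\<And>i. i \<in> F \<Longrightarrow> 0 \<le> b i"
  shows "(\<Sum>i\<in>F. a i * b i) \<le> (\<Sum>i\<in>F. a i powr q) powr (1/q) * (\<Sum>i\<in>F. b i powr p) powr (1/p)"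
proof -
  have "cmod (\<Sum>i\<in>F. of_real (a i) * of_real (b i)) \<le>
      fin_norm q F (\<lambda>i. of_real (a i)) * fin_norm p F (\<lambda>i. of_real (b i))"
    by (rule Holder_fin[OF assms(1,2)])
  moreover have "(\<Sum>i\<in>F. complex_of_real (a i) * of_real (b i)) = of_real (\<Sum>i\<in>F. a i * b i)" by simp
  ultimately show ?thesis using assms(3,4) by (simp add: fin_norm_def del: of_real_sum)
qed

lemma fin_norm_le_dual:
  assumes "finite F" "conj_pair p q" "0 \<le> C"
    "\<And>y. cmod (\<Sum>i\<in>F. y i * x i) \<le> C * fin_norm q F y"
  shows "fin_norm p F x \<le> C"
  unfolding fin_norm_eq_Lp_norm[OF assms(1)]
  by (rule Lp_norm_le_dual[OF assms(2) Lp_mem_count_space assms(3)])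
     (use assms in \<open>auto simp: fin_norm_eq_Lp_norm pairing_def lebesgue_integral_count_space_finite\<close>)

text \<open>A bound for the norm of T as an operator from l_p(J) to l_p(I), for C \<ge> 0, in
  bilinear form: sums can then be regrouped symmetrically in rows and columns.
  \<open>bilinear_bound_iff\<close> is the translation.\<close>

definition bilinear_bound ::
  "real \<Rightarrow> real \<Rightarrow> 'i set \<Rightarrow> 'j set \<Rightarrow> ('i \<Rightarrow> 'j \<Rightarrow> complex) \<Rightarrow> real \<Rightarrow> bool" where
  "bilinear_bound p q I J T C \<longleftrightarrow>
     (\<forall>x y. cmod (\<Sum>i\<in>I. \<Sum>j\<in>J. T i j * x j * y i) \<le> C * fin_norm p J x * fin_norm q I y)"

lemma bilinear_boundD:
  "bilinear_bound p q I J T C \<Longrightarrow> cmod (\<Sum>i\<in>I. \<Sum>j\<in>J. T i j * x j * y i) \<le> C * fin_norm p J x * fin_norm q I y"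
  by (simp add: bilinear_bound_def)

lemma bilinear_bound_iff:
  assumes "finite I" "conj_pair p q" "0 \<le> C"
  shows "bilinear_bound p q I J T C \<longleftrightarrow> (\<forall>x. fin_norm p I (\<lambda>i. \<Sum>j\<in>J. T i j * x j) \<le> C * fin_norm p J x)"
proof -
  have *: "(\<Sum>i\<in>I. \<Sum>j\<in>J. T i j * x j * y i) = (\<Sum>i\<in>I. y i * (\<Sum>j\<in>J. T i j * x j))" for x y
    by (simp add: sum_distrib_left mult_ac)
  show ?thesis
  proof
    assume "bilinear_bound p q I J T C"
    then show "\<forall>x. fin_norm p I (\<lambda>i. \<Sum>j\<in>J. T i j * x j) \<le> C * fin_norm p J x"
      using assms by (auto simp: bilinear_bound_def * intro!: fin_norm_le_dual)
  next
    assume b: "\<forall>x. fin_norm p I (\<lambda>i. \<Sum>j\<in>J. T i j * x j) \<le> C * fin_norm p J x"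
    show "bilinear_bound p q I J T C" unfolding bilinear_bound_def *
    proof (intro allI)
      fix x y
      have "cmod (\<Sum>i\<in>I. y i * (\<Sum>j\<in>J. T i j * x j)) \<le> fin_norm q I y * fin_norm p I (\<lambda>i. \<Sum>j\<in>J. T i j * x j)"
        by (rule Holder_fin[OF assms(1,2)])
      also have "\<dots> \<le> fin_norm q I y * (C * fin_norm p J x)" using b by (intro mult_left_mono) auto
      finally show "cmod (\<Sum>i\<in>I. y i * (\<Sum>j\<in>J. T i j * x j)) \<le> C * fin_norm p J x * fin_norm q I y" by (simp add: mult_ac)
    qed
  qed
qed

text \<open>The finite form of the V_p norm; the constant C is uniform over all finite index sets.
  This is the hub through which both inclusions of the theorem pass.\<close>

definition schur_bd :: "real \<Rightarrow> real \<Rightarrow> real \<Rightarrow> ('i \<times> 'i \<Rightarrow> complex) \<Rightarrow> bool" where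
  "schur_bd p q C \<psi> \<longleftrightarrow> (\<forall>F T. finite F \<and> bilinear_bound p q F F T 1 \<longrightarrow>
     bilinear_bound p q F F (\<lambda>i j. \<psi> (i, j) * T i j) C)"

text \<open>The labels a and b may repeat, so several rows or columns can carry the same group
  element. Compress T along the fibres of a and b by the normalised restrictions of y and x: the
  compression T' is again contractive, and since \<psi> sees only labels, Schur multiplication
  commutes with it. Evaluating the multiplied T' at the fibre norms gives back the sum at x and
  y.\<close>

lemma schur_bd_rectangular:
  fixes \<psi> :: "'g \<times> 'g \<Rightarrow> complex"
  assumes pq: "conj_pair p q" and S: "schur_bd p q C \<psi>" and C: "0 \<le> C"
    and fin: "finite I" "finite J" and T: "bilinear_bound p q I J T 1"
  shows "bilinear_bound p q I J (\<lambda>i j. \<psi> (a i, b j) * T i j) C"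
  unfolding bilinear_bound_def
proof (intro allI)
  fix x y
  note P = conj_pairD[OF pq]
  define F where "F = a ` I \<union> b ` J"
  have F: "finite F" "a ` I \<subseteq> F" "b ` J \<subseteq> F" using fin by (auto simp: F_def)
  define X where "X t = fin_norm p {j \<in> J. b j = t} x" for t
  define Y where "Y s = fin_norm q {i \<in> I. a i = s} y" for s
  \<comment> \<open>A fibre on which x or y has norm 0 contributes 0 here, division by zero being 0;
    this loses nothing since x or y then vanishes on it.\<close>
  define T' where "T' s t = (\<Sum>i\<in>{i \<in> I. a i = s}. \<Sum>j\<in>{j \<in> J. b j = t}. T i j * x j * y i / of_real (X t * Y s))" for s t
  have grp: "(\<Sum>s\<in>F. \<Sum>t\<in>F. \<phi> s t * (\<Sum>i\<in>{i \<in> I. a i = s}. \<Sum>j\<in>{j \<in> J. b j = t}. K i j s t)) = (\<Sum>i\<in>I. \<Sum>j\<in>J. \<phi> (a i) (b j) * K i j (a i) (b j))"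
    for \<phi> :: "'g \<Rightarrow> 'g \<Rightarrow> complex" and K
  proof -
    have "(\<Sum>s\<in>F. \<Sum>t\<in>F. \<phi> s t * (\<Sum>i\<in>{i \<in> I. a i = s}. \<Sum>j\<in>{j \<in> J. b j = t}. K i j s t))
        = (\<Sum>s\<in>F. \<Sum>i\<in>{i \<in> I. a i = s}. \<Sum>t\<in>F. \<Sum>j\<in>{j \<in> J. b j = t}. \<phi> (a i) (b j) * K i j (a i) (b j))"
      by (subst sum.swap[of _ F]) (auto simp: sum_distrib_left intro!: sum.cong)
    also have "\<dots> = (\<Sum>s\<in>F. \<Sum>i\<in>{i \<in> I. a i = s}. \<Sum>j\<in>J. \<phi> (a i) (b j) * K i j (a i) (b j))"
      using fin F by (intro sum.cong refl sum.group)
    also have "\<dots> = (\<Sum>i\<in>I. \<Sum>j\<in>J. \<phi> (a i) (b j) * K i j (a i) (b j))"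
      using fin F by (intro sum.group)
    finally show ?thesis .
  qed
  \<comment> \<open>Spreading a vector \<xi> over the fibres along the normalised pieces of z does
    not increase its norm; an isometry on nonzero fibres and 0 on the others.\<close>
  have contr: "fin_norm r J' (\<lambda>j. z j * \<xi> (c j) / of_real (fin_norm r {k \<in> J'. c k = c j} z)) \<le> fin_norm r F \<xi>"
    if r: "1 < r" and J': "finite J'" "c ` J' \<subseteq> F" for r and J' :: "'k set" and z \<xi> and c :: "'k \<Rightarrow> 'g"
  proof -
    have "(\<Sum>j\<in>J'. cmod (z j * \<xi> (c j) / of_real (fin_norm r {k \<in> J'. c k = c j} z)) powr r)
      = (\<Sum>t\<in>F. \<Sum>j\<in>{j \<in> J'. c j = t}. cmod (z j * \<xi> (c j) / of_real (fin_norm r {k \<in> J'. c k = c j} z)) powr r)"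
      using F J' by (intro sum.group[symmetric])
    also have "\<dots> = (\<Sum>t\<in>F. cmod (\<xi> t) powr r * ((\<Sum>j\<in>{j \<in> J'. c j = t}. cmod (z j) powr r) / fin_norm r {k \<in> J'. c k = t} z powr r))"
      by (intro sum.cong refl) (simp add: norm_mult norm_divide powr_mult powr_divide sum_distrib_left sum_divide_distrib mult_ac)
    also have "\<dots> \<le> (\<Sum>t\<in>F. cmod (\<xi> t) powr r * 1)"
    proof (intro sum_mono mult_left_mono)
      fix t
      have "(\<Sum>j\<in>{j \<in> J'. c j = t}. cmod (z j) powr r) = fin_norm r {k \<in> J'. c k = t} z powr r"
        using r by (simp add: fin_norm_powr)
      then show "(\<Sum>j\<in>{j \<in> J'. c j = t}. cmod (z j) powr r) / fin_norm r {k \<in> J'. c k = t} z powr r \<le> 1" by (simp add: divide_le_eq)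
    qed auto
    finally show ?thesis unfolding fin_norm_def[of r J'] fin_norm_def[of r F] using r by (intro powr_mono2) (auto intro: sum_nonneg)
  qed
  have nrm: "fin_norm r F (\<lambda>t. of_real (fin_norm r {k \<in> J'. c k = t} z)) = fin_norm r J' z"
    if r: "1 < r" and J': "finite J'" "c ` J' \<subseteq> F" for r and J' :: "'k set" and z and c :: "'k \<Rightarrow> 'g"
  proof -
    have "(\<Sum>t\<in>F. cmod (of_real (fin_norm r {k \<in> J'. c k = t} z)) powr r) = (\<Sum>t\<in>F. \<Sum>k\<in>{k \<in> J'. c k = t}. cmod (z k) powr r)"
      using r by (simp add: fin_norm_powr)
    also have "\<dots> = (\<Sum>k\<in>J'. cmod (z k) powr r)" using F J' by (intro sum.group)
    finally show ?thesis by (simp add: fin_norm_def[of r F] fin_norm_def[of r J'])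
  qed
  have "bilinear_bound p q F F T' 1"
    unfolding bilinear_bound_def
  proof (intro allI)
    fix \<xi> \<eta>
    have "(\<Sum>s\<in>F. \<Sum>t\<in>F. T' s t * \<xi> t * \<eta> s) = (\<Sum>s\<in>F. \<Sum>t\<in>F. (\<xi> t * \<eta> s) * (\<Sum>i\<in>{i \<in> I. a i = s}. \<Sum>j\<in>{j \<in> J. b j = t}. T i j * x j * y i / of_real (X t * Y s)))"
      by (simp add: T'_def mult_ac)
    also have "\<dots> = (\<Sum>i\<in>I. \<Sum>j\<in>J. (\<xi> (b j) * \<eta> (a i)) * (T i j * x j * y i / of_real (X (b j) * Y (a i))))"
      by (rule grp)
    also have "\<dots> = (\<Sum>i\<in>I. \<Sum>j\<in>J. T i j * (x j * \<xi> (b j) / of_real (X (b j))) * (y i * \<eta> (a i) / of_real (Y (a i))))"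
      by (simp add: mult_ac)
    also have "cmod \<dots> \<le> 1 * fin_norm p J (\<lambda>j. x j * \<xi> (b j) / of_real (X (b j))) * fin_norm q I (\<lambda>i. y i * \<eta> (a i) / of_real (Y (a i)))"
      by (rule bilinear_boundD[OF T])
    also have "\<dots> \<le> 1 * fin_norm p F \<xi> * fin_norm q F \<eta>"
      unfolding X_def Y_def using P F fin by (intro mult_mono contr) auto
    finally show "cmod (\<Sum>s\<in>F. \<Sum>t\<in>F. T' s t * \<xi> t * \<eta> s) \<le> 1 * fin_norm p F \<xi> * fin_norm q F \<eta>" .
  qed
  then have "bilinear_bound p q F F (\<lambda>i j. \<psi> (i, j) * T' i j) C"
    using S F unfolding schur_bd_def by blast
  then have *: "cmod (\<Sum>s\<in>F. \<Sum>t\<in>F. \<psi> (s, t) * T' s t * of_real (X t) * of_real (Y s)) \<le> C * fin_norm p F (\<lambda>t. of_real (X t)) * fin_norm q F (\<lambda>s. of_real (Y s))"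
    by (rule bilinear_boundD)
  \<comment> \<open>These cover the fibres of norm 0, where cancelling the normalisation is not
    literally possible.\<close>
  have x0: "x j = 0" if "j \<in> J" "X (b j) = 0" for j
    using that fin P unfolding X_def by (subst (asm) fin_norm_eq_0) auto
  have y0: "y i = 0" if "i \<in> I" "Y (a i) = 0" for i
    using that fin P unfolding Y_def by (subst (asm) fin_norm_eq_0) auto
  have "(\<Sum>s\<in>F. \<Sum>t\<in>F. \<psi> (s, t) * T' s t * of_real (X t) * of_real (Y s))
     = (\<Sum>s\<in>F. \<Sum>t\<in>F. (\<psi> (s, t) * of_real (X t) * of_real (Y s)) * (\<Sum>i\<in>{i \<in> I. a i = s}. \<Sum>j\<in>{j \<in> J. b j = t}. T i j * x j * y i / of_real (X t * Y s)))"
    by (simp add: T'_def mult_ac)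
  also have "\<dots> = (\<Sum>i\<in>I. \<Sum>j\<in>J. (\<psi> (a i, b j) * of_real (X (b j)) * of_real (Y (a i))) * (T i j * x j * y i / of_real (X (b j) * Y (a i))))"
    by (rule grp)
  also have "\<dots> = (\<Sum>i\<in>I. \<Sum>j\<in>J. \<psi> (a i, b j) * T i j * x j * y i)"
  proof (intro sum.cong refl)
    fix i j assume ij: "i \<in> I" "j \<in> J"
    show "(\<psi> (a i, b j) * of_real (X (b j)) * of_real (Y (a i))) * (T i j * x j * y i / of_real (X (b j) * Y (a i))) = \<psi> (a i, b j) * T i j * x j * y i"
      using x0[OF ij(2)] y0[OF ij(1)] by (cases "X (b j) = 0"; cases "Y (a i) = 0") auto
  qed
  finally show "cmod (\<Sum>i\<in>I. \<Sum>j\<in>J. \<psi> (a i, b j) * T i j * x j * y i) \<le> C * fin_norm p J x * fin_norm q I y"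
    using * P F fin unfolding X_def Y_def by (simp add: nrm)
qed

section \<open>The projective tensor norm in finite dimension\<close>

text \<open>Hahn-Banach for a finite family of vectors instead of a space: l prescribes real values
  on the generators v b, and the inequality for all real combinations makes these values compatible
  with linear relations, since \<pi> is 0 at 0. The extension goes one vector at a time.\<close>

lemma finite_Hahn_Banach:
  fixes \<pi> :: "('k \<Rightarrow> complex) \<Rightarrow> real" and v :: "'b \<Rightarrow> 'k \<Rightarrow> complex"
  assumes sub: "\<And>f g. \<pi> (\<lambda>k. f k + g k) \<le> \<pi> f + \<pi> g"
    and hom: "\<And>t f. 0 < t \<Longrightarrow> \<pi> (\<lambda>k. of_real t * f k) = t * \<pi> f"
    and zero: "\<pi> (\<lambda>k. 0) = 0" and B: "finite B" "b0 \<notin> B"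
  shows "\<exists>l. l b0 = \<pi> (v b0) \<and>
    (\<forall>t. (\<Sum>b\<in>insert b0 B. t b * l b) \<le> \<pi> (\<lambda>k. \<Sum>b\<in>insert b0 B. of_real (t b) * v b k))"
  using B
proof (induction B)
  case empty
  have "t * \<pi> (v b0) \<le> \<pi> (\<lambda>k. of_real t * v b0 k)" for t
  proof -
    consider "t > 0" | "t = 0" | "t < 0" by linarith
    then show ?thesis
    proof cases
      case 3
      have "\<pi> (\<lambda>k. of_real t * v b0 k + of_real (-t) * v b0 k) \<le> \<pi> (\<lambda>k. of_real t * v b0 k) + \<pi> (\<lambda>k. of_real (-t) * v b0 k)"
        by (rule sub)
      then show ?thesis using 3 hom[of "-t" "v b0"] zero by simp
    qed (use hom zero in auto)
  qed
  then show ?case by auto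
next
  case (insert b B)
  then obtain l where l: "l b0 = \<pi> (v b0)"
    "\<And>t. (\<Sum>b\<in>insert b0 B. t b * l b) \<le> \<pi> (\<lambda>k. \<Sum>b\<in>insert b0 B. of_real (t b) * v b k)" by auto
  define L where "L t = (\<Sum>b\<in>insert b0 B. t b * l b)" for t
  define V where "V t k = (\<Sum>b\<in>insert b0 B. of_real (t b) * v b k)" for t k
  have lin: "L t + L s = L (\<lambda>b. t b + s b)" "V t k + V s k = V (\<lambda>b. t b + s b) k"
     "L (\<lambda>b. c * t b) = c * L t" "V (\<lambda>b. c * t b) k = of_real c * V t k" for t s k c
    unfolding L_def V_def by (simp_all add: sum.distrib sum_distrib_left algebra_simps)
  have lV: "L t \<le> \<pi> (V t)" for t using l(2)[of t] by (simp add: L_def V_def[abs_def])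
  have sep: "L t - \<pi> (\<lambda>k. V t k - v b k) \<le> \<pi> (\<lambda>k. V s k + v b k) - L s" for t s
  proof -
    have "L t + L s = L (\<lambda>b. t b + s b)" by (rule lin(1))
    also have "\<dots> \<le> \<pi> (V (\<lambda>b. t b + s b))" by (rule lV)
    also have "\<dots> = \<pi> (\<lambda>k. V t k + V s k)" by (simp only: lin(2))
    also have "\<dots> = \<pi> (\<lambda>k. (V t k - v b k) + (V s k + v b k))" by (simp add: algebra_simps)
    also have "\<dots> \<le> \<pi> (\<lambda>k. V t k - v b k) + \<pi> (\<lambda>k. V s k + v b k)" by (rule sub)
    finally show ?thesis by linarith
  qed
  \<comment> \<open>By \<open>sep\<close> every lower constraint on the value at the new vector lies
    below every upper one; the supremum of the lower ones satisfies both.\<close>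
  define \<alpha> where "\<alpha> = (SUP t. L t - \<pi> (\<lambda>k. V t k - v b k))"
  have bdd: "bdd_above (range (\<lambda>t. L t - \<pi> (\<lambda>k. V t k - v b k)))"
    using sep by (intro bdd_aboveI2)
  have a1: "L t - \<pi> (\<lambda>k. V t k - v b k) \<le> \<alpha>" for t
    unfolding \<alpha>_def by (rule cSUP_upper[OF UNIV_I bdd])
  have a2: "\<alpha> \<le> \<pi> (\<lambda>k. V s k + v b k) - L s" for s
    unfolding \<alpha>_def using sep by (intro cSUP_least) auto
  have main: "L t + r * \<alpha> \<le> \<pi> (\<lambda>k. V t k + of_real r * v b k)" for t r
  proof -
    consider "r > 0" | "r = 0" | "r < 0" by linarith
    then show ?thesis
    proof cases
      case 1
      have "r * \<alpha> \<le> r * (\<pi> (\<lambda>k. V (\<lambda>b. (1/r) * t b) k + v b k) - L (\<lambda>b. (1/r) * t b))"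
        using 1 a2 by (intro mult_left_mono) auto
      also have "\<dots> = r * \<pi> (\<lambda>k. V (\<lambda>b. (1/r) * t b) k + v b k) - L t"
        unfolding lin using 1 by (simp add: right_diff_distrib)
      also have "r * \<pi> (\<lambda>k. V (\<lambda>b. (1/r) * t b) k + v b k) = \<pi> (\<lambda>k. of_real r * (V (\<lambda>b. (1/r) * t b) k + v b k))"
        using hom[OF 1] by simp
      also have "(\<lambda>k. of_real r * (V (\<lambda>b. (1/r) * t b) k + v b k)) = (\<lambda>k. V t k + of_real r * v b k)"
        unfolding lin using 1 by (simp add: distrib_left)
      finally show ?thesis by linarith
    next
      case 2
      then show ?thesis using lV by simp
    next
      case 3
      define r' where "r' = - r"
      have r': "r' > 0" "r = - r'" using 3 by (auto simp: r'_def)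
      have "r' * (L (\<lambda>b. (1/r') * t b) - \<pi> (\<lambda>k. V (\<lambda>b. (1/r') * t b) k - v b k)) \<le> r' * \<alpha>"
        using r' a1 by (intro mult_left_mono) auto
      moreover have "r' * (L (\<lambda>b. (1/r') * t b) - \<pi> (\<lambda>k. V (\<lambda>b. (1/r') * t b) k - v b k)) = L t - r' * \<pi> (\<lambda>k. V (\<lambda>b. (1/r') * t b) k - v b k)"
        unfolding lin using r' by (simp add: right_diff_distrib)
      moreover have "r' * \<pi> (\<lambda>k. V (\<lambda>b. (1/r') * t b) k - v b k) = \<pi> (\<lambda>k. V t k + of_real r * v b k)"
      proof -
        have "(\<lambda>k. V t k + of_real r * v b k) = (\<lambda>k. of_real r' * (V (\<lambda>b. (1/r') * t b) k - v b k))"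
          unfolding lin using r' by (simp add: right_diff_distrib)
        then show ?thesis using hom[OF r'(1)] by simp
      qed
      ultimately have "L t - \<pi> (\<lambda>k. V t k + of_real r * v b k) \<le> r' * \<alpha>" by linarith
      then show ?thesis using r'(2) by simp
    qed
  qed
  define l' where "l' = l(b := \<alpha>)"
  have bn: "b \<notin> insert b0 B" using insert by auto
  have fin: "finite (insert b0 B)" using insert by auto
  have eqset: "insert b0 (insert b B) = insert b (insert b0 B)" by auto
  have Ll: "(\<Sum>c\<in>insert b0 B. t c * l' c) = L t" for t
    unfolding L_def l'_def using bn by (intro sum.cong) auto
  show ?case
  proof (intro exI[of _ l'] conjI allI)
    show "l' b0 = \<pi> (v b0)" using l bn by (auto simp: l'_def)
    fix t
    have "(\<Sum>c\<in>insert b0 (insert b B). t c * l' c) = L t + t b * \<alpha>"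
      unfolding eqset sum.insert[OF fin bn] Ll by (simp add: l'_def)
    also have "\<dots> \<le> \<pi> (\<lambda>k. V t k + of_real (t b) * v b k)" by (rule main)
    also have "(\<lambda>k. V t k + of_real (t b) * v b k) = (\<lambda>k. \<Sum>c\<in>insert b0 (insert b B). of_real (t c) * v c k)"
      unfolding eqset sum.insert[OF fin bn] V_def by (simp add: add.commute)
    finally show "(\<Sum>c\<in>insert b0 (insert b B). t c * l' c) \<le> \<pi> (\<lambda>k. \<Sum>c\<in>insert b0 (insert b B). of_real (t c) * v c k)" .
  qed
qed

text \<open>The infimum \<pi> of the costs of finite expansions is the projective norm. A functional
  that attains \<pi> at f and lies below \<pi> everywhere is a matrix T bounded on N and N', so D
  applies to it. N and N' are allowed to vanish on nonzero vectors, as happens for step functions on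
  null cells. The expansion is normalised by N x \<le> 1, leaving the cost in N' alone.\<close>

lemma projective_duality:
  fixes N :: "('j \<Rightarrow> complex) \<Rightarrow> real" and N' :: "('i \<Rightarrow> complex) \<Rightarrow> real"
  assumes fin: "finite I" "finite J"
    and N: "\<And>x. 0 \<le> N x" "\<And>c x. N (\<lambda>j. c * x j) = cmod c * N x"
    and N': "\<And>y. 0 \<le> N' y" "\<And>c y. N' (\<lambda>i. c * y i) = cmod c * N' y"
    and D: "\<And>T. (\<And>x y. cmod (\<Sum>i\<in>I. \<Sum>j\<in>J. T i j * x j * y i) \<le> N x * N' y) \<Longrightarrow>
       cmod (\<Sum>i\<in>I. \<Sum>j\<in>J. f (i, j) * T i j) \<le> D"
    and \<eta>: "0 < \<eta>"
  obtains ps where "\<forall>(y, x)\<in>set ps. N x \<le> 1"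
    "\<And>i j. i \<in> I \<Longrightarrow> j \<in> J \<Longrightarrow> f (i, j) = (\<Sum>(y, x)\<leftarrow>ps. y i * x j)"
    "(\<Sum>(y, x)\<leftarrow>ps. N' y) \<le> D + \<eta>"
proof -
  define K where "K = I \<times> J"
  have finK: "finite K" using fin by (simp add: K_def)
  define R where "R f ps \<longleftrightarrow> (\<forall>(y, x)\<in>set ps. N x \<le> 1) \<and> (\<forall>i\<in>I. \<forall>j\<in>J. f (i, j) = (\<Sum>(y, x)\<leftarrow>ps. y i * x j))"
    for f and ps :: "(('i \<Rightarrow> complex) \<times> ('j \<Rightarrow> complex)) list"
  define cost where "cost ps = (\<Sum>(y, x)\<leftarrow>ps. N' y)" for ps :: "(('i \<Rightarrow> complex) \<times> ('j \<Rightarrow> complex)) list"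
  define \<pi> where "\<pi> f = Inf {cost ps | ps. R f ps}" for f
  have cost0: "0 \<le> cost ps" for ps
    unfolding cost_def by (intro sum_list_nonneg) (auto simp: N')
  have bdd: "bdd_below {cost ps | ps. R f ps}" for f
    by (intro bdd_belowI[of _ 0]) (auto simp: cost0)
  have pi_le: "\<pi> f \<le> cost ps" if "R f ps" for f ps
    unfolding \<pi>_def using that by (intro cInf_lower bdd) auto
  have single: "\<pi> f \<le> N x * N' y" if f: "\<And>i j. i \<in> I \<Longrightarrow> j \<in> J \<Longrightarrow> f (i, j) = y i * x j" for f y x
  proof (cases "N x = 0")
    case True
    have "\<pi> f \<le> 0"
    proof (rule field_le_epsilon)
      fix e :: real assume e: "0 < e"
      \<comment> \<open>If N x = 0 the factor x can be scaled up freely and y scaled down, so the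
        cost is arbitrarily small.\<close>
      define r where "r = e / (1 + N' y)"
      have pos: "0 < 1 + N' y" using N'(1)[of y] by linarith
      have r: "0 < r" using e pos by (simp add: r_def)
      have c: "complex_of_real r * complex_of_real (1/r) = 1" using r by simp
      have "R f [((\<lambda>i. of_real r * y i), (\<lambda>j. of_real (1/r) * x j))]"
        using f r True c by (simp only: R_def list.set) (auto simp: N(2)[of "complex_of_real (1/r)" x] simp del: of_real_divide of_real_1)
      then have "\<pi> f \<le> r * N' y" using pi_le r N'(2)[of "of_real r" y] by (fastforce simp: cost_def)
      also have "\<dots> \<le> r * (1 + N' y)" using r by (intro mult_left_mono) auto
      also have "\<dots> = e" using pos by (simp add: r_def)
      finally show "\<pi> f \<le> 0 + e" by simp
    qed
    then show ?thesis using True by simp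
  next
    case False
    then have n: "N x > 0" using N(1)[of x] by linarith
    have c: "complex_of_real (N x) * complex_of_real (1 / N x) = 1" using n by simp
    have "R f [((\<lambda>i. of_real (N x) * y i), (\<lambda>j. of_real (1 / N x) * x j))]"
      using f n c by (simp only: R_def list.set) (auto simp: N(2)[of "complex_of_real (1 / N x)" x] norm_divide simp del: of_real_divide of_real_1)
    then show ?thesis using pi_le[of f] n N'(2)[of "of_real (N x)" y] by (fastforce simp: cost_def)
  qed
  \<comment> \<open>Expand in matrix units; the factor r j, at least 1, normalises the unit vectors
    for N.\<close>
  have ex: "\<exists>ps. R f ps" for f
  proof -
    obtain ks where ks: "set ks = K" "distinct ks" using finite_distinct_list[OF finK] by blast
    define \<delta> :: "'j \<Rightarrow> 'j \<Rightarrow> complex" where "\<delta> j0 j = (if j = j0 then 1 else 0)" for j0 j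
    define \<delta>' :: "'i \<Rightarrow> 'i \<Rightarrow> complex" where "\<delta>' j0 j = (if j = j0 then 1 else 0)" for j0 j
    define r where "r j = 1 + N (\<delta> j)" for j
    have r: "r j > 0" for j using N(1)[of "\<delta> j"] by (simp add: r_def add_pos_nonneg)
    define ps where "ps = map (\<lambda>k. ((\<lambda>i. f k * of_real (r (snd k)) * \<delta>' (fst k) i), (\<lambda>j. of_real (1 / r (snd k)) * \<delta> (snd k) j))) ks"
    have "R f ps" unfolding R_def
    proof (intro conjI ballI)
      fix z assume "z \<in> set ps"
      then obtain k where k: "z = ((\<lambda>i. f k * of_real (r (snd k)) * \<delta>' (fst k) i), (\<lambda>j. of_real (1 / r (snd k)) * \<delta> (snd k) j))"
        by (auto simp: ps_def)
      have "N (\<lambda>j. of_real (1 / r (snd k)) * \<delta> (snd k) j) = N (\<delta> (snd k)) / r (snd k)"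
        using N(2)[of "of_real (1 / r (snd k))" "\<delta> (snd k)"] r[of "snd k"] by (simp add: norm_divide)
      also have "\<dots> \<le> 1" using r[of "snd k"] by (simp add: r_def)
      finally show "case z of (y, x) \<Rightarrow> N x \<le> 1" by (simp add: k)
    next
      fix i j assume ij: "i \<in> I" "j \<in> J"
      have "(\<Sum>(y, x)\<leftarrow>ps. y i * x j) = (\<Sum>k\<leftarrow>ks. f k * \<delta>' (fst k) i * \<delta> (snd k) j)"
        unfolding ps_def map_map o_def case_prod_conv using r less_imp_neq[OF r]
        by (intro arg_cong[where f = sum_list] map_cong refl) (simp add: order_less_imp_not_eq2)
      also have "\<dots> = (\<Sum>k\<in>K. f k * \<delta>' (fst k) i * \<delta> (snd k) j)"
        using ks by (simp add: sum_list_distinct_conv_sum_set)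
      also have "\<dots> = (\<Sum>k\<in>K. if k = (i, j) then f k else 0)"
        by (intro sum.cong refl) (auto simp: \<delta>_def \<delta>'_def)
      also have "\<dots> = f (i, j)" using ij finK by (simp add: K_def)
      finally show "f (i, j) = (\<Sum>(y, x)\<leftarrow>ps. y i * x j)" ..
    qed
    then show ?thesis ..
  qed
  have approx: "\<exists>ps. R f ps \<and> cost ps < \<pi> f + e" if "0 < e" for f e
  proof -
    have "{cost ps | ps. R f ps} \<noteq> {}" using ex by auto
    moreover have "Inf {cost ps | ps. R f ps} < \<pi> f + e" using that by (simp add: \<pi>_def)
    ultimately show ?thesis using cInf_less_iff[OF _ bdd] by blast
  qed
  have sub: "\<pi> (\<lambda>k. f k + g k) \<le> \<pi> f + \<pi> g" for f g
  proof (rule field_le_epsilon)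
    fix e :: real assume e: "0 < e"
    obtain ps qs where ps: "R f ps" "cost ps < \<pi> f + e/2" and qs: "R g qs" "cost qs < \<pi> g + e/2"
      using approx[of "e/2" f] approx[of "e/2" g] e by auto
    have "R (\<lambda>k. f k + g k) (ps @ qs)" using ps(1) qs(1) unfolding R_def by auto
    then have "\<pi> (\<lambda>k. f k + g k) \<le> cost (ps @ qs)" by (rule pi_le)
    then show "\<pi> (\<lambda>k. f k + g k) \<le> \<pi> f + \<pi> g + e" using ps(2) qs(2) by (simp add: cost_def)
  qed
  have hom_le: "\<pi> (\<lambda>k. of_real t * f k) \<le> t * \<pi> f" if t: "0 < t" for t f
  proof (rule field_le_epsilon)
    fix e :: real assume e: "0 < e"
    obtain ps where ps: "R f ps" "cost ps < \<pi> f + e/t" using approx[of "e/t" f] e t by auto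
    define qs where "qs = map (\<lambda>(y, x). ((\<lambda>i. of_real t * y i), x)) ps"
    have m: "(\<Sum>(y, x)\<leftarrow>qs. y i * x j) = of_real t * (\<Sum>(y, x)\<leftarrow>ps. y i * x j)" for i j
      unfolding qs_def by (induction ps) (auto simp: algebra_simps)
    have "cost qs = t * cost ps"
      unfolding qs_def cost_def using t by (induction ps) (auto simp: distrib_left N'(2))
    moreover have "R (\<lambda>k. of_real t * f k) qs" unfolding R_def m using ps(1) by (auto simp: R_def qs_def)
    ultimately have "\<pi> (\<lambda>k. of_real t * f k) \<le> t * cost ps" using pi_le by metis
    also have "\<dots> \<le> t * (\<pi> f + e/t)" using ps(2) t by (intro mult_left_mono) auto
    also have "\<dots> = t * \<pi> f + e" using t by (simp add: distrib_left)
    finally show "\<pi> (\<lambda>k. of_real t * f k) \<le> t * \<pi> f + e" .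
  qed
  have hom: "\<pi> (\<lambda>k. of_real t * f k) = t * \<pi> f" if t: "0 < t" for t f
  proof (rule antisym[OF hom_le[OF t]])
    have "\<pi> (\<lambda>k. of_real (1/t) * (of_real t * f k)) \<le> 1/t * \<pi> (\<lambda>k. of_real t * f k)"
      using t by (intro hom_le) auto
    also have "(\<lambda>k. of_real (1/t) * (of_real t * f k)) = f" using t by auto
    finally show "t * \<pi> f \<le> \<pi> (\<lambda>k. of_real t * f k)" using t by (simp add: field_simps)
  qed
  have "\<pi> (\<lambda>k. 0) \<le> cost []" by (intro pi_le) (auto simp: R_def)
  moreover have "0 \<le> \<pi> f" for f unfolding \<pi>_def using ex cost0 by (intro cInf_greatest) auto
  ultimately have zero: "\<pi> (\<lambda>k. 0) = 0" by (simp add: cost_def antisym)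
  \<comment> \<open>\<open>None\<close> stands for f, and the pairs \<open>Some (k, True)\<close>
    and \<open>Some (k, False)\<close> for the unit at k and i times it: a real basis of the complex
    matrices on K.\<close>
  define v :: "(('i \<times> 'j) \<times> bool) option \<Rightarrow> ('i \<times> 'j) \<Rightarrow> complex" where
    "v b k = (case b of None \<Rightarrow> f k | Some (k', c) \<Rightarrow> if k = k' then (if c then 1 else \<i>) else 0)" for b k
  define B where "B = Some ` (K \<times> (UNIV :: bool set))"
  have B: "finite B" "None \<notin> B" using finK by (auto simp: B_def)
  have "\<exists>l. l None = \<pi> (v None) \<and>
    (\<forall>t. (\<Sum>b\<in>insert None B. t b * l b) \<le> \<pi> (\<lambda>k. \<Sum>b\<in>insert None B. of_real (t b) * v b k))"
    by (rule finite_Hahn_Banach[OF sub hom zero B])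
  then obtain l where l: "l None = \<pi> (v None)"
    "\<And>t. (\<Sum>b\<in>insert None B. t b * l b) \<le> \<pi> (\<lambda>k. \<Sum>b\<in>insert None B. of_real (t b) * v b k)" by blast
  have sumB: "(\<Sum>b\<in>B. h b) = (\<Sum>k\<in>K. h (Some (k, True)) + h (Some (k, False)))" for h :: "_ \<Rightarrow> 'z::comm_monoid_add"
  proof -
    have "(\<Sum>b\<in>B. h b) = (\<Sum>z\<in>K \<times> UNIV. h (Some z))"
      unfolding B_def by (subst sum.reindex) auto
    also have "\<dots> = (\<Sum>k\<in>K. \<Sum>c\<in>UNIV. h (Some (k, c)))"
      by (subst sum.cartesian_product) (simp add: split_def)
    finally show ?thesis by (simp add: UNIV_bool add.commute)
  qed
  \<comment> \<open>The complex functional with real part l, read off from its values at a unit and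
    at i times that unit.\<close>
  define T where "T i j = Complex (l (Some ((i, j), True))) (- l (Some ((i, j), False)))" for i j
  have lT: "(\<Sum>k\<in>K. Re (g k) * l (Some (k, True)) + Im (g k) * l (Some (k, False))) = Re (\<Sum>i\<in>I. \<Sum>j\<in>J. g (i, j) * T i j)" for g
    unfolding K_def by (simp add: T_def sum.cartesian_product split_def)
  have vsum: "(\<Sum>b\<in>B. of_real (case b of None \<Rightarrow> 0 | Some (k, c) \<Rightarrow> if c then Re (g k) else Im (g k)) * v b k) = g k" if "k \<in> K" for g k
  proof -
    have "(\<Sum>b\<in>B. of_real (case b of None \<Rightarrow> 0 | Some (k, c) \<Rightarrow> if c then Re (g k) else Im (g k)) * v b k)
        = (\<Sum>k'\<in>K. if k' = k then g k else 0)"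
      unfolding sumB by (intro sum.cong refl) (auto simp: v_def complex_eq_iff)
    then show ?thesis using finK that by simp
  qed
  have pi_cong: "\<pi> g = \<pi> h" if "\<And>k. k \<in> K \<Longrightarrow> g k = h k" for g h
  proof -
    have "R g = R h" using that by (auto simp: R_def K_def fun_eq_iff)
    then show ?thesis by (simp add: \<pi>_def)
  qed
  have Tpi: "Re (\<Sum>i\<in>I. \<Sum>j\<in>J. g (i, j) * T i j) \<le> \<pi> g" for g
  proof -
    define t where "t b = (case b of None \<Rightarrow> 0 | Some (k, c) \<Rightarrow> if c then Re (g k) else Im (g k))" for b
    have "(\<Sum>b\<in>insert None B. t b * l b) = (\<Sum>b\<in>B. t b * l b)" using B by (simp add: t_def)
    also have "\<dots> = Re (\<Sum>i\<in>I. \<Sum>j\<in>J. g (i, j) * T i j)" unfolding sumB lT[symmetric] by (simp add: t_def)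
    finally have "Re (\<Sum>i\<in>I. \<Sum>j\<in>J. g (i, j) * T i j) \<le> \<pi> (\<lambda>k. \<Sum>b\<in>insert None B. of_real (t b) * v b k)"
      using l(2)[of t] by simp
    also have "\<dots> = \<pi> g"
    proof (rule pi_cong)
      fix k assume "k \<in> K"
      then show "(\<Sum>b\<in>insert None B. of_real (t b) * v b k) = g k"
        using B vsum[of k g] by (simp add: t_def)
    qed
    finally show ?thesis .
  qed
  have "\<pi> f \<le> Re (\<Sum>i\<in>I. \<Sum>j\<in>J. f (i, j) * T i j)"
  proof -
    \<comment> \<open>f minus its own coordinate expansion is zero on K, so the Hahn-Banach
      inequality at these coefficients compares \<pi> f with the value of T at f.\<close>
    define t where "t b = (case b of None \<Rightarrow> 1 | Some (k, c) \<Rightarrow> - (if c then Re (f k) else Im (f k)))" for b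
    have "(\<Sum>b\<in>insert None B. t b * l b) = \<pi> f + (\<Sum>b\<in>B. t b * l b)" using B l(1) by (simp add: t_def v_def[abs_def])
    also have "(\<Sum>b\<in>B. t b * l b) = - Re (\<Sum>i\<in>I. \<Sum>j\<in>J. f (i, j) * T i j)"
      unfolding sumB lT[symmetric] by (simp add: t_def sum_negf[symmetric])
    finally have "\<pi> f - Re (\<Sum>i\<in>I. \<Sum>j\<in>J. f (i, j) * T i j) \<le> \<pi> (\<lambda>k. \<Sum>b\<in>insert None B. of_real (t b) * v b k)"
      using l(2)[of t] by simp
    also have "\<dots> = \<pi> (\<lambda>k. 0)"
    proof (rule pi_cong)
      fix k assume k: "k \<in> K"
      have "(\<Sum>b\<in>B. of_real (t b) * v b k) = - (\<Sum>b\<in>B. of_real (case b of None \<Rightarrow> 0 | Some (k, c) \<Rightarrow> if c then Re (f k) else Im (f k)) * v b k)"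
        unfolding sum_negf[symmetric] by (intro sum.cong refl) (auto simp: t_def B_def)
      then show "(\<Sum>b\<in>insert None B. of_real (t b) * v b k) = 0"
        using B vsum[OF k, of f] by (simp add: t_def v_def)
    qed
    finally show ?thesis using zero by simp
  qed
  also have "\<dots> \<le> cmod (\<Sum>i\<in>I. \<Sum>j\<in>J. f (i, j) * T i j)" by (rule complex_Re_le_cmod)
  also have "\<dots> \<le> D"
  proof (rule D)
    fix x y
    define S where "S = (\<Sum>i\<in>I. \<Sum>j\<in>J. T i j * x j * y i)"
    \<comment> \<open>Rotating y by a phase makes the value of T at the elementary tensor of y and x
      real and nonnegative, so the bound on its real part bounds its modulus.\<close>
    define z where "z = (if S = 0 then 1 else cnj S / cmod S)"
    have z: "cmod z = 1" "z * S = of_real (cmod S)"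
      by (auto simp: z_def norm_divide complex_norm_square[symmetric] power2_eq_square mult.commute)
    have e: "z * S = (\<Sum>i\<in>I. \<Sum>j\<in>J. (\<lambda>(i, j). z * y i * x j) (i, j) * T i j)"
      unfolding S_def by (simp add: sum_distrib_left mult_ac)
    have "cmod S = Re (z * S)" by (simp add: z(2))
    also have "\<dots> = Re (\<Sum>i\<in>I. \<Sum>j\<in>J. (\<lambda>(i, j). z * y i * x j) (i, j) * T i j)" by (simp only: e)
    also have "\<dots> \<le> \<pi> (\<lambda>(i, j). z * y i * x j)" by (rule Tpi)
    also have "\<dots> \<le> N x * N' (\<lambda>i. z * y i)" by (rule single) simp
    also have "\<dots> = N x * N' y" using z by (simp add: N'(2))
    finally show "cmod (\<Sum>i\<in>I. \<Sum>j\<in>J. T i j * x j * y i) \<le> N x * N' y" by (simp add: S_def)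
  qed
  finally have "\<pi> f \<le> D" .
  moreover obtain ps where "R f ps" "cost ps < \<pi> f + \<eta>" using approx[OF \<eta>] by blast
  ultimately show ?thesis using that[of ps] by (auto simp: R_def cost_def)
qed

section \<open>Kernels on two finite measure spaces and martingale averages\<close>

text \<open>The labellings \<open>c n\<close> and \<open>d n\<close> are finite measurable
  partitions; \<psi> varies by at most 1/(n+1) on products of their cells. The partitions
  \<open>d n\<close> are nested because averaging takes place in the second variable. The measures
  to be substituted are |g|^q and |f|^p times Haar measure, summed over components.\<close>

locale fine_kernel =
  fixes p q :: real and M' :: "'x measure" and M :: "'y measure" and \<psi> :: "'x \<times> 'y \<Rightarrow> complex"
    and c :: "nat \<Rightarrow> 'x \<Rightarrow> nat" and d :: "nat \<Rightarrow> 'y \<Rightarrow> nat"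
  assumes pq: "conj_pair p q"
    and finite_M': "finite_measure M'" and finite_M: "finite_measure M"
    and space_M' [simp]: "space M' = UNIV" and space_M [simp]: "space M = UNIV"
    and c_measurable [measurable]: "\<And>n. c n \<in> measurable M' (count_space UNIV)"
    and d_measurable [measurable]: "\<And>n. d n \<in> measurable M (count_space UNIV)"
    and c_finite: "\<And>n. finite (range (c n))" and d_finite: "\<And>n. finite (range (d n))"
    and d_refine: "\<And>n r r'. d (Suc n) r = d (Suc n) r' \<Longrightarrow> d n r = d n r'"
    and osc: "\<And>n t t' r r'. c n t = c n t' \<Longrightarrow> d n r = d n r' \<Longrightarrow> cmod (\<psi> (t, r) - \<psi> (t', r')) \<le> 1 / real (Suc n)"
    and schur: "\<And>(I :: nat set) (J :: nat set) a b T. finite I \<Longrightarrow> finite J \<Longrightarrow> bilinear_bound p q I J T 1 \<Longrightarrow>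
      bilinear_bound p q I J (\<lambda>i j. \<psi> (a i, b j) * T i j) 1"
begin

sublocale M: finite_measure M by (rule finite_M)
sublocale M': finite_measure M' by (rule finite_M')

lemma p1: "1 < p" "1 < q" "0 < p" "0 < q" using conj_pairD[OF pq] by auto

lemma integral_indicator_complex:
  "A \<in> sets M \<Longrightarrow> (\<integral>r. indicator A r \<partial>M) = complex_of_real (measure M A)"
proof -
  assume A: "A \<in> sets M"
  have "(\<integral>r. indicator A r \<partial>M) = (\<integral>r. complex_of_real (indicat_real A r) \<partial>M)"
    by (intro Bochner_Integration.integral_cong refl) (auto simp: indicator_def)
  then show ?thesis by (simp add: integral_complex_of_real)
qed

definition cell :: "nat \<Rightarrow> nat \<Rightarrow> 'y set" where "cell k j = {r. d k r = j}"
definition J :: "nat \<Rightarrow> nat set" where "J k = range (d k)"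
definition b :: "nat \<Rightarrow> nat \<Rightarrow> 'y" where "b k j = (SOME r. d k r = j)"
definition a :: "nat \<Rightarrow> nat \<Rightarrow> 'x" where "a k j = (SOME t. c k t = j)"
definition mass :: "nat \<Rightarrow> nat \<Rightarrow> real" where "mass k j = measure M (cell k j)"

lemma finite_J [simp]: "finite (J k)" using d_finite by (simp add: J_def)
lemma d_in_J [simp]: "d k r \<in> J k" by (simp add: J_def)
lemma d_b [simp]: "d k (b k (d k r)) = d k r" unfolding b_def by (rule someI) simp
lemma c_a [simp]: "c k (a k (c k t)) = c k t" unfolding a_def by (rule someI) simp
lemma cell_measurable [measurable]: "cell k j \<in> sets M"
proof -
  have "cell k j = d k -` {j} \<inter> space M" by (auto simp: cell_def)
  then show ?thesis using measurable_sets[OF d_measurable, of "{j}" k] by simp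
qed
lemma mass_nonneg [simp]: "0 \<le> mass k j" by (simp add: mass_def)

lemma d_refine_le: "k \<le> m \<Longrightarrow> d m r = d m r' \<Longrightarrow> d k r = d k r'"
  by (induction m rule: dec_induct) (auto dest: d_refine)

definition bdm :: "('y \<Rightarrow> complex) \<Rightarrow> bool" where
  "bdm h \<longleftrightarrow> h \<in> borel_measurable M \<and> (\<exists>B. \<forall>r. cmod (h r) \<le> B)"
definition bdm' :: "('x \<Rightarrow> complex) \<Rightarrow> bool" where
  "bdm' h \<longleftrightarrow> h \<in> borel_measurable M' \<and> (\<exists>B. \<forall>r. cmod (h r) \<le> B)"

lemma bdm_Lp: "bdm h \<Longrightarrow> Lp_mem M p h"
proof -
  assume "bdm h"
  then obtain B where B: "h \<in> borel_measurable M" "\<And>r. cmod (h r) \<le> B" by (auto simp: bdm_def)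
  then have "0 \<le> B" using norm_ge_zero order_trans by blast
  then show ?thesis unfolding Lp_mem_def using B p1
    by (intro conjI M.integrable_const_bound[where B = "B powr p"]) (auto intro!: powr_mono2)
qed

lemma bdm'_Lp: "bdm' h \<Longrightarrow> Lp_mem M' q h"
proof -
  assume "bdm' h"
  then obtain B where B: "h \<in> borel_measurable M'" "\<And>r. cmod (h r) \<le> B" by (auto simp: bdm'_def)
  then have "0 \<le> B" using norm_ge_zero order_trans by blast
  then show ?thesis unfolding Lp_mem_def using B p1
    by (intro conjI M'.integrable_const_bound[where B = "B powr q"]) (auto intro!: powr_mono2)
qed

lemma bdm_integrable: "bdm h \<Longrightarrow> integrable M h"
  unfolding bdm_def by (auto intro: M.integrable_const_bound)

lemma bdm_step [simp]: "bdm (\<lambda>r. x (d n r))"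
proof -
  have "bounded ((\<lambda>r. x (d n r)) ` UNIV)"
    using finite_J[of n] by (intro finite_imp_bounded) (simp add: J_def image_image[symmetric])
  then show ?thesis unfolding bdm_def bounded_iff
    by (intro conjI measurable_compose[OF d_measurable]) auto
qed

lemma bdm'_step [simp]: "bdm' (\<lambda>r. x (c n r))"
proof -
  have "bounded ((\<lambda>r. x (c n r)) ` UNIV)"
    using c_finite[of n] by (intro finite_imp_bounded) (simp add: image_image[symmetric])
  then show ?thesis unfolding bdm'_def bounded_iff
    by (intro conjI measurable_compose[OF c_measurable]) auto
qed

lemma bdm_add: "bdm f \<Longrightarrow> bdm g \<Longrightarrow> bdm (\<lambda>r. f r + g r)"
  unfolding bdm_def
proof (elim conjE exE, intro conjI)
  fix A B assume "\<forall>r. cmod (f r) \<le> A" "\<forall>r. cmod (g r) \<le> B"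
  then show "\<exists>B. \<forall>r. cmod (f r + g r) \<le> B" by (intro exI[of _ "A + B"]) (simp add: norm_triangle_mono)
qed auto

lemma bdm_cmult: "bdm f \<Longrightarrow> bdm (\<lambda>r. z * f r)"
  unfolding bdm_def
proof (elim conjE exE, intro conjI)
  fix A assume "\<forall>r. cmod (f r) \<le> A"
  then show "\<exists>B. \<forall>r. cmod (z * f r) \<le> B" by (intro exI[of _ "cmod z * A"]) (simp add: norm_mult mult_left_mono)
qed auto

lemma bdm_diff: "bdm f \<Longrightarrow> bdm g \<Longrightarrow> bdm (\<lambda>r. f r - g r)"
  using bdm_add[of f "\<lambda>r. -1 * g r"] bdm_cmult[of g "-1"] by simp

lemma bdm'_add: "bdm' f \<Longrightarrow> bdm' g \<Longrightarrow> bdm' (\<lambda>r. f r + g r)"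
  unfolding bdm'_def
proof (elim conjE exE, intro conjI)
  fix A B assume "\<forall>r. cmod (f r) \<le> A" "\<forall>r. cmod (g r) \<le> B"
  then show "\<exists>B. \<forall>r. cmod (f r + g r) \<le> B" by (intro exI[of _ "A + B"]) (simp add: norm_triangle_mono)
qed auto

lemma bdm'_cmult: "bdm' f \<Longrightarrow> bdm' (\<lambda>r. z * f r)"
  unfolding bdm'_def
proof (elim conjE exE, intro conjI)
  fix A assume "\<forall>r. cmod (f r) \<le> A"
  then show "\<exists>B. \<forall>r. cmod (z * f r) \<le> B" by (intro exI[of _ "cmod z * A"]) (simp add: norm_mult mult_left_mono)
qed auto

lemma bdm'_diff: "bdm' f \<Longrightarrow> bdm' g \<Longrightarrow> bdm' (\<lambda>r. f r - g r)"
  using bdm'_add[of f "\<lambda>r. -1 * g r"] bdm'_cmult[of g "-1"] by simp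

lemma integral_cells:
  fixes h :: "'y \<Rightarrow> 'z::{banach, second_countable_topology, real_normed_div_algebra}"
  assumes "integrable M h"
  shows "(\<integral>r. h r \<partial>M) = (\<Sum>j\<in>J k. \<integral>r. indicator (cell k j) r * h r \<partial>M)"
proof -
  have i: "integrable M (\<lambda>r. indicator (cell k j) r * h r)" for j
    by (rule Bochner_Integration.integrable_bound[OF assms]) (use assms in \<open>auto simp: indicator_def\<close>)
  have "(\<Sum>j\<in>J k. indicator (cell k j) r * h r) = (\<Sum>j\<in>J k. if j = d k r then h r else 0)" for r
    by (intro sum.cong) (auto simp: cell_def indicator_def)
  then have "h r = (\<Sum>j\<in>J k. indicator (cell k j) r * h r)" for r by simp
  then have "(\<integral>r. h r \<partial>M) = (\<integral>r. (\<Sum>j\<in>J k. indicator (cell k j) r * h r) \<partial>M)" by presburger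
  also have "\<dots> = (\<Sum>j\<in>J k. \<integral>r. indicator (cell k j) r * h r \<partial>M)"
    by (rule Bochner_Integration.integral_sum) (rule i)
  finally show ?thesis .
qed

text \<open>On a cell of positive mass this is the mean; on a null cell it is the value at the
  sample point \<open>b k j\<close>. With this default \<open>E\<close> stays pointwise close to its
  argument everywhere, not just almost everywhere, which is needed because the kernels are later
  evaluated along curves.\<close>

definition av :: "nat \<Rightarrow> nat \<Rightarrow> ('y \<Rightarrow> complex) \<Rightarrow> complex" where
  "av k j h = (if mass k j = 0 then h (b k j) else (\<integral>r. indicator (cell k j) r * h r \<partial>M) / of_real (mass k j))"
definition E :: "nat \<Rightarrow> ('y \<Rightarrow> complex) \<Rightarrow> 'y \<Rightarrow> complex" where
  "E k h r = av k (d k r) h"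

lemma integrable_cell: "bdm h \<Longrightarrow> integrable M (\<lambda>r. indicator (cell k j) r * h r)"
  by (rule Bochner_Integration.integrable_bound[OF bdm_integrable]) (auto simp: indicator_def bdm_def)

lemma av_add: "bdm f \<Longrightarrow> bdm g \<Longrightarrow> av k j (\<lambda>r. f r + g r) = av k j f + av k j g"
  using integrable_cell[of f] integrable_cell[of g]
  by (simp add: av_def distrib_left add_divide_distrib)

lemma av_cmult: "av k j (\<lambda>r. z * f r) = z * av k j f"
  by (simp add: av_def mult.left_commute)

lemma av_diff: "bdm f \<Longrightarrow> bdm g \<Longrightarrow> av k j (\<lambda>r. f r - g r) = av k j f - av k j g"
  using av_add[of f "\<lambda>r. -1 * g r" k j] bdm_cmult[of g "-1"] av_cmult[of k j "-1" g] by simp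

lemma av_bound:
  assumes "bdm h" "\<And>r. d k r = d k r0 \<Longrightarrow> cmod (h r) \<le> B"
  shows "cmod (av k (d k r0) h) \<le> B"
proof (cases "mass k (d k r0) = 0")
  case True
  then show ?thesis using assms(2)[of "b k (d k r0)"] by (simp add: av_def)
next
  case False
  have i: "integrable M (\<lambda>r. cmod (indicator (cell k (d k r0)) r * h r))" by (intro integrable_norm integrable_cell assms(1))
  have B: "0 \<le> B" using assms(2)[of r0] norm_ge_zero order_trans by blast
  have "cmod (\<integral>r. indicator (cell k (d k r0)) r * h r \<partial>M) \<le> (\<integral>r. cmod (indicator (cell k (d k r0)) r * h r) \<partial>M)"
    by (rule integral_norm_bound)
  also have "\<dots> \<le> (\<integral>r. B * indicator (cell k (d k r0)) r \<partial>M)"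
  proof (rule integral_mono[OF i])
    show "integrable M (\<lambda>r. B * indicat_real (cell k (d k r0)) r)" by (simp add: M.emeasure_eq_measure)
    show "cmod (indicator (cell k (d k r0)) r * h r) \<le> B * indicat_real (cell k (d k r0)) r" for r
      using assms(2)[of r] by (auto simp: indicator_def cell_def)
  qed
  also have "\<dots> = B * mass k (d k r0)" by (simp add: mass_def)
  finally have "cmod (\<integral>r. indicator (cell k (d k r0)) r * h r \<partial>M) \<le> B * mass k (d k r0)" .
  moreover have "0 < mass k (d k r0)" using False mass_nonneg[of k "d k r0"] by linarith
  ultimately show ?thesis by (simp add: av_def norm_divide divide_le_eq)
qed

lemma bdm_E [simp]: "bdm (E k h)"
  using bdm_step[of "\<lambda>j. av k j h" k] by (simp add: E_def[abs_def])

lemma integral_cell_av: "bdm h \<Longrightarrow> (\<integral>r. indicator (cell k j) r * h r \<partial>M) = of_real (mass k j) * av k j h"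
proof (cases "mass k j = 0")
  case True
  then have "cell k j \<in> null_sets M" by (auto simp: mass_def null_sets_def M.emeasure_eq_measure)
  from AE_not_in[OF this] have "AE r in M. indicator (cell k j) r * h r = 0"
    by eventually_elim (simp add: indicator_def)
  then have "(\<integral>r. indicator (cell k j) r * h r \<partial>M) = 0" by (rule integral_eq_zero_AE)
  then show ?thesis using True by simp
qed (simp add: av_def)

text \<open>Tower property of conditional expectation: a cell of level k is a union of cells of the
  finer level m, and averaging preserves the integral over each of these.\<close>

lemma av_E:
  assumes h: "bdm h" and km: "k \<le> m" and nz: "mass k j \<noteq> 0"
  shows "av k j (E m h) = av k j h"
proof -
  have sub: "indicator (cell k j) r * (indicator (cell m l) r :: complex) = (if cell m l \<subseteq> cell k j then indicator (cell m l) r else 0)" for l r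
  proof (cases "r \<in> cell k j \<and> r \<in> cell m l")
    case True
    have "cell m l \<subseteq> cell k j"
    proof
      fix r' assume "r' \<in> cell m l"
      then have "d k r' = d k r" using True by (intro d_refine_le[OF km]) (simp add: cell_def)
      then show "r' \<in> cell k j" using True by (simp add: cell_def)
    qed
    then show ?thesis using True by simp
  next
    case False
    then show ?thesis by (auto simp: indicator_def)
  qed
  have split: "(\<integral>r. indicator (cell k j) r * f r \<partial>M) = (\<Sum>l\<in>J m. if cell m l \<subseteq> cell k j then (\<integral>r. indicator (cell m l) r * f r \<partial>M) else 0)"
    if f: "bdm f" for f
  proof -
    have "(\<integral>r. indicator (cell k j) r * f r \<partial>M) = (\<Sum>l\<in>J m. \<integral>r. indicator (cell m l) r * (indicator (cell k j) r * f r) \<partial>M)"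
      by (rule integral_cells[OF integrable_cell[OF f]])
    also have "\<dots> = (\<Sum>l\<in>J m. \<integral>r. (indicator (cell k j) r * indicator (cell m l) r) * f r \<partial>M)"
      by (intro sum.cong Bochner_Integration.integral_cong refl) (simp only: mult_ac)
    also have "\<dots> = (\<Sum>l\<in>J m. if cell m l \<subseteq> cell k j then (\<integral>r. indicator (cell m l) r * f r \<partial>M) else 0)"
      unfolding sub by (intro sum.cong refl) simp
    finally show ?thesis .
  qed
  have "(\<integral>r. indicator (cell m l) r * E m h r \<partial>M) = (\<integral>r. indicator (cell m l) r * h r \<partial>M)" for l
  proof -
    have "(\<integral>r. indicator (cell m l) r * E m h r \<partial>M) = (\<integral>r. indicator (cell m l) r * av m l h \<partial>M)"
      by (intro Bochner_Integration.integral_cong) (auto simp: indicator_def cell_def E_def)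
    also have "\<dots> = of_real (mass m l) * av m l h" by (simp add: mass_def integral_indicator_complex)
    finally show ?thesis using integral_cell_av[OF h] by simp
  qed
  then have "(\<integral>r. indicator (cell k j) r * E m h r \<partial>M) = (\<integral>r. indicator (cell k j) r * h r \<partial>M)"
    unfolding split[OF bdm_E] split[OF h] by (simp only:)
  then show ?thesis using nz by (simp add: av_def)
qed

abbreviation N where "N \<equiv> Lp_norm M p"
abbreviation N' where "N' \<equiv> Lp_norm M' q"

lemma N_step: "N (\<lambda>r. x (d k r)) powr p = (\<Sum>j\<in>J k. mass k j * cmod (x j) powr p)"
proof -
  have m: "bdm (\<lambda>r. x (d k r))" by simp
  have "N (\<lambda>r. x (d k r)) powr p = (\<integral>r. cmod (x (d k r)) powr p \<partial>M)" using p1 by (simp add: Lp_norm_powr)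
  also have "\<dots> = (\<Sum>j\<in>J k. \<integral>r. indicator (cell k j) r * cmod (x (d k r)) powr p \<partial>M)"
    by (rule integral_cells[OF Lp_memD(2)[OF bdm_Lp[OF m]]])
  also have "\<dots> = (\<Sum>j\<in>J k. \<integral>r. indicator (cell k j) r * cmod (x j) powr p \<partial>M)"
    by (intro sum.cong Bochner_Integration.integral_cong) (auto simp: indicator_def cell_def)
  finally show ?thesis by (simp add: mass_def)
qed

text \<open>On each cell Hoelder against the indicator bounds the p-th power of the mean by the mean
  of the p-th powers; summing over the cells gives contractivity.\<close>

lemma N_E_le: assumes h: "bdm h" shows "N (E k h) \<le> N h"
proof (rule powr_le_imp_le)
  have Lh: "Lp_mem M p h" by (rule bdm_Lp[OF h])
  have "N (E k h) powr p = (\<Sum>j\<in>J k. mass k j * cmod (av k j h) powr p)"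
    using N_step[of "\<lambda>j. av k j h" k] by (simp add: E_def[abs_def])
  also have "\<dots> \<le> (\<Sum>j\<in>J k. \<integral>r. indicator (cell k j) r * cmod (h r) powr p \<partial>M)"
  proof (rule sum_mono)
    fix j
    let ?I = "indicator (cell k j) :: 'y \<Rightarrow> complex"
    have bi: "Lp_mem M q ?I" unfolding Lp_mem_def
      using p1 by (intro conjI M.integrable_const_bound[where B = 1]) (auto simp: indicator_def)
    have Ih: "Lp_mem M p (\<lambda>r. ?I r * h r)" by (rule Lp_mem_indicator_mult[OF Lh]) (use p1 in auto)
    show "mass k j * cmod (av k j h) powr p \<le> (\<integral>r. indicator (cell k j) r * cmod (h r) powr p \<partial>M)"
    proof (cases "mass k j = 0")
      case True
      then show ?thesis by (auto intro!: integral_nonneg_AE)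
    next
      case False
      then have m: "mass k j > 0" using mass_nonneg[of k j] by linarith
      define H where "H = (\<integral>r. indicator (cell k j) r * cmod (h r) powr p \<partial>M)"
      have H0: "0 \<le> H" unfolding H_def by (auto intro!: integral_nonneg_AE)
      have nI: "Lp_norm M q ?I = mass k j powr (1/q)"
      proof -
        have "(\<lambda>r. cmod (?I r) powr q) = indicat_real (cell k j)" using p1 by (auto simp: indicator_def)
        then show ?thesis by (simp add: Lp_norm_def mass_def)
      qed
      have nh: "N (\<lambda>r. ?I r * h r) = H powr (1/p)"
      proof -
        have "(\<lambda>r. cmod (?I r * h r) powr p) = (\<lambda>r. indicator (cell k j) r * cmod (h r) powr p)"
          using p1 by (auto simp: indicator_def)
        then show ?thesis by (simp add: Lp_norm_def H_def)
      qed
      have "cmod (pairing M ?I (\<lambda>r. ?I r * h r)) \<le> mass k j powr (1/q) * H powr (1/p)"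
        using Holder_pairing[OF pq bi Ih] by (simp add: nI nh)
      moreover have "pairing M ?I (\<lambda>r. ?I r * h r) = of_real (mass k j) * av k j h"
        unfolding integral_cell_av[OF h, symmetric] pairing_def
        by (intro Bochner_Integration.integral_cong) (auto simp: indicator_def)
      ultimately have "mass k j * cmod (av k j h) \<le> mass k j powr (1/q) * H powr (1/p)"
        using m by (simp add: norm_mult)
      then have "(mass k j * cmod (av k j h)) powr p \<le> (mass k j powr (1/q) * H powr (1/p)) powr p"
        using p1 m by (intro powr_mono2) auto
      also have "\<dots> = mass k j powr (p/q) * H" using p1 H0 by (simp add: powr_mult powr_powr)
      also have "p / q = p - 1" by (rule conj_pair_eqs(5)[OF pq])
      finally have "mass k j powr p * cmod (av k j h) powr p \<le> mass k j powr (p - 1) * H" by (simp add: powr_mult)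
      moreover have "mass k j powr p = mass k j powr (p - 1) * mass k j" using m by (simp add: powr_diff)
      ultimately have "mass k j powr (p - 1) * (mass k j * cmod (av k j h) powr p) \<le> mass k j powr (p - 1) * H" by (simp add: mult_ac)
      then show ?thesis using m by (simp add: H_def)
    qed
  qed
  also have "\<dots> = (\<integral>r. cmod (h r) powr p \<partial>M)" by (rule integral_cells[OF Lp_memD(2)[OF Lh], symmetric])
  also have "\<dots> = N h powr p" using p1 by (simp add: Lp_norm_powr)
  finally show "N (E k h) powr p \<le> N h powr p" .
qed (use p1 in auto)

text \<open>By the tower property both terms average back to the same values at level k, except on
  null cells, which do not influence the norm.\<close>

lemma N_E_E:
  assumes h: "bdm h" and km: "k \<le> m"
  shows "N (E k (\<lambda>r. (E k h r + E m h r) / 2)) = N (E k h)"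
proof -
  have "N (E k (\<lambda>r. (E k h r + E m h r) / 2)) powr p = (\<Sum>j\<in>J k. mass k j * cmod (av k j (\<lambda>r. (E k h r + E m h r) / 2)) powr p)"
    using N_step[of "\<lambda>j. av k j (\<lambda>r. (E k h r + E m h r) / 2)" k] by (simp add: E_def[of k "\<lambda>r. (E k h r + E m h r) / 2", abs_def])
  also have "\<dots> = (\<Sum>j\<in>J k. mass k j * cmod (av k j h) powr p)"
  proof (intro sum.cong refl)
    fix j
    have "av k j (\<lambda>r. (1/2) * (E k h r + E m h r)) = av k j h" if "mass k j \<noteq> 0"
      unfolding av_cmult av_add[OF bdm_E bdm_E] using av_E[OF h order_refl that] av_E[OF h km that] by simp
    then show "mass k j * cmod (av k j (\<lambda>r. (E k h r + E m h r) / 2)) powr p = mass k j * cmod (av k j h) powr p"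
      by (cases "mass k j = 0") auto
  qed
  also have "\<dots> = N (E k h) powr p"
    using N_step[of "\<lambda>j. av k j h" k] by (simp add: E_def[abs_def])
  finally have e: "N (E k (\<lambda>r. (E k h r + E m h r) / 2)) powr p = N (E k h) powr p" .
  show ?thesis
    by (rule antisym; rule powr_le_imp_le[where p = p]) (use p1 e in auto)
qed

text \<open>A martingale difference is paid for by growth of the norm. Averaging the midpoint of the
  two levels returns the coarser one, so the midpoint has norm at least that of the coarser level,
  and the convexity gap is at most half the increase of the p-th powers.\<close>

lemma E_jump:
  assumes K: "0 \<le> K" "\<And>a b :: complex. cmod (a - b) powr p \<le> \<epsilon> * (cmod a powr p + cmod b powr p) + K * convexity_gap p a b"
    and eps: "0 \<le> \<epsilon>" and h: "bdm h" and km: "k \<le> m"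
  shows "N (E k h) \<le> N (E m h)"
    and "N (\<lambda>r. E m h r - E k h r) powr p \<le> 2 * \<epsilon> * N h powr p + K / 2 * (N (E m h) powr p - N (E k h) powr p)"
proof -
  have L: "Lp_mem M p (E k h)" "Lp_mem M p (E m h)" by (auto intro: bdm_Lp)
  have mid: "bdm (\<lambda>r. (E k h r + E m h r) / 2)" using bdm_cmult[OF bdm_add[OF bdm_E[of k h] bdm_E[of m h]], of "1/2"] by simp
  \<comment> \<open>This lower bound on the midpoint is what makes the gap term in uniform convexity
    small.\<close>
  have ge: "N (E k h) \<le> N (\<lambda>r. (E k h r + E m h r) / 2)"
    using N_E_le[OF mid, of k] N_E_E[OF h km] by simp
  have "N (\<lambda>r. (E k h r + E m h r) / 2) = 1/2 * N (\<lambda>r. E k h r + E m h r)"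
    using Lp_norm_cmult[of p M "1/2" "\<lambda>r. E k h r + E m h r"] p1 by simp
  also have "\<dots> \<le> 1/2 * (N (E k h) + N (E m h))" using Minkowski[OF L p1(1)] by simp
  finally show mono: "N (E k h) \<le> N (E m h)" using ge by simp
  have le: "N (E i h) powr p \<le> N h powr p" for i using N_E_le[OF h] p1 by (intro powr_mono2) auto
  have "N (\<lambda>r. E m h r - E k h r) powr p = N (\<lambda>r. E k h r - E m h r) powr p"
    by (simp add: Lp_norm_minus_commute[of M p "E m h"])
  also have "\<dots> \<le> \<epsilon> * (N (E k h) powr p + N (E m h) powr p) +
      K * ((N (E k h) powr p + N (E m h) powr p) / 2 - N (\<lambda>r. (E k h r + E m h r) / 2) powr p)"
    by (rule uniform_convexity_Lp[OF K(2) p1(1) L])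
  also have "\<dots> \<le> \<epsilon> * (N h powr p + N h powr p) +
      K * ((N (E k h) powr p + N (E m h) powr p) / 2 - N (E k h) powr p)"
  proof (intro add_mono mult_left_mono eps K(1) diff_mono order_refl)
    show "N (E k h) powr p \<le> N (\<lambda>r. (E k h r + E m h r) / 2) powr p" using ge p1 by (intro powr_mono2) auto
  qed (rule le)+
  also have "\<dots> = 2 * \<epsilon> * N h powr p + K / 2 * (N (E m h) powr p - N (E k h) powr p)"
  proof -
    have "\<epsilon> * (H + H) + K * ((X + Y) / 2 - X) = 2 * \<epsilon> * H + K / 2 * (Y - X)" for H X Y :: real
      by (simp add: field_simps)
    then show ?thesis .
  qed
  finally show "N (\<lambda>r. E m h r - E k h r) powr p \<le> 2 * \<epsilon> * N h powr p + K / 2 * (N (E m h) powr p - N (E k h) powr p)" .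
qed

text \<open>The kernel w has an expansion of projective cost at most x in L_q(M') and L_p(M), by
  finitely many bounded factors. The expansion is an identity at all points, so it survives
  substitution of r = - s + t.\<close>

definition R :: "('x \<Rightarrow> 'y \<Rightarrow> complex) \<Rightarrow> real \<Rightarrow> bool" where
  "R w x \<longleftrightarrow> (\<exists>ps. (\<forall>(g, f)\<in>set ps. bdm' g \<and> bdm f) \<and> (\<forall>t r. w t r = (\<Sum>(g, f)\<leftarrow>ps. g t * f r)) \<and>
     (\<Sum>(g, f)\<leftarrow>ps. N' g * N f) \<le> x)"

lemma R_mono: "R w x \<Longrightarrow> x \<le> y \<Longrightarrow> R w y"
  unfolding R_def by (elim exE conjE, intro exI conjI; (assumption | erule (1) order_trans))

lemma R_add: assumes "R v x" "R w y" shows "R (\<lambda>t r. v t r + w t r) (x + y)"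
proof -
  obtain ps qs where ps: "\<forall>(g, f)\<in>set ps. bdm' g \<and> bdm f" "\<forall>t r. v t r = (\<Sum>(g, f)\<leftarrow>ps. g t * f r)" "(\<Sum>(g, f)\<leftarrow>ps. N' g * N f) \<le> x"
    and qs: "\<forall>(g, f)\<in>set qs. bdm' g \<and> bdm f" "\<forall>t r. w t r = (\<Sum>(g, f)\<leftarrow>qs. g t * f r)" "(\<Sum>(g, f)\<leftarrow>qs. N' g * N f) \<le> y"
    using assms unfolding R_def by blast
  show ?thesis unfolding R_def by (rule exI[of _ "ps @ qs"]) (use ps qs in auto)
qed

lemma R_cong: "R v x \<Longrightarrow> (\<And>t r. v t r = w t r) \<Longrightarrow> R w x"
  by (simp add: R_def)

lemma R_neg: assumes "R v x" shows "R (\<lambda>t r. - v t r) x"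
proof -
  obtain ps where ps: "\<forall>(g, f)\<in>set ps. bdm' g \<and> bdm f" "\<forall>t r. v t r = (\<Sum>(g, f)\<leftarrow>ps. g t * f r)" "(\<Sum>(g, f)\<leftarrow>ps. N' g * N f) \<le> x"
    using assms unfolding R_def by blast
  define qs where "qs = map (\<lambda>(g, f). (\<lambda>t. -1 * g t, f)) ps"
  have "(\<Sum>(g, f)\<leftarrow>qs. N' g * N f) = (\<Sum>(g, f)\<leftarrow>ps. N' g * N f)"
    unfolding qs_def using p1 Lp_norm_cmult[of q M' "-1"] by (induction ps) auto
  moreover have "(\<Sum>(g, f)\<leftarrow>qs. g t * f r) = - (\<Sum>(g, f)\<leftarrow>ps. g t * f r)" for t r
    unfolding qs_def by (induction ps) auto
  moreover have "\<forall>(g, f)\<in>set qs. bdm' g \<and> bdm f" using ps(1) bdm'_cmult[of _ "-1"] by (auto simp: qs_def)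
  ultimately show ?thesis using ps unfolding R_def by (intro exI[of _ qs]) auto
qed

lemma R_diff: "R v x \<Longrightarrow> R w y \<Longrightarrow> R (\<lambda>t r. v t r - w t r) (x + y)"
  using R_add[of v x "\<lambda>t r. - w t r" y] R_neg[of w y] by simp

text \<open>The product of the norms of the two constant functions 1. This is the cost that the
  Schur bound 1 allows for \<psi>.\<close>

definition total :: real where "total = measure M' UNIV powr (1/q) * measure M UNIV powr (1/p)"

lemma total_nonneg: "0 \<le> total" by (simp add: total_def)

lemma N_bounded: assumes h: "bdm h" "\<And>r. cmod (h r) \<le> B" "0 \<le> B" shows "N h \<le> B * measure M UNIV powr (1/p)"
proof -
  have "N h \<le> N (\<lambda>r. of_real B * 1)"
    by (rule Lp_norm_mono) (use h p1 bdm_step[of "\<lambda>_. of_real B" 0] in \<open>auto intro!: bdm_Lp simp: bdm_def\<close>)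
  also have "\<dots> = B * measure M UNIV powr (1/p)" unfolding Lp_norm_cmult[OF p1(3)] using h by (simp add: Lp_norm_def)
  finally show ?thesis .
qed

lemma N'_bounded: assumes h: "bdm' h" "\<And>r. cmod (h r) \<le> B" "0 \<le> B" shows "N' h \<le> B * measure M' UNIV powr (1/q)"
proof -
  have "N' h \<le> N' (\<lambda>r. of_real B * 1)"
    by (rule Lp_norm_mono) (use h p1 bdm'_step[of "\<lambda>_. of_real B" 0] in \<open>auto intro!: bdm'_Lp simp: bdm'_def\<close>)
  also have "\<dots> = B * measure M' UNIV powr (1/q)" unfolding Lp_norm_cmult[OF p1(4)] using h by (simp add: Lp_norm_def)
  finally show ?thesis .
qed

text \<open>Expand over the finitely many cells of level k. The factor \<open>card (J k)\<close> is
  harmless as long as k is fixed while \<delta> tends to 0.\<close>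

lemma R_finite_rank:
  assumes w: "\<And>t r. w t r = g (d k r) t" and g: "\<And>j. bdm' (g j)" "\<And>t r. cmod (g (d k r) t) \<le> \<delta>" and \<delta>: "0 \<le> \<delta>"
  shows "R w (real (card (J k)) * \<delta> * total)"
proof -
  define js where "js = sorted_list_of_set (J k)"
  have js: "set js = J k" "distinct js" "length js = card (J k)" by (auto simp: js_def)
  define f where "f j r = (if d k r = j then 1 else 0 :: complex)" for j r
  have f: "bdm (f j)" for j using bdm_step[of "\<lambda>i. if i = j then 1 else 0" k] by (simp add: f_def[abs_def])
  show ?thesis unfolding R_def
  proof (intro exI[of _ "map (\<lambda>j. (g j, f j)) js"] conjI allI)
    show "\<forall>(g, f)\<in>set (map (\<lambda>j. (g j, f j)) js). bdm' g \<and> bdm f" using g f by auto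
    fix t r
    have "(\<Sum>(g, f)\<leftarrow>map (\<lambda>j. (g j, f j)) js. g t * f r) = (\<Sum>j\<leftarrow>js. g j t * f j r)"
      by (simp add: o_def)
    also have "\<dots> = (\<Sum>j\<in>J k. g j t * f j r)"
      using js by (simp add: sum_list_distinct_conv_sum_set)
    also have "\<dots> = (\<Sum>j\<in>J k. if j = d k r then g (d k r) t else 0)"
      by (intro sum.cong refl) (auto simp: f_def)
    finally show "w t r = (\<Sum>(g, f)\<leftarrow>map (\<lambda>j. (g j, f j)) js. g t * f r)" using w by simp
  next
    have "(\<Sum>(g, f)\<leftarrow>map (\<lambda>j. (g j, f j)) js. N' g * N f) = (\<Sum>j\<leftarrow>js. N' (g j) * N (f j))"
      by (simp add: o_def)
    also have "\<dots> = (\<Sum>j\<in>J k. N' (g j) * N (f j))" using js by (simp add: sum_list_distinct_conv_sum_set)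
    also have "\<dots> \<le> (\<Sum>j\<in>J k. (\<delta> * measure M' UNIV powr (1/q)) * (1 * measure M UNIV powr (1/p)))"
    proof (intro sum_mono mult_mono N_bounded N'_bounded g f \<delta>)
      fix j t assume "j \<in> J k"
      then obtain r where "j = d k r" by (auto simp: J_def)
      then show "cmod (g j t) \<le> \<delta>" using g(2) by simp
    qed (auto simp: f_def \<delta>)
    also have "\<dots> = real (card (J k)) * \<delta> * total" by (simp add: total_def)
    finally show "(\<Sum>(g, f)\<leftarrow>map (\<lambda>j. (g j, f j)) js. N' g * N f) \<le> real (card (J k)) * \<delta> * total" .
  qed
qed

text \<open>The approximants have two parameters: n is the fineness of the sampling of \<psi> in
  both variables, k the level of the subsequent averaging in r. For fixed k the rank stays bounded
  as n grows.\<close>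

definition V :: "nat \<Rightarrow> nat \<Rightarrow> 'x \<Rightarrow> 'y \<Rightarrow> complex" where
  "V n k t r = E k (\<lambda>r'. \<psi> (a n (c n t), b n (d n r'))) r"

lemma sample_close: "cmod (\<psi> (a n (c n t), b n (d n r)) - \<psi> (t, r)) \<le> 1 / real (Suc n)"
  by (rule osc) auto

lemma V_psi_close: "cmod (V n k t r - \<psi> (t, r)) \<le> 1 / real (Suc n) + 1 / real (Suc k)"
proof -
  have const: "av k j (\<lambda>_. z) = z" for j z
    by (auto simp: av_def mass_def integral_indicator_complex)
  have "V n k t r - \<psi> (t, r) = av k (d k r) (\<lambda>r'. \<psi> (a n (c n t), b n (d n r')) - \<psi> (t, r))"
    using av_diff[of "\<lambda>r'. \<psi> (a n (c n t), b n (d n r'))" "\<lambda>_. \<psi> (t, r)" k "d k r"]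
      bdm_step[of "\<lambda>j. \<psi> (a n (c n t), b n j)" n] bdm_step[of "\<lambda>j. \<psi> (t, r)" n] const
    by (simp add: V_def E_def)
  also have "cmod \<dots> \<le> 1 / real (Suc n) + 1 / real (Suc k)"
  proof (rule av_bound)
    show "bdm (\<lambda>r'. \<psi> (a n (c n t), b n (d n r')) - \<psi> (t, r))"
      using bdm_step[of "\<lambda>j. \<psi> (a n (c n t), b n j) - \<psi> (t, r)" n] by simp
    fix r' assume "d k r' = d k r"
    then have "cmod (\<psi> (t, r') - \<psi> (t, r)) \<le> 1 / real (Suc k)" by (intro osc) auto
    then show "cmod (\<psi> (a n (c n t), b n (d n r')) - \<psi> (t, r)) \<le> 1 / real (Suc n) + 1 / real (Suc k)"
      using sample_close[of n t r'] norm_diff_triangle_le by blast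
  qed
  finally show ?thesis .
qed

text \<open>Both kernels depend on r only through its cell of level k, and both are uniformly close
  to averages of \<psi>, so the finite rank estimate applies.\<close>

lemma R_V_diff: "R (\<lambda>t r. V n k t r - V m k t r) (real (card (J k)) * (1 / real (Suc n) + 1 / real (Suc m)) * total)"
proof (rule R_finite_rank)
  define u where "u j t = av k j (\<lambda>r'. \<psi> (a n (c n t), b n (d n r'))) - av k j (\<lambda>r'. \<psi> (a m (c m t), b m (d m r')))" for j t
  show "V n k t r - V m k t r = u (d k r) t" for t r by (simp add: V_def E_def u_def)
  show "bdm' (u j)" for j unfolding u_def
    using bdm'_diff[OF bdm'_step[of "\<lambda>i. av k j (\<lambda>r'. \<psi> (a n i, b n (d n r')))" n] bdm'_step[of "\<lambda>i. av k j (\<lambda>r'. \<psi> (a m i, b m (d m r')))" m]] .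
  show "cmod (u (d k r) t) \<le> 1 / real (Suc n) + 1 / real (Suc m)" for t r
  proof -
    have bs: "bdm (\<lambda>r'. \<psi> (a n (c n t), b n (d n r')))" for n
      using bdm_step[of "\<lambda>j. \<psi> (a n (c n t), b n j)" n] by simp
    have "u (d k r) t = av k (d k r) (\<lambda>r'. \<psi> (a n (c n t), b n (d n r')) - \<psi> (a m (c m t), b m (d m r')))"
      unfolding u_def by (rule av_diff[symmetric, OF bs bs])
    also have "cmod \<dots> \<le> 1 / real (Suc n) + 1 / real (Suc m)"
    proof (rule av_bound[OF bdm_diff[OF bs bs]])
      fix r'
      have "cmod (\<psi> (t, r') - \<psi> (a m (c m t), b m (d m r'))) \<le> 1 / real (Suc m)"
        using sample_close[of m t r'] by (simp add: norm_minus_commute)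
      then show "cmod (\<psi> (a n (c n t), b n (d n r')) - \<psi> (a m (c m t), b m (d m r'))) \<le> 1 / real (Suc n) + 1 / real (Suc m)"
        using sample_close[of n t r'] norm_diff_triangle_le by blast
    qed
    finally show ?thesis .
  qed
qed auto

end

lemma Lp_norm_step:
  fixes x :: "nat \<Rightarrow> complex"
  assumes M: "finite_measure M" and sp: "space M = UNIV" and d: "d \<in> measurable M (count_space UNIV)" "finite (range d)" and p: "0 < p"
  shows "Lp_norm M p (\<lambda>r. x (d r)) = fin_norm p (range d) (\<lambda>j. of_real (measure M {r. d r = j} powr (1/p)) * x j)"
proof -
  interpret finite_measure M by (rule M)
  have s: "{r. d r = j} \<in> sets M" for j
  proof -
    have "{r. d r = j} = d -` {j} \<inter> space M" using sp by auto
    then show ?thesis using measurable_sets[OF d(1), of "{j}"] by simp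
  qed
  have pt: "cmod (x (d r)) powr p = (\<Sum>j\<in>range d. indicator {r. d r = j} r * cmod (x j) powr p)" for r
  proof -
    have "(\<Sum>j\<in>range d. indicator {r. d r = j} r * cmod (x j) powr p) = (\<Sum>j\<in>range d. if j = d r then cmod (x j) powr p else 0)"
      by (intro sum.cong refl) (auto simp: indicator_def)
    then show ?thesis using d(2) by simp
  qed
  have "(\<integral>r. cmod (x (d r)) powr p \<partial>M) = (\<Sum>j\<in>range d. \<integral>r. indicator {r. d r = j} r * cmod (x j) powr p \<partial>M)"
    unfolding pt using s by (intro Bochner_Integration.integral_sum integrable_mult_left) (simp add: emeasure_eq_measure)
  also have "\<dots> = (\<Sum>j\<in>range d. measure M {r. d r = j} * cmod (x j) powr p)"
    using s sp by (intro sum.cong refl) simp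
  also have "\<dots> = (\<Sum>j\<in>range d. cmod (of_real (measure M {r. d r = j} powr (1/p)) * x j) powr p)"
    using p by (intro sum.cong refl) (simp add: norm_mult powr_mult powr_powr)
  finally show ?thesis by (simp add: Lp_norm_def fin_norm_def)
qed

context fine_kernel
begin

text \<open>Finite duality for the kernel sampled at level n. Norms of step functions are weighted
  l_p norms; dividing a dual matrix T by the weights makes it a plain contraction, the Schur bound
  applies, and evaluation at the weights gives \<open>total\<close>.\<close>

lemma sample_decomposition:
  assumes \<eta>: "0 < \<eta>"
  obtains ps where "\<forall>(y, x)\<in>set ps. N (\<lambda>r. x (d n r)) \<le> 1"
    "\<And>t r. \<psi> (a n (c n t), b n (d n r)) = (\<Sum>(y, x)\<leftarrow>ps. y (c n t) * x (d n r))"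
    "(\<Sum>(y, x)\<leftarrow>ps. N' (\<lambda>t. y (c n t))) \<le> total + \<eta>"
proof -
  define I where "I = range (c n)"
  have finI: "finite I" by (simp add: I_def c_finite)
  define \<alpha> where "\<alpha> j = measure M {r. d n r = j} powr (1/p)" for j
  define \<beta> where "\<beta> j = measure M' {r. c n r = j} powr (1/q)" for j
  have ab0: "0 \<le> \<alpha> j" "0 \<le> \<beta> j" for j by (auto simp: \<alpha>_def \<beta>_def)
  have N: "N (\<lambda>r. x (d n r)) = fin_norm p (J n) (\<lambda>j. of_real (\<alpha> j) * x j)" for x :: "nat \<Rightarrow> complex"
    unfolding \<alpha>_def J_def using p1 d_finite by (intro Lp_norm_step finite_M) auto
  have N': "N' (\<lambda>r. x (c n r)) = fin_norm q I (\<lambda>j. of_real (\<beta> j) * x j)" for x :: "nat \<Rightarrow> complex"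
    unfolding \<beta>_def I_def using p1 c_finite by (intro Lp_norm_step finite_M') auto
  have D: "cmod (\<Sum>i\<in>I. \<Sum>j\<in>J n. (\<lambda>(i, j). \<psi> (a n i, b n j)) (i, j) * T i j) \<le> total"
    if T: "\<And>x y. cmod (\<Sum>i\<in>I. \<Sum>j\<in>J n. T i j * x j * y i) \<le> N (\<lambda>r. x (d n r)) * N' (\<lambda>t. y (c n t))" for T
  proof -
    \<comment> \<open>\<alpha> and \<beta> are the cell masses to the powers 1/p and 1/q.\<close>
    define S where "S i j = T i j / of_real (\<alpha> j * \<beta> i)" for i j
    have mono: "fin_norm r K (\<lambda>j. of_real (\<gamma> j) * (x j / of_real (\<gamma> j))) \<le> fin_norm r K x" if "0 < r" for r K x and \<gamma> :: "nat \<Rightarrow> real"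
    proof (rule fin_norm_mono[OF that])
      fix i show "cmod (of_real (\<gamma> i) * (x i / of_real (\<gamma> i))) \<le> cmod (x i)" by (cases "\<gamma> i = 0") auto
    qed
    have "bilinear_bound p q I (J n) S 1"
      unfolding bilinear_bound_def
    proof (intro allI)
      fix x y
      have "(\<Sum>i\<in>I. \<Sum>j\<in>J n. S i j * x j * y i) = (\<Sum>i\<in>I. \<Sum>j\<in>J n. T i j * (x j / of_real (\<alpha> j)) * (y i / of_real (\<beta> i)))"
        by (simp add: S_def)
      also have "cmod \<dots> \<le> N (\<lambda>r. x (d n r) / of_real (\<alpha> (d n r))) * N' (\<lambda>t. y (c n t) / of_real (\<beta> (c n t)))"
        by (rule T)
      also have "\<dots> \<le> fin_norm p (J n) x * fin_norm q I y"
        using N[of "\<lambda>j. x j / of_real (\<alpha> j)"] N'[of "\<lambda>j. y j / of_real (\<beta> j)"] mono[OF p1(3), of "J n" \<alpha> x] mono[OF p1(4), of I \<beta> y]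
        by (simp only:) (intro mult_mono fin_norm_nonneg)
      finally show "cmod (\<Sum>i\<in>I. \<Sum>j\<in>J n. S i j * x j * y i) \<le> 1 * fin_norm p (J n) x * fin_norm q I y" by simp
    qed
    from schur[OF finI finite_J this, of "a n" "b n"]
    have "cmod (\<Sum>i\<in>I. \<Sum>j\<in>J n. (\<psi> (a n i, b n j) * S i j) * of_real (\<alpha> j) * of_real (\<beta> i)) \<le> 1 * fin_norm p (J n) (\<lambda>j. of_real (\<alpha> j)) * fin_norm q I (\<lambda>i. of_real (\<beta> i))"
      by (rule bilinear_boundD)
    also have "\<dots> = N (\<lambda>_. 1) * N' (\<lambda>_. 1)"
      using N[of "\<lambda>_. 1"] N'[of "\<lambda>_. 1"] by simp
    also have "\<dots> = total" by (simp add: Lp_norm_def total_def)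
    also have "(\<Sum>i\<in>I. \<Sum>j\<in>J n. (\<psi> (a n i, b n j) * S i j) * of_real (\<alpha> j) * of_real (\<beta> i)) = (\<Sum>i\<in>I. \<Sum>j\<in>J n. \<psi> (a n i, b n j) * T i j)"
    proof (intro sum.cong refl)
      fix i j assume ij: "i \<in> I" "j \<in> J n"
      \<comment> \<open>Weights that vanish cannot be divided out; there the bound on T, tested on
        the unit vectors at j and i, forces the entry to be 0.\<close>
      have "T i j = 0" if z: "\<alpha> j = 0 \<or> \<beta> i = 0"
      proof -
        define \<xi> where "\<xi> l = (if l = j then 1 else 0 :: complex)" for l
        define \<zeta> where "\<zeta> l = (if l = i then 1 else 0 :: complex)" for l
        have "(\<Sum>k\<in>I. \<Sum>l\<in>J n. T k l * \<xi> l * \<zeta> k) = (\<Sum>k\<in>I. if k = i then T i j else 0)"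
        proof (intro sum.cong refl)
          fix k
          have "(\<Sum>l\<in>J n. T k l * \<xi> l * \<zeta> k) = (\<Sum>l\<in>J n. if l = j then T k j * \<zeta> k else 0)"
            by (intro sum.cong refl) (auto simp: \<xi>_def)
          then show "(\<Sum>l\<in>J n. T k l * \<xi> l * \<zeta> k) = (if k = i then T i j else 0)"
            using ij by (simp add: \<zeta>_def)
        qed
        then have "cmod (T i j) \<le> N (\<lambda>r. \<xi> (d n r)) * N' (\<lambda>t. \<zeta> (c n t))"
          using T[of \<xi> \<zeta>] ij finI by simp
        also have "N (\<lambda>r. \<xi> (d n r)) * N' (\<lambda>t. \<zeta> (c n t)) = 0"
        proof -
          have "N (\<lambda>r. \<xi> (d n r)) = 0" if "\<alpha> j = 0"
            unfolding N using that p1 by (subst fin_norm_eq_0) (auto simp: \<xi>_def)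
          moreover have "N' (\<lambda>r. \<zeta> (c n r)) = 0" if "\<beta> i = 0"
            unfolding N' using that p1 finI by (subst fin_norm_eq_0) (auto simp: \<zeta>_def)
          ultimately show ?thesis using z by auto
        qed
        finally show ?thesis by simp
      qed
      then show "(\<psi> (a n i, b n j) * S i j) * of_real (\<alpha> j) * of_real (\<beta> i) = \<psi> (a n i, b n j) * T i j"
        by (cases "\<alpha> j = 0 \<or> \<beta> i = 0") (auto simp: S_def)
    qed
    finally show ?thesis by simp
  qed
  obtain ps where ps: "\<forall>(y, x)\<in>set ps. N (\<lambda>r. x (d n r)) \<le> 1"
    "\<And>i j. i \<in> I \<Longrightarrow> j \<in> J n \<Longrightarrow> (\<lambda>(i, j). \<psi> (a n i, b n j)) (i, j) = (\<Sum>(y, x)\<leftarrow>ps. y i * x j)"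
    "(\<Sum>(y, x)\<leftarrow>ps. N' (\<lambda>t. y (c n t))) \<le> total + \<eta>"
  proof (rule projective_duality[where I = I and J = "J n" and N = "\<lambda>x. N (\<lambda>r. x (d n r))" and N' = "\<lambda>y. N' (\<lambda>t. y (c n t))"
        and f = "\<lambda>(i, j). \<psi> (a n i, b n j)" and D = total and \<eta> = \<eta>])
    show "finite I" "finite (J n)" using finI by auto
    show "\<And>x. 0 \<le> N (\<lambda>r. x (d n r))" "\<And>x. 0 \<le> N' (\<lambda>r. x (c n r))" by auto
    show "\<And>z x. N (\<lambda>r. z * x (d n r)) = cmod z * N (\<lambda>r. x (d n r))" using p1 by (simp add: Lp_norm_cmult)
    show "\<And>z x. N' (\<lambda>r. z * x (c n r)) = cmod z * N' (\<lambda>r. x (c n r))" using p1 by (simp add: Lp_norm_cmult)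
  qed (use D \<eta> in auto)
  show ?thesis
    by (rule that[OF ps(1) _ ps(3)]) (use ps(2) in \<open>auto simp: I_def\<close>)
qed

lemma E_sum_list:
  "E k (\<lambda>r'. \<Sum>(y, x)\<leftarrow>ps. z y * x (d n r')) r = (\<Sum>(y, x)\<leftarrow>ps. z y * E k (\<lambda>r'. x (d n r')) r)"
proof (induction ps)
  case Nil
  have "E k (\<lambda>r. 0 * 0) r = 0" unfolding E_def av_cmult by simp
  then show ?case by simp
next
  case (Cons w ps)
  obtain y x where w: "w = (y, x)" by force
  have 1: "bdm (\<lambda>r'. z y * x (d n r'))" using bdm_step[of "\<lambda>j. z y * x j" n] by simp
  have 2: "bdm (\<lambda>r'. \<Sum>(y, x)\<leftarrow>ps. z y * x (d n r'))"
    using bdm_step[of "\<lambda>j. \<Sum>(y, x)\<leftarrow>ps. z y * x j" n] by simp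
  have "E k (\<lambda>r'. z y * x (d n r') + (\<Sum>(y, x)\<leftarrow>ps. z y * x (d n r'))) r
      = z y * E k (\<lambda>r'. x (d n r')) r + E k (\<lambda>r'. \<Sum>(y, x)\<leftarrow>ps. z y * x (d n r')) r"
    unfolding E_def av_add[OF 1 2] av_cmult ..
  then show ?case using Cons by (simp add: w)
qed

lemma V_decomposition:
  assumes "\<And>t r. \<psi> (a n (c n t), b n (d n r)) = (\<Sum>(y, x)\<leftarrow>ps. y (c n t) * x (d n r))"
  shows "V n k t r = (\<Sum>(y, x)\<leftarrow>ps. y (c n t) * E k (\<lambda>r'. x (d n r')) r)"
  unfolding V_def assms by (rule E_sum_list)

text \<open>Averaging in r acts on the second factors of the sampled expansion only, and
  contractively, so the cost does not increase at any level k.\<close>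

lemma R_V: assumes \<eta>: "0 < \<eta>" shows "R (V n k) (total + \<eta>)"
proof -
  obtain ps where ps: "\<forall>(y, x)\<in>set ps. N (\<lambda>r. x (d n r)) \<le> 1"
    "\<And>t r. \<psi> (a n (c n t), b n (d n r)) = (\<Sum>(y, x)\<leftarrow>ps. y (c n t) * x (d n r))"
    "(\<Sum>(y, x)\<leftarrow>ps. N' (\<lambda>t. y (c n t))) \<le> total + \<eta>"
    using sample_decomposition[OF \<eta>] by blast
  let ?qs = "map (\<lambda>(y, x). (\<lambda>t. y (c n t), E k (\<lambda>r. x (d n r)))) ps"
  show ?thesis unfolding R_def
  proof (intro exI[of _ ?qs] conjI allI)
    show "\<forall>(g, f)\<in>set ?qs. bdm' g \<and> bdm f" by auto
    show "V n k t r = (\<Sum>(g, f)\<leftarrow>?qs. g t * f r)" for t r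
      unfolding V_decomposition[OF ps(2)] by (simp add: o_def split_def)
    have "(\<Sum>(g, f)\<leftarrow>?qs. N' g * N f) = (\<Sum>(y, x)\<leftarrow>ps. N' (\<lambda>t. y (c n t)) * N (E k (\<lambda>r. x (d n r))))"
      by (simp add: o_def split_def)
    also have "\<dots> \<le> (\<Sum>(y, x)\<leftarrow>ps. N' (\<lambda>t. y (c n t)))"
    proof (rule sum_list_mono)
      fix z assume z: "z \<in> set ps"
      obtain y x where yx: "z = (y, x)" by force
      have "N (E k (\<lambda>r. x (d n r))) \<le> 1" using N_E_le[OF bdm_step[of x n], of k] ps(1) z yx by force
      then have "N' (\<lambda>t. y (c n t)) * N (E k (\<lambda>r. x (d n r))) \<le> N' (\<lambda>t. y (c n t)) * 1" by (intro mult_left_mono) auto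
      then show "(case z of (y, x) \<Rightarrow> N' (\<lambda>t. y (c n t)) * N (E k (\<lambda>r. x (d n r)))) \<le> (case z of (y, x) \<Rightarrow> N' (\<lambda>t. y (c n t)))"
        by (simp add: yx)
    qed
    also note ps(3)
    finally show "(\<Sum>(g, f)\<leftarrow>?qs. N' g * N f) \<le> total + \<eta>" .
  qed
qed

text \<open>Uniform convexity controls p-th powers whereas cost is linear in norms. If s exceeds e,
  then s^(p - 1) exceeds e^(p - 1), which absorbs the mismatch at the price of a constant.\<close>

lemma le_eps_plus_powr:
  assumes "0 < (e :: real)" "0 \<le> s"
  shows "s \<le> e + e powr (1 - p) * s powr p"
proof (cases "s \<le> e")
  case True
  then show ?thesis by (simp add: add_increasing2)
next
  case False
  then have s: "s > e" "s > 0" using assms by auto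
  have "e powr (p - 1) \<le> s powr (p - 1)" using s assms p1 by (intro powr_mono2) auto
  then have "e powr (1 - p) * (e powr (p - 1) * s) \<le> e powr (1 - p) * (s powr (p - 1) * s)"
    using s by (intro mult_left_mono mult_right_mono) auto
  moreover have "e powr (1 - p) * (e powr (p - 1) * s) = s" using assms by (simp flip: powr_add mult.assoc)
  moreover have "s powr (p - 1) * s = s powr p" using s by (simp add: powr_diff)
  ultimately show ?thesis using assms by simp
qed

lemma pigeonhole_increment:
  fixes Q :: "nat \<Rightarrow> real"
  assumes "0 \<le> Q 0" "Q L \<le> B" "0 < L"
  shows "\<exists>i<L. Q (Suc i) - Q i \<le> B / real L"
proof (rule ccontr)
  assume "\<not> ?thesis"
  then have "\<And>i. i \<in> {..<L} \<Longrightarrow> B / real L < Q (Suc i) - Q i" by force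
  then have "(\<Sum>i<L. B / real L) < (\<Sum>i<L. Q (Suc i) - Q i)" using assms(3) by (intro sum_strict_mono) auto
  also have "\<dots> = Q L - Q 0" by (rule sum_lessThan_telescope)
  finally show False using assms by simp
qed

text \<open>The number L is chosen before n and the levels K, so it bounds the jumps of all sampled
  kernels simultaneously. The cost-weighted p-th power energy of the averaged factors increases with
  the level and stays below B; among L steps one adds at most B/L, and \<open>E_jump\<close>
  converts this into a small projective cost.\<close>

lemma R_V_jump:
  assumes e: "0 < e"
  shows "\<exists>L. \<forall>n K. mono K \<longrightarrow> (\<exists>i<L. R (\<lambda>t r. V n (K (Suc i)) t r - V n (K i) t r) e)"
proof -
  define B where "B = total + 1"
  have B: "0 < B" using total_nonneg by (simp add: B_def)
  \<comment> \<open>The budget: the e1 terms cost e/2 in all, the \<epsilon> terms e/4, and the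
    energy increment e/4 by the choice of L. The factor s is the constant of
    \<open>le_eps_plus_powr\<close>.\<close>
  define e1 where "e1 = e / (2 * B)"
  have e1: "0 < e1" using e B by (simp add: e1_def)
  define s where "s = e1 powr (1 - p)"
  have s: "0 < s" using e1 by (simp add: s_def)
  define \<epsilon> where "\<epsilon> = e / (8 * s * B)"
  have eps: "0 < \<epsilon>" using e s B by (simp add: \<epsilon>_def)
  obtain K0 where K0: "0 \<le> K0" "\<And>a b :: complex. cmod (a - b) powr p \<le> \<epsilon> * (cmod a powr p + cmod b powr p) + K0 * convexity_gap p a b"
    using uniform_convexity_scalar[OF p1(1) eps] by blast
  obtain L0 :: nat where L0: "2 * s * K0 * B / e < real L0" using reals_Archimedean2 by blast
  define L where "L = Suc L0"
  have L: "s * (K0 / 2 * (B / real L)) \<le> e / 4"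
  proof -
    have "2 * s * K0 * B < real L0 * e" using L0 e by (simp add: field_simps)
    also have "\<dots> \<le> real L * e" using e by (simp add: L_def)
    finally show ?thesis by (simp add: L_def field_simps)
  qed
  show ?thesis
  proof (rule exI[of _ L], intro allI impI)
    fix n and K :: "nat \<Rightarrow> nat" assume K: "mono K"
    obtain ps where ps: "\<forall>(y, x)\<in>set ps. N (\<lambda>r. x (d n r)) \<le> 1"
      "\<And>t r. \<psi> (a n (c n t), b n (d n r)) = (\<Sum>(y, x)\<leftarrow>ps. y (c n t) * x (d n r))"
      "(\<Sum>(y, x)\<leftarrow>ps. N' (\<lambda>t. y (c n t))) \<le> B"
      using sample_decomposition[of 1 n] unfolding B_def by auto
    define l where "l z = N' (\<lambda>t. fst z (c n t))" for z :: "(nat \<Rightarrow> complex) \<times> (nat \<Rightarrow> complex)"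
    define X where "X z r = snd z (d n r)" for z :: "(nat \<Rightarrow> complex) \<times> (nat \<Rightarrow> complex)" and r
    have l0: "0 \<le> l z" for z by (simp add: l_def)
    have lB: "(\<Sum>z\<leftarrow>ps. l z) \<le> B" using ps(3) by (simp add: l_def split_def)
    have X: "bdm (X z)" for z by (simp add: X_def[abs_def])
    have X1: "N (X z) \<le> 1" if "z \<in> set ps" for z using ps(1) that by (auto simp: X_def[abs_def] split_def)
    \<comment> \<open>The energy at level K i, each expansion term weighted by the norm of its first
      factor.\<close>
    define Q where "Q i = (\<Sum>z\<leftarrow>ps. l z * N (E (K i) (X z)) powr p)" for i
    have "\<exists>i<L. Q (Suc i) - Q i \<le> B / real L"
    proof (rule pigeonhole_increment)
      show "0 \<le> Q 0" unfolding Q_def using l0 by (intro sum_list_nonneg) auto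
      have "Q L \<le> (\<Sum>z\<leftarrow>ps. l z)" unfolding Q_def
      proof (rule sum_list_mono)
        fix z assume z: "z \<in> set ps"
        have "N (E (K L) (X z)) \<le> 1" using N_E_le[OF X, of "K L" z] X1[OF z] by linarith
        then have "N (E (K L) (X z)) powr p \<le> 1 powr p" using p1 by (intro powr_mono2) auto
        then show "l z * N (E (K L) (X z)) powr p \<le> l z" using l0[of z] by (simp add: mult_left_le)
      qed
      then show "Q L \<le> B" using lB by linarith
    qed (simp add: L_def)
    then obtain i where i: "i < L" "Q (Suc i) - Q i \<le> B / real L" by blast
    have Ki: "K i \<le> K (Suc i)" using K by (simp add: mono_def)
    let ?h = "\<lambda>z r. E (K (Suc i)) (X z) r - E (K i) (X z) r"
    let ?qs = "map (\<lambda>z. (\<lambda>t. fst z (c n t), ?h z)) ps"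
    have "R (\<lambda>t r. V n (K (Suc i)) t r - V n (K i) t r) e"
      unfolding R_def
    proof (intro exI[of _ ?qs] conjI allI)
      show "\<forall>(g, f)\<in>set ?qs. bdm' g \<and> bdm f" by (auto intro: bdm_diff)
      show "V n (K (Suc i)) t r - V n (K i) t r = (\<Sum>(g, f)\<leftarrow>?qs. g t * f r)" for t r
        unfolding V_decomposition[OF ps(2)]
        by (simp add: o_def split_def right_diff_distrib sum_list_subtractf X_def[abs_def])
      have "(\<Sum>(g, f)\<leftarrow>?qs. N' g * N f) = (\<Sum>z\<leftarrow>ps. l z * N (?h z))" by (simp add: o_def l_def)
      also have "\<dots> \<le> (\<Sum>z\<leftarrow>ps. (e1 + s * (2 * \<epsilon>)) * l z + s * (K0 / 2) * (l z * N (E (K (Suc i)) (X z)) powr p - l z * N (E (K i) (X z)) powr p))"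
      proof (rule sum_list_mono)
        fix z assume z: "z \<in> set ps"
        have "N (?h z) powr p \<le> 2 * \<epsilon> * N (X z) powr p + K0 / 2 * (N (E (K (Suc i)) (X z)) powr p - N (E (K i) (X z)) powr p)"
          by (rule E_jump(2)[OF K0 less_imp_le[OF eps] X Ki])
        moreover have "N (X z) powr p \<le> 1 powr p" using X1[OF z] p1 by (intro powr_mono2) auto
        then have "2 * \<epsilon> * N (X z) powr p \<le> 2 * \<epsilon> * 1" using eps by (intro mult_left_mono) auto
        ultimately have "N (?h z) powr p \<le> 2 * \<epsilon> + K0 / 2 * (N (E (K (Suc i)) (X z)) powr p - N (E (K i) (X z)) powr p)" by linarith
        then have "s * N (?h z) powr p \<le> s * (2 * \<epsilon> + K0 / 2 * (N (E (K (Suc i)) (X z)) powr p - N (E (K i) (X z)) powr p))"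
          using s by (intro mult_left_mono) auto
        moreover have "N (?h z) \<le> e1 + s * N (?h z) powr p"
          unfolding s_def by (rule le_eps_plus_powr[OF e1 Lp_norm_nonneg])
        ultimately have "N (?h z) \<le> e1 + s * (2 * \<epsilon> + K0 / 2 * (N (E (K (Suc i)) (X z)) powr p - N (E (K i) (X z)) powr p))" by linarith
        then have "l z * N (?h z) \<le> l z * (e1 + s * (2 * \<epsilon> + K0 / 2 * (N (E (K (Suc i)) (X z)) powr p - N (E (K i) (X z)) powr p)))"
          using l0 by (intro mult_left_mono) auto
        also have "\<dots> = (e1 + s * (2 * \<epsilon>)) * l z + s * (K0 / 2) * (l z * N (E (K (Suc i)) (X z)) powr p - l z * N (E (K i) (X z)) powr p)"
        proof -
          have "l z * (e1 + s * (2 * \<epsilon> + K0 / 2 * (u - v))) = (e1 + s * (2 * \<epsilon>)) * l z + s * (K0 / 2) * (l z * u - l z * v)" for u v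
            by (simp add: field_simps)
          then show ?thesis .
        qed
        finally show "l z * N (?h z) \<le> (e1 + s * (2 * \<epsilon>)) * l z + s * (K0 / 2) * (l z * N (E (K (Suc i)) (X z)) powr p - l z * N (E (K i) (X z)) powr p)" .
      qed
      also have "\<dots> = (e1 + s * (2 * \<epsilon>)) * (\<Sum>z\<leftarrow>ps. l z) + s * (K0 / 2) * (Q (Suc i) - Q i)"
        by (simp only: sum_list_addf sum_list_const_mult sum_list_subtractf Q_def)
      also have "\<dots> \<le> (e1 + s * (2 * \<epsilon>)) * B + s * (K0 / 2) * (B / real L)"
        using e1 s eps K0(1) lB i(2) by (intro add_mono mult_left_mono) auto
      also have "\<dots> \<le> e"
      proof -
        have "e1 * B = e / 2" "s * (2 * \<epsilon>) * B = e / 4" using B s by (auto simp: e1_def \<epsilon>_def)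
        moreover have "s * (K0 / 2) * (B / real L) \<le> e / 4" using L by (simp only: mult.assoc)
        ultimately show ?thesis by (simp only: distrib_right)
      qed
      finally show "(\<Sum>(g, f)\<leftarrow>?qs. N' g * N f) \<le> e" .
    qed
    then show "\<exists>i<L. R (\<lambda>t r. V n (K (Suc i)) t r - V n (K i) t r) e" using i(1) by blast
  qed
qed

text \<open>At a fixed averaging level the sampling parameter can be increased until the finite rank
  estimate falls below e. The threshold is also taken to be at least k, so that both errors in
  \<open>V_psi_close\<close> are controlled by k.\<close>

lemma R_V_stable:
  assumes e: "0 < e"
  shows "\<exists>n0\<ge>k. \<forall>n\<ge>n0. \<forall>m\<ge>n0. R (\<lambda>t r. V n k t r - V m k t r) e"
proof -
  obtain n1 :: nat where n1: "2 * real (card (J k)) * total / e < real n1" using reals_Archimedean2 by blast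
  have "R (\<lambda>t r. V n k t r - V m k t r) e" if nm: "n \<ge> max k n1" "m \<ge> max k n1" for n m
  proof (rule R_mono[OF R_V_diff])
    have inv: "1 / real (Suc i) \<le> 1 / real (Suc n1)" if "i \<ge> max k n1" for i using that by (simp add: frac_le)
    have "real (card (J k)) * (1 / real (Suc n) + 1 / real (Suc m)) * total
        \<le> real (card (J k)) * (1 / real (Suc n1) + 1 / real (Suc n1)) * total"
      using inv[OF nm(1)] inv[OF nm(2)] total_nonneg by (intro mult_right_mono mult_left_mono add_mono) auto
    also have "\<dots> = 2 * real (card (J k)) * total / real (Suc n1)" by simp
    also have "\<dots> \<le> e"
    proof -
      have "2 * real (card (J k)) * total < real n1 * e" using n1 e by (simp add: field_simps)
      also have "\<dots> \<le> real (Suc n1) * e" using e by simp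
      finally show ?thesis by (simp add: field_simps)
    qed
    finally show "real (card (J k)) * (1 / real (Suc n) + 1 / real (Suc m)) * total \<le> e" .
  qed
  then show ?thesis by (intro exI[of _ "max k n1"]) auto
qed

text \<open>A diagonal sequence through the two parameters is, along suitable levels, Cauchy in
  projective cost and converges uniformly to \<psi>. Telescoping it gives a series whose first term
  costs about \<open>total\<close> and whose remaining terms cost arbitrarily little
  together.\<close>

theorem kernel_series:
  assumes \<eta>: "0 < \<eta>"
  obtains u x where "\<And>i. R (u i) (x i)" "\<And>i. 0 \<le> x i" "summable x" "suminf x \<le> total + \<eta>"
    "\<And>n t r. cmod ((\<Sum>i<Suc n. u i t r) - \<psi> (t, r)) \<le> 2 / real (Suc n)"
proof -
  have "\<exists>f. \<forall>k. f k \<ge> k \<and> (\<forall>n\<ge>f k. \<forall>m\<ge>f k. R (\<lambda>t r. V n k t r - V m k t r) ((1/2) ^ k))"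
    by (intro choice allI) (use R_V_stable[of "(1/2) ^ _"] in force)
  then obtain f where f: "\<And>k. f k \<ge> k" "\<And>k n m. n \<ge> f k \<Longrightarrow> m \<ge> f k \<Longrightarrow> R (\<lambda>t r. V n k t r - V m k t r) ((1/2) ^ k)"
    by blast
  \<comment> \<open>From \<open>f k\<close> on, further sampling changes level k by cost at most
    (1/2)^k only.\<close>
  define w where "w k = V (f k) k" for k
  have w_close: "cmod (w k t r - \<psi> (t, r)) \<le> 2 / real (Suc k)" for k t r
  proof -
    have "cmod (w k t r - \<psi> (t, r)) \<le> 1 / real (Suc (f k)) + 1 / real (Suc k)" unfolding w_def by (rule V_psi_close)
    also have "1 / real (Suc (f k)) \<le> 1 / real (Suc k)" using f(1)[of k] by (simp add: frac_le)
    finally show ?thesis by simp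
  qed
  \<comment> \<open>Otherwise there would be an infinite chain of levels at which w jumps by more
    than e. Passing to one common sampling parameter n would give L consecutive jumps of
    \<open>V n\<close> above e/2, contradicting \<open>R_V_jump\<close>.\<close>
  have cauchy: "\<exists>k0\<ge>m. \<forall>k\<ge>k0. R (\<lambda>t r. w k t r - w k0 t r) e" if e: "0 < e" for e m
  proof (rule ccontr)
    assume "\<not> ?thesis"
    then have neg: "\<forall>k0\<ge>m. \<exists>k\<ge>k0. \<not> R (\<lambda>t r. w k t r - w k0 t r) e" by blast
    obtain L where L: "\<And>n K. mono K \<Longrightarrow> \<exists>i<L. R (\<lambda>t r. V n (K (Suc i)) t r - V n (K i) t r) (e/2)"
      using R_V_jump[of "e/2"] e by auto
    obtain m1 where m1: "(1/2) ^ m1 < e/4" using real_arch_pow_inv[of "e/4" "1/2"] e by auto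
    have "\<exists>K. \<forall>i. K i \<ge> max m m1 \<and> (K (Suc i) \<ge> K i \<and> \<not> R (\<lambda>t r. w (K (Suc i)) t r - w (K i) t r) e)"
    proof (rule dependent_nat_choice)
      show "\<exists>x. max m m1 \<le> x" by blast
      fix x :: nat assume "max m m1 \<le> x"
      then show "\<exists>y. max m m1 \<le> y \<and> (x \<le> y \<and> \<not> R (\<lambda>t r. w y t r - w x t r) e)"
      proof -
        from \<open>max m m1 \<le> x\<close> have "m \<le> x" by simp
        with neg obtain y where "y \<ge> x" "\<not> R (\<lambda>t r. w y t r - w x t r) e" by blast
        then show ?thesis using \<open>max m m1 \<le> x\<close> order_trans by blast
      qed
    qed
    then obtain K where K: "\<And>i. K i \<ge> max m m1" "\<And>i. K (Suc i) \<ge> K i" "\<And>i. \<not> R (\<lambda>t r. w (K (Suc i)) t r - w (K i) t r) e" by blast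
    have "mono K" using K(2) by (simp add: mono_iff_le_Suc)
    \<comment> \<open>One n beyond the thresholds of all levels K 0, ..., K L; replacing w by
      \<open>V n\<close> at these levels costs at most e/4 each.\<close>
    define n where "n = Max ((\<lambda>i. f (K i)) ` {..L})"
    have n: "f (K i) \<le> n" if "i \<le> L" for i unfolding n_def using that by (intro Max_ge) auto
    obtain i where i: "i < L" "R (\<lambda>t r. V n (K (Suc i)) t r - V n (K i) t r) (e/2)" using L[OF \<open>mono K\<close>] by blast
    have w: "R (\<lambda>t r. w (K j) t r - V n (K j) t r) (e/4)" if "j \<le> L" for j
    proof (rule R_mono)
      show "R (\<lambda>t r. w (K j) t r - V n (K j) t r) ((1/2) ^ K j)" unfolding w_def using n[OF that] by (intro f(2)) auto
      have "(1/2::real) ^ K j \<le> (1/2) ^ m1" using K(1)[of j] by (intro power_decreasing) auto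
      then show "(1/2) ^ K j \<le> e/4" using m1 by linarith
    qed
    have "R (\<lambda>t r. ((w (K (Suc i)) t r - V n (K (Suc i)) t r) + (V n (K (Suc i)) t r - V n (K i) t r)) - (w (K i) t r - V n (K i) t r)) ((e/4 + e/2) + e/4)"
      by (intro R_diff R_add w i(2)) (use i(1) in auto)
    then have "R (\<lambda>t r. w (K (Suc i)) t r - w (K i) t r) e"
      by (rule R_mono[OF R_cong]) auto
    then show False using K(3) by blast
  qed
  \<comment> \<open>These costs add up to \<eta>/2; the other half of \<eta> goes into the first
    term of the series.\<close>
  define e where "e i = \<eta> / 2 * (1/2) ^ Suc i" for i :: nat
  have e: "0 < e i" for i using \<eta> by (simp add: e_def)
  have "\<exists>\<kappa>. \<forall>i. (i \<le> \<kappa> i \<and> (\<forall>k\<ge>\<kappa> i. R (\<lambda>t r. w k t r - w (\<kappa> i) t r) (e i))) \<and> \<kappa> i \<le> \<kappa> (Suc i)"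
  proof (rule dependent_nat_choice)
    show "\<exists>x. 0 \<le> x \<and> (\<forall>k\<ge>x. R (\<lambda>t r. w k t r - w x t r) (e 0))" using cauchy[OF e[of 0], of 0] by blast
    fix x n :: nat
    show "\<exists>y. (Suc n \<le> y \<and> (\<forall>k\<ge>y. R (\<lambda>t r. w k t r - w y t r) (e (Suc n)))) \<and> x \<le> y"
      using cauchy[OF e[of "Suc n"], of "max x (Suc n)"] by auto
  qed
  then obtain \<kappa> where \<kappa>: "\<And>i. i \<le> \<kappa> i" "\<And>i k. k \<ge> \<kappa> i \<Longrightarrow> R (\<lambda>t r. w k t r - w (\<kappa> i) t r) (e i)" "\<And>i. \<kappa> i \<le> \<kappa> (Suc i)" by blast
  \<comment> \<open>Telescoping differences, with partial sums equal to w at the chosen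
    levels.\<close>
  define u where "u i t r = (case i of 0 \<Rightarrow> w (\<kappa> 0) t r | Suc j \<Rightarrow> w (\<kappa> (Suc j)) t r - w (\<kappa> j) t r)" for i t r
  define x where "x i = (case i of 0 \<Rightarrow> total + \<eta>/2 | Suc j \<Rightarrow> e j)" for i
  have sum_u: "(\<Sum>i<Suc n. u i t r) = w (\<kappa> n) t r" for n t r
    by (induction n) (auto simp: u_def)
  have es: "e sums (\<eta>/2)"
    unfolding e_def using sums_mult[OF power_half_series, of "\<eta>/2"] by simp
  have "(\<lambda>j. x (Suc j)) sums (\<eta>/2)" using es by (simp add: x_def)
  then have xs: "x sums (\<eta>/2 + x 0)" by (rule sums_Suc)
  show ?thesis
  proof
    show "R (u i) (x i)" for i
    proof (cases i)
      case 0
      then show ?thesis using R_V[of "\<eta>/2"] \<eta> by (simp add: u_def[abs_def] x_def w_def)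
    next
      case (Suc j)
      then show ?thesis using \<kappa>(2)[OF \<kappa>(3)[of j]] by (simp add: u_def[abs_def] x_def)
    qed
    show "0 \<le> x i" for i using e total_nonneg \<eta> by (cases i) (auto simp: x_def less_imp_le)
    show "summable x" using xs by (rule sums_summable)
    show "suminf x \<le> total + \<eta>" using sums_unique[OF xs] by (simp add: x_def)
    show "cmod ((\<Sum>i<Suc n. u i t r) - \<psi> (t, r)) \<le> 2 / real (Suc n)" for n t r
    proof -
      have "cmod ((\<Sum>i<Suc n. u i t r) - \<psi> (t, r)) \<le> 2 / real (Suc (\<kappa> n))" unfolding sum_u by (rule w_close)
      also have "\<dots> \<le> 2 / real (Suc n)" using \<kappa>(1)[of n] by (simp add: frac_le)
      finally show ?thesis .
    qed
  qed
qed

end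

section \<open>Double series and L_p norms of vectors\<close>

text \<open>Absolute summability over pairs permits rearrangement along \<open>prod_decode\<close>.
  It is used to concatenate countably many expansions into a single one while keeping track of the
  total cost.\<close>

lemma double_series:
  fixes f :: "nat \<Rightarrow> nat \<Rightarrow> 'a::banach"
  assumes le: "\<And>i j. norm (f i j) \<le> a i j" and a: "\<And>i. a i sums A i" and A: "A sums S"
  shows "(\<lambda>n. f (fst (prod_decode n)) (snd (prod_decode n))) sums (\<Sum>i. \<Sum>j. f i j)"
    and "summable (\<lambda>n. norm (f (fst (prod_decode n)) (snd (prod_decode n))))"
    and "(\<lambda>n. a (fst (prod_decode n)) (snd (prod_decode n))) sums S"
    and "summable (\<lambda>i. \<Sum>j. f i j)" and "\<And>i. summable (f i)"
proof -
  have a0: "0 \<le> a i j" for i j using le[of i j] norm_ge_zero order_trans by blast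
  have A0: "0 \<le> A i" for i using a0 sums_le[OF _ sums_zero a[of i]] by simp
  have ahas: "(a i has_sum A i) UNIV" for i
    using norm_summable_imp_has_sum[of "a i" "A i"] a[of i] a0 by (simp add: sums_iff)
  have Ahas: "(A has_sum S) UNIV"
    using norm_summable_imp_has_sum[of A S] A A0 by (simp add: sums_iff)
  have abs_a: "(\<lambda>z. norm (a (fst z) (snd z))) summable_on (UNIV \<times> UNIV)"
  proof -
    have "a i summable_on UNIV" "infsum (a i) UNIV = A i" for i
      using has_sum_imp_summable[OF ahas] infsumI[OF ahas] by auto
    moreover have "A summable_on UNIV" by (rule has_sum_imp_summable[OF Ahas])
    ultimately show ?thesis
      unfolding Infinite_Sum.abs_summable_on_Sigma_iff using a0 A0 by simp
  qed
  have abs_f: "(\<lambda>z. norm (f (fst z) (snd z))) summable_on (UNIV \<times> UNIV)"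
    by (rule Infinite_Sum.abs_summable_on_comparison_test[OF abs_a]) (use le a0 in auto)
  have bij: "bij_betw prod_decode UNIV (UNIV \<times> UNIV)" using bij_prod_decode by simp
  show sf: "summable (f i)" for i
    by (rule summable_comparison_test[OF _ sums_summable[OF a[of i]]]) (use le in auto)
  have fhas: "(f i has_sum (\<Sum>j. f i j)) UNIV" for i
  proof (rule norm_summable_imp_has_sum)
    show "summable (\<lambda>n. norm (f i n))"
      by (rule summable_comparison_test[OF _ sums_summable[OF a[of i]]]) (use le in auto)
    show "f i sums (\<Sum>j. f i j)" using sf by (simp add: summable_sums)
  qed
  define F where "F = infsum (\<lambda>z. f (fst z) (snd z)) (UNIV \<times> UNIV)"
  have hF: "((\<lambda>z. f (fst z) (snd z)) has_sum F) (UNIV \<times> UNIV)"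
    unfolding F_def by (rule has_sum_infsum[OF Infinite_Sum.abs_summable_summable[OF abs_f]])
  have "((\<lambda>i. \<Sum>j. f i j) has_sum F) UNIV"
    by (rule has_sum_SigmaD[OF hF]) (use fhas in auto)
  then have s: "(\<lambda>i. \<Sum>j. f i j) sums F" by (rule has_sum_imp_sums)
  then show "summable (\<lambda>i. \<Sum>j. f i j)" by (rule sums_summable)
  have FF: "F = (\<Sum>i. \<Sum>j. f i j)" using s by (simp add: sums_iff)
  show "(\<lambda>n. f (fst (prod_decode n)) (snd (prod_decode n))) sums (\<Sum>i. \<Sum>j. f i j)"
    unfolding FF[symmetric]
    by (intro has_sum_imp_sums) (use has_sum_reindex_bij_betw[OF bij, of "\<lambda>z. f (fst z) (snd z)"] hF in simp)
  have "(\<lambda>n. norm (f (fst (prod_decode n)) (snd (prod_decode n)))) summable_on UNIV"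
    using summable_on_reindex_bij_betw[OF bij, of "\<lambda>z. norm (f (fst z) (snd z))"] abs_f by simp
  then show "summable (\<lambda>n. norm (f (fst (prod_decode n)) (snd (prod_decode n))))" by (rule summable_on_imp_summable)
  have ha: "((\<lambda>z. a (fst z) (snd z)) has_sum infsum (\<lambda>z. a (fst z) (snd z)) (UNIV \<times> UNIV)) (UNIV \<times> UNIV)"
    by (rule has_sum_infsum[OF Infinite_Sum.abs_summable_summable[OF abs_a]])
  have "(A has_sum infsum (\<lambda>z. a (fst z) (snd z)) (UNIV \<times> UNIV)) UNIV"
    by (rule has_sum_SigmaD[OF ha]) (use ahas in auto)
  then have "infsum (\<lambda>z. a (fst z) (snd z)) (UNIV \<times> UNIV) = S" using Ahas has_sum_unique by blast
  then show "(\<lambda>n. a (fst (prod_decode n)) (snd (prod_decode n))) sums S"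
    by (intro has_sum_imp_sums) (use has_sum_reindex_bij_betw[OF bij, of "\<lambda>z. a (fst z) (snd z)"] ha in simp)
qed

text \<open>The norm of l_p^m tensored with L_p in the p-norm, the space on which matrices of
  operators act.\<close>

definition vec_norm :: "'a measure \<Rightarrow> real \<Rightarrow> nat \<Rightarrow> (nat \<Rightarrow> 'a \<Rightarrow> complex) \<Rightarrow> real" where
  "vec_norm M p m f = (\<Sum>l<m. Lp_norm M p (f l) powr p) powr (1 / p)"

lemma vec_norm_fin_norm: "vec_norm M p m f = fin_norm p {..<m} (\<lambda>l. of_real (Lp_norm M p (f l)))"
  by (simp add: vec_norm_def fin_norm_def)

lemma vec_norm_nonneg [simp]: "0 \<le> vec_norm M p m f"
  by (simp add: vec_norm_def)

lemma vec_norm_powr: "p \<noteq> 0 \<Longrightarrow> vec_norm M p m f powr p = (\<Sum>l<m. Lp_norm M p (f l) powr p)"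
  by (simp add: vec_norm_def powr_powr sum_nonneg)

lemma Lp_norm_le_vec_norm:
  assumes "l < m" "0 < p" shows "Lp_norm M p (f l) \<le> vec_norm M p m f"
proof (rule powr_le_imp_le)
  show "Lp_norm M p (f l) powr p \<le> vec_norm M p m f powr p"
    using assms by (subst vec_norm_powr) (auto intro!: member_le_sum)
qed (use assms in auto)

lemma vec_norm_triangle:
  assumes "\<And>l. l < m \<Longrightarrow> Lp_norm M p (h l) \<le> Lp_norm M p (f l) + Lp_norm M p (g l)" "1 < p"
  shows "vec_norm M p m h \<le> vec_norm M p m f + vec_norm M p m g"
proof -
  have "vec_norm M p m h \<le> fin_norm p {..<m} (\<lambda>l. of_real (Lp_norm M p (f l)) + of_real (Lp_norm M p (g l)))"
    unfolding vec_norm_fin_norm using assms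
    by (intro fin_norm_mono) (auto simp flip: of_real_add)
  also have "\<dots> \<le> vec_norm M p m f + vec_norm M p m g"
    unfolding vec_norm_fin_norm using assms by (intro fin_norm_add) auto
  finally show ?thesis .
qed

lemma vec_norm_mono:
  assumes "\<And>l. l < m \<Longrightarrow> Lp_norm M p (h l) \<le> Lp_norm M p (f l)" "0 < p"
  shows "vec_norm M p m h \<le> vec_norm M p m f"
  unfolding vec_norm_fin_norm using assms by (intro fin_norm_mono) auto

lemma vec_norm_cmult: "0 < p \<Longrightarrow> vec_norm M p m (\<lambda>l x. c * f l x) = cmod c * vec_norm M p m f"
  using fin_norm_cmult[of "{..<m}" p "of_real (cmod c)" "\<lambda>l. of_real (Lp_norm M p (f l))"]
  by (simp add: vec_norm_fin_norm Lp_norm_cmult)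

lemma vec_norm_1 [simp]: "0 < p \<Longrightarrow> vec_norm M p (Suc 0) f = Lp_norm M p (f 0)"
  by (simp add: vec_norm_def powr_powr)

lemma vec_Holder:
  assumes "conj_pair p q"
  shows "(\<Sum>k<m. Lp_norm M q (g k) * Lp_norm M p (f k)) \<le> vec_norm M q m g * vec_norm M p m f"
  unfolding vec_norm_def by (rule Holder_fin_real[OF _ assms]) auto

section \<open>Left translation, A_p and its pairing with PM_p\<close>

locale haar_group =
  fixes \<mu> :: "'g::{topological_group_add, t2_space} measure" and p q :: real
  assumes lc: "locally_compact_space (euclidean :: 'g topology)"
    and haar: "left_haar_measure \<mu>" and pq: "conj_pair p q"
begin

lemma p1: "1 < p" "1 < q" "0 < p" "0 < q" using conj_pairD[OF pq] by auto

lemma qp: "conj_pair q p" using pq by (rule conj_pair_sym)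

lemma q_eq: "conj_exp p = q" using conj_pair_eqs(4)[OF pq] by simp

lemma sets_mu [measurable_cong]: "sets \<mu> = sets borel"
  using haar by (simp add: left_haar_measure_def)

lemma space_mu [simp]: "space \<mu> = UNIV"
  using sets_eq_imp_space_eq[OF sets_mu] by simp

lemma shift_measurable [measurable]: "(\<lambda>x. s + x) \<in> measurable \<mu> \<mu>"
  unfolding measurable_cong_sets[OF sets_mu sets_mu]
  by (intro borel_measurable_continuous_onI continuous_intros)

lemma distr_shift: "distr \<mu> \<mu> ((+) s) = \<mu>"
proof (rule measure_eqI)
  fix A assume "A \<in> sets (distr \<mu> \<mu> ((+) s))"
  then have A: "A \<in> sets borel" by (simp add: sets_mu)
  have "emeasure (distr \<mu> \<mu> ((+) s)) A = emeasure \<mu> ((+) s -` A)"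
    using A shift_measurable[of s] by (subst emeasure_distr) (auto simp: sets_mu)
  also have "(+) s -` A = (+) (- s) ` A" by (force simp: image_iff algebra_simps add.assoc[symmetric])
  also have "emeasure \<mu> \<dots> = emeasure \<mu> A" using haar A by (simp add: left_haar_measure_def)
  finally show "emeasure (distr \<mu> \<mu> ((+) s)) A = emeasure \<mu> A" .
qed simp

lemma integral_shift:
  fixes f :: "'g \<Rightarrow> 'b::{banach, second_countable_topology}"
  assumes "f \<in> borel_measurable \<mu>"
  shows "(\<integral>x. f (s + x) \<partial>\<mu>) = (\<integral>x. f x \<partial>\<mu>)"
  using integral_distr[of "(+) s" \<mu> \<mu> f] shift_measurable[of s] assms by (simp add: distr_shift)

lemma integrable_shift:
  fixes f :: "'g \<Rightarrow> 'b::{banach, second_countable_topology}"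
  assumes "f \<in> borel_measurable \<mu>"
  shows "integrable \<mu> (\<lambda>x. f (s + x)) \<longleftrightarrow> integrable \<mu> f"
  using integrable_distr_eq[of "(+) s" \<mu> \<mu> f] shift_measurable[of s] assms by (simp add: distr_shift)

lemma AE_shift:
  assumes "AE x in \<mu>. P x" shows "AE x in \<mu>. P (s + x)"
proof -
  have "AE x in distr \<mu> \<mu> ((+) s). P x" using assms by (simp only: distr_shift)
  from AE_distrD[OF shift_measurable this] show ?thesis .
qed

lemma measurable_lambda:
  assumes "f \<in> borel_measurable \<mu>" shows "lambda_p s f \<in> borel_measurable \<mu>"
  unfolding lambda_p_def using measurable_compose[OF shift_measurable assms] .

lemma Lp_mem_lambda: "Lp_mem \<mu> r f \<Longrightarrow> Lp_mem \<mu> r (lambda_p s f)"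
  using integrable_shift[of "\<lambda>x. cmod (f x) powr r" "-s"] measurable_lambda[of f s]
  by (auto simp: Lp_mem_def lambda_p_def)

lemma Lp_norm_lambda: "Lp_mem \<mu> r f \<Longrightarrow> Lp_norm \<mu> r (lambda_p s f) = Lp_norm \<mu> r f"
  using integral_shift[of "\<lambda>x. cmod (f x) powr r" "-s"]
  by (auto simp: Lp_mem_def lambda_p_def Lp_norm_def)

text \<open>The coefficient function of the left regular representation on L_p; the elementary
  tensors of A_p.\<close>

definition Lam :: "('g \<Rightarrow> complex) \<Rightarrow> ('g \<Rightarrow> complex) \<Rightarrow> 'g \<Rightarrow> complex" where
  "Lam g f s = pairing \<mu> g (lambda_p s f)"

lemma Lam_bound: "Lp_mem \<mu> q g \<Longrightarrow> Lp_mem \<mu> p f \<Longrightarrow> cmod (Lam g f s) \<le> Lp_norm \<mu> q g * Lp_norm \<mu> p f"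
  using Holder_pairing[OF pq, of \<mu> g "lambda_p s f"] by (simp add: Lam_def Lp_mem_lambda Lp_norm_lambda)

lemma Ap_rep_iff: "Ap_rep \<mu> p u gs fs \<longleftrightarrow>
   (\<forall>n. Lp_mem \<mu> q (gs n) \<and> Lp_mem \<mu> p (fs n)) \<and> summable (\<lambda>n. Lp_norm \<mu> q (gs n) * Lp_norm \<mu> p (fs n)) \<and>
   (\<forall>s. u s = (\<Sum>n. Lam (gs n) (fs n) s))"
  by (simp add: Ap_rep_def ptensor_def q_eq Lam_def)

lemma ptensor_iff: "ptensor \<mu> p gs fs \<longleftrightarrow>
   (\<forall>n. Lp_mem \<mu> q (gs n) \<and> Lp_mem \<mu> p (fs n)) \<and> summable (\<lambda>n. Lp_norm \<mu> q (gs n) * Lp_norm \<mu> p (fs n))"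
  by (simp add: ptensor_def q_eq)

lemma summable_Lam:
  assumes "ptensor \<mu> p gs fs" shows "summable (\<lambda>n. norm (Lam (gs n) (fs n) s))"
  by (rule summable_comparison_test[of _ "\<lambda>n. Lp_norm \<mu> q (gs n) * Lp_norm \<mu> p (fs n)"])
     (use assms Lam_bound in \<open>auto simp: ptensor_iff\<close>)

lemma tfun_span:
  assumes "ptensor \<mu> p gs fs"
  shows "tfun \<mu> gs fs (\<lambda>f t. \<Sum>j<k. c j * lambda_p (s j) f t) = (\<Sum>j<k. c j * (\<Sum>n. Lam (gs n) (fs n) (s j)))"
proof -
  have m: "Lp_mem \<mu> q (gs n)" "Lp_mem \<mu> p (fs n)" for n using assms by (auto simp: ptensor_iff)
  have "pairing \<mu> (gs n) (\<lambda>t. \<Sum>j<k. c j * lambda_p (s j) (fs n) t) = (\<Sum>j<k. c j * Lam (gs n) (fs n) (s j))" for n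
    by (subst pairing_sum_right[OF pq m(1)]) (auto intro!: Lp_mem_cmult Lp_mem_lambda m simp: pairing_cmult_right Lam_def)
  then have "tfun \<mu> gs fs (\<lambda>f t. \<Sum>j<k. c j * lambda_p (s j) f t) = (\<Sum>n. \<Sum>j<k. c j * Lam (gs n) (fs n) (s j))"
    by (simp add: tfun_def)
  also have "\<dots> = (\<Sum>j<k. \<Sum>n. c j * Lam (gs n) (fs n) (s j))"
    by (rule suminf_sum) (intro summable_mult summable_norm_cancel[OF summable_Lam[OF assms]])
  also have "\<dots> = (\<Sum>j<k. c j * (\<Sum>n. Lam (gs n) (fs n) (s j)))"
    by (intro sum.cong refl suminf_mult summable_norm_cancel[OF summable_Lam[OF assms]])
  finally show ?thesis .
qed

lemma Ap_rep_ptensor: "Ap_rep \<mu> p u gs fs \<Longrightarrow> ptensor \<mu> p gs fs"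
  by (simp add: Ap_rep_def)

lemma Ap_rep_eq: "Ap_rep \<mu> p u gs fs \<Longrightarrow> u s = (\<Sum>n. Lam (gs n) (fs n) s)"
  by (simp add: Ap_rep_iff)

text \<open>On the span of translations a tensor acts through its function u alone. Elements of PM_p
  are weak-star limits of that span, and both tensors can be tested against the same approximant, so
  they agree on T as well.\<close>

lemma tfun_unique:
  assumes T: "T \<in> PMp \<mu> p" and r: "Ap_rep \<mu> p u gs fs" "Ap_rep \<mu> p u gs' fs'"
  shows "tfun \<mu> gs fs T = tfun \<mu> gs' fs' T"
proof (rule ccontr)
  assume ne: "\<not> ?thesis"
  define e where "e = cmod (tfun \<mu> gs fs T - tfun \<mu> gs' fs' T) / 2"
  have e: "0 < e" using ne by (simp add: e_def)
  define G where "G i = (if i = 0 then gs else gs')" for i :: nat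
  define F where "F i = (if i = 0 then fs else fs')" for i :: nat
  have pt: "ptensor \<mu> p gs fs" "ptensor \<mu> p gs' fs'" using r by (auto simp: Ap_rep_ptensor)
  then have "\<forall>i<2. ptensor \<mu> p (G i) (F i)" by (simp add: G_def F_def)
  then obtain S where S: "S \<in> lambda_span" "\<And>i. i < 2 \<Longrightarrow> cmod (tfun \<mu> (G i) (F i) S - tfun \<mu> (G i) (F i) T) < e"
    using T e unfolding PMp_def by blast
  from S(1) obtain k c s where S_eq: "S = (\<lambda>f t. \<Sum>j<(k::nat). c j * lambda_p (s j) f t)"
    unfolding lambda_span_def mem_Collect_eq by (elim exE conjE) (rule that)
  have "tfun \<mu> gs fs S = tfun \<mu> gs' fs' S"
    unfolding S_eq tfun_span[OF pt(1)] tfun_span[OF pt(2)] Ap_rep_eq[OF r(1), symmetric] Ap_rep_eq[OF r(2), symmetric] ..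
  moreover have "cmod (tfun \<mu> gs fs S - tfun \<mu> gs fs T) < e" "cmod (tfun \<mu> gs' fs' S - tfun \<mu> gs' fs' T) < e"
    using S(2)[of 0] S(2)[of 1] by (auto simp: G_def F_def)
  ultimately have "cmod (tfun \<mu> gs fs T - tfun \<mu> gs' fs' T) < e + e"
    by (metis norm_diff_triangle_less norm_minus_commute)
  then show False by (simp add: e_def)
qed

text \<open>By uniqueness the choice of representation inside \<open>pm_pair\<close> is immaterial;
  every later computation may use the expansion at hand.\<close>

lemma pm_pair_eq:
  assumes T: "T \<in> PMp \<mu> p" and r: "Ap_rep \<mu> p u gs fs"
  shows "pm_pair \<mu> p T u = tfun \<mu> gs fs T"
  unfolding pm_pair_def
proof (rule some_equality)
  show "\<exists>gs' fs'. Ap_rep \<mu> p u gs' fs' \<and> tfun \<mu> gs fs T = tfun \<mu> gs' fs' T" using r by blast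
  show "z = tfun \<mu> gs fs T" if "\<exists>gs fs. Ap_rep \<mu> p u gs fs \<and> z = tfun \<mu> gs fs T" for z
    using that tfun_unique[OF T _ r] by blast
qed

lemma PMp_bdd: "T \<in> PMp \<mu> p \<Longrightarrow> Lp_bdd_op \<mu> p T"
  by (simp add: PMp_def)

lemma
  assumes "Lp_bdd_op \<mu> p T"
  shows bdd_op_mem: "\<And>f. Lp_mem \<mu> p f \<Longrightarrow> Lp_mem \<mu> p (T f)"
    and bdd_op_bound: "\<exists>C\<ge>0. \<forall>f. Lp_mem \<mu> p f \<longrightarrow> Lp_norm \<mu> p (T f) \<le> C * Lp_norm \<mu> p f"
    and bdd_op_lin: "\<And>f g c. Lp_mem \<mu> p f \<Longrightarrow> Lp_mem \<mu> p g \<Longrightarrow> AE x in \<mu>. T (\<lambda>y. f y + c * g y) x = T f x + c * T g x"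
proof -
  show "\<exists>C\<ge>0. \<forall>f. Lp_mem \<mu> p f \<longrightarrow> Lp_norm \<mu> p (T f) \<le> C * Lp_norm \<mu> p f"
  proof -
    obtain C where C: "\<And>f. Lp_mem \<mu> p f \<Longrightarrow> Lp_norm \<mu> p (T f) \<le> C * Lp_norm \<mu> p f"
      using assms unfolding Lp_bdd_op_def by blast
    have "Lp_norm \<mu> p (T f) \<le> \<bar>C\<bar> * Lp_norm \<mu> p f" if "Lp_mem \<mu> p f" for f
      by (rule order_trans[OF C[OF that] mult_right_mono]) auto
    then show ?thesis by (intro exI[of _ "\<bar>C\<bar>"]) auto
  qed
qed (use assms in \<open>auto simp: Lp_bdd_op_def\<close>)

lemma summable_tfun:
  assumes T: "Lp_bdd_op \<mu> p T" and r: "ptensor \<mu> p gs fs"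
  shows "summable (\<lambda>n. norm (pairing \<mu> (gs n) (T (fs n))))"
proof -
  obtain C where C: "0 \<le> C" "\<And>f. Lp_mem \<mu> p f \<Longrightarrow> Lp_norm \<mu> p (T f) \<le> C * Lp_norm \<mu> p f"
    using bdd_op_bound[OF T] by blast
  have mem: "Lp_mem \<mu> q (gs n)" "Lp_mem \<mu> p (fs n)" for n using r by (auto simp: ptensor_iff)
  have le: "cmod (pairing \<mu> (gs n) (T (fs n))) \<le> C * (Lp_norm \<mu> q (gs n) * Lp_norm \<mu> p (fs n))" for n
  proof -
    have "cmod (pairing \<mu> (gs n) (T (fs n))) \<le> Lp_norm \<mu> q (gs n) * Lp_norm \<mu> p (T (fs n))"
      by (intro Holder_pairing[OF pq] mem bdd_op_mem[OF T])
    also have "\<dots> \<le> Lp_norm \<mu> q (gs n) * (C * Lp_norm \<mu> p (fs n))" by (intro mult_left_mono C mem) simp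
    finally show ?thesis by (simp add: mult_ac)
  qed
  have "summable (\<lambda>n. C * (Lp_norm \<mu> q (gs n) * Lp_norm \<mu> p (fs n)))"
    using r by (intro summable_mult) (simp add: ptensor_iff)
  then show ?thesis by (rule summable_comparison_test[rotated]) (use le in auto)
qed

text \<open>Countable sums of elements of $A_p$: the representing tensors are concatenated along a
  bijection of the index set with pairs.\<close>

lemma Ap_rep_sums:
  assumes rep: "\<And>i. Ap_rep \<mu> p (a i) (gs i) (fs i)"
    and sm: "summable (\<lambda>i. \<Sum>n. Lp_norm \<mu> q (gs i n) * Lp_norm \<mu> p (fs i n))"
    and u: "\<And>s. (\<lambda>i. a i s) sums u s"
  defines "G \<equiv> \<lambda>n. gs (fst (prod_decode n)) (snd (prod_decode n))"
    and "F \<equiv> \<lambda>n. fs (fst (prod_decode n)) (snd (prod_decode n))"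
  shows "Ap_rep \<mu> p u G F"
    and "Lp_bdd_op \<mu> p T \<Longrightarrow> (\<lambda>i. tfun \<mu> (gs i) (fs i) T) sums tfun \<mu> G F T"
proof -
  have mem: "Lp_mem \<mu> q (gs i n)" "Lp_mem \<mu> p (fs i n)" for i n using rep[of i] by (auto simp: Ap_rep_iff)
  have s: "(\<lambda>n. Lp_norm \<mu> q (gs i n) * Lp_norm \<mu> p (fs i n)) sums (\<Sum>n. Lp_norm \<mu> q (gs i n) * Lp_norm \<mu> p (fs i n))" for i
    using rep[of i] by (intro summable_sums) (simp add: Ap_rep_iff)
  note S = summable_sums[OF sm]
  show "Ap_rep \<mu> p u G F"
    unfolding Ap_rep_iff
  proof (intro conjI allI)
    fix n show "Lp_mem \<mu> q (G n)" "Lp_mem \<mu> p (F n)" by (auto simp: G_def F_def mem)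
  next
    show "summable (\<lambda>n. Lp_norm \<mu> q (G n) * Lp_norm \<mu> p (F n))"
      unfolding G_def F_def
      by (rule sums_summable[OF double_series(3)[where f = "\<lambda>i n. Lp_norm \<mu> q (gs i n) * Lp_norm \<mu> p (fs i n)", OF _ s S]]) simp
  next
    fix z
    have "(\<lambda>n. Lam (G n) (F n) z) sums (\<Sum>i. \<Sum>n. Lam (gs i n) (fs i n) z)"
      unfolding G_def F_def
      by (rule double_series(1)[where f = "\<lambda>i n. Lam (gs i n) (fs i n) z", OF _ s S]) (intro Lam_bound mem)
    also have "(\<Sum>i. \<Sum>n. Lam (gs i n) (fs i n) z) = u z"
      unfolding Ap_rep_eq[OF rep, symmetric] using u by (simp add: sums_iff)
    finally show "u z = (\<Sum>n. Lam (G n) (F n) z)" by (simp add: sums_iff)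
  qed
  assume T: "Lp_bdd_op \<mu> p T"
  obtain C where C: "0 \<le> C" "\<And>f. Lp_mem \<mu> p f \<Longrightarrow> Lp_norm \<mu> p (T f) \<le> C * Lp_norm \<mu> p f"
    using bdd_op_bound[OF T] by blast
  have le: "cmod (pairing \<mu> (gs i n) (T (fs i n))) \<le> C * (Lp_norm \<mu> q (gs i n) * Lp_norm \<mu> p (fs i n))" for i n
  proof -
    have "cmod (pairing \<mu> (gs i n) (T (fs i n))) \<le> Lp_norm \<mu> q (gs i n) * Lp_norm \<mu> p (T (fs i n))"
      by (intro Holder_pairing[OF pq] mem bdd_op_mem[OF T])
    also have "\<dots> \<le> Lp_norm \<mu> q (gs i n) * (C * Lp_norm \<mu> p (fs i n))" by (intro mult_left_mono C mem) simp
    finally show ?thesis by (simp add: mult_ac)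
  qed
  note ds = double_series[where f = "\<lambda>i n. pairing \<mu> (gs i n) (T (fs i n))", OF le sums_mult[OF s] sums_mult[OF S]]
  have "tfun \<mu> G F T = (\<Sum>i. tfun \<mu> (gs i) (fs i) T)"
    using sums_unique[OF ds(1)] by (simp add: tfun_def G_def F_def)
  then show "(\<lambda>i. tfun \<mu> (gs i) (fs i) T) sums tfun \<mu> G F T"
    using summable_sums[OF ds(4)] by (simp add: tfun_def)
qed

lemma Ap_mult_const: "Ap_rep \<mu> p u gs fs \<Longrightarrow> Ap_rep \<mu> p (\<lambda>s. c * u s) (\<lambda>n x. c * gs n x) fs"
proof -
  assume r: "Ap_rep \<mu> p u gs fs"
  have L: "Lam (\<lambda>x. c * g x) f s = c * Lam g f s" for g f s by (simp add: Lam_def pairing_def mult.assoc)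
  have "c * u s = (\<Sum>n. c * Lam (gs n) (fs n) s)" for s
    unfolding Ap_rep_eq[OF r] by (intro suminf_mult[symmetric] summable_norm_cancel[OF summable_Lam[OF Ap_rep_ptensor[OF r]]])
  moreover have "summable (\<lambda>n. Lp_norm \<mu> q (\<lambda>x. c * gs n x) * Lp_norm \<mu> p (fs n))"
    using r p1 summable_mult[of "\<lambda>n. Lp_norm \<mu> q (gs n) * Lp_norm \<mu> p (fs n)" "cmod c"]
    by (simp add: Ap_rep_iff Lp_norm_cmult mult.assoc)
  ultimately show ?thesis using r by (simp add: Ap_rep_iff L Lp_mem_cmult)
qed

text \<open>u + c v is treated as a countable sum with two nonzero terms, so that the concatenation
  of tensors yields both membership and additivity of the pairing.\<close>

lemma pm_pair_linear:
  assumes T: "T \<in> PMp \<mu> p" and u: "u \<in> Ap \<mu> p" and v: "v \<in> Ap \<mu> p"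
  shows "(\<lambda>s. u s + c * v s) \<in> Ap \<mu> p"
    and "pm_pair \<mu> p T (\<lambda>s. u s + c * v s) = pm_pair \<mu> p T u + c * pm_pair \<mu> p T v"
proof -
  obtain gs fs where r: "Ap_rep \<mu> p u gs fs" using u by (auto simp: Ap_def)
  obtain gs' fs' where r': "Ap_rep \<mu> p v gs' fs'" using v by (auto simp: Ap_def)
  note rc = Ap_mult_const[OF r', of c]
  have z: "Ap_rep \<mu> p (\<lambda>s. 0) (\<lambda>n x. 0) (\<lambda>n x. 0)" by (simp add: Ap_rep_iff Lam_def pairing_def)
  \<comment> \<open>All terms from index 2 on are zero.\<close>
  define a where "a i = (case i of 0 \<Rightarrow> u | Suc 0 \<Rightarrow> (\<lambda>s. c * v s) | _ \<Rightarrow> (\<lambda>s. 0))" for i :: nat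
  define G where "G i = (case i of 0 \<Rightarrow> gs | Suc 0 \<Rightarrow> (\<lambda>n x. c * gs' n x) | _ \<Rightarrow> (\<lambda>n x. 0))" for i :: nat
  define F where "F i = (case i of 0 \<Rightarrow> fs | Suc 0 \<Rightarrow> fs' | _ \<Rightarrow> (\<lambda>n x. 0))" for i :: nat
  have rep: "Ap_rep \<mu> p (a i) (G i) (F i)" for i
    unfolding a_def G_def F_def using r rc z by (auto split: nat.splits)
  have fin2: "f sums (f 0 + f 1)" if "\<And>i. i \<ge> 2 \<Longrightarrow> f i = 0" for f :: "nat \<Rightarrow> 'z::{comm_monoid_add, t2_space}"
  proof -
    have "f sums sum f {..<2}" by (rule sums_finite) (use that in auto)
    then show ?thesis by (simp add: numeral_2_eq_2)
  qed
  have sm: "summable (\<lambda>i. \<Sum>n. Lp_norm \<mu> q (G i n) * Lp_norm \<mu> p (F i n))"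
    by (rule sums_summable[OF fin2]) (auto simp: G_def F_def split: nat.splits)
  have su: "(\<lambda>i. a i s) sums (u s + c * v s)" for s
  proof -
    have "(\<lambda>i. a i s) sums (a 0 s + a 1 s)" by (rule fin2) (auto simp: a_def split: nat.splits)
    then show ?thesis by (simp add: a_def)
  qed
  note R = Ap_rep_sums[OF rep sm su]
  show "(\<lambda>s. u s + c * v s) \<in> Ap \<mu> p" using R(1) by (auto simp: Ap_def)
  have "(\<lambda>i. tfun \<mu> (G i) (F i) T) sums (tfun \<mu> (G 0) (F 0) T + tfun \<mu> (G 1) (F 1) T)"
    by (rule fin2) (auto simp: G_def F_def tfun_def pairing_def split: nat.splits)
  with R(2)[OF PMp_bdd[OF T]]
  have "tfun \<mu> (\<lambda>n. G (fst (prod_decode n)) (snd (prod_decode n))) (\<lambda>n. F (fst (prod_decode n)) (snd (prod_decode n))) T = tfun \<mu> (G 0) (F 0) T + tfun \<mu> (G 1) (F 1) T"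
    by (rule sums_unique2)
  moreover have "tfun \<mu> (G 1) (F 1) T = c * tfun \<mu> gs' fs' T"
  proof -
    have "summable (\<lambda>n. norm (pairing \<mu> (gs' n) (T (fs' n))))"
      by (rule summable_tfun[OF PMp_bdd[OF T] Ap_rep_ptensor[OF r']])
    then have "(\<Sum>n. c * pairing \<mu> (gs' n) (T (fs' n))) = c * tfun \<mu> gs' fs' T"
      unfolding tfun_def by (rule suminf_mult[OF summable_norm_cancel])
    then show ?thesis by (simp add: tfun_def G_def F_def pairing_def mult.assoc)
  qed
  ultimately show "pm_pair \<mu> p T (\<lambda>s. u s + c * v s) = pm_pair \<mu> p T u + c * pm_pair \<mu> p T v"
    unfolding pm_pair_eq[OF T R(1)] pm_pair_eq[OF T r] pm_pair_eq[OF T r'] by (simp add: G_def F_def)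
qed

lemma Ap_rep_single:
  assumes "Lp_mem \<mu> q g" "Lp_mem \<mu> p f"
  shows "Ap_rep \<mu> p (Lam g f) (\<lambda>n. if n = 0 then g else (\<lambda>x. 0)) (\<lambda>n. if n = 0 then f else (\<lambda>x. 0))"
    and "tfun \<mu> (\<lambda>n. if n = 0 then g else (\<lambda>x. 0)) (\<lambda>n. if n = 0 then f else (\<lambda>x. 0)) T = pairing \<mu> g (T f)"
proof -
  have s: "h sums h 0" if "\<And>i. i \<noteq> 0 \<Longrightarrow> h i = 0" for h :: "nat \<Rightarrow> 'z::{comm_monoid_add, t2_space}"
    using sums_finite[of "{0}" h] that by simp
  have a: "(\<lambda>n. Lp_norm \<mu> q (if n = 0 then g else (\<lambda>x. 0)) * Lp_norm \<mu> p (if n = 0 then f else (\<lambda>x. 0))) sums (Lp_norm \<mu> q g * Lp_norm \<mu> p f)"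
    using s[of "\<lambda>n. Lp_norm \<mu> q (if n = 0 then g else (\<lambda>x. 0)) * Lp_norm \<mu> p (if n = 0 then f else (\<lambda>x. 0))"] by simp
  have b: "(\<lambda>n. Lam (if n = 0 then g else (\<lambda>x. 0)) (if n = 0 then f else (\<lambda>x. 0)) z) sums Lam g f z" for z
    using s[of "\<lambda>n. Lam (if n = 0 then g else (\<lambda>x. 0)) (if n = 0 then f else (\<lambda>x. 0)) z"] by (simp add: Lam_def pairing_def)
  show "Ap_rep \<mu> p (Lam g f) (\<lambda>n. if n = 0 then g else (\<lambda>x. 0)) (\<lambda>n. if n = 0 then f else (\<lambda>x. 0))"
    using assms sums_summable[OF a] sums_unique[OF b] by (simp add: Ap_rep_iff)
  show "tfun \<mu> (\<lambda>n. if n = 0 then g else (\<lambda>x. 0)) (\<lambda>n. if n = 0 then f else (\<lambda>x. 0)) T = pairing \<mu> g (T f)"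
    using s[of "\<lambda>n. pairing \<mu> (if n = 0 then g else (\<lambda>x. 0)) (T (if n = 0 then f else (\<lambda>x. 0)))"]
    by (simp add: tfun_def pairing_def sums_iff)
qed

lemma Lam_in_Ap: "Lp_mem \<mu> q g \<Longrightarrow> Lp_mem \<mu> p f \<Longrightarrow> Lam g f \<in> Ap \<mu> p"
  using Ap_rep_single(1) by (auto simp: Ap_def)

section \<open>Matrices of coefficient functions with a common expansion\<close>

text \<open>All entries w k l are expanded by the same vectors G n and F n, only their components
  varying. The cost x is measured by the norms of whole vectors, so it is the projective cost on the
  m-fold spaces and not a sum over entries.\<close>

definition REP_by :: "nat \<Rightarrow> (nat \<Rightarrow> nat \<Rightarrow> 'g \<Rightarrow> complex) \<Rightarrow> real \<Rightarrow>
    (nat \<Rightarrow> nat \<Rightarrow> 'g \<Rightarrow> complex) \<Rightarrow> (nat \<Rightarrow> nat \<Rightarrow> 'g \<Rightarrow> complex) \<Rightarrow> bool" where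
  "REP_by m w x G F \<longleftrightarrow> (\<forall>n. \<forall>k<m. Lp_mem \<mu> q (G n k) \<and> Lp_mem \<mu> p (F n k)) \<and>
     summable (\<lambda>n. vec_norm \<mu> q m (G n) * vec_norm \<mu> p m (F n)) \<and>
     (\<Sum>n. vec_norm \<mu> q m (G n) * vec_norm \<mu> p m (F n)) \<le> x \<and>
     (\<forall>k<m. \<forall>l<m. \<forall>s. (\<lambda>n. Lam (G n k) (F n l) s) sums w k l s)"

definition REP :: "nat \<Rightarrow> (nat \<Rightarrow> nat \<Rightarrow> 'g \<Rightarrow> complex) \<Rightarrow> real \<Rightarrow> bool" where
  "REP m w x \<longleftrightarrow> (\<exists>G F. REP_by m w x G F)"

lemma REP_byD:
  assumes "REP_by m w x G F"
  shows "\<And>n k. k < m \<Longrightarrow> Lp_mem \<mu> q (G n k) \<and> Lp_mem \<mu> p (F n k)"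
    "summable (\<lambda>n. vec_norm \<mu> q m (G n) * vec_norm \<mu> p m (F n))"
    "(\<Sum>n. vec_norm \<mu> q m (G n) * vec_norm \<mu> p m (F n)) \<le> x"
    "\<And>k l s. k < m \<Longrightarrow> l < m \<Longrightarrow> (\<lambda>n. Lam (G n k) (F n l) s) sums w k l s"
  using assms by (auto simp: REP_by_def)

lemma REP_mono: "REP m w x \<Longrightarrow> x \<le> y \<Longrightarrow> REP m w y"
  unfolding REP_def REP_by_def by (elim exE conjE, intro exI conjI; (assumption | erule (1) order_trans))

lemma vec_prod_bound:
  assumes "k < m" "l < m"
  shows "Lp_norm \<mu> q (g k) * Lp_norm \<mu> p (f l) \<le> vec_norm \<mu> q m g * vec_norm \<mu> p m f"
  using assms p1 by (intro mult_mono Lp_norm_le_vec_norm) auto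

text \<open>The expansions of the summands are concatenated along pairs of indices; each entry
  converges absolutely because its norms are dominated by the vector norms.\<close>

lemma REP_sums:
  assumes rep: "\<And>i. REP m (u i) (x i)" and x: "summable x"
    and w: "\<And>k l s. k < m \<Longrightarrow> l < m \<Longrightarrow> (\<lambda>i. u i k l s) sums w k l s"
  shows "REP m w (suminf x)"
proof -
  obtain G F where "\<And>i. REP_by m (u i) (x i) (G i) (F i)"
    using rep unfolding REP_def by metis
  note GF = REP_byD[OF this]
  define A where "A i = (\<Sum>n. vec_norm \<mu> q m (G i n) * vec_norm \<mu> p m (F i n))" for i
  have A0: "0 \<le> A i" for i unfolding A_def by (intro suminf_nonneg GF) simp
  have sA: "summable A" by (rule summable_comparison_test[OF _ x]) (use A0 GF(3) in \<open>auto simp: A_def\<close>)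
  have s: "(\<lambda>n. vec_norm \<mu> q m (G i n) * vec_norm \<mu> p m (F i n)) sums A i" for i
    unfolding A_def by (intro summable_sums GF)
  note S = summable_sums[OF sA]
  have a: "(\<lambda>n. vec_norm \<mu> q m (G (fst (prod_decode n)) (snd (prod_decode n))) * vec_norm \<mu> p m (F (fst (prod_decode n)) (snd (prod_decode n)))) sums suminf A"
    by (rule double_series(3)[where f = "\<lambda>i n. vec_norm \<mu> q m (G i n) * vec_norm \<mu> p m (F i n)", OF _ s S]) simp
  have "suminf A \<le> suminf x" by (rule suminf_le[OF _ sA x]) (use GF(3) in \<open>auto simp: A_def\<close>)
  moreover have "(\<lambda>n. Lam (G (fst (prod_decode n)) (snd (prod_decode n)) k) (F (fst (prod_decode n)) (snd (prod_decode n)) l) z) sums w k l z"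
    if kl: "k < m" "l < m" for k l z
  proof -
    have "(\<lambda>n. Lam (G (fst (prod_decode n)) (snd (prod_decode n)) k) (F (fst (prod_decode n)) (snd (prod_decode n)) l) z) sums (\<Sum>i. \<Sum>n. Lam (G i n k) (F i n l) z)"
    proof (rule double_series(1)[where f = "\<lambda>i n. Lam (G i n k) (F i n l) z", OF _ s S])
      fix i j
      have "cmod (Lam (G i j k) (F i j l) z) \<le> Lp_norm \<mu> q (G i j k) * Lp_norm \<mu> p (F i j l)"
        using GF(1) kl by (intro Lam_bound) auto
      also have "\<dots> \<le> vec_norm \<mu> q m (G i j) * vec_norm \<mu> p m (F i j)" by (rule vec_prod_bound[OF kl])
      finally show "cmod (Lam (G i j k) (F i j l) z) \<le> vec_norm \<mu> q m (G i j) * vec_norm \<mu> p m (F i j)" .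
    qed
    also have "(\<Sum>i. \<Sum>n. Lam (G i n k) (F i n l) z) = w k l z"
      using GF(4)[OF kl] w[OF kl] by (simp add: sums_iff)
    finally show ?thesis .
  qed
  ultimately show ?thesis unfolding REP_def REP_by_def
    apply -
    apply (rule exI[of _ "\<lambda>n. G (fst (prod_decode n)) (snd (prod_decode n))"])
    apply (rule exI[of _ "\<lambda>n. F (fst (prod_decode n)) (snd (prod_decode n))"])
    using GF(1) a by (auto simp: sums_iff)
qed

lemma REP_list:
  assumes mem: "\<And>g f k. (g, f) \<in> set ps \<Longrightarrow> k < m \<Longrightarrow> Lp_mem \<mu> q (g k) \<and> Lp_mem \<mu> p (f k)"
    and x: "(\<Sum>(g, f)\<leftarrow>ps. vec_norm \<mu> q m g * vec_norm \<mu> p m f) \<le> x"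
    and w: "\<And>k l s. k < m \<Longrightarrow> l < m \<Longrightarrow> w k l s = (\<Sum>(g, f)\<leftarrow>ps. Lam (g k) (f l) s)"
  shows "REP m w x"
proof -
  define z where "z n = (if n < length ps then ps ! n else ((\<lambda>k x. 0), (\<lambda>k x. 0)))" for n
  have s: "(\<lambda>n. h (z n)) sums (\<Sum>y\<leftarrow>ps. h y)" if "h ((\<lambda>k x. 0), (\<lambda>k x. 0)) = 0" for h :: "_ \<Rightarrow> 'z::{comm_monoid_add, t2_space}"
  proof -
    have "(\<lambda>n. h (z n)) sums (\<Sum>n<length ps. h (z n))"
      by (rule sums_finite) (use that in \<open>auto simp: z_def\<close>)
    also have "(\<Sum>n<length ps. h (z n)) = (\<Sum>y\<leftarrow>ps. h y)"
      by (simp add: z_def sum_list_sum_nth atLeast0LessThan)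
    finally show ?thesis .
  qed
  have a: "(\<lambda>n. vec_norm \<mu> q m (fst (z n)) * vec_norm \<mu> p m (snd (z n))) sums (\<Sum>(g, f)\<leftarrow>ps. vec_norm \<mu> q m g * vec_norm \<mu> p m f)"
    using s[of "\<lambda>y. vec_norm \<mu> q m (fst y) * vec_norm \<mu> p m (snd y)"] by (simp add: split_def vec_norm_def)
  show ?thesis unfolding REP_def REP_by_def
  proof (rule exI[of _ "\<lambda>n. fst (z n)"], rule exI[of _ "\<lambda>n. snd (z n)"], intro conjI allI impI)
    fix n k assume "k < m"
    then show "Lp_mem \<mu> q (fst (z n) k)" "Lp_mem \<mu> p (snd (z n) k)"
      using mem[of "fst (ps ! n)" "snd (ps ! n)" k] by (auto simp: z_def)
  next
    fix k l y assume kl: "k < m" "l < m"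
    show "(\<lambda>n. Lam (fst (z n) k) (snd (z n) l) y) sums w k l y"
      using s[of "\<lambda>a. Lam (fst a k) (snd a l) y"] by (simp add: w[OF kl] split_def Lam_def pairing_def)
  qed (use a x in \<open>auto simp: sums_iff\<close>)
qed

text \<open>The use of a common expansion: each of its terms is a pair of vectors on which the whole
  matrix T acts contractively, so the total pairing is at most the cost.\<close>

lemma REP_pm_pair_bound:
  assumes rep: "REP m w x" and T: "\<And>k l. k < m \<Longrightarrow> l < m \<Longrightarrow> T k l \<in> PMp \<mu> p"
    and bd: "\<And>g f. (\<And>k. k < m \<Longrightarrow> Lp_mem \<mu> q (g k) \<and> Lp_mem \<mu> p (f k)) \<Longrightarrow>
      cmod (\<Sum>k<m. \<Sum>l<m. pairing \<mu> (g k) (T k l (f l))) \<le> vec_norm \<mu> q m g * vec_norm \<mu> p m f"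
  shows "cmod (\<Sum>k<m. \<Sum>l<m. pm_pair \<mu> p (T k l) (w k l)) \<le> x"
proof -
  obtain G F where "REP_by m w x G F" using rep unfolding REP_def by blast
  note GF = REP_byD[OF this]
  have s: "(\<lambda>n. pairing \<mu> (G n k) (T k l (F n l))) sums pm_pair \<mu> p (T k l) (w k l)" if kl: "k < m" "l < m" for k l
  proof -
    have sm: "summable (\<lambda>n. Lp_norm \<mu> q (G n k) * Lp_norm \<mu> p (F n l))"
      by (rule summable_comparison_test[OF _ GF(2)]) (use vec_prod_bound[OF kl] in auto)
    then have r: "Ap_rep \<mu> p (w k l) (\<lambda>n. G n k) (\<lambda>n. F n l)"
      using GF(1,4) kl by (auto simp: Ap_rep_iff sums_iff)
    note Tb = PMp_bdd[OF T[OF kl]]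
    have "summable (\<lambda>n. pairing \<mu> (G n k) (T k l (F n l)))"
      by (rule summable_norm_cancel[OF summable_tfun[OF Tb Ap_rep_ptensor[OF r]]])
    then show ?thesis unfolding pm_pair_eq[OF T[OF kl] r] tfun_def by (rule summable_sums)
  qed
  have S: "(\<lambda>n. \<Sum>k<m. \<Sum>l<m. pairing \<mu> (G n k) (T k l (F n l))) sums (\<Sum>k<m. \<Sum>l<m. pm_pair \<mu> p (T k l) (w k l))"
    by (intro sums_sum s) auto
  have le: "cmod (\<Sum>k<m. \<Sum>l<m. pairing \<mu> (G n k) (T k l (F n l))) \<le> vec_norm \<mu> q m (G n) * vec_norm \<mu> p m (F n)" for n
    using GF(1) by (intro bd) auto
  have sn: "summable (\<lambda>n. cmod (\<Sum>k<m. \<Sum>l<m. pairing \<mu> (G n k) (T k l (F n l))))"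
    by (rule summable_comparison_test[OF _ GF(2)]) (use le in auto)
  have "cmod (\<Sum>k<m. \<Sum>l<m. pm_pair \<mu> p (T k l) (w k l)) \<le> (\<Sum>n. cmod (\<Sum>k<m. \<Sum>l<m. pairing \<mu> (G n k) (T k l (F n l))))"
    using summable_norm[OF sn] S by (simp add: sums_iff)
  also have "\<dots> \<le> (\<Sum>n. vec_norm \<mu> q m (G n) * vec_norm \<mu> p m (F n))" by (rule suminf_le[OF le sn GF(2)])
  also note GF(3)
  finally show ?thesis .
qed

end

section \<open>Finite partitions adapted to a continuous kernel\<close>

text \<open>Overlapping sets are made disjoint by letting each newly added set override the earlier
  labels with a new one. The label 0 is reserved for points outside the union.\<close>

lemma label_list:
  assumes "\<forall>d\<in>set ds. V d \<in> sets M"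
  shows "\<exists>F :: 'a \<Rightarrow> nat. F \<in> measurable M (count_space UNIV) \<and> range F \<subseteq> {..length ds} \<and>
    (\<forall>r. 0 < F r \<longleftrightarrow> r \<in> (\<Union>d\<in>set ds. V d)) \<and>
    (\<forall>r r'. F r = F r' \<and> 0 < F r \<longrightarrow> (\<exists>d\<in>set ds. r \<in> V d \<and> r' \<in> V d))"
  using assms
proof (induction ds)
  case Nil
  show ?case by (rule exI[of _ "\<lambda>_. 0"]) auto
next
  case (Cons d ds)
  have "\<forall>d\<in>set ds. V d \<in> sets M" using Cons.prems by simp
  from Cons.IH[OF this] obtain F :: "'a \<Rightarrow> nat" where F: "F \<in> measurable M (count_space UNIV)" "range F \<subseteq> {..length ds}"
    "\<forall>r. 0 < F r \<longleftrightarrow> r \<in> (\<Union>d\<in>set ds. V d)"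
    "\<forall>r r'. F r = F r' \<and> 0 < F r \<longrightarrow> (\<exists>d\<in>set ds. r \<in> V d \<and> r' \<in> V d)" by (elim exE conjE)
  define F' where "F' r = (if r \<in> V d then Suc (length ds) else F r)" for r
  have le: "F r \<le> length ds" for r using F(2) by auto
  have Vd: "{x \<in> space M. x \<in> V d} \<in> sets M"
  proof -
    have "V d \<in> sets M" using Cons.prems by simp
    then have "space M \<inter> V d \<in> sets M" by (rule sets.Int[OF sets.top])
    then show ?thesis by (simp add: Int_def)
  qed
  show ?case
  proof (intro exI[of _ F'] conjI allI impI)
    show "F' \<in> measurable M (count_space UNIV)"
      unfolding F'_def using F(1) Vd by (intro measurable_If) auto
    show "range F' \<subseteq> {..length (d # ds)}" using le by (auto simp: F'_def le_SucI)
    show "0 < F' r \<longleftrightarrow> r \<in> (\<Union>d\<in>set (d # ds). V d)" for r using F(3) by (auto simp: F'_def)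
    fix r r' assume e: "F' r = F' r' \<and> 0 < F' r"
    show "\<exists>d\<in>set (d # ds). r \<in> V d \<and> r' \<in> V d"
    proof (cases "r \<in> V d \<or> r' \<in> V d")
      case True
      then have "r \<in> V d \<and> r' \<in> V d" using e le[of r] le[of r'] by (auto simp: F'_def split: if_splits)
      then show ?thesis by auto
    next
      case False
      then have "F r = F r' \<and> 0 < F r" using e by (simp add: F'_def)
      then show ?thesis using F(4) by auto
    qed
  qed
qed

text \<open>By the tube lemma each point has a neighbourhood on which the kernel varies by less than
  e/2 uniformly for t in K; finitely many of these cover K.\<close>

lemma partition_label:
  fixes \<Phi> :: "'a::t2_space \<times> 'a \<Rightarrow> complex"
  assumes K: "compact K" and \<Phi>: "continuous_on UNIV \<Phi>" and e: "0 < e"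
  obtains h :: "'a \<Rightarrow> nat" where "h \<in> measurable borel (count_space UNIV)" "finite (range h)"
    "\<And>r r'. h r = h r' \<Longrightarrow> r \<in> K \<longleftrightarrow> r' \<in> K"
    "\<And>r r' t. h r = h r' \<Longrightarrow> r \<in> K \<Longrightarrow> t \<in> K \<Longrightarrow> cmod (\<Phi> (t, r) - \<Phi> (t, r')) \<le> e"
proof -
  have "\<exists>V. r0 \<in> V \<and> open V \<and> V \<times> K \<subseteq> {z. cmod (\<Phi> (snd z, fst z) - \<Phi> (snd z, r0)) < e/2}" for r0
  proof (rule Elementary_Topology.tube_lemma[OF K])
    have "continuous_on UNIV (\<lambda>z. \<Phi> (snd z, fst z))" "continuous_on UNIV (\<lambda>z::'a \<times> 'a. \<Phi> (snd z, r0))"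
      by (rule continuous_on_compose2[OF \<Phi>]; auto intro!: continuous_intros)+
    then show "open {z. cmod (\<Phi> (snd z, fst z) - \<Phi> (snd z, r0)) < e/2}"
      by (intro open_Collect_less continuous_intros)
  qed (use e in auto)
  then have "\<exists>V. \<forall>r0. r0 \<in> V r0 \<and> open (V r0) \<and> V r0 \<times> K \<subseteq> {z. cmod (\<Phi> (snd z, fst z) - \<Phi> (snd z, r0)) < e/2}"
    by (intro choice allI)
  then obtain V where V': "\<forall>r0. r0 \<in> V r0 \<and> open (V r0) \<and> V r0 \<times> K \<subseteq> {z. cmod (\<Phi> (snd z, fst z) - \<Phi> (snd z, r0)) < e/2}" ..
  have V: "r0 \<in> V r0" "open (V r0)" "V r0 \<times> K \<subseteq> {z. cmod (\<Phi> (snd z, fst z) - \<Phi> (snd z, r0)) < e/2}" for r0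
    using V'[rule_format, of r0] by auto
  obtain D where D: "D \<subseteq> K" "finite D" "K \<subseteq> (\<Union>d\<in>D. V d)"
    by (rule compactE_image[OF K, of K V]) (use V in auto)
  obtain ds where ds: "set ds = D" using finite_list[OF D(2)] by blast
  obtain F :: "'a \<Rightarrow> nat" where F: "F \<in> measurable borel (count_space UNIV)" "range F \<subseteq> {..length ds}"
    "\<forall>r. 0 < F r \<longleftrightarrow> r \<in> (\<Union>d\<in>set ds. V d)"
    "\<forall>r r'. F r = F r' \<and> 0 < F r \<longrightarrow> (\<exists>d\<in>set ds. r \<in> V d \<and> r' \<in> V d)"
    using label_list[of ds V borel] V(2) by auto
  \<comment> \<open>The complement of K becomes a single cell with label 0, so that cells respect
    K.\<close>
  define h where "h r = (if r \<in> K then F r else 0)" for r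
  have pos: "0 < h r \<longleftrightarrow> r \<in> K" for r using F(3) D(3) ds by (auto simp: h_def)
  show ?thesis
  proof
    have "K \<in> sets borel" using K by (intro borel_closed compact_imp_closed)
    then show "h \<in> measurable borel (count_space UNIV)"
      unfolding h_def using F(1) by (intro measurable_If) auto
    have "range h \<subseteq> {..length ds}" using F(2) by (auto simp: h_def)
    then show "finite (range h)" by (rule finite_subset) simp
    show K': "r \<in> K \<longleftrightarrow> r' \<in> K" if "h r = h r'" for r r' using pos[of r] pos[of r'] that by simp
    fix r r' t assume r: "h r = h r'" "r \<in> K" "t \<in> K"
    then have "F r = F r' \<and> 0 < F r" using K'[OF r(1)] pos[of r] by (simp add: h_def)
    then obtain d where d: "r \<in> V d" "r' \<in> V d" using F(4) by blast
    have "cmod (\<Phi> (t, r) - \<Phi> (t, d)) < e/2" "cmod (\<Phi> (t, r') - \<Phi> (t, d)) < e/2"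
      using V(3)[of d] d r(3) by auto
    then show "cmod (\<Phi> (t, r) - \<Phi> (t, r')) \<le> e"
      using norm_triangle_ineq4[of "\<Phi> (t, r) - \<Phi> (t, d)" "\<Phi> (t, r') - \<Phi> (t, d)"] by simp
  qed
qed

section \<open>Regularity of Haar measure and splitting into compact supports\<close>

context haar_group
begin

lemma compact_sets: "compact K \<Longrightarrow> K \<in> sets borel" for K :: "'g set"
  by (intro borel_closed compact_imp_closed)

lemma Compl_sets: "A \<in> sets \<mu> \<Longrightarrow> - A \<in> sets \<mu>"
  using sets.compl_sets[of A \<mu>] by (simp add: Compl_eq_Diff_UNIV)

lemma compact_finite: "compact K \<Longrightarrow> emeasure \<mu> K < \<infinity>"
  using haar by (simp add: left_haar_measure_def)

lemma open_superset_approx: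
  assumes A: "A \<in> sets borel" "emeasure \<mu> A < \<infinity>" and e: "0 < e"
  shows "\<exists>U. open U \<and> A \<subseteq> U \<and> emeasure \<mu> U < \<infinity> \<and> measure \<mu> U < measure \<mu> A + e"
proof -
  have outer: "emeasure \<mu> A = (INF U\<in>{U. open U \<and> A \<subseteq> U}. emeasure \<mu> U)"
    using haar A(1) unfolding left_haar_measure_def by blast
  have "\<exists>U\<in>{U. open U \<and> A \<subseteq> U}. emeasure \<mu> U < emeasure \<mu> A + ennreal e"
    by (rule INF_approx_ennreal[OF _ outer]) (use A(2) e in auto)
  then obtain U where U: "open U" "A \<subseteq> U" "emeasure \<mu> U < emeasure \<mu> A + ennreal e" by blast
  have fin: "emeasure \<mu> U < \<infinity>"
    using U(3) by (rule order_less_trans) (use A(2) in \<open>simp add: ennreal_add_less_top\<close>)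
  have "ennreal (measure \<mu> U) < ennreal (measure \<mu> A) + ennreal e"
    using U(3) A(2) fin by (simp add: emeasure_eq_ennreal_measure less_top)
  then have "measure \<mu> U < measure \<mu> A + e"
    using e by (simp add: ennreal_plus[symmetric] ennreal_less_iff del: ennreal_plus)
  with U fin show ?thesis by blast
qed

text \<open>Inner regularity is given for open sets only. For A of finite measure, take an open U
  above A, a compact L nearly filling U, and an open W slightly larger than U - A.\<close>

lemma compact_subset_approx:
  assumes A: "A \<in> sets borel" "emeasure \<mu> A < \<infinity>" and e: "0 < e"
  shows "\<exists>K. compact K \<and> K \<subseteq> A \<and> measure \<mu> (A - K) < e"
proof -
  have inner: "emeasure \<mu> U = (SUP K\<in>{K. compact K \<and> K \<subseteq> U}. emeasure \<mu> K)" if "open U" for U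
    using haar that unfolding left_haar_measure_def by blast
  have e2: "0 < e/2" using e by simp
  obtain U where U: "open U" "A \<subseteq> U" "emeasure \<mu> U < \<infinity>" "measure \<mu> U < measure \<mu> A + e/2"
    using open_superset_approx[OF A e2] by blast
  have Ub: "U \<in> sets borel" using U(1) by simp
  note Ufin = U(3)
  have "\<exists>L\<in>{K. compact K \<and> K \<subseteq> U}. emeasure \<mu> U < emeasure \<mu> L + ennreal (e/2)"
    by (rule SUP_approx_ennreal[OF _ _ inner[OF U(1)]]) (use e Ufin in auto)
  then obtain L where L: "compact L" "L \<subseteq> U" "emeasure \<mu> U < emeasure \<mu> L + ennreal (e/2)" by blast
  have "emeasure \<mu> (U - A) < \<infinity>"
    using emeasure_mono[of "U - A" U \<mu>] Ufin Ub by (auto simp: sets_mu intro: le_less_trans)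
  then obtain W where W: "open W" "U - A \<subseteq> W" "emeasure \<mu> W < \<infinity>" "measure \<mu> W < measure \<mu> (U - A) + e/2"
    using open_superset_approx[of "U - A", OF _ _ e2] Ub A(1) by blast
  note Wfin = W(3)
  have fm: "U \<in> fmeasurable \<mu>" "A \<in> fmeasurable \<mu>" "L \<in> fmeasurable \<mu>" "W \<in> fmeasurable \<mu>" "U - A \<in> fmeasurable \<mu>"
    using Ufin A Wfin U W L compact_finite[OF L(1)] compact_sets[OF L(1)] \<open>emeasure \<mu> (U - A) < \<infinity>\<close>
    by (auto simp: fmeasurable_def sets_mu)
  have "ennreal (measure \<mu> U) < ennreal (measure \<mu> L) + ennreal (e/2)"
    using L(3) fm by (simp add: emeasure_eq_measure2)
  then have mL: "measure \<mu> U < measure \<mu> L + e/2"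
    using e by (simp add: ennreal_plus[symmetric] ennreal_less_iff del: ennreal_plus)
  show ?thesis
  \<comment> \<open>Removing W from L discards all of U - A, so the rest lies in A, and it stays
    compact because W is open.\<close>
  proof (intro exI[of _ "L - W"] conjI)
    show "compact (L - W)" by (rule compact_diff[OF L(1) W(1)])
    show "L - W \<subseteq> A" using L(2) W(2) by auto
    have "measure \<mu> (A - (L - W)) \<le> measure \<mu> ((U - L) \<union> (W - (U - A)))"
      by (rule measure_mono_fmeasurable) (use U(2) fm in \<open>auto simp: fmeasurableD\<close>)
    also have "\<dots> \<le> measure \<mu> (U - L) + measure \<mu> (W - (U - A))"
      by (rule measure_Un_le) (use fm in auto)
    also have "measure \<mu> (U - L) = measure \<mu> U - measure \<mu> L"
      by (rule measurable_measure_Diff) (use fm L(2) in auto)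
    also have "measure \<mu> (W - (U - A)) = measure \<mu> W - measure \<mu> (U - A)"
      by (rule measurable_measure_Diff) (use fm W(2) in auto)
    finally show "measure \<mu> (A - (L - W)) < e" using mL W(4) by linarith
  qed
qed

text \<open>The level sets where \<phi> lies between 1/(n+1) and n+1 have finite measure by Markov
  and carry almost all of the integral; on such a set \<phi> is bounded, so a compact subset of
  nearly full measure suffices.\<close>

lemma integrable_tight:
  fixes \<phi> :: "'g \<Rightarrow> real"
  assumes \<phi>: "integrable \<mu> \<phi>" "\<And>x. 0 \<le> \<phi> x" and e: "0 < e"
  shows "\<exists>K. compact K \<and> (\<integral>x. indicator (- K) x * \<phi> x \<partial>\<mu>) \<le> e"
proof -
  note [measurable] = borel_measurable_integrable[OF \<phi>(1)]
  define A where "A n = {x. 1 / real (Suc n) \<le> \<phi> x \<and> \<phi> x \<le> real (Suc n)}" for n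
  have A_sets: "A n \<in> sets \<mu>" for n
  proof -
    have "A n = {x \<in> space \<mu>. 1 / real (Suc n) \<le> \<phi> x \<and> \<phi> x \<le> real (Suc n)}" by (simp add: A_def)
    also have "\<dots> \<in> sets \<mu>" by measurable
    finally show ?thesis .
  qed
  note [measurable] = A_sets
  have "(\<lambda>n. \<integral>x. indicator (- A n) x * \<phi> x \<partial>\<mu>) \<longlonglongrightarrow> (\<integral>x. 0 \<partial>\<mu>)"
  proof (rule integral_dominated_convergence[where w = \<phi>])
    show "AE x in \<mu>. (\<lambda>n. indicator (- A n) x * \<phi> x) \<longlonglongrightarrow> 0"
    proof (rule AE_I2)
      fix x
      show "(\<lambda>n. indicator (- A n) x * \<phi> x) \<longlonglongrightarrow> 0"
      proof (cases "\<phi> x = 0")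
        case False
        then have pos: "0 < \<phi> x" using \<phi>(2)[of x] by linarith
        obtain N :: nat where N: "max (\<phi> x) (1 / \<phi> x) < real N" using reals_Archimedean2 by blast
        have "x \<in> A n" if "n \<ge> N" for n
        proof -
          have b: "\<phi> x < real (Suc n)" "1 / \<phi> x < real (Suc n)" using N that by auto
          then have "1 / real (Suc n) \<le> \<phi> x" using pos by (simp add: field_simps)
          then show ?thesis using b(1) by (simp add: A_def)
        qed
        then have "\<forall>\<^sub>F n in sequentially. indicator (- A n) x * \<phi> x = 0"
          unfolding eventually_sequentially by (intro exI[of _ N]) auto
        then show ?thesis by (rule tendsto_eventually)
      qed simp
    qed
    show "AE x in \<mu>. norm (indicator (- A n) x * \<phi> x) \<le> \<phi> x" for n
      using \<phi>(2) by (auto simp: indicator_def)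
  qed (use \<phi> in auto)
  then have "\<forall>\<^sub>F n in sequentially. (\<integral>x. indicator (- A n) x * \<phi> x \<partial>\<mu>) < e/2"
    using e by (intro order_tendstoD(2)) auto
  then obtain n where n: "(\<integral>x. indicator (- A n) x * \<phi> x \<partial>\<mu>) < e/2"
    by (auto simp: eventually_sequentially)
  have Afin: "emeasure \<mu> (A n) < \<infinity>"
  proof -
    have "emeasure \<mu> (A n) \<le> emeasure \<mu> {x \<in> space \<mu>. 1 / real (Suc n) \<le> \<phi> x}"
      by (rule emeasure_mono) (auto simp: A_def)
    also have "\<dots> \<le> ennreal (1 / (1 / real (Suc n)) * (\<integral>x. \<phi> x \<partial>\<mu>))"
      by (rule integral_Markov_inequality[OF \<phi>(1)]) (use \<phi>(2) in auto)
    finally show ?thesis by (auto intro: le_less_trans)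
  qed
  define B where "B = real (Suc n)"
  have B: "0 < B" by (simp add: B_def)
  obtain K where K: "compact K" "K \<subseteq> A n" "measure \<mu> (A n - K) < e / (2 * B)"
  proof -
    have "A n \<in> sets borel" "0 < e / (2 * B)" using A_sets[of n] e B by (auto simp: sets_mu)
    from compact_subset_approx[OF this(1) Afin this(2)] show ?thesis using that by blast
  qed
  have Ks: "K \<in> sets \<mu>" using compact_sets[OF K(1)] by (simp add: sets_mu)
  have AKfin: "emeasure \<mu> (A n - K) < \<infinity>"
    using emeasure_mono[of "A n - K" "A n" \<mu>] A_sets[of n] Afin by (auto intro: le_less_trans)
  have iAK: "integrable \<mu> (\<lambda>x. B * indicator (A n - K) x)"
    using AKfin Ks A_sets by (intro integrable_mult_right integrable_real_indicator) auto
  have "(\<integral>x. indicator (- K) x * \<phi> x \<partial>\<mu>) \<le> (\<integral>x. indicator (- A n) x * \<phi> x + B * indicator (A n - K) x \<partial>\<mu>)"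
  proof (rule integral_mono)
    show "integrable \<mu> (\<lambda>x. indicator (- K) x * \<phi> x)"
      by (rule Bochner_Integration.integrable_bound[OF \<phi>(1)]) (use Ks \<phi>(2) in \<open>auto simp: indicator_def\<close>)
    have "integrable \<mu> (\<lambda>x. indicator (- A n) x * \<phi> x)"
      by (rule Bochner_Integration.integrable_bound[OF \<phi>(1)]) (use \<phi>(2) in \<open>auto simp: indicator_def\<close>)
    then show "integrable \<mu> (\<lambda>x. indicator (- A n) x * \<phi> x + B * indicator (A n - K) x)" using iAK by simp
    show "indicator (- K) x * \<phi> x \<le> indicator (- A n) x * \<phi> x + B * indicator (A n - K) x" for x
      using \<phi>(2)[of x] K(2) by (auto simp: indicator_def A_def B_def)
  qed
  also have "\<dots> = (\<integral>x. indicator (- A n) x * \<phi> x \<partial>\<mu>) + B * measure \<mu> (A n - K)"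
  proof -
    have "integrable \<mu> (\<lambda>x. indicator (- A n) x * \<phi> x)"
      by (rule Bochner_Integration.integrable_bound[OF \<phi>(1)]) (use \<phi>(2) in \<open>auto simp: indicator_def\<close>)
    then show ?thesis using iAK by simp
  qed
  also have "\<dots> \<le> e/2 + B * (e / (2 * B))" using n K(3) B by (intro add_mono mult_left_mono) auto
  also have "\<dots> = e" using B by simp
  finally show ?thesis using K(1) by blast
qed

lemma vec_norm_indicator_tight:
  assumes r: "1 < r" and f: "\<And>l. l < m \<Longrightarrow> Lp_mem \<mu> r (f l)" and e: "0 < e"
  shows "\<exists>K. compact K \<and> vec_norm \<mu> r m (\<lambda>l x. indicator (- K) x * f l x) \<le> e"
proof -
  have i: "integrable \<mu> (\<lambda>x. cmod (f l x) powr r)" if "l < m" for l using f[OF that] by (simp add: Lp_mem_def)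
  have "integrable \<mu> (\<lambda>x. \<Sum>l<m. cmod (f l x) powr r)" using i by auto
  moreover have "0 < e powr r" using e by simp
  ultimately have "\<exists>K. compact K \<and> (\<integral>x. indicator (- K) x * (\<Sum>l<m. cmod (f l x) powr r) \<partial>\<mu>) \<le> e powr r"
    by (intro integrable_tight) (auto intro: sum_nonneg)
  then obtain K where K: "compact K" "(\<integral>x. indicator (- K) x * (\<Sum>l<m. cmod (f l x) powr r) \<partial>\<mu>) \<le> e powr r"
    by (elim exE conjE)
  have Ks: "K \<in> sets \<mu>" using compact_sets[OF K(1)] by (simp add: sets_mu)
  have "vec_norm \<mu> r m (\<lambda>l x. indicator (- K) x * f l x) powr r = (\<Sum>l<m. \<integral>x. cmod (indicator (- K) x * f l x) powr r \<partial>\<mu>)"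
    using r by (simp add: vec_norm_powr Lp_norm_powr)
  also have "\<dots> = (\<Sum>l<m. \<integral>x. indicator (- K) x * cmod (f l x) powr r \<partial>\<mu>)"
    using r by (intro sum.cong Bochner_Integration.integral_cong) (auto simp: indicator_def)
  also have "\<dots> = (\<integral>x. (\<Sum>l<m. indicator (- K) x * cmod (f l x) powr r) \<partial>\<mu>)"
  proof (rule Bochner_Integration.integral_sum[symmetric])
    fix l assume "l \<in> {..<m}"
    then show "integrable \<mu> (\<lambda>x. indicator (- K) x * cmod (f l x) powr r)"
      by (intro Bochner_Integration.integrable_bound[OF i[of l]]) (use Ks i in \<open>auto simp: indicator_def\<close>)
  qed
  also have "\<dots> \<le> e powr r" using K(2) by (simp add: sum_distrib_left)
  finally have "vec_norm \<mu> r m (\<lambda>l x. indicator (- K) x * f l x) \<le> e"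
    by (rule powr_le_imp_le) (use r e in auto)
  then show ?thesis using K(1) by (intro exI[of _ K] conjI)
qed

text \<open>The main piece is a truncation of f, of norm at most that of f; the corrections between
  successively better truncations have summable small norms. The total norm therefore exceeds that
  of f by no more than e.\<close>

lemma compact_decomposition:
  assumes r: "1 < r" and f: "\<And>l. l < m \<Longrightarrow> Lp_mem \<mu> r (f l)" and e: "0 < e"
  obtains h C where "\<And>j :: nat. compact (C j)" "\<And>j l. l < m \<Longrightarrow> Lp_mem \<mu> r (h j l)"
    "\<And>j l x. x \<notin> C j \<Longrightarrow> h j l x = 0"
    "summable (\<lambda>j. vec_norm \<mu> r m (h j))" "(\<Sum>j. vec_norm \<mu> r m (h j)) \<le> vec_norm \<mu> r m f + e"
    "\<And>l. l < m \<Longrightarrow> (\<lambda>n. Lp_norm \<mu> r (\<lambda>x. (\<Sum>j<n. h j l x) - f l x)) \<longlonglongrightarrow> 0"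
proof -
  \<comment> \<open>The corrections have norms at most \<delta> i + \<delta> (i+1), and these sum to
    3e/4.\<close>
  define \<delta> where "\<delta> j = (e/4) * (1/2) ^ j" for j :: nat
  have d: "0 < \<delta> j" for j using e by (simp add: \<delta>_def)
  have "\<exists>K. compact K \<and> vec_norm \<mu> r m (\<lambda>l x. indicator (- K) x * f l x) \<le> \<delta> j" for j
    by (rule vec_norm_indicator_tight[OF r f d[of j]])
  then have "\<exists>K. \<forall>j. compact (K j) \<and> vec_norm \<mu> r m (\<lambda>l x. indicator (- K j) x * f l x) \<le> \<delta> j"
    by (intro choice allI)
  then obtain K where K': "\<forall>j. compact (K j) \<and> vec_norm \<mu> r m (\<lambda>l x. indicator (- K j) x * f l x) \<le> \<delta> j" ..
  have K: "compact (K j)" "vec_norm \<mu> r m (\<lambda>l x. indicator (- K j) x * f l x) \<le> \<delta> j" for j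
    using K'[rule_format, of j] by simp_all
  have Ks: "K j \<in> sets \<mu>" for j using compact_sets[OF K(1)] by (simp add: sets_mu)
  have mem: "Lp_mem \<mu> r (\<lambda>x. indicator (K j) x * f l x)" "Lp_mem \<mu> r (\<lambda>x. indicator (- K j) x * f l x)" if "l < m" for j l
    using f[OF that] Ks[of j] r by (auto intro!: Lp_mem_indicator_mult Compl_sets)
  \<comment> \<open>The sets K i are not nested; the difference of consecutive truncations is
    supported in the union of two of them.\<close>
  define h where "h j l x = (case j of 0 \<Rightarrow> indicator (K 0) x * f l x
     | Suc i \<Rightarrow> indicator (- K i) x * f l x - indicator (- K (Suc i)) x * f l x)" for j l x
  define C where "C j = (case j of 0 \<Rightarrow> K 0 | Suc i \<Rightarrow> K i \<union> K (Suc i))" for j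
  have sum_h: "(\<Sum>j<Suc n. h j l x) = indicator (K n) x * f l x" for n l x
  proof (induction n)
    case (Suc n)
    have "(\<Sum>j<Suc (Suc n). h j l x) = indicator (K n) x * f l x + h (Suc n) l x" using Suc by simp
    then show ?case by (auto simp: h_def indicator_def)
  qed (simp add: h_def)
  define x where "x j = (case j of 0 \<Rightarrow> vec_norm \<mu> r m f | Suc i \<Rightarrow> \<delta> i + \<delta> (Suc i))" for j
  have le: "vec_norm \<mu> r m (h j) \<le> x j" for j
  proof (cases j)
    case 0
    have "vec_norm \<mu> r m (h 0) \<le> vec_norm \<mu> r m f"
    proof (rule vec_norm_mono)
      fix l assume l: "l < m"
      show "Lp_norm \<mu> r (h 0 l) \<le> Lp_norm \<mu> r (f l)"
        by (rule Lp_norm_mono[OF f[OF l]]) (use r Lp_memD(1)[OF mem(1)[OF l, of 0]] in \<open>auto simp: h_def[abs_def] indicator_def\<close>)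
    qed (use r in simp)
    then show ?thesis by (simp add: 0 x_def)
  next
    case (Suc i)
    have "vec_norm \<mu> r m (h (Suc i)) \<le> vec_norm \<mu> r m (\<lambda>l x. indicator (- K i) x * f l x) + vec_norm \<mu> r m (\<lambda>l x. indicator (- K (Suc i)) x * f l x)"
    proof (rule vec_norm_triangle[OF _ r])
      fix l assume l: "l < m"
      have "Lp_norm \<mu> r (h (Suc i) l) = Lp_norm \<mu> r (\<lambda>x. indicator (- K i) x * f l x + (-1) * (indicator (- K (Suc i)) x * f l x))"
        by (simp add: h_def[abs_def])
      also have "\<dots> \<le> Lp_norm \<mu> r (\<lambda>x. indicator (- K i) x * f l x) + Lp_norm \<mu> r (\<lambda>x. (-1) * (indicator (- K (Suc i)) x * f l x))"
        by (intro Minkowski mem Lp_mem_cmult l r)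
      also have "Lp_norm \<mu> r (\<lambda>x. (-1) * (indicator (- K (Suc i)) x * f l x)) = Lp_norm \<mu> r (\<lambda>x. indicator (- K (Suc i)) x * f l x)"
        using r by (subst Lp_norm_cmult) auto
      finally show "Lp_norm \<mu> r (h (Suc i) l) \<le> Lp_norm \<mu> r (\<lambda>x. indicator (- K i) x * f l x) + Lp_norm \<mu> r (\<lambda>x. indicator (- K (Suc i)) x * f l x)" .
    qed
    also have "\<dots> \<le> \<delta> i + \<delta> (Suc i)" by (intro add_mono K(2))
    finally show ?thesis by (simp add: Suc x_def)
  qed
  have ds: "\<delta> sums (e/2)"
  proof -
    have "(\<lambda>j. (1/2::real) ^ j) sums (1 / (1 - 1/2))" by (rule geometric_sums) simp
    from sums_mult[OF this, of "e/4"] show ?thesis by (simp add: \<delta>_def[abs_def])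
  qed
  have d2: "(\<lambda>i. \<delta> (Suc i)) sums (e/4)"
    using sums_mult[OF power_half_series, of "e/4"] by (simp add: \<delta>_def)
  have "(\<lambda>i. x (Suc i)) sums (e/2 + e/4)" using sums_add[OF ds d2] unfolding x_def by (simp only: nat.case)
  then have xs: "x sums (e/2 + e/4 + x 0)" by (rule sums_Suc)
  have sv: "summable (\<lambda>j. vec_norm \<mu> r m (h j))"
    by (rule summable_comparison_test[OF _ sums_summable[OF xs]]) (use le in auto)
  show ?thesis
  proof
    show "compact (C j)" for j using K(1) by (cases j) (auto simp: C_def)
    show "Lp_mem \<mu> r (h j l)" if "l < m" for j l
      using mem[OF that] r by (cases j) (auto simp: h_def[abs_def] intro!: Lp_mem_diff)
    show "h j l x = 0" if "x \<notin> C j" for j l x using that by (cases j) (auto simp: h_def C_def)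
    show "summable (\<lambda>j. vec_norm \<mu> r m (h j))" by (rule sv)
    have "(\<Sum>j. vec_norm \<mu> r m (h j)) \<le> suminf x" by (rule suminf_le[OF le sv sums_summable[OF xs]])
    also have "\<dots> = e/2 + e/4 + x 0" using xs by (simp add: sums_iff)
    also have "\<dots> \<le> vec_norm \<mu> r m f + e" using e by (simp add: x_def)
    finally show "(\<Sum>j. vec_norm \<mu> r m (h j)) \<le> vec_norm \<mu> r m f + e" .
    fix l assume l: "l < m"
    have "(\<lambda>n. Lp_norm \<mu> r (\<lambda>x. (\<Sum>j<Suc n. h j l x) - f l x)) \<longlonglongrightarrow> 0"
    proof (rule Lim_null_comparison[OF always_eventually, rule_format])
      fix n
      have "Lp_norm \<mu> r (\<lambda>x. (\<Sum>j<Suc n. h j l x) - f l x) = Lp_norm \<mu> r (\<lambda>x. f l x - indicator (K n) x * f l x)"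
        unfolding sum_h by (rule Lp_norm_minus_commute)
      also have "(\<lambda>x. f l x - indicator (K n) x * f l x) = (\<lambda>x. indicator (- K n) x * f l x)"
        by (auto simp: indicator_def)
      also have "Lp_norm \<mu> r \<dots> \<le> vec_norm \<mu> r m (\<lambda>l x. indicator (- K n) x * f l x)"
        using Lp_norm_le_vec_norm[OF l, of r \<mu> "\<lambda>l x. indicator (- K n) x * f l x"] r by simp
      also have "\<dots> \<le> \<delta> n" by (rule K(2))
      finally show "norm (Lp_norm \<mu> r (\<lambda>x. (\<Sum>j<Suc n. h j l x) - f l x)) \<le> \<delta> n" by simp
    next
      show "\<delta> \<longlonglongrightarrow> 0" using summable_LIMSEQ_zero[OF sums_summable[OF ds]] .
    qed
    then show "(\<lambda>n. Lp_norm \<mu> r (\<lambda>x. (\<Sum>j<n. h j l x) - f l x)) \<longlonglongrightarrow> 0" by (rule LIMSEQ_imp_Suc)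
  qed
qed

end

section \<open>Multiplying coefficient matrices by u\<close>

text \<open>Common refinement of the first labellings. Coding pairs by \<open>prod_encode\<close>
  keeps labels in the naturals, and its injectivity gives nestedness.\<close>

primrec refine_label :: "(nat \<Rightarrow> 'a \<Rightarrow> nat) \<Rightarrow> nat \<Rightarrow> 'a \<Rightarrow> nat" where
  "refine_label h 0 r = h 0 r"
| "refine_label h (Suc n) r = prod_encode (refine_label h n r, h (Suc n) r)"

lemma refine_label_measurable:
  assumes "\<And>n. h n \<in> measurable M (count_space UNIV)"
  shows "refine_label h n \<in> measurable M (count_space UNIV)"
proof (induction n)
  case 0
  have "refine_label h 0 = h 0" by (simp add: fun_eq_iff)
  then show ?case using assms[of 0] by simp
next
  case (Suc n)
  show ?case
    unfolding measurable_count_space_eq2_countable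
  proof (intro conjI ballI)
    fix a :: nat
    obtain a1 a2 where "prod_decode a = (a1, a2)" by force
    then have a: "a = prod_encode (a1, a2)" using prod_decode_inverse[of a] by simp
    have "refine_label h (Suc n) -` {a} \<inter> space M = (refine_label h n -` {a1} \<inter> space M) \<inter> (h (Suc n) -` {a2} \<inter> space M)"
      by (auto simp: prod_encode_eq a)
    then show "refine_label h (Suc n) -` {a} \<inter> space M \<in> sets M"
      using measurable_sets[OF Suc, of "{a1}"] measurable_sets[OF assms, of "{a2}" "Suc n"] by auto
  qed auto
qed

lemma refine_label_finite:
  assumes "\<And>n. finite (range (h n))"
  shows "finite (range (refine_label h n))"
proof (induction n)
  case 0
  then show ?case using assms[of 0] by simp
next
  case (Suc n)
  have "range (refine_label h (Suc n)) \<subseteq> prod_encode ` (range (refine_label h n) \<times> range (h (Suc n)))" by auto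
  then show ?case by (rule finite_subset) (use Suc assms in auto)
qed

lemma refine_label_Suc: "refine_label h (Suc n) r = refine_label h (Suc n) r' \<Longrightarrow> refine_label h n r = refine_label h n r'"
  by (simp add: prod_encode_eq)

lemma refine_label_le: "refine_label h n r = refine_label h n r' \<Longrightarrow> h n r = h n r'"
  by (cases n) (auto simp: prod_encode_eq)

text \<open>Under this weighted measure the L_r norm of a scalar function F equals the norm of the
  vector with components F f_l. A scalar kernel expansion thereby acts on all components at once,
  which is why the matrix case costs no more than the scalar one.\<close>

definition dens :: "'a measure \<Rightarrow> real \<Rightarrow> nat \<Rightarrow> (nat \<Rightarrow> 'a \<Rightarrow> complex) \<Rightarrow> 'a measure" where
  "dens M r m f = density M (\<lambda>x. ennreal (\<Sum>l<m. cmod (f l x) powr r))"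

lemma
  assumes f: "\<And>l. l < m \<Longrightarrow> Lp_mem M r (f l)" and r: "1 < r"
  shows finite_measure_dens: "finite_measure (dens M r m f)"
    and sets_dens: "sets (dens M r m f) = sets M" and space_dens: "space (dens M r m f) = space M"
    and Lp_norm_dens: "\<And>F B. F \<in> borel_measurable M \<Longrightarrow> (\<And>x. cmod (F x) \<le> B) \<Longrightarrow>
      Lp_norm (dens M r m f) r F = vec_norm M r m (\<lambda>l x. F x * f l x)"
    and measure_dens: "measure (dens M r m f) (space M) powr (1/r) = vec_norm M r m f"
proof -
  have i: "integrable M (\<lambda>x. cmod (f l x) powr r)" if "l < m" for l using f[OF that] by (simp add: Lp_mem_def)
  have I: "integrable M (\<lambda>x. \<Sum>l<m. cmod (f l x) powr r)" using i by auto
  note [measurable] = borel_measurable_integrable[OF I]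
  have nn: "(\<integral>\<^sup>+x. ennreal (\<Sum>l<m. cmod (f l x) powr r) \<partial>M) = ennreal (\<integral>x. (\<Sum>l<m. cmod (f l x) powr r) \<partial>M)"
    by (rule nn_integral_eq_integral[OF I]) (intro AE_I2 sum_nonneg, simp)
  have em: "emeasure (dens M r m f) (space M) = ennreal (\<integral>x. (\<Sum>l<m. cmod (f l x) powr r) \<partial>M)"
    unfolding dens_def nn[symmetric] by (subst emeasure_density) (auto intro!: nn_integral_cong)
  show "sets (dens M r m f) = sets M" "space (dens M r m f) = space M" by (auto simp: dens_def)
  then show "finite_measure (dens M r m f)" by (intro finite_measureI) (simp add: em)
  have int: "(\<integral>x. (\<Sum>l<m. cmod (f l x) powr r) \<partial>M) = (\<Sum>l<m. Lp_norm M r (f l) powr r)"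
    using i r by (simp add: Bochner_Integration.integral_sum Lp_norm_powr)
  have "measure (dens M r m f) (space M) = (\<Sum>l<m. Lp_norm M r (f l) powr r)"
    unfolding measure_def em int by (simp add: sum_nonneg)
  then show "measure (dens M r m f) (space M) powr (1/r) = vec_norm M r m f" by (simp add: vec_norm_def)
  fix F :: "'a \<Rightarrow> complex" and B
  assume F[measurable]: "F \<in> borel_measurable M" and B: "\<And>x. cmod (F x) \<le> B"
  have mem: "Lp_mem M r (\<lambda>x. F x * f l x)" if "l < m" for l
    by (rule Lp_mem_mult_bounded[OF f[OF that] F B]) (use r in auto)
  have "(\<integral>x. cmod (F x) powr r \<partial>dens M r m f) = (\<integral>x. (\<Sum>l<m. cmod (f l x) powr r) *\<^sub>R cmod (F x) powr r \<partial>M)"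
    unfolding dens_def
  proof (rule integral_density)
    show "AE x in M. 0 \<le> (\<Sum>l<m. cmod (f l x) powr r)" by (rule AE_I2) (simp add: sum_nonneg)
  qed measurable
  also have "\<dots> = (\<integral>x. (\<Sum>l<m. cmod (F x * f l x) powr r) \<partial>M)"
    by (simp add: sum_distrib_left sum_distrib_right norm_mult powr_mult mult.commute)
  also have "\<dots> = (\<Sum>l<m. \<integral>x. cmod (F x * f l x) powr r \<partial>M)"
    by (rule Bochner_Integration.integral_sum) (use mem in \<open>auto simp: Lp_mem_def\<close>)
  also have "\<dots> = (\<Sum>l<m. Lp_norm M r (\<lambda>x. F x * f l x) powr r)" using r by (simp add: Lp_norm_powr)
  finally show "Lp_norm (dens M r m f) r F = vec_norm M r m (\<lambda>l x. F x * f l x)"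
    unfolding Lp_norm_def[of "dens M r m f"] vec_norm_def by simp
qed

lemma bilinear_bound_mask:
  assumes T: "bilinear_bound p q I J T 1" and p: "0 < p" "0 < q"
  shows "bilinear_bound p q I J (\<lambda>i j. (if P i \<and> Q j then T i j else 0)) 1"
  unfolding bilinear_bound_def
proof (intro allI)
  fix x y :: "_ \<Rightarrow> complex"
  have "(\<Sum>i\<in>I. \<Sum>j\<in>J. (if P i \<and> Q j then T i j else 0) * x j * y i)
      = (\<Sum>i\<in>I. \<Sum>j\<in>J. T i j * (if Q j then x j else 0) * (if P i then y i else 0))"
    by (intro sum.cong refl) auto
  also have "cmod \<dots> \<le> 1 * fin_norm p J (\<lambda>j. if Q j then x j else 0) * fin_norm q I (\<lambda>i. if P i then y i else 0)"
    by (rule bilinear_boundD[OF T])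
  also have "\<dots> \<le> 1 * fin_norm p J x * fin_norm q I y"
    using p by (intro mult_mono fin_norm_mono) auto
  finally show "cmod (\<Sum>i\<in>I. \<Sum>j\<in>J. (if P i \<and> Q j then T i j else 0) * x j * y i) \<le> 1 * fin_norm p J x * fin_norm q I y" .
qed

context haar_group
begin

text \<open>On K the kernel u(t + - r) satisfies the assumptions of \<open>fine_kernel\<close> for
  the weights built from g and f. Its series expansion, multiplied by g_k(t) f_l(r) and integrated
  along r = - s + t, becomes an expansion of u times each coefficient.\<close>

lemma REP_compact:
  assumes u: "continuous_on UNIV u" and S: "schur_bd p q 1 (\<lambda>(s, t). u (s + - t))"
    and K: "compact K" and g: "\<And>k. k < m \<Longrightarrow> Lp_mem \<mu> q (g k)" and f: "\<And>k. k < m \<Longrightarrow> Lp_mem \<mu> p (f k)"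
    and g0: "\<And>k x. x \<notin> K \<Longrightarrow> g k x = 0" and f0: "\<And>k x. x \<notin> K \<Longrightarrow> f k x = 0" and e: "0 < e"
  shows "REP m (\<lambda>k l s. u s * Lam (g k) (f l) s) (vec_norm \<mu> q m g * vec_norm \<mu> p m f + e)"
proof -
  \<comment> \<open>Cutting the kernel off outside K in both variables controls its oscillation on
    all cells; nothing changes under the integral because g and f vanish off K.\<close>
  define \<psi>0 where "\<psi>0 = (\<lambda>(t, r). if t \<in> K \<and> r \<in> K then u (t + - r) else 0)"
  \<comment> \<open>Half of the allowed oscillation for each of the two variables.\<close>
  define \<epsilon> where "\<epsilon> n = 1 / (2 * real (Suc n))" for n
  let ?P = "\<lambda>h :: 'g \<Rightarrow> nat. h \<in> measurable borel (count_space UNIV) \<and> finite (range h) \<and> (\<forall>r r'. h r = h r' \<longrightarrow> (r \<in> K \<longleftrightarrow> r' \<in> K))"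
  let ?R = "\<lambda>h n. \<forall>r r' t. h r = h r' \<longrightarrow> r \<in> K \<longrightarrow> t \<in> K \<longrightarrow> cmod (u (t + - r) - u (t + - r')) \<le> \<epsilon> n"
  let ?L = "\<lambda>h n. \<forall>t t' r. h t = h t' \<longrightarrow> t \<in> K \<longrightarrow> r \<in> K \<longrightarrow> cmod (u (t + - r) - u (t' + - r)) \<le> \<epsilon> n"
  have eps: "0 < \<epsilon> n" for n by (simp add: \<epsilon>_def)
  have c1: "continuous_on UNIV (\<lambda>z. u (fst z + - snd z))" and c2: "continuous_on UNIV (\<lambda>z. u (snd z + - fst z))"
    by (rule continuous_on_compose2[OF u]; auto intro!: continuous_intros)+
  have "\<exists>h::'g \<Rightarrow> nat. ?P h \<and> ?R h n" for n
  proof (rule partition_label[OF K c1 eps[of n]], goal_cases)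
    case (1 h)
    note h = 1[unfolded fst_conv snd_conv]
    show ?case
      by (rule exI[of _ h], intro conjI allI impI) (rule h(1), rule h(2), rule h(3), assumption, rule h(4))
  qed
  then have "\<exists>h::nat \<Rightarrow> 'g \<Rightarrow> nat. \<forall>n. ?P (h n) \<and> ?R (h n) n"
    by (rule choice[OF allI])
  then obtain h :: "nat \<Rightarrow> 'g \<Rightarrow> nat" where h': "\<forall>n. ?P (h n) \<and> ?R (h n) n" ..
  have h1: "h n \<in> measurable borel (count_space UNIV)" for n using h'[THEN spec, of n] by (elim conjE)
  have h2: "finite (range (h n))" for n using h'[THEN spec, of n] by (elim conjE)
  have h3: "\<forall>r r'. h n r = h n r' \<longrightarrow> (r \<in> K \<longleftrightarrow> r' \<in> K)" for n using h'[THEN spec, of n] by (elim conjE)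
  have h4: "\<forall>r r' t. h n r = h n r' \<longrightarrow> r \<in> K \<longrightarrow> t \<in> K \<longrightarrow> cmod (u (t + - r) - u (t + - r')) \<le> \<epsilon> n" for n
    using h'[THEN spec, of n] by (elim conjE)
  have "\<exists>h::'g \<Rightarrow> nat. ?P h \<and> ?L h n" for n
  proof (rule partition_label[OF K c2 eps[of n]], goal_cases)
    case (1 h)
    note h = 1[unfolded fst_conv snd_conv]
    show ?case
      by (rule exI[of _ h], intro conjI allI impI) (rule h(1), rule h(2), rule h(3), assumption, rule h(4))
  qed
  then have "\<exists>h::nat \<Rightarrow> 'g \<Rightarrow> nat. \<forall>n. ?P (h n) \<and> ?L (h n) n"
    by (rule choice[OF allI])
  then obtain c :: "nat \<Rightarrow> 'g \<Rightarrow> nat" where c': "\<forall>n. ?P (c n) \<and> ?L (c n) n" ..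
  have c1: "c n \<in> measurable borel (count_space UNIV)" for n using c'[THEN spec, of n] by (elim conjE)
  have c2: "finite (range (c n))" for n using c'[THEN spec, of n] by (elim conjE)
  have c3: "\<forall>r r'. c n r = c n r' \<longrightarrow> (r \<in> K \<longleftrightarrow> r' \<in> K)" for n using c'[THEN spec, of n] by (elim conjE)
  have c4: "\<forall>t t' r. c n t = c n t' \<longrightarrow> t \<in> K \<longrightarrow> r \<in> K \<longrightarrow> cmod (u (t + - r) - u (t' + - r)) \<le> \<epsilon> n" for n
    using c'[THEN spec, of n] by (elim conjE)
  define d where "d = refine_label h"
  define M where "M = dens \<mu> p m f"
  define M' where "M' = dens \<mu> q m g"
  have sM: "sets M = sets borel" "sets M' = sets borel"
    using sets_dens[of m \<mu> p f] sets_dens[of m \<mu> q g] f g p1 by (auto simp: M_def M'_def sets_mu)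
  interpret fk: fine_kernel p q M' M \<psi>0 c d
  proof (rule fine_kernel.intro)
    show "conj_pair p q" by (rule pq)
    show "finite_measure M'" unfolding M'_def by (rule finite_measure_dens) (use g p1 in auto)
    show "finite_measure M" unfolding M_def by (rule finite_measure_dens) (use f p1 in auto)
    show "space M' = UNIV" "space M = UNIV" using sets_eq_imp_space_eq[OF sM(1)] sets_eq_imp_space_eq[OF sM(2)] by auto
    show "c n \<in> measurable M' (count_space UNIV)" for n
      using c1[of n] unfolding measurable_cong_sets[OF sM(2) refl] .
    show "d n \<in> measurable M (count_space UNIV)" for n
      unfolding measurable_cong_sets[OF sM(1) refl] d_def by (rule refine_label_measurable) (rule h1)
    show "finite (range (c n))" for n by (rule c2)
    show "finite (range (d n))" for n unfolding d_def by (rule refine_label_finite) (rule h2)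
    show "d n r = d n r'" if "d (Suc n) r = d (Suc n) r'" for n r r'
      using that unfolding d_def by (rule refine_label_Suc)
    show "cmod (\<psi>0 (t, r) - \<psi>0 (t', r')) \<le> 1 / real (Suc n)" if "c n t = c n t'" "d n r = d n r'" for n t t' r r'
    proof -
      have hn: "h n r = h n r'" using that(2) unfolding d_def by (rule refine_label_le)
      note eqK = c3[rule_format, OF that(1)] h3[rule_format, OF hn]
      show ?thesis
      proof (cases "t \<in> K \<and> r \<in> K")
        case True
        then have "\<psi>0 (t, r) - \<psi>0 (t', r') = (u (t + - r) - u (t + - r')) + (u (t + - r') - u (t' + - r'))"
          using eqK by (simp add: \<psi>0_def)
        also have "cmod \<dots> \<le> \<epsilon> n + \<epsilon> n"
          using True eqK by (intro norm_triangle_mono h4[rule_format, OF hn] c4[rule_format, OF that(1)]) auto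
        also have "\<dots> = 1 / real (Suc n)" by (simp add: \<epsilon>_def field_simps)
        finally show ?thesis .
      next
        case False
        then show ?thesis using eqK by (auto simp: \<psi>0_def)
      qed
    qed
    show "bilinear_bound p q I J (\<lambda>i j. \<psi>0 (a i, b j) * T i j) 1"
      if fin: "finite I" "finite J" and T: "bilinear_bound p q I J T 1" for I J :: "nat set" and a b T
    proof -
      \<comment> \<open>The cutoff amounts to deleting rows and columns of T, which preserves
        contractivity.\<close>
      have "bilinear_bound p q I J (\<lambda>i j. (\<lambda>(s, t). u (s + - t)) (a i, b j) * (if a i \<in> K \<and> b j \<in> K then T i j else 0)) 1"
        by (rule schur_bd_rectangular[OF pq S _ fin]) (use bilinear_bound_mask[OF T p1(3,4)] in auto)
      also have "(\<lambda>i j. (\<lambda>(s, t). u (s + - t)) (a i, b j) * (if a i \<in> K \<and> b j \<in> K then T i j else 0)) = (\<lambda>i j. \<psi>0 (a i, b j) * T i j)"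
        by (auto simp: \<psi>0_def fun_eq_iff)
      finally show ?thesis .
    qed
  qed
  have Nf: "Lp_norm M p F = vec_norm \<mu> p m (\<lambda>l x. F x * f l x)" and memf: "k < m \<Longrightarrow> Lp_mem \<mu> p (\<lambda>x. F x * f k x)"
    if bd: "fk.bdm F" for F k
  proof -
    obtain B where B: "F \<in> borel_measurable M" "\<And>x. cmod (F x) \<le> B" using bd by (auto simp: fk.bdm_def)
    have Fm: "F \<in> borel_measurable \<mu>" using B(1) unfolding measurable_cong_sets[OF sM(1) refl] measurable_cong_sets[OF sets_mu refl] .
    show "Lp_norm M p F = vec_norm \<mu> p m (\<lambda>l x. F x * f l x)"
      unfolding M_def by (rule Lp_norm_dens[OF f _ Fm B(2)]) (use p1 in auto)
    show "Lp_mem \<mu> p (\<lambda>x. F x * f k x)" if "k < m"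
      by (rule Lp_mem_mult_bounded[OF f[OF that] Fm B(2)]) (use p1 in auto)
  qed
  have Ng: "Lp_norm M' q F = vec_norm \<mu> q m (\<lambda>l x. F x * g l x)" and memg: "k < m \<Longrightarrow> Lp_mem \<mu> q (\<lambda>x. F x * g k x)"
    if bd: "fk.bdm' F" for F k
  proof -
    obtain B where B: "F \<in> borel_measurable M'" "\<And>x. cmod (F x) \<le> B" using bd by (auto simp: fk.bdm'_def)
    have Fm: "F \<in> borel_measurable \<mu>" using B(1) unfolding measurable_cong_sets[OF sM(2) refl] measurable_cong_sets[OF sets_mu refl] .
    show "Lp_norm M' q F = vec_norm \<mu> q m (\<lambda>l x. F x * g l x)"
      unfolding M'_def by (rule Lp_norm_dens[OF g _ Fm B(2)]) (use p1 in auto)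
    show "Lp_mem \<mu> q (\<lambda>x. F x * g k x)" if "k < m"
      by (rule Lp_mem_mult_bounded[OF g[OF that] Fm B(2)]) (use p1 in auto)
  qed
  have tot: "fk.total = vec_norm \<mu> q m g * vec_norm \<mu> p m f"
    unfolding fk.total_def unfolding M_def M'_def using measure_dens[of m \<mu> p f] measure_dens[of m \<mu> q g] f g p1 by simp
  \<comment> \<open>Multiplying the factors G by g k and F by f l turns a kernel expansion of cost x
    into a common expansion of the integrated coefficients at the same cost.\<close>
  have BL: "REP m (\<lambda>k l s. \<integral>t. g k t * w t (- s + t) * f l (- s + t) \<partial>\<mu>) x"
    "k < m \<Longrightarrow> l < m \<Longrightarrow> integrable \<mu> (\<lambda>t. g k t * w t (- s + t) * f l (- s + t))"
    if R: "fk.R w x" for w x k l s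
  proof -
    obtain ps where ps: "\<forall>(G, F)\<in>set ps. fk.bdm' G \<and> fk.bdm F" "\<forall>t r. w t r = (\<Sum>(G, F)\<leftarrow>ps. G t * F r)"
      "(\<Sum>(G, F)\<leftarrow>ps. Lp_norm M' q G * Lp_norm M p F) \<le> x"
      using R unfolding fk.R_def by (elim exE conjE) (rule that)
    let ?qs = "map (\<lambda>(G, F). (\<lambda>k x. G x * g k x, \<lambda>k x. F x * f k x)) ps"
    have I: "integrable \<mu> (\<lambda>t. (G t * g k t) * lambda_p s (\<lambda>r. F r * f l r) t)" if "(G, F) \<in> set ps" "k < m" "l < m" for G F k l s
      using ps(1) that by (intro Holder_integrable[OF pq] memg Lp_mem_lambda memf) auto
    have eq: "g k t * w t (- s + t) * f l (- s + t) = (\<Sum>(G, F)\<leftarrow>ps. (G t * g k t) * lambda_p s (\<lambda>r. F r * f l r) t)" for k l s t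
    proof -
      have "g k t * w t (- s + t) * f l (- s + t) = (g k t * f l (- s + t)) * (\<Sum>z\<leftarrow>ps. fst z t * snd z (- s + t))"
        using ps(2) by (simp add: split_def)
      also have "\<dots> = (\<Sum>z\<leftarrow>ps. (g k t * f l (- s + t)) * (fst z t * snd z (- s + t)))" by (rule sum_list_const_mult[symmetric])
      finally show ?thesis by (simp add: split_def lambda_p_def mult_ac)
    qed
    have ind: "integrable \<mu> (\<lambda>t. \<Sum>(G, F)\<leftarrow>qs. (G t * g k t) * lambda_p s (\<lambda>r. F r * f l r) t) \<and>
       (\<integral>t. (\<Sum>(G, F)\<leftarrow>qs. (G t * g k t) * lambda_p s (\<lambda>r. F r * f l r) t) \<partial>\<mu>) = (\<Sum>(G, F)\<leftarrow>qs. Lam (\<lambda>t. G t * g k t) (\<lambda>r. F r * f l r) s)"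
      if "set qs \<subseteq> set ps" "k < m" "l < m" for qs k l s
      using that
    proof (induction qs)
      case (Cons z qs)
      obtain G F where z: "z = (G, F)" by force
      have "integrable \<mu> (\<lambda>t. (G t * g k t) * lambda_p s (\<lambda>r. F r * f l r) t)" using Cons.prems by (intro I) (auto simp: z)
      then show ?case using Cons by (simp add: z Lam_def pairing_def)
    qed simp
    show "integrable \<mu> (\<lambda>t. g k t * w t (- s + t) * f l (- s + t))" if "k < m" "l < m"
      unfolding eq using ind[OF order_refl that] by (rule conjunct1)
    show "REP m (\<lambda>k l s. \<integral>t. g k t * w t (- s + t) * f l (- s + t) \<partial>\<mu>) x"
    proof (rule REP_list[where ps = ?qs])
      fix G F k assume GF: "(G, F) \<in> set (?qs)" "k < m"
      then obtain G' F' where z: "(G', F') \<in> set ps" "G = (\<lambda>k x. G' x * g k x)" "F = (\<lambda>k x. F' x * f k x)" by auto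
      then have "fk.bdm' G'" "fk.bdm F'" using ps(1) by auto
      then show "Lp_mem \<mu> q (G k) \<and> Lp_mem \<mu> p (F k)" using memg memf GF(2) z by simp
    next
      have "(\<Sum>(G, F)\<leftarrow>?qs. vec_norm \<mu> q m G * vec_norm \<mu> p m F)
         = (\<Sum>(G, F)\<leftarrow>ps. Lp_norm M' q G * Lp_norm M p F)"
        unfolding map_map o_def split_def fst_conv snd_conv
        using ps(1) Ng Nf by (intro arg_cong[where f = sum_list] map_cong refl) (auto simp: split_def)
      then show "(\<Sum>(G, F)\<leftarrow>?qs. vec_norm \<mu> q m G * vec_norm \<mu> p m F) \<le> x"
        using ps(3) by simp
    next
      fix k l s assume "k < m" "l < m"
      show "(\<integral>t. g k t * w t (- s + t) * f l (- s + t) \<partial>\<mu>) = (\<Sum>(G, F)\<leftarrow>?qs. Lam (G k) (F l) s)"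
        unfolding eq ind[OF order_refl \<open>k < m\<close> \<open>l < m\<close>, THEN conjunct2] by (simp add: o_def split_def)
    qed
  qed
  obtain v x where v: "\<And>i. fk.R (v i) (x i)" "\<And>i. 0 \<le> x i" "summable x" "suminf x \<le> fk.total + e"
    "\<And>n t r. cmod ((\<Sum>i<Suc n. v i t r) - \<psi>0 (t, r)) \<le> 2 / real (Suc n)"
    by (rule fk.kernel_series[OF e]) (rule that)
  have "REP m (\<lambda>k l s. u s * Lam (g k) (f l) s) (suminf x)"
  proof (rule REP_sums[OF BL(1)[OF v(1)] v(3)])
    fix k l s assume kl: "k < m" "l < m"
    let ?S = "\<lambda>n t. \<Sum>i<Suc n. g k t * v i t (- s + t) * f l (- s + t)"
    let ?I = "\<lambda>i. \<integral>t. g k t * v i t (- s + t) * f l (- s + t) \<partial>\<mu>"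
    have fl: "Lp_mem \<mu> p (lambda_p s (f l))" by (rule Lp_mem_lambda[OF f[OF kl(2)]])
    have J: "integrable \<mu> (\<lambda>t. g k t * lambda_p s (f l) t)" by (rule Holder_integrable[OF pq g[OF kl(1)] fl])
    define C where "C = (\<integral>t. cmod (g k t * lambda_p s (f l) t) \<partial>\<mu>)"
    \<comment> \<open>The change of variable behind the construction: with r = - s + t one has t + -
      r = s, so the scalar u s is the kernel at (t, r).\<close>
    have pt: "u s * (g k t * lambda_p s (f l) t) = g k t * \<psi>0 (t, - s + t) * f l (- s + t)" for t
    proof (cases "t \<in> K \<and> - s + t \<in> K")
      case True
      have "t + - (- s + t) = s" by (simp add: minus_add add.assoc[symmetric])
      then show ?thesis using True by (simp add: \<psi>0_def lambda_p_def mult_ac)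
    next
      case False
      then show ?thesis using g0 f0 by (auto simp: lambda_p_def)
    qed
    \<comment> \<open>Uniform convergence of the kernel series suffices here, since g_k times the
      translate of f_l is integrable.\<close>
    have "(\<lambda>n. (\<Sum>i<Suc n. ?I i) - u s * Lam (g k) (f l) s) \<longlonglongrightarrow> 0"
    proof (rule Lim_null_comparison[OF always_eventually, rule_format])
      fix n
      have Iv: "integrable \<mu> (\<lambda>t. g k t * v i t (- s + t) * f l (- s + t))" for i by (rule BL(2)[OF v(1) kl])
      have "(\<Sum>i<Suc n. ?I i) - u s * Lam (g k) (f l) s
         = (\<integral>t. ?S n t - u s * (g k t * lambda_p s (f l) t) \<partial>\<mu>)"
      proof -
        have "(\<integral>t. ?S n t - u s * (g k t * lambda_p s (f l) t) \<partial>\<mu>)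
          = (\<integral>t. ?S n t \<partial>\<mu>) - (\<integral>t. u s * (g k t * lambda_p s (f l) t) \<partial>\<mu>)"
          by (rule Bochner_Integration.integral_diff) (intro Bochner_Integration.integrable_sum Iv integrable_mult_right J)+
        also have "(\<integral>t. ?S n t \<partial>\<mu>) = (\<Sum>i<Suc n. ?I i)"
          by (rule Bochner_Integration.integral_sum) (rule Iv)
        also have "(\<integral>t. u s * (g k t * lambda_p s (f l) t) \<partial>\<mu>) = u s * Lam (g k) (f l) s"
          unfolding Lam_def pairing_def by (rule integral_mult_right_zero)
        finally show ?thesis ..
      qed
      also have "\<dots> = (\<integral>t. (g k t * lambda_p s (f l) t) * ((\<Sum>i<Suc n. v i t (- s + t)) - \<psi>0 (t, - s + t)) \<partial>\<mu>)"
      proof (rule Bochner_Integration.integral_cong[OF refl])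
        fix t
        have "?S n t = (\<Sum>i<Suc n. (g k t * lambda_p s (f l) t) * v i t (- s + t))"
          unfolding lambda_p_def by (intro sum.cong refl) (simp only: mult_ac)
        also have "\<dots> = (g k t * lambda_p s (f l) t) * (\<Sum>i<Suc n. v i t (- s + t))" by (rule sum_distrib_left[symmetric])
        finally have a: "?S n t = (g k t * lambda_p s (f l) t) * (\<Sum>i<Suc n. v i t (- s + t))" .
        have b: "u s * (g k t * lambda_p s (f l) t) = (g k t * lambda_p s (f l) t) * \<psi>0 (t, - s + t)"
          unfolding pt unfolding lambda_p_def by (simp only: mult_ac)
        show "?S n t - u s * (g k t * lambda_p s (f l) t)
            = (g k t * lambda_p s (f l) t) * ((\<Sum>i<Suc n. v i t (- s + t)) - \<psi>0 (t, - s + t))"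
          unfolding a b by (simp only: right_diff_distrib)
      qed
      finally have e: "(\<Sum>i<Suc n. ?I i) - u s * Lam (g k) (f l) s = (\<integral>t. (g k t * lambda_p s (f l) t) * ((\<Sum>i<Suc n. v i t (- s + t)) - \<psi>0 (t, - s + t)) \<partial>\<mu>)" .
      have "norm ((\<Sum>i<Suc n. ?I i) - u s * Lam (g k) (f l) s) \<le> (\<integral>t. cmod ((g k t * lambda_p s (f l) t) * ((\<Sum>i<Suc n. v i t (- s + t)) - \<psi>0 (t, - s + t))) \<partial>\<mu>)"
        unfolding e by (rule integral_norm_bound)
      also have "\<dots> \<le> (\<integral>t. cmod (g k t * lambda_p s (f l) t) * (2 / real (Suc n)) \<partial>\<mu>)"
      proof -
        have B: "cmod (X * Y) \<le> cmod X * c" if "cmod Y \<le> c" for X Y :: complex and c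
          unfolding norm_mult by (rule mult_left_mono[OF that norm_ge_zero])
        show ?thesis
          by (rule integral_mono'[OF integrable_mult_left[OF integrable_norm[OF J]] B[OF v(5)] mult_nonneg_nonneg[OF norm_ge_zero]]) simp
      qed
      also have "\<dots> = C * (2 / real (Suc n))" unfolding C_def by (rule integral_mult_left_zero)
      finally show "norm ((\<Sum>i<Suc n. ?I i) - u s * Lam (g k) (f l) s) \<le> C * (2 / real (Suc n))" .
    next
      have "(\<lambda>n. C * 2 * (1 / real (Suc n))) \<longlonglongrightarrow> C * 2 * 0"
        by (intro tendsto_mult tendsto_const LIMSEQ_Suc[OF lim_1_over_n])
      then show "(\<lambda>n. C * (2 / real (Suc n))) \<longlonglongrightarrow> 0" by simp
    qed
    then have "(\<lambda>n. \<Sum>i<Suc n. ?I i) \<longlonglongrightarrow> u s * Lam (g k) (f l) s" by (rule LIM_zero_cancel)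
    then show "?I sums (u s * Lam (g k) (f l) s)" unfolding sums_def by (rule LIMSEQ_imp_Suc)
  qed
  then show ?thesis by (rule REP_mono) (use v(4) tot in simp)
qed

lemma Lam_sums_right:
  assumes g: "Lp_mem \<mu> q g" and h: "\<And>j. Lp_mem \<mu> p (h j)" and f: "Lp_mem \<mu> p f"
    and lim: "(\<lambda>n. Lp_norm \<mu> p (\<lambda>x. (\<Sum>j<n. h j x) - f x)) \<longlonglongrightarrow> 0"
  shows "(\<lambda>j. Lam g (h j) s) sums Lam g f s"
proof -
  have "(\<lambda>n. (\<Sum>j<n. Lam g (h j) s) - Lam g f s) \<longlonglongrightarrow> 0"
  proof (rule Lim_null_comparison[OF always_eventually, rule_format])
    fix n
    have hs: "Lp_mem \<mu> p (\<lambda>x. \<Sum>j<n. h j x)" using h p1 by (intro Lp_mem_sum)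
    have "(\<Sum>j<n. Lam g (h j) s) = pairing \<mu> g (\<lambda>x. \<Sum>j<n. lambda_p s (h j) x)"
      unfolding Lam_def by (rule pairing_sum_right[OF pq g, symmetric]) (intro Lp_mem_lambda h)
    also have "(\<lambda>x. \<Sum>j<n. lambda_p s (h j) x) = lambda_p s (\<lambda>x. \<Sum>j<n. h j x)" by (simp add: lambda_p_def)
    finally have "(\<Sum>j<n. Lam g (h j) s) - Lam g f s = Lam g (\<lambda>x. (\<Sum>j<n. h j x) - f x) s"
      using pairing_add_right[OF pq g Lp_mem_lambda[OF hs] Lp_mem_lambda[OF f], where c = "-1"]
      by (simp add: Lam_def lambda_p_def)
    also have "cmod \<dots> \<le> Lp_norm \<mu> q g * Lp_norm \<mu> p (\<lambda>x. (\<Sum>j<n. h j x) - f x)"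
      by (intro Lam_bound g Lp_mem_diff hs f p1)
    finally show "norm ((\<Sum>j<n. Lam g (h j) s) - Lam g f s) \<le> Lp_norm \<mu> q g * Lp_norm \<mu> p (\<lambda>x. (\<Sum>j<n. h j x) - f x)" .
  next
    show "(\<lambda>n. Lp_norm \<mu> q g * Lp_norm \<mu> p (\<lambda>x. (\<Sum>j<n. h j x) - f x)) \<longlonglongrightarrow> 0"
      using tendsto_mult_right_zero[OF lim] by simp
  qed
  then show ?thesis unfolding sums_def by (rule LIM_zero_cancel)
qed

lemma Lam_sums_left:
  assumes f: "Lp_mem \<mu> p f" and h: "\<And>j. Lp_mem \<mu> q (h j)" and g: "Lp_mem \<mu> q g"
    and lim: "(\<lambda>n. Lp_norm \<mu> q (\<lambda>x. (\<Sum>j<n. h j x) - g x)) \<longlonglongrightarrow> 0"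
  shows "(\<lambda>j. Lam (h j) f s) sums Lam g f s"
proof -
  have fl: "Lp_mem \<mu> p (lambda_p s f)" by (rule Lp_mem_lambda[OF f])
  have "(\<lambda>n. (\<Sum>j<n. Lam (h j) f s) - Lam g f s) \<longlonglongrightarrow> 0"
  proof (rule Lim_null_comparison[OF always_eventually, rule_format])
    fix n
    have hs: "Lp_mem \<mu> q (\<lambda>x. \<Sum>j<n. h j x)" using h p1 by (intro Lp_mem_sum)
    have "(\<Sum>j<n. Lam (h j) f s) = pairing \<mu> (lambda_p s f) (\<lambda>x. \<Sum>j<n. h j x)"
      unfolding Lam_def pairing_commute[of \<mu> _ "lambda_p s f"] by (rule pairing_sum_right[OF qp fl h, symmetric])
    then have "(\<Sum>j<n. Lam (h j) f s) - Lam g f s = Lam (\<lambda>x. (\<Sum>j<n. h j x) - g x) f s"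
      using pairing_add_right[OF qp fl hs g, where c = "-1"]
      by (simp add: Lam_def pairing_commute[of \<mu> _ "lambda_p s f"])
    also have "cmod \<dots> \<le> Lp_norm \<mu> q (\<lambda>x. (\<Sum>j<n. h j x) - g x) * Lp_norm \<mu> p f"
      by (intro Lam_bound f Lp_mem_diff hs g p1)
    finally show "norm ((\<Sum>j<n. Lam (h j) f s) - Lam g f s) \<le> Lp_norm \<mu> q (\<lambda>x. (\<Sum>j<n. h j x) - g x) * Lp_norm \<mu> p f" .
  next
    show "(\<lambda>n. Lp_norm \<mu> q (\<lambda>x. (\<Sum>j<n. h j x) - g x) * Lp_norm \<mu> p f) \<longlonglongrightarrow> 0"
      using tendsto_mult_left_zero[OF lim] by simp
  qed
  then show ?thesis unfolding sums_def by (rule LIM_zero_cancel)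
qed

text \<open>Both vectors are split into compactly supported pieces of almost the same total norm.
  Each pair of pieces is handled by \<open>REP_compact\<close>, and the double series of expansions
  has cost close to the product of the norms.\<close>

theorem REP_mult:
  assumes u: "continuous_on UNIV u" and S: "schur_bd p q 1 (\<lambda>(s, t). u (s + - t))"
    and g: "\<And>k. k < m \<Longrightarrow> Lp_mem \<mu> q (g k)" and f: "\<And>k. k < m \<Longrightarrow> Lp_mem \<mu> p (f k)" and e: "0 < e"
  shows "REP m (\<lambda>k l s. u s * Lam (g k) (f l) s) (vec_norm \<mu> q m g * vec_norm \<mu> p m f + e)"
proof -
  define A where "A = vec_norm \<mu> q m g"
  define B where "B = vec_norm \<mu> p m f"
  have AB: "0 \<le> A" "0 \<le> B" by (auto simp: A_def B_def)
  \<comment> \<open>Chosen so that (A + \<delta>)(B + \<delta>) + \<delta> is at most A B + e; the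
    last \<delta> pays for the errors of the countably many pairs.\<close>
  define \<delta> where "\<delta> = min 1 (e / (A + B + 2))"
  have pos: "0 < A + B + 2" using AB by linarith
  have "\<delta> \<le> e / (A + B + 2)" by (simp add: \<delta>_def)
  then have "\<delta> * (A + B + 2) \<le> e" by (simp only: pos_le_divide_eq[OF pos])
  moreover have "0 < \<delta>" "\<delta> \<le> 1" using e pos by (auto simp: \<delta>_def)
  ultimately have d: "0 < \<delta>" "\<delta> \<le> 1" "\<delta> * (A + B + 2) \<le> e" by auto
  obtain gh C where gh: "\<And>j :: nat. compact (C j)" "\<And>j l. l < m \<Longrightarrow> Lp_mem \<mu> q (gh j l)"
    "\<And>j l x. x \<notin> C j \<Longrightarrow> gh j l x = 0"
    "summable (\<lambda>j. vec_norm \<mu> q m (gh j))" "(\<Sum>j. vec_norm \<mu> q m (gh j)) \<le> vec_norm \<mu> q m g + \<delta>"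
    "\<And>l. l < m \<Longrightarrow> (\<lambda>n. Lp_norm \<mu> q (\<lambda>x. (\<Sum>j<n. gh j l x) - g l x)) \<longlonglongrightarrow> 0"
  proof (rule compact_decomposition[where r = q and m = m and f = g, OF p1(2) _ d(1)])
    fix l assume "l < m" then show "Lp_mem \<mu> q (g l)" by (rule g)
  qed (rule that)
  obtain fh D where fh: "\<And>j :: nat. compact (D j)" "\<And>j l. l < m \<Longrightarrow> Lp_mem \<mu> p (fh j l)"
    "\<And>j l x. x \<notin> D j \<Longrightarrow> fh j l x = 0"
    "summable (\<lambda>j. vec_norm \<mu> p m (fh j))" "(\<Sum>j. vec_norm \<mu> p m (fh j)) \<le> vec_norm \<mu> p m f + \<delta>"
    "\<And>l. l < m \<Longrightarrow> (\<lambda>n. Lp_norm \<mu> p (\<lambda>x. (\<Sum>j<n. fh j l x) - f l x)) \<longlonglongrightarrow> 0"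
  proof (rule compact_decomposition[where r = p and m = m and f = f, OF p1(1) _ d(1)])
    fix l assume "l < m" then show "Lp_mem \<mu> p (f l)" by (rule f)
  qed (rule that)
  define A' where "A' = (\<Sum>j. vec_norm \<mu> q m (gh j))"
  define B' where "B' = (\<Sum>j. vec_norm \<mu> p m (fh j))"
  have s1: "(\<lambda>j. vec_norm \<mu> q m (gh i) * vec_norm \<mu> p m (fh j)) sums (vec_norm \<mu> q m (gh i) * B')" for i
    unfolding B'_def by (intro sums_mult summable_sums fh)
  have s2: "(\<lambda>i. vec_norm \<mu> q m (gh i) * B') sums (A' * B')"
    unfolding A'_def by (intro sums_mult2 summable_sums gh)
  define i where "i n = fst (prod_decode n)" for n
  define j where "j n = snd (prod_decode n)" for n
  define x where "x n = vec_norm \<mu> q m (gh (i n)) * vec_norm \<mu> p m (fh (j n)) + \<delta> * (1/2) ^ Suc n" for n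
  have xs: "x sums (A' * B' + \<delta>)"
  proof -
    have a: "(\<lambda>n. vec_norm \<mu> q m (gh (i n)) * vec_norm \<mu> p m (fh (j n))) sums (A' * B')"
      unfolding i_def j_def
      by (rule double_series(3)[where f = "\<lambda>i j. vec_norm \<mu> q m (gh i) * vec_norm \<mu> p m (fh j)", OF _ s1 s2]) simp
    have "(\<lambda>n. \<delta> * (1/2) ^ Suc n) sums (\<delta> * 1)" by (intro sums_mult power_half_series)
    from sums_add[OF a this] show ?thesis unfolding x_def by simp
  qed
  have "REP m (\<lambda>k l s. u s * Lam (g k) (f l) s) (suminf x)"
  proof (rule REP_sums[where u = "\<lambda>n k l s. u s * Lam (gh (i n) k) (fh (j n) l) s"])
    fix n
    show "REP m (\<lambda>k l s. u s * Lam (gh (i n) k) (fh (j n) l) s) (x n)"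
      unfolding x_def
    proof (rule REP_compact[OF u S, where K = "C (i n) \<union> D (j n)" and g = "gh (i n)" and f = "fh (j n)" and e = "\<delta> * (1/2) ^ Suc n"])
      show "compact (C (i n) \<union> D (j n))" by (intro compact_Un gh fh)
      show "Lp_mem \<mu> q (gh (i n) k)" "Lp_mem \<mu> p (fh (j n) k)" if "k < m" for k using gh(2) fh(2) that by auto
      show "gh (i n) k x = 0" "fh (j n) k x = 0" if "x \<notin> C (i n) \<union> D (j n)" for k x using gh(3) fh(3) that by auto
      show "0 < \<delta> * (1/2) ^ Suc n" using d by simp
    qed
  next
    show "summable x" using xs by (rule sums_summable)
  next
    fix k l s assume kl: "k < m" "l < m"
    have bd: "norm (Lam (gh a k) (fh b l) s) \<le> vec_norm \<mu> q m (gh a) * vec_norm \<mu> p m (fh b)" for a b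
      by (rule order_trans[OF Lam_bound[OF gh(2)[OF kl(1)] fh(2)[OF kl(2)]] vec_prod_bound[OF kl, where g = "gh a" and f = "fh b"]])
    have ib: "(\<Sum>b. Lam (gh a k) (fh b l) s) = Lam (gh a k) (f l) s" for a
      using Lam_sums_right[OF gh(2)[OF kl(1)] fh(2)[OF kl(2)] f[OF kl(2)] fh(6)[OF kl(2)]] by (simp add: sums_iff)
    have ia: "(\<Sum>a. Lam (gh a k) (f l) s) = Lam (g k) (f l) s"
      using Lam_sums_left[OF f[OF kl(2)] gh(2)[OF kl(1)] g[OF kl(1)] gh(6)[OF kl(1)]] by (simp add: sums_iff)
    have "(\<lambda>n. Lam (gh (i n) k) (fh (j n) l) s) sums (\<Sum>a. \<Sum>b. Lam (gh a k) (fh b l) s)"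
      unfolding i_def j_def by (rule double_series(1)[where f = "\<lambda>a b. Lam (gh a k) (fh b l) s", OF bd s1 s2])
    then show "(\<lambda>n. u s * Lam (gh (i n) k) (fh (j n) l) s) sums (u s * Lam (g k) (f l) s)"
      unfolding ib ia by (rule sums_mult)
  qed
  moreover have "suminf x \<le> A * B + e"
  proof -
    have "suminf x = A' * B' + \<delta>" using xs by (simp add: sums_iff)
    also have "\<dots> \<le> (A + \<delta>) * (B + \<delta>) + \<delta>"
    proof (rule add_right_mono, rule mult_mono)
      show "A' \<le> A + \<delta>" using gh(5) by (simp add: A'_def A_def)
      show "B' \<le> B + \<delta>" using fh(5) by (simp add: B'_def B_def)
      show "0 \<le> A + \<delta>" using AB d by simp
      show "0 \<le> B'" unfolding B'_def by (intro suminf_nonneg fh) simp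
    qed
    also have "\<dots> = A * B + \<delta> * (A + B + \<delta> + 1)" by (simp add: algebra_simps)
    also have "\<dots> \<le> A * B + \<delta> * (A + B + 2)" using d by (intro add_left_mono mult_left_mono) auto
    also have "\<dots> \<le> A * B + e" using d by simp
    finally show ?thesis .
  qed
  ultimately show ?thesis unfolding A_def B_def by (rule REP_mono)
qed

end

section \<open>Matrix norms of operators through pairings\<close>

lemma le_mult_by_approx:
  fixes a x C :: real
  assumes "\<And>e. 0 < e \<Longrightarrow> a \<le> C * (x + e)" "0 \<le> C"
  shows "a \<le> C * x"
proof (rule field_le_epsilon)
  fix e :: real assume e: "0 < e"
  have "a \<le> C * (x + e / (C + 1))" by (rule assms(1)) (use e assms(2) in simp)
  also have "\<dots> = C * x + C / (C + 1) * e" by (simp add: distrib_left)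
  also have "\<dots> \<le> C * x + 1 * e" using e assms(2) by (intro add_left_mono mult_right_mono) auto
  finally show "a \<le> C * x + e" by simp
qed

context haar_group
begin

lemma dual_eq:
  assumes "Lp_mem \<mu> p f" "Lp_mem \<mu> p h" "\<And>g. Lp_mem \<mu> q g \<Longrightarrow> pairing \<mu> g f = pairing \<mu> g h"
  shows "AE x in \<mu>. f x = h x"
proof -
  have "AE x in \<mu>. f x + (-1) * h x = 0"
  proof (rule Lp_zero_dual[OF pq])
    show "Lp_mem \<mu> p (\<lambda>x. f x + (-1) * h x)" using Lp_mem_diff[OF assms(1,2)] p1 by simp
    fix g assume g: "Lp_mem \<mu> q g"
    show "pairing \<mu> g (\<lambda>x. f x + (-1) * h x) = 0"
      unfolding pairing_add_right[OF pq g assms(1,2)] assms(3)[OF g] by simp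
  qed
  then show ?thesis by (rule AE_mp) (rule AE_I2, simp)
qed

lemma pairing_cong_AE:
  assumes "AE x in \<mu>. f x = h x" "Lp_mem \<mu> p f" "Lp_mem \<mu> p h" "Lp_mem \<mu> q g"
  shows "pairing \<mu> g f = pairing \<mu> g h"
  unfolding pairing_def
proof (rule integral_cong_AE)
  note [measurable] = Lp_memD(1)[OF assms(2)] Lp_memD(1)[OF assms(3)] Lp_memD(1)[OF assms(4)]
  show "(\<lambda>x. g x * f x) \<in> borel_measurable \<mu>" by measurable
  show "(\<lambda>x. g x * h x) \<in> borel_measurable \<mu>" by measurable
  show "AE x in \<mu>. g x * f x = g x * h x" using assms(1) by (rule AE_mp) (rule AE_I2, simp)
qed

lemma Lam_cong_AE:
  assumes "AE x in \<mu>. f x = h x" "Lp_mem \<mu> p f" "Lp_mem \<mu> p h" "Lp_mem \<mu> q g"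
  shows "Lam g f s = Lam g h s"
  unfolding Lam_def
proof (rule pairing_cong_AE)
  show "AE x in \<mu>. lambda_p s f x = lambda_p s h x" unfolding lambda_p_def by (rule AE_shift) (rule assms(1))
qed (intro Lp_mem_lambda assms)+

lemma Lam_add_right:
  assumes "Lp_mem \<mu> q g" "Lp_mem \<mu> p f" "Lp_mem \<mu> p h"
  shows "Lam g (\<lambda>x. f x + c * h x) s = Lam g f s + c * Lam g h s"
  using pairing_add_right[OF pq assms(1) Lp_mem_lambda[OF assms(2)] Lp_mem_lambda[OF assms(3)]]
  unfolding Lam_def lambda_p_def .

lemma Lam_add_left:
  assumes "Lp_mem \<mu> p f" "Lp_mem \<mu> q g" "Lp_mem \<mu> q h"
  shows "Lam (\<lambda>x. g x + c * h x) f s = Lam g f s + c * Lam h f s"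
  using pairing_add_right[OF qp Lp_mem_lambda[OF assms(1)] assms(2,3)]
  unfolding Lam_def pairing_commute[of \<mu> _ "lambda_p s f"] .

text \<open>Test on the duality map of the image vector: the pairing becomes V^p and the test vector
  has norm V^(p/q), where V is the norm of the image of a unit vector.\<close>

lemma Lp_mat_norm_le_1I:
  assumes T: "\<And>k l. k < m \<Longrightarrow> l < m \<Longrightarrow> Lp_bdd_op \<mu> p (T k l)"
    and bd: "\<And>g f. (\<And>k. k < m \<Longrightarrow> Lp_mem \<mu> q (g k) \<and> Lp_mem \<mu> p (f k)) \<Longrightarrow>
      cmod (\<Sum>k<m. \<Sum>l<m. pairing \<mu> (g k) (T k l (f l))) \<le> vec_norm \<mu> q m g * vec_norm \<mu> p m f"
  shows "Lp_mat_norm \<mu> p m T \<le> 1"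
  unfolding Lp_mat_norm_def
proof (rule Sup_least)
  fix z assume "z \<in> {ereal ((\<Sum>k<m. (Lp_norm \<mu> p (\<lambda>x. \<Sum>l<m. T k l (f l) x)) powr p) powr (1 / p))
      | f. (\<forall>l<m. Lp_mem \<mu> p (f l)) \<and> (\<Sum>l<m. (Lp_norm \<mu> p (f l)) powr p) \<le> 1}"
  then obtain f where z: "z = ereal ((\<Sum>k<m. (Lp_norm \<mu> p (\<lambda>x. \<Sum>l<m. T k l (f l) x)) powr p) powr (1 / p))"
    and f: "\<forall>l<m. Lp_mem \<mu> p (f l)" and f1: "(\<Sum>l<m. (Lp_norm \<mu> p (f l)) powr p) \<le> 1"
    by blast
  define h where "h k = (\<lambda>x. \<Sum>l<m. T k l (f l) x)" for k
  define V where "V = vec_norm \<mu> p m h"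
  have mT: "Lp_mem \<mu> p (T k l (f l))" if "k < m" "l < m" for k l by (rule bdd_op_mem[OF T[OF that]]) (use f that in auto)
  have mh: "Lp_mem \<mu> p (h k)" if "k < m" for k unfolding h_def using mT that p1 by (intro Lp_mem_sum) auto
  have Vp: "V powr p = (\<Sum>k<m. Lp_norm \<mu> p (h k) powr p)" unfolding V_def by (rule vec_norm_powr) (use p1 in simp)
  have "(\<Sum>k<m. \<Sum>l<m. pairing \<mu> (\<lambda>x. conj_map p (h k x)) (T k l (f l))) = (\<Sum>k<m. of_real (Lp_norm \<mu> p (h k) powr p))"
  proof (intro sum.cong refl)
    fix k assume "k \<in> {..<m}" then have k: "k < m" by simp
    have "pairing \<mu> (\<lambda>x. conj_map p (h k x)) (h k) = (\<Sum>l<m. pairing \<mu> (\<lambda>x. conj_map p (h k x)) (T k l (f l)))"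
      unfolding h_def[of k] by (rule pairing_sum_right[OF pq]) (use Lp_mem_conj_map[OF pq mh[OF k]] mT k in \<open>auto simp: h_def\<close>)
    then show "(\<Sum>l<m. pairing \<mu> (\<lambda>x. conj_map p (h k x)) (T k l (f l))) = of_real (Lp_norm \<mu> p (h k) powr p)"
      unfolding pairing_conj_map[OF pq mh[OF k]] by simp
  qed
  then have e: "(\<Sum>k<m. \<Sum>l<m. pairing \<mu> (\<lambda>x. conj_map p (h k x)) (T k l (f l))) = of_real (V powr p)"
    unfolding Vp by simp
  have ng: "vec_norm \<mu> q m (\<lambda>k x. conj_map p (h k x)) = V powr (p / q)"
  proof -
    have "(\<Sum>k<m. Lp_norm \<mu> q (\<lambda>x. conj_map p (h k x)) powr q) = (\<Sum>k<m. Lp_norm \<mu> p (h k) powr p)"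
      by (intro sum.cong refl) (use conj_pair_eqs(3)[OF pq] in \<open>simp add: Lp_norm_conj_map[OF pq mh] powr_powr\<close>)
    then show ?thesis unfolding vec_norm_def Vp[symmetric] by (simp add: powr_powr)
  qed
  have "vec_norm \<mu> p m f \<le> 1 powr (1/p)" unfolding vec_norm_def using f1 p1 by (intro powr_mono2 sum_nonneg) auto
  then have nf: "vec_norm \<mu> p m f \<le> 1" by simp
  have "cmod (\<Sum>k<m. \<Sum>l<m. pairing \<mu> (\<lambda>x. conj_map p (h k x)) (T k l (f l)))
     \<le> vec_norm \<mu> q m (\<lambda>k x. conj_map p (h k x)) * vec_norm \<mu> p m f"
    by (rule bd) (use Lp_mem_conj_map[OF pq mh] f in auto)
  then have "V powr p \<le> V powr (p / q) * vec_norm \<mu> p m f" unfolding e ng by simp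
  also have "\<dots> \<le> V powr (p / q) * 1" by (intro mult_left_mono nf) simp
  finally have le: "V powr p \<le> V powr (p / q)" by simp
  \<comment> \<open>p/q is smaller than p, so V^p \<le> V^(p/q) excludes V > 1.\<close>
  have "V \<le> 1"
  proof (rule ccontr)
    assume "\<not> V \<le> 1"
    moreover have "p / q < p" using p1 by (simp add: divide_less_eq)
    ultimately have "V powr (p / q) < V powr p" by (intro powr_less_mono) auto
    with le show False by simp
  qed
  then show "z \<le> 1" unfolding z V_def vec_norm_def h_def by (simp add: one_ereal_def)
qed

text \<open>The norm speaks about unit vectors only; homogeneity extends it to all f, and Hoelder,
  on components and across components, gives the pairing bound.\<close>

lemma Lp_mat_norm_le_1D:
  assumes T: "\<And>k l. k < m \<Longrightarrow> l < m \<Longrightarrow> Lp_bdd_op \<mu> p (T k l)" and n: "Lp_mat_norm \<mu> p m T \<le> 1"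
    and gf: "\<And>k. k < m \<Longrightarrow> Lp_mem \<mu> q (g k) \<and> Lp_mem \<mu> p (f k)"
  shows "cmod (\<Sum>k<m. \<Sum>l<m. pairing \<mu> (g k) (T k l (f l))) \<le> vec_norm \<mu> q m g * vec_norm \<mu> p m f"
proof -
  define h where "h f k = (\<lambda>x. \<Sum>l<m. T k l (f l) x)" for f k
  have mT: "Lp_mem \<mu> p (T k l (f l))" if "k < m" "l < m" "\<And>k. k < m \<Longrightarrow> Lp_mem \<mu> p (f k)" for k l f
    by (rule bdd_op_mem[OF T[OF that(1,2)]]) (use that in auto)
  have mh: "Lp_mem \<mu> p (h f k)" if "k < m" "\<And>k. k < m \<Longrightarrow> Lp_mem \<mu> p (f k)" for f k
    unfolding h_def using mT that p1 by (intro Lp_mem_sum) auto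
  have unit: "vec_norm \<mu> p m (h f) \<le> 1" if f: "\<And>k. k < m \<Longrightarrow> Lp_mem \<mu> p (f k)" and f1: "vec_norm \<mu> p m f \<le> 1" for f
  proof -
    have "vec_norm \<mu> p m f powr p \<le> 1 powr p" using f1 p1 by (intro powr_mono2) auto
    then have "(\<Sum>l<m. (Lp_norm \<mu> p (f l)) powr p) \<le> 1" using p1 by (simp add: vec_norm_powr)
    then have "ereal (vec_norm \<mu> p m (h f)) \<le> Lp_mat_norm \<mu> p m T"
      unfolding Lp_mat_norm_def by (intro Sup_upper CollectI exI[of _ f]) (use f in \<open>simp add: vec_norm_def h_def\<close>)
    then have "ereal (vec_norm \<mu> p m (h f)) \<le> 1" using n by (rule order_trans)
    then show ?thesis by (simp add: one_ereal_def)
  qed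
  have f: "\<And>k. k < m \<Longrightarrow> Lp_mem \<mu> p (f k)" and g: "\<And>k. k < m \<Longrightarrow> Lp_mem \<mu> q (g k)" using gf by auto
  have hb: "vec_norm \<mu> p m (h f) \<le> vec_norm \<mu> p m f"
  proof (rule field_le_epsilon)
    fix d :: real assume d: "0 < d"
    \<comment> \<open>Adding d keeps the scaling factor finite when f has norm 0.\<close>
    define c :: real where "c = inverse (vec_norm \<mu> p m f + d)"
    have N: "0 < vec_norm \<mu> p m f + d" by (rule add_nonneg_pos[OF _ d]) simp
    have c: "0 < c" unfolding c_def using N by simp
    let ?f = "\<lambda>l x. complex_of_real c * f l x"
    have cf: "\<And>k. k < m \<Longrightarrow> Lp_mem \<mu> p (?f k)" using f by (intro Lp_mem_cmult)
    have "vec_norm \<mu> p m ?f = c * vec_norm \<mu> p m f" using vec_norm_cmult[OF p1(3), where c = "of_real c"] c by simp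
    also have "\<dots> \<le> c * (vec_norm \<mu> p m f + d)" using c d by (intro mult_left_mono) auto
    also have "\<dots> = 1" unfolding c_def using N by simp
    finally have cf1: "vec_norm \<mu> p m ?f \<le> 1" .
    have u: "vec_norm \<mu> p m (h ?f) \<le> 1" by (rule unit[OF _ cf1]) (rule cf)
    have "Lp_norm \<mu> p (h ?f k) = c * Lp_norm \<mu> p (h f k)" if k: "k < m" for k
    proof -
      \<comment> \<open>Operators act on representatives and are linear only almost everywhere; even
        T 0 = 0 holds only in that sense and is derived from additivity.\<close>
      have "AE x in \<mu>. \<forall>l\<in>{..<m}. T k l (?f l) x = of_real c * T k l (f l) x"
      proof (rule AE_finite_allI)
        fix l assume "l \<in> {..<m}" then have l: "l < m" by simp
        have z2: "AE x in \<mu>. T k l (\<lambda>y. 0 + 1 * 0) x = T k l (\<lambda>y. 0) x + 1 * T k l (\<lambda>y. 0) x"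
          by (rule bdd_op_lin[OF T[OF k l]]) auto
        have a: "AE x in \<mu>. T k l (\<lambda>y. 0 + of_real c * f l y) x = T k l (\<lambda>y. 0) x + of_real c * T k l (f l) x"
          by (rule bdd_op_lin[OF T[OF k l]]) (use f l in auto)
        show "AE x in \<mu>. T k l (?f l) x = of_real c * T k l (f l) x" using z2 a by eventually_elim simp
      qed simp
      then have "AE x in \<mu>. h ?f k x = of_real c * h f k x"
        unfolding h_def sum_distrib_left by eventually_elim (rule sum.cong, auto)
      then have "Lp_norm \<mu> p (h ?f k) = Lp_norm \<mu> p (\<lambda>x. of_real c * h f k x)"
        by (rule Lp_norm_cong_AE) (rule Lp_memD[OF mh[OF k cf]], assumption, rule Lp_memD[OF Lp_mem_cmult[OF mh[OF k f]]], assumption)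
      then show ?thesis using Lp_norm_cmult[OF p1(3), where c = "of_real c"] c by simp
    qed
    then have "vec_norm \<mu> p m (h ?f) = vec_norm \<mu> p m (\<lambda>k x. of_real c * h f k x)"
      unfolding vec_norm_def using c p1 by (simp add: Lp_norm_cmult)
    then have "c * vec_norm \<mu> p m (h f) \<le> 1" using u c p1 by (simp add: vec_norm_cmult)
    then have "(vec_norm \<mu> p m f + d) * (c * vec_norm \<mu> p m (h f)) \<le> (vec_norm \<mu> p m f + d) * 1"
      using N by (intro mult_left_mono) auto
    then show "vec_norm \<mu> p m (h f) \<le> vec_norm \<mu> p m f + d" unfolding c_def using N by (simp add: mult.assoc[symmetric])
  qed
  have "(\<Sum>k<m. \<Sum>l<m. pairing \<mu> (g k) (T k l (f l))) = (\<Sum>k<m. pairing \<mu> (g k) (h f k))"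
    unfolding h_def by (intro sum.cong refl, rule pairing_sum_right[OF pq, symmetric]) (use g mT f in auto)
  then have "cmod (\<Sum>k<m. \<Sum>l<m. pairing \<mu> (g k) (T k l (f l))) = cmod (\<Sum>k<m. pairing \<mu> (g k) (h f k))" by (rule arg_cong)
  also have "\<dots> \<le> (\<Sum>k<m. Lp_norm \<mu> q (g k) * Lp_norm \<mu> p (h f k))"
    by (intro sum_norm_le Holder_pairing[OF pq]) (use g mh f in auto)
  also have "\<dots> \<le> vec_norm \<mu> q m g * vec_norm \<mu> p m (h f)" by (rule vec_Holder[OF pq])
  also have "\<dots> \<le> vec_norm \<mu> q m g * vec_norm \<mu> p m f" by (intro mult_left_mono hb) simp
  finally show ?thesis .
qed

end

section \<open>The adjoint of multiplication by u on PM_p\<close>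

locale schur_group = haar_group \<mu> p q
  for \<mu> :: "'g::{topological_group_add, t2_space} measure" and p q :: real +
  fixes u :: "'g \<Rightarrow> complex"
  assumes u: "continuous_on UNIV u" and S: "schur_bd p q 1 (\<lambda>(s, t). u (s + - t))"
begin

lemma mult_Lam_rep:
  assumes g: "Lp_mem \<mu> q g" and f: "Lp_mem \<mu> p f" and e: "0 < e"
  shows "\<exists>G F. Ap_rep \<mu> p (\<lambda>s. u s * Lam g f s) G F \<and>
    (\<Sum>n. Lp_norm \<mu> q (G n) * Lp_norm \<mu> p (F n)) \<le> Lp_norm \<mu> q g * Lp_norm \<mu> p f + e"
proof -
  have "REP (Suc 0) (\<lambda>k l s. u s * Lam g f s) (vec_norm \<mu> q (Suc 0) (\<lambda>_. g) * vec_norm \<mu> p (Suc 0) (\<lambda>_. f) + e)"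
    by (rule REP_mult[OF u S g f e])
  then obtain G F where R: "REP_by (Suc 0) (\<lambda>k l s. u s * Lam g f s) (Lp_norm \<mu> q g * Lp_norm \<mu> p f + e) G F"
    unfolding REP_def vec_norm_1[OF p1(3)] vec_norm_1[OF p1(4)] by (elim exE)
  note D = REP_byD[OF R]
  have "Ap_rep \<mu> p (\<lambda>s. u s * Lam g f s) (\<lambda>n. G n 0) (\<lambda>n. F n 0)"
    unfolding Ap_rep_iff using D(1)[of 0] D(2) D(4)[of 0 0] p1 by (auto simp: sums_iff)
  moreover have "(\<Sum>n. Lp_norm \<mu> q (G n 0) * Lp_norm \<mu> p (F n 0)) \<le> Lp_norm \<mu> q g * Lp_norm \<mu> p f + e"
    using D(3) p1 by simp
  ultimately show ?thesis
    by (intro exI[of _ "\<lambda>n. F n 0"] exI[of _ "\<lambda>n. G n 0"] conjI)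
qed

lemma mult_Lam_mem: "Lp_mem \<mu> q g \<Longrightarrow> Lp_mem \<mu> p f \<Longrightarrow> (\<lambda>s. u s * Lam g f s) \<in> Ap \<mu> p"
  using mult_Lam_rep[of g f 1] unfolding Ap_def by auto

text \<open>Each elementary coefficient in the expansion of a is multiplied separately, with excess
  cost (1/2)^i, and the results are concatenated. The second conclusion, additivity of the pairing
  along this series, is what \<open>tfun_MT\<close> rests on.\<close>

lemma mult_rep:
  assumes a: "Ap_rep \<mu> p a gs fs"
  shows "\<exists>G F. Ap_rep \<mu> p (\<lambda>s. u s * a s) G F \<and>
    (\<forall>T\<in>PMp \<mu> p. (\<lambda>i. pm_pair \<mu> p T (\<lambda>s. u s * Lam (gs i) (fs i) s)) sums pm_pair \<mu> p T (\<lambda>s. u s * a s))"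
proof -
  note r = Ap_rep_ptensor[OF a, unfolded ptensor_iff]
  have gs: "Lp_mem \<mu> q (gs i)" and fs: "Lp_mem \<mu> p (fs i)" for i using r by auto
  have "\<forall>i. \<exists>G F. Ap_rep \<mu> p (\<lambda>s. u s * Lam (gs i) (fs i) s) G F \<and>
    (\<Sum>n. Lp_norm \<mu> q (G n) * Lp_norm \<mu> p (F n)) \<le> Lp_norm \<mu> q (gs i) * Lp_norm \<mu> p (fs i) + (1/2) ^ i"
    by (intro allI mult_Lam_rep gs fs) simp
  from choice[OF this] obtain G where "\<forall>i. \<exists>F. Ap_rep \<mu> p (\<lambda>s. u s * Lam (gs i) (fs i) s) (G i) F \<and>
    (\<Sum>n. Lp_norm \<mu> q (G i n) * Lp_norm \<mu> p (F n)) \<le> Lp_norm \<mu> q (gs i) * Lp_norm \<mu> p (fs i) + (1/2) ^ i" ..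
  from choice[OF this] obtain F where "\<forall>i. Ap_rep \<mu> p (\<lambda>s. u s * Lam (gs i) (fs i) s) (G i) (F i) \<and>
    (\<Sum>n. Lp_norm \<mu> q (G i n) * Lp_norm \<mu> p (F i n)) \<le> Lp_norm \<mu> q (gs i) * Lp_norm \<mu> p (fs i) + (1/2) ^ i" ..
  then have GF: "Ap_rep \<mu> p (\<lambda>s. u s * Lam (gs i) (fs i) s) (G i) (F i)"
    "(\<Sum>n. Lp_norm \<mu> q (G i n) * Lp_norm \<mu> p (F i n)) \<le> Lp_norm \<mu> q (gs i) * Lp_norm \<mu> p (fs i) + (1/2) ^ i" for i by simp_all
  have sm: "summable (\<lambda>i. \<Sum>n. Lp_norm \<mu> q (G i n) * Lp_norm \<mu> p (F i n))"
  proof (rule summable_comparison_test'[where N = 0])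
    show "summable (\<lambda>i. Lp_norm \<mu> q (gs i) * Lp_norm \<mu> p (fs i) + (1/2) ^ i)"
      using r by (intro summable_add summable_geometric) auto
    fix i
    have "0 \<le> (\<Sum>n. Lp_norm \<mu> q (G i n) * Lp_norm \<mu> p (F i n))"
      by (rule suminf_nonneg) (use GF(1)[of i] in \<open>auto simp: Ap_rep_iff\<close>)
    then show "norm (\<Sum>n. Lp_norm \<mu> q (G i n) * Lp_norm \<mu> p (F i n)) \<le> Lp_norm \<mu> q (gs i) * Lp_norm \<mu> p (fs i) + (1/2) ^ i"
      using GF(2)[of i] by simp
  qed
  have su: "(\<lambda>i. u s * Lam (gs i) (fs i) s) sums (u s * a s)" for s
    unfolding Ap_rep_eq[OF a] by (intro sums_mult summable_sums summable_norm_cancel[OF summable_Lam[OF Ap_rep_ptensor[OF a]]])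
  note rep = Ap_rep_sums[OF GF(1) sm su]
  show ?thesis
  proof (rule exI, rule exI, rule conjI, rule rep(1), rule ballI)
    fix T assume T: "T \<in> PMp \<mu> p"
    show "(\<lambda>i. pm_pair \<mu> p T (\<lambda>s. u s * Lam (gs i) (fs i) s)) sums pm_pair \<mu> p T (\<lambda>s. u s * a s)"
      unfolding pm_pair_eq[OF T GF(1)] pm_pair_eq[OF T rep(1)] by (rule rep(2)[OF PMp_bdd[OF T]])
  qed
qed

lemma mult_Ap: "a \<in> Ap \<mu> p \<Longrightarrow> (\<lambda>s. u s * a s) \<in> Ap \<mu> p"
  unfolding Ap_def using mult_rep by fast

lemma pm_pair_mult_Lam_bound:
  assumes T: "T \<in> PMp \<mu> p" and C: "0 \<le> C" "\<And>f. Lp_mem \<mu> p f \<Longrightarrow> Lp_norm \<mu> p (T f) \<le> C * Lp_norm \<mu> p f"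
    and g: "Lp_mem \<mu> q g" and f: "Lp_mem \<mu> p f"
  shows "cmod (pm_pair \<mu> p T (\<lambda>s. u s * Lam g f s)) \<le> C * (Lp_norm \<mu> q g * Lp_norm \<mu> p f)"
proof (rule le_mult_by_approx[OF _ C(1)])
  fix e :: real assume e: "0 < e"
  obtain G F where GF: "Ap_rep \<mu> p (\<lambda>s. u s * Lam g f s) G F"
    "(\<Sum>n. Lp_norm \<mu> q (G n) * Lp_norm \<mu> p (F n)) \<le> Lp_norm \<mu> q g * Lp_norm \<mu> p f + e"
    using mult_Lam_rep[OF g f e] by (elim exE conjE)
  note r = Ap_rep_ptensor[OF GF(1)]
  have mem: "Lp_mem \<mu> q (G n)" "Lp_mem \<mu> p (F n)" for n using r by (auto simp: ptensor_iff)
  have sm: "summable (\<lambda>n. Lp_norm \<mu> q (G n) * Lp_norm \<mu> p (F n))" using r by (simp add: ptensor_iff)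
  have le: "cmod (pairing \<mu> (G n) (T (F n))) \<le> C * (Lp_norm \<mu> q (G n) * Lp_norm \<mu> p (F n))" for n
  proof -
    have "cmod (pairing \<mu> (G n) (T (F n))) \<le> Lp_norm \<mu> q (G n) * Lp_norm \<mu> p (T (F n))"
      by (rule Holder_pairing[OF pq mem(1) bdd_op_mem[OF PMp_bdd[OF T] mem(2)]])
    also have "\<dots> \<le> Lp_norm \<mu> q (G n) * (C * Lp_norm \<mu> p (F n))" by (intro mult_left_mono C(2) mem) simp
    finally show ?thesis by (simp only: mult_ac)
  qed
  have "cmod (pm_pair \<mu> p T (\<lambda>s. u s * Lam g f s)) \<le> (\<Sum>n. cmod (pairing \<mu> (G n) (T (F n))))"
    unfolding pm_pair_eq[OF T GF(1)] tfun_def by (rule summable_norm[OF summable_tfun[OF PMp_bdd[OF T] r]])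
  also have "\<dots> \<le> (\<Sum>n. C * (Lp_norm \<mu> q (G n) * Lp_norm \<mu> p (F n)))"
    by (rule suminf_le[OF le summable_tfun[OF PMp_bdd[OF T] r] summable_mult[OF sm]])
  also have "\<dots> = C * (\<Sum>n. Lp_norm \<mu> q (G n) * Lp_norm \<mu> p (F n))" by (rule suminf_mult[OF sm])
  also have "\<dots> \<le> C * (Lp_norm \<mu> q g * Lp_norm \<mu> p f + e)" by (rule mult_left_mono[OF GF(2) C(1)])
  finally show "cmod (pm_pair \<mu> p T (\<lambda>s. u s * Lam g f s)) \<le> C * (Lp_norm \<mu> q g * Lp_norm \<mu> p f + e)" .
qed

text \<open>The adjoint of a \<mapsto> u a, produced vector by vector: for fixed f the pairing of T
  with u <g, lambda(.) f> is a bounded functional of g, represented by an L_p function through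
  \<open>Lp_dual\<close>. It is determined up to null sets.\<close>

definition MT :: "(('g \<Rightarrow> complex) \<Rightarrow> ('g \<Rightarrow> complex)) \<Rightarrow> ('g \<Rightarrow> complex) \<Rightarrow> ('g \<Rightarrow> complex)" where
  "MT T f = (SOME h. Lp_mem \<mu> p h \<and> (\<forall>g. Lp_mem \<mu> q g \<longrightarrow> pairing \<mu> g h = pm_pair \<mu> p T (\<lambda>s. u s * Lam g f s)))"

lemma
  assumes T: "T \<in> PMp \<mu> p" and f: "Lp_mem \<mu> p f"
  shows MT_mem: "Lp_mem \<mu> p (MT T f)"
    and pairing_MT: "\<And>g. Lp_mem \<mu> q g \<Longrightarrow> pairing \<mu> g (MT T f) = pm_pair \<mu> p T (\<lambda>s. u s * Lam g f s)"
proof -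
  obtain C where C: "0 \<le> C" "\<forall>f. Lp_mem \<mu> p f \<longrightarrow> Lp_norm \<mu> p (T f) \<le> C * Lp_norm \<mu> p f"
    using bdd_op_bound[OF PMp_bdd[OF T]] by (elim exE conjE)
  have "\<exists>h. Lp_mem \<mu> p h \<and> (\<forall>g. Lp_mem \<mu> q g \<longrightarrow> pairing \<mu> g h = pm_pair \<mu> p T (\<lambda>s. u s * Lam g f s))"
  proof (rule Lp_dual[OF pq, where \<phi> = "\<lambda>g. pm_pair \<mu> p T (\<lambda>s. u s * Lam g f s)" and C = "C * Lp_norm \<mu> p f"])
    fix g h c assume gh: "Lp_mem \<mu> q g" "Lp_mem \<mu> q h"
    have "(\<lambda>s. u s * Lam (\<lambda>x. g x + c * h x) f s) = (\<lambda>s. u s * Lam g f s + c * (u s * Lam h f s))"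
      unfolding Lam_add_left[OF f gh] by (simp only: distrib_left mult_ac)
    then show "pm_pair \<mu> p T (\<lambda>s. u s * Lam (\<lambda>x. g x + c * h x) f s) = pm_pair \<mu> p T (\<lambda>s. u s * Lam g f s) + c * pm_pair \<mu> p T (\<lambda>s. u s * Lam h f s)"
      using pm_pair_linear(2)[OF T mult_Lam_mem[OF gh(1) f] mult_Lam_mem[OF gh(2) f]] by simp
  next
    fix g assume "Lp_mem \<mu> q g"
    from pm_pair_mult_Lam_bound[OF T C(1) C(2)[rule_format] this f]
    show "cmod (pm_pair \<mu> p T (\<lambda>s. u s * Lam g f s)) \<le> C * Lp_norm \<mu> p f * Lp_norm \<mu> q g" by (simp only: mult_ac)
  next
    fix h assume h: "Lp_mem \<mu> p h" "\<And>g. Lp_mem \<mu> q g \<Longrightarrow> pm_pair \<mu> p T (\<lambda>s. u s * Lam g f s) = pairing \<mu> g h"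
    show ?thesis by (rule exI[of _ h]) (use h in simp)
  qed
  from someI_ex[OF this, folded MT_def]
  show "Lp_mem \<mu> p (MT T f)" "\<And>g. Lp_mem \<mu> q g \<Longrightarrow> pairing \<mu> g (MT T f) = pm_pair \<mu> p T (\<lambda>s. u s * Lam g f s)" by auto
qed

lemma MT_bdd:
  assumes T: "T \<in> PMp \<mu> p"
  shows "Lp_bdd_op \<mu> p (MT T)"
  unfolding Lp_bdd_op_def
proof (intro conjI allI impI; (elim conjE)?)
  fix f assume f: "Lp_mem \<mu> p f"
  show "Lp_mem \<mu> p (MT T f)" by (rule MT_mem[OF T f])
next
  fix f h assume fh: "Lp_mem \<mu> p f" "Lp_mem \<mu> p h" "AE x in \<mu>. f x = h x"
  show "AE x in \<mu>. MT T f x = MT T h x"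
    by (rule dual_eq) (auto simp: MT_mem[OF T] pairing_MT[OF T] fh Lam_cong_AE[OF fh(3,1,2)])
next
  fix f h c assume fh: "Lp_mem \<mu> p f" "Lp_mem \<mu> p h"
  have fc: "Lp_mem \<mu> p (\<lambda>y. f y + c * h y)" using fh p1 by (intro Lp_mem_add Lp_mem_cmult)
  show "AE x in \<mu>. MT T (\<lambda>y. f y + c * h y) x = MT T f x + c * MT T h x"
  proof (rule dual_eq)
    show "Lp_mem \<mu> p (MT T (\<lambda>y. f y + c * h y))" by (rule MT_mem[OF T fc])
    show "Lp_mem \<mu> p (\<lambda>x. MT T f x + c * MT T h x)" using MT_mem[OF T] fh p1 by (intro Lp_mem_add Lp_mem_cmult)
    fix g assume g: "Lp_mem \<mu> q g"
    have "(\<lambda>s. u s * Lam g (\<lambda>y. f y + c * h y) s) = (\<lambda>s. u s * Lam g f s + c * (u s * Lam g h s))"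
      unfolding Lam_add_right[OF g fh] by (simp only: distrib_left mult_ac)
    then show "pairing \<mu> g (MT T (\<lambda>y. f y + c * h y)) = pairing \<mu> g (\<lambda>x. MT T f x + c * MT T h x)"
      unfolding pairing_add_right[OF pq g MT_mem[OF T fh(1)] MT_mem[OF T fh(2)]]
        pairing_MT[OF T fh(1) g] pairing_MT[OF T fh(2) g] pairing_MT[OF T fc g]
      using pm_pair_linear(2)[OF T mult_Lam_mem[OF g fh(1)] mult_Lam_mem[OF g fh(2)]] by simp
  qed
next
  obtain C where C: "0 \<le> C" "\<forall>f. Lp_mem \<mu> p f \<longrightarrow> Lp_norm \<mu> p (T f) \<le> C * Lp_norm \<mu> p f"
    using bdd_op_bound[OF PMp_bdd[OF T]] by (elim exE conjE)
  show "\<exists>C. \<forall>f. Lp_mem \<mu> p f \<longrightarrow> Lp_norm \<mu> p (MT T f) \<le> C * Lp_norm \<mu> p f"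
  proof (intro exI[of _ C] allI impI)
    fix f assume f: "Lp_mem \<mu> p f"
    show "Lp_norm \<mu> p (MT T f) \<le> C * Lp_norm \<mu> p f"
    proof (rule Lp_norm_le_dual[OF pq MT_mem[OF T f]])
      fix g assume g: "Lp_mem \<mu> q g"
      show "cmod (pairing \<mu> g (MT T f)) \<le> C * Lp_norm \<mu> p f * Lp_norm \<mu> q g"
        unfolding pairing_MT[OF T f g] using pm_pair_mult_Lam_bound[OF T C(1) C(2)[rule_format] g f] by (simp only: mult_ac)
    qed (use C in simp)
  qed
qed

lemma tfun_MT:
  assumes T: "T \<in> PMp \<mu> p" and a: "Ap_rep \<mu> p a gs fs"
  shows "tfun \<mu> gs fs (MT T) = pm_pair \<mu> p T (\<lambda>s. u s * a s)"
proof -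
  have m: "Lp_mem \<mu> q (gs n)" "Lp_mem \<mu> p (fs n)" for n using a by (auto simp: Ap_rep_iff)
  have "(\<lambda>i. pm_pair \<mu> p T (\<lambda>s. u s * Lam (gs i) (fs i) s)) sums pm_pair \<mu> p T (\<lambda>s. u s * a s)"
    using mult_rep[OF a] T by blast
  then show ?thesis unfolding tfun_def pairing_MT[OF T m(2) m(1)] by (simp add: sums_iff)
qed

text \<open>On the span of translations the adjoint multiplies the coefficient at s_j by u(s_j). If
  such a combination approximates T on the tensors representing u a_i, the modified combination
  approximates \<open>MT T\<close> on those representing a_i.\<close>

lemma MT_PMp:
  assumes T: "T \<in> PMp \<mu> p"
  shows "MT T \<in> PMp \<mu> p"
  unfolding PMp_def
proof (intro CollectI conjI allI impI MT_bdd[OF T])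
  fix k :: nat and gs fs :: "nat \<Rightarrow> nat \<Rightarrow> 'g \<Rightarrow> complex" and e :: real
  assume "(\<forall>i<k. ptensor \<mu> p (gs i) (fs i)) \<and> 0 < e"
  then have pt: "\<And>i. i < k \<Longrightarrow> ptensor \<mu> p (gs i) (fs i)" and e: "0 < e" by auto
  define a where "a i s = (\<Sum>n. Lam (gs i n) (fs i n) s)" for i s
  have rep: "Ap_rep \<mu> p (a i) (gs i) (fs i)" if "i < k" for i
    using pt[OF that] unfolding Ap_rep_def by (simp add: a_def Lam_def)
  have "\<exists>G. i < k \<longrightarrow> (\<exists>F. Ap_rep \<mu> p (\<lambda>s. u s * a i s) G F)" for i
  proof (cases "i < k")
    case True
    from mult_rep[OF rep[OF True]] show ?thesis by (elim exE conjE) (rule exI, rule impI, rule exI)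
  qed simp
  then have "\<forall>i. \<exists>G. i < k \<longrightarrow> (\<exists>F. Ap_rep \<mu> p (\<lambda>s. u s * a i s) G F)" ..
  from choice[OF this] obtain G where "\<forall>i. i < k \<longrightarrow> (\<exists>F. Ap_rep \<mu> p (\<lambda>s. u s * a i s) (G i) F)" ..
  then have "\<forall>i. \<exists>F. i < k \<longrightarrow> Ap_rep \<mu> p (\<lambda>s. u s * a i s) (G i) F" by simp
  from choice[OF this] obtain F where "\<forall>i. i < k \<longrightarrow> Ap_rep \<mu> p (\<lambda>s. u s * a i s) (G i) (F i)" ..
  then have GF: "Ap_rep \<mu> p (\<lambda>s. u s * a i s) (G i) (F i)" if "i < k" for i using that by simp
  have "(\<forall>i<k. ptensor \<mu> p (G i) (F i)) \<and> 0 < e" using Ap_rep_ptensor[OF GF] e by simp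
  then have "\<exists>R\<in>lambda_span. \<forall>i<k. cmod (tfun \<mu> (G i) (F i) R - tfun \<mu> (G i) (F i) T) < e"
    using T unfolding PMp_def by blast
  then obtain R where R: "R \<in> lambda_span" "\<forall>i<k. cmod (tfun \<mu> (G i) (F i) R - tfun \<mu> (G i) (F i) T) < e" by (elim bexE)
  then obtain N :: nat and c s where Req: "R = (\<lambda>f t. \<Sum>j<N. c j * lambda_p (s j) f t)" unfolding lambda_span_def by blast
  \<comment> \<open>R with its coefficients multiplied by the values of u.\<close>
  define R' where "R' = (\<lambda>f t. \<Sum>j<N. (c j * u (s j)) * lambda_p (s j) f t)"
  show "\<exists>S\<in>lambda_span. \<forall>i<k. cmod (tfun \<mu> (gs i) (fs i) S - tfun \<mu> (gs i) (fs i) (MT T)) < e"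
  proof (rule bexI[of _ R'], intro allI impI)
    show "R' \<in> lambda_span" unfolding lambda_span_def R'_def
      by (rule CollectI, rule exI[of _ N], rule exI[of _ "\<lambda>j. c j * u (s j)"], rule exI[of _ s]) simp
    fix i assume i: "i < k"
    have "tfun \<mu> (G i) (F i) R = (\<Sum>j<N. c j * (u (s j) * a i (s j)))"
      unfolding Req tfun_span[OF Ap_rep_ptensor[OF GF[OF i]]] Ap_rep_eq[OF GF[OF i], symmetric] ..
    moreover have "tfun \<mu> (gs i) (fs i) R' = (\<Sum>j<N. c j * u (s j) * a i (s j))"
      unfolding R'_def tfun_span[OF pt[OF i]] a_def ..
    ultimately have 1: "tfun \<mu> (gs i) (fs i) R' = tfun \<mu> (G i) (F i) R" by (simp add: mult.assoc)
    have 2: "tfun \<mu> (gs i) (fs i) (MT T) = tfun \<mu> (G i) (F i) T"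
      unfolding tfun_MT[OF T rep[OF i]] by (rule pm_pair_eq[OF T GF[OF i]])
    show "cmod (tfun \<mu> (gs i) (fs i) R' - tfun \<mu> (gs i) (fs i) (MT T)) < e" unfolding 1 2 using R(2) i by simp
  qed
qed

lemma pm_pair_MT:
  assumes T: "T \<in> PMp \<mu> p" and a: "a \<in> Ap \<mu> p"
  shows "pm_pair \<mu> p (MT T) a = pm_pair \<mu> p T (\<lambda>s. u s * a s)"
proof -
  obtain gs fs where r: "Ap_rep \<mu> p a gs fs" using a unfolding Ap_def by blast
  show ?thesis unfolding pm_pair_eq[OF MT_PMp[OF T] r] by (rule tfun_MT[OF T r])
qed

text \<open>Complete contractivity of the adjoint. The pairings with all entries are evaluated on
  one common expansion from \<open>REP_mult\<close>, on which the contractive matrix T acts as a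
  whole; here the vector form of the expansion is essential.\<close>

lemma MT_mat_norm:
  assumes T: "\<And>k l. k < m \<Longrightarrow> l < m \<Longrightarrow> T k l \<in> PMp \<mu> p" and n: "Lp_mat_norm \<mu> p m T \<le> 1"
  shows "Lp_mat_norm \<mu> p m (\<lambda>k l. MT (T k l)) \<le> 1"
proof (rule Lp_mat_norm_le_1I)
  show "Lp_bdd_op \<mu> p (MT (T k l))" if "k < m" "l < m" for k l by (rule MT_bdd[OF T[OF that]])
  fix g f assume gf: "\<And>k. k < m \<Longrightarrow> Lp_mem \<mu> q (g k) \<and> Lp_mem \<mu> p (f k)"
  have g: "\<And>k. k < m \<Longrightarrow> Lp_mem \<mu> q (g k)" and f: "\<And>k. k < m \<Longrightarrow> Lp_mem \<mu> p (f k)" using gf by auto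
  have e: "(\<Sum>k<m. \<Sum>l<m. pairing \<mu> (g k) (MT (T k l) (f l))) = (\<Sum>k<m. \<Sum>l<m. pm_pair \<mu> p (T k l) (\<lambda>s. u s * Lam (g k) (f l) s))"
    by (intro sum.cong refl pairing_MT T f g) auto
  show "cmod (\<Sum>k<m. \<Sum>l<m. pairing \<mu> (g k) (MT (T k l) (f l))) \<le> vec_norm \<mu> q m g * vec_norm \<mu> p m f"
  proof (rule field_le_epsilon)
    fix d :: real assume d: "0 < d"
    show "cmod (\<Sum>k<m. \<Sum>l<m. pairing \<mu> (g k) (MT (T k l) (f l))) \<le> vec_norm \<mu> q m g * vec_norm \<mu> p m f + d"
      unfolding e
      by (rule REP_pm_pair_bound[OF REP_mult[OF u S g f d] T Lp_mat_norm_le_1D[OF PMp_bdd[OF T] n]])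
  qed
qed

text \<open>u is moved from tau to T by \<open>pm_pair_MT\<close>; the matrix of adjoints is again
  admissible in the supremum defining the norm of tau.\<close>

lemma Ap_mat_norm_mult:
  assumes \<tau>: "\<And>i j. i < n \<Longrightarrow> j < n \<Longrightarrow> \<tau> i j \<in> Ap \<mu> p"
    and m: "0 < m" and T: "\<And>k l. k < m \<Longrightarrow> l < m \<Longrightarrow> T k l \<in> PMp \<mu> p" and nT: "Lp_mat_norm \<mu> p m T \<le> 1"
  shows "scal_mat_norm p (n * m) (\<lambda>a b. pm_pair \<mu> p (T (a mod m) (b mod m)) (\<lambda>s. u s * \<tau> (a div m) (b div m) s))
    \<le> Ap_mat_norm \<mu> p n \<tau>"
proof -
  have "(\<Sum>b<n*m. pm_pair \<mu> p (T (a mod m) (b mod m)) (\<lambda>s. u s * \<tau> (a div m) (b div m) s) * x b)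
     = (\<Sum>b<n*m. pm_pair \<mu> p (MT (T (a mod m) (b mod m))) (\<tau> (a div m) (b div m)) * x b)" if "a < n * m" for a x
  proof (intro sum.cong refl arg_cong2[where f = "(*)"])
    fix b assume "b \<in> {..<n * m}"
    then have "a div m < n" "b div m < n" "a mod m < m" "b mod m < m" using that m by (auto simp: less_mult_imp_div_less)
    then show "pm_pair \<mu> p (T (a mod m) (b mod m)) (\<lambda>s. u s * \<tau> (a div m) (b div m) s)
       = pm_pair \<mu> p (MT (T (a mod m) (b mod m))) (\<tau> (a div m) (b div m))"
      by (intro pm_pair_MT[symmetric] T \<tau>)
  qed
  then have "scal_mat_norm p (n * m) (\<lambda>a b. pm_pair \<mu> p (T (a mod m) (b mod m)) (\<lambda>s. u s * \<tau> (a div m) (b div m) s))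
    = scal_mat_norm p (n * m) (\<lambda>a b. pm_pair \<mu> p (MT (T (a mod m) (b mod m))) (\<tau> (a div m) (b div m)))"
    unfolding scal_mat_norm_def by simp
  also have "\<dots> \<le> Ap_mat_norm \<mu> p n \<tau>"
    unfolding Ap_mat_norm_def
    by (rule Sup_upper, rule CollectI, rule exI[of _ m], rule exI[of _ "\<lambda>k l. MT (T k l)"])
       (use m T MT_PMp MT_mat_norm[OF T nT] in auto)
  finally show ?thesis .
qed

end

section \<open>From Schur bounds to completely bounded multipliers\<close>

lemma scal_mat_norm_cmult:
  assumes "0 \<le> c" "0 < p" "scal_mat_norm p N A \<le> 1"
  shows "scal_mat_norm p N (\<lambda>a b. of_real c * A a b) \<le> ereal c"
  unfolding scal_mat_norm_def
proof (rule Sup_least)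
  fix z assume "z \<in> {ereal ((\<Sum>a<N. (cmod (\<Sum>b<N. of_real c * A a b * x b)) powr p) powr (1 / p))
      | x. (\<Sum>b<N. (cmod (x b)) powr p) \<le> 1}"
  then obtain x where z: "z = ereal ((\<Sum>a<N. (cmod (\<Sum>b<N. of_real c * A a b * x b)) powr p) powr (1 / p))"
    and x: "(\<Sum>b<N. (cmod (x b)) powr p) \<le> 1" by blast
  have "ereal ((\<Sum>a<N. (cmod (\<Sum>b<N. A a b * x b)) powr p) powr (1 / p)) \<le> scal_mat_norm p N A"
    unfolding scal_mat_norm_def by (rule Sup_upper) (use x in blast)
  then have 1: "fin_norm p {..<N} (\<lambda>a. \<Sum>b<N. A a b * x b) \<le> 1"
    using order_trans[OF _ assms(3)] unfolding fin_norm_def one_ereal_def ereal_less_eq(3)[symmetric] by blast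
  have "z = ereal (fin_norm p {..<N} (\<lambda>a. of_real c * (\<Sum>b<N. A a b * x b)))"
    unfolding z fin_norm_def sum_distrib_left by (simp add: mult.assoc)
  also have "\<dots> = ereal (c * fin_norm p {..<N} (\<lambda>a. \<Sum>b<N. A a b * x b))"
    using assms by (simp add: fin_norm_cmult)
  also have "\<dots> \<le> ereal c" using mult_left_mono[OF 1 assms(1)] by simp
  finally show "z \<le> ereal c" .
qed

lemma bilinear_bound_scale:
  assumes "bilinear_bound p q I J T C" "0 \<le> c"
  shows "bilinear_bound p q I J (\<lambda>i j. of_real c * T i j) (c * C)"
  unfolding bilinear_bound_def
proof (intro allI)
  fix x y
  have "(\<Sum>i\<in>I. \<Sum>j\<in>J. of_real c * T i j * x j * y i) = of_real c * (\<Sum>i\<in>I. \<Sum>j\<in>J. T i j * x j * y i)"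
    by (simp add: sum_distrib_left mult.assoc)
  then have "cmod (\<Sum>i\<in>I. \<Sum>j\<in>J. of_real c * T i j * x j * y i) = c * cmod (\<Sum>i\<in>I. \<Sum>j\<in>J. T i j * x j * y i)"
    using assms(2) by (simp add: norm_mult)
  also have "\<dots> \<le> c * (C * fin_norm p J x * fin_norm q I y)" by (rule mult_left_mono[OF bilinear_boundD[OF assms(1)] assms(2)])
  finally show "cmod (\<Sum>i\<in>I. \<Sum>j\<in>J. of_real c * T i j * x j * y i) \<le> c * C * fin_norm p J x * fin_norm q I y"
    by (simp only: mult.assoc)
qed

lemma schur_bd_scale:
  assumes "schur_bd p q C \<psi>" "0 < c"
  shows "schur_bd p q (c * C) (\<lambda>z. of_real c * \<psi> z)"
  unfolding schur_bd_def
proof (intro allI impI)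
  fix F :: "'a set" and T :: "'a \<Rightarrow> 'a \<Rightarrow> complex"
  assume FT: "finite F \<and> bilinear_bound p q F F T 1"
  have "bilinear_bound p q F F (\<lambda>i j. of_real c * (\<psi> (i, j) * T i j)) (c * C)"
    by (rule bilinear_bound_scale[OF assms(1)[unfolded schur_bd_def, rule_format, OF FT]]) (use assms(2) in simp)
  then show "bilinear_bound p q F F (\<lambda>i j. of_real c * \<psi> (i, j) * T i j) (c * C)" by (simp only: mult.assoc)
qed

context haar_group
begin

text \<open>Dividing u by C reduces to the contractive case of \<open>schur_group\<close>; the
  factor C then comes out of every pairing and every scalar matrix norm.\<close>

theorem schur_bd_imp_Mcb:
  assumes u: "continuous_on UNIV u" and S: "schur_bd p q C (\<lambda>(s, t). u (s + - t))" and C: "0 < C"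
  shows "u \<in> Mcb \<mu> p" "Mcb_norm \<mu> p u \<le> ereal C"
proof -
  define v where "v s = of_real (inverse C) * u s" for s
  have uv: "u s = of_real C * v s" for s using C by (simp add: v_def)
  interpret v: schur_group \<mu> p q v
  proof unfold_locales
    show "continuous_on UNIV v" unfolding v_def by (intro continuous_intros u)
    have "schur_bd p q (inverse C * C) (\<lambda>z. of_real (inverse C) * (case z of (s, t) \<Rightarrow> u (s + - t)))"
      by (rule schur_bd_scale[OF S]) (use C in simp)
    then show "schur_bd p q 1 (\<lambda>(s, t). v (s + - t))" using C by (simp add: v_def split_def)
  qed
  have mem: "(\<lambda>s. u s * a s) \<in> Ap \<mu> p" if "a \<in> Ap \<mu> p" for a
  proof -
    have "(\<lambda>s. v s * a s) \<in> Ap \<mu> p" by (rule v.mult_Ap[OF that])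
    then obtain gs fs where "Ap_rep \<mu> p (\<lambda>s. v s * a s) gs fs" unfolding Ap_def by (elim CollectE exE)
    from Ap_mult_const[OF this, of "of_real C"] have "(\<lambda>s. of_real C * (v s * a s)) \<in> Ap \<mu> p"
      unfolding Ap_def by (intro CollectI exI)
    then show ?thesis by (simp add: uv mult.assoc)
  qed
  have pp: "pm_pair \<mu> p T (\<lambda>s. u s * a s) = of_real C * pm_pair \<mu> p T (\<lambda>s. v s * a s)"
    if T: "T \<in> PMp \<mu> p" and a: "a \<in> Ap \<mu> p" for T a
  proof -
    have va: "(\<lambda>s. v s * a s) \<in> Ap \<mu> p" by (rule v.mult_Ap[OF a])
    \<comment> \<open>C v a is written as v a + (C - 1) v a to match the form of
      \<open>pm_pair_linear\<close>.\<close>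
    have "(\<lambda>s. u s * a s) = (\<lambda>s. v s * a s + (of_real C - 1) * (v s * a s))"
      by (simp add: uv algebra_simps)
    then have "pm_pair \<mu> p T (\<lambda>s. u s * a s) = pm_pair \<mu> p T (\<lambda>s. v s * a s) + (of_real C - 1) * pm_pair \<mu> p T (\<lambda>s. v s * a s)"
      using pm_pair_linear(2)[OF T va va] by simp
    then show ?thesis by (simp add: algebra_simps)
  qed
  show le: "Mcb_norm \<mu> p u \<le> ereal C"
    unfolding Mcb_norm_def
  proof (rule Sup_least, elim CollectE exE conjE)
    fix z n \<tau> assume z: "z = Ap_mat_norm \<mu> p n (\<lambda>i j s. u s * \<tau> i j s)" and n: "0 < n"
      and \<tau>: "\<forall>i<n. \<forall>j<n. \<tau> i j \<in> Ap \<mu> p" and \<tau>1: "Ap_mat_norm \<mu> p n \<tau> \<le> 1"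
    show "z \<le> ereal C"
      unfolding z Ap_mat_norm_def
    proof (rule Sup_least, elim CollectE exE conjE)
      fix y m T assume y: "y = scal_mat_norm p (n * m)
        (\<lambda>a b. pm_pair \<mu> p (T (a mod m) (b mod m)) (\<lambda>s. u s * \<tau> (a div m) (b div m) s))"
        and m: "0 < m" and T: "\<forall>k<m. \<forall>l<m. T k l \<in> PMp \<mu> p" and T1: "Lp_mat_norm \<mu> p m T \<le> 1"
      have s1: "scal_mat_norm p (n * m) (\<lambda>a b. pm_pair \<mu> p (T (a mod m) (b mod m)) (\<lambda>s. v s * \<tau> (a div m) (b div m) s)) \<le> 1"
        by (rule order_trans[OF v.Ap_mat_norm_mult \<tau>1]) (use \<tau> m T T1 in auto)
      have "(\<Sum>b<n*m. pm_pair \<mu> p (T (a mod m) (b mod m)) (\<lambda>s. u s * \<tau> (a div m) (b div m) s) * x b)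
        = (\<Sum>b<n*m. of_real C * pm_pair \<mu> p (T (a mod m) (b mod m)) (\<lambda>s. v s * \<tau> (a div m) (b div m) s) * x b)" if "a < n * m" for a x
      proof (intro sum.cong refl arg_cong2[where f = "(*)"])
        fix b assume "b \<in> {..<n * m}"
        then have "a div m < n" "b div m < n" "a mod m < m" "b mod m < m" using that m by (auto simp: less_mult_imp_div_less)
        then show "pm_pair \<mu> p (T (a mod m) (b mod m)) (\<lambda>s. u s * \<tau> (a div m) (b div m) s)
          = of_real C * pm_pair \<mu> p (T (a mod m) (b mod m)) (\<lambda>s. v s * \<tau> (a div m) (b div m) s)"
          using T \<tau> by (intro pp) auto
      qed
      then have "y = scal_mat_norm p (n * m) (\<lambda>a b. of_real C * pm_pair \<mu> p (T (a mod m) (b mod m)) (\<lambda>s. v s * \<tau> (a div m) (b div m) s))"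
        unfolding y scal_mat_norm_def by simp
      also have "\<dots> \<le> ereal C" by (rule scal_mat_norm_cmult[OF _ p1(3) s1]) (use C in simp)
      finally show "y \<le> ereal C" .
    qed
  qed
  show "u \<in> Mcb \<mu> p" unfolding Mcb_def using mem le by (auto intro: le_less_trans)
qed

end

section \<open>Continuity of translation, of A_p and of multipliers\<close>

context haar_group
begin

text \<open>Squeeze A between a compact K and an open U of nearly equal measure; for s close to 0
  the translate s + K still lies in U.\<close>

lemma translation_indicator:
  assumes A: "A \<in> sets borel" "emeasure \<mu> A < \<infinity>" and e: "0 < e"
  shows "\<exists>V. open V \<and> 0 \<in> V \<and> (\<forall>s\<in>V. (\<integral>x. \<bar>indicator A (- s + x) - indicator A x :: real\<bar> \<partial>\<mu>) \<le> e)"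
proof -
  obtain U where U: "open U" "A \<subseteq> U" "emeasure \<mu> U < \<infinity>" "measure \<mu> U < measure \<mu> A + e/4"
    using open_superset_approx[OF A, of "e/4"] e by auto
  obtain K where K: "compact K" "K \<subseteq> A" "measure \<mu> (A - K) < e/4"
    using compact_subset_approx[OF A, of "e/4"] e by auto
  have Kb: "K \<in> sets borel" by (rule compact_sets[OF K(1)])
  have iA: "integrable \<mu> (indicator A :: 'g \<Rightarrow> real)" using A by (simp add: sets_mu)
  have iU: "integrable \<mu> (indicator U :: 'g \<Rightarrow> real)" using U by (simp add: sets_mu)
  have iK: "integrable \<mu> (indicator K :: 'g \<Rightarrow> real)" using Kb compact_finite[OF K(1)] by (simp add: sets_mu)
  note [measurable] = borel_measurable_integrable[OF iA] borel_measurable_integrable[OF iK]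
  have mK: "measure \<mu> A - measure \<mu> K < e/4"
    using K(3) measurable_measure_Diff[of A \<mu> K] A compact_finite[OF K(1)] Kb K(2)
    by (simp add: fmeasurable_def sets_mu)
  have "\<exists>V. 0 \<in> V \<and> open V \<and> V \<times> K \<subseteq> {z. fst z + snd z \<in> U}"
  proof (rule Elementary_Topology.tube_lemma[OF K(1)])
    show "open {z. fst z + snd z \<in> U}"
      using open_vimage[OF U(1), of "\<lambda>z. fst z + snd z"] by (simp add: vimage_def continuous_intros)
    show "{0} \<times> K \<subseteq> {z. fst z + snd z \<in> U}" using K U by auto
  qed
  then obtain V where V: "0 \<in> V" "open V" "V \<times> K \<subseteq> {z. fst z + snd z \<in> U}" by blast
  show ?thesis
  proof (intro exI[of _ V] conjI V ballI)
    fix s assume s: "s \<in> V"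
    have VK: "x \<in> U" if "- s + x \<in> K" for x
      using subsetD[OF V(3), of "(s, - s + x)"] s that by (simp add: add.assoc[symmetric])
    have ish: "integrable \<mu> (\<lambda>x. indicator A (- s + x) :: real)" "integrable \<mu> (\<lambda>x. indicator K (- s + x) :: real)"
      using integrable_shift[of "indicator A" "- s"] integrable_shift[of "indicator K" "- s"] iA iK by auto
    have es: "(\<integral>x. indicator A (- s + x) \<partial>\<mu>) = measure \<mu> A" "(\<integral>x. indicator K (- s + x) \<partial>\<mu>) = measure \<mu> K"
      using integral_shift[of "indicator A :: 'g \<Rightarrow> real" "- s"] integral_shift[of "indicator K :: 'g \<Rightarrow> real" "- s"] A Kb by (auto simp: sets_mu)
    \<comment> \<open>An absolute value is twice the positive part minus the function. The positive
      part of 1_A(- s + x) - 1_A(x) is at most the sum of the two squeezing errors, and the function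
      itself has integral 0 by left invariance.\<close>
    have "(\<integral>x. \<bar>indicator A (- s + x) - indicator A x :: real\<bar> \<partial>\<mu>) \<le>
      (\<integral>x. 2 * ((indicator A (- s + x) - indicator K (- s + x)) + (indicator U x - indicator A x)) - indicator A (- s + x) + indicator A x \<partial>\<mu>)"
    proof (rule integral_mono)
      fix x
      show "\<bar>indicator A (- s + x) - indicator A x :: real\<bar> \<le>
        2 * ((indicator A (- s + x) - indicator K (- s + x)) + (indicator U x - indicator A x)) - indicator A (- s + x) + indicator A x"
        using VK[of x] U(2) K(2) by (auto simp: indicator_def)
    qed (use ish iA iU in auto)
    also have "\<dots> = 2 * ((measure \<mu> A - measure \<mu> K) + (measure \<mu> U - measure \<mu> A)) - measure \<mu> A + measure \<mu> A"
      using ish iA iU es by simp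
    also have "\<dots> \<le> e" using mK U(4) by simp
    finally show "(\<integral>x. \<bar>indicator A (- s + x) - indicator A x :: real\<bar> \<partial>\<mu>) \<le> e" .
  qed
qed

text \<open>Continuity at the identity of the orbit of f under left translation, formulated with
  neighbourhoods because the topology need not be metrisable.\<close>

definition TC :: "('g \<Rightarrow> complex) \<Rightarrow> bool" where
  "TC f \<longleftrightarrow> Lp_mem \<mu> p f \<and> (\<forall>e>0. \<exists>V. open V \<and> 0 \<in> V \<and> (\<forall>s\<in>V. Lp_norm \<mu> p (\<lambda>x. lambda_p s f x - f x) \<le> e))"

lemma TC_zero: "TC (\<lambda>x. 0)"
  unfolding TC_def by (auto simp: lambda_p_def intro!: exI[of _ UNIV])

lemma TC_indicator:
  assumes A: "A \<in> sets borel" "emeasure \<mu> A < \<infinity>"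
  shows "TC (indicator A)"
proof -
  have iA: "integrable \<mu> (indicator A :: 'g \<Rightarrow> real)" using A by (simp add: sets_mu)
  have 1: "cmod (indicator A x) powr p = indicator A x" for x by (simp add: indicator_def)
  have mem: "Lp_mem \<mu> p (indicator A)" unfolding Lp_mem_def 1 using iA A by (simp add: sets_mu)
  moreover have "\<exists>V. open V \<and> 0 \<in> V \<and> (\<forall>s\<in>V. Lp_norm \<mu> p (\<lambda>x. lambda_p s (indicator A) x - indicator A x) \<le> e)" if e: "0 < e" for e
  proof -
    obtain V where V: "open V" "0 \<in> V" "\<forall>s\<in>V. (\<integral>x. \<bar>indicator A (- s + x) - indicator A x :: real\<bar> \<partial>\<mu>) \<le> e powr p"
      using translation_indicator[OF A, of "e powr p"] e by auto
    show ?thesis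
    proof (intro exI[of _ V] conjI V ballI)
      fix s assume s: "s \<in> V"
      have "Lp_norm \<mu> p (\<lambda>x. lambda_p s (indicator A) x - indicator A x) powr p = (\<integral>x. cmod (indicator A (- s + x) - indicator A x) powr p \<partial>\<mu>)"
        using p1 by (simp add: Lp_norm_powr lambda_p_def)
      also have "(\<lambda>x. cmod (indicator A (- s + x) - indicator A x) powr p) = (\<lambda>x. \<bar>indicator A (- s + x) - indicator A x :: real\<bar>)"
        by (auto simp: indicator_def fun_eq_iff)
      finally have "Lp_norm \<mu> p (\<lambda>x. lambda_p s (indicator A) x - indicator A x) powr p \<le> e powr p" using V(3) s by simp
      then show "Lp_norm \<mu> p (\<lambda>x. lambda_p s (indicator A) x - indicator A x) \<le> e" by (rule powr_le_imp_le) (use p1 e in auto)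
    qed
  qed
  ultimately show ?thesis unfolding TC_def by simp
qed

lemma TC_cmult:
  assumes f: "TC f" shows "TC (\<lambda>x. c * f x)"
  unfolding TC_def
proof (intro conjI allI impI)
  show "Lp_mem \<mu> p (\<lambda>x. c * f x)" using f by (auto simp: TC_def intro: Lp_mem_cmult)
  fix e :: real assume e: "0 < e"
  have "0 < e / (cmod c + 1)" using e by (simp add: add_nonneg_pos)
  then obtain V where V: "open V" "0 \<in> V" "\<forall>s\<in>V. Lp_norm \<mu> p (\<lambda>x. lambda_p s f x - f x) \<le> e / (cmod c + 1)"
    using f unfolding TC_def by blast
  show "\<exists>V. open V \<and> 0 \<in> V \<and> (\<forall>s\<in>V. Lp_norm \<mu> p (\<lambda>x. lambda_p s (\<lambda>x. c * f x) x - c * f x) \<le> e)"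
  proof (intro exI[of _ V] conjI V ballI)
    fix s assume "s \<in> V"
    have "Lp_norm \<mu> p (\<lambda>x. lambda_p s (\<lambda>x. c * f x) x - c * f x) = cmod c * Lp_norm \<mu> p (\<lambda>x. lambda_p s f x - f x)"
      using Lp_norm_cmult[OF p1(3), of \<mu> c "\<lambda>x. lambda_p s f x - f x"] by (simp add: lambda_p_def right_diff_distrib)
    also have "\<dots> \<le> cmod c * (e / (cmod c + 1))" using V(3) \<open>s \<in> V\<close> by (intro mult_left_mono) auto
    also have "\<dots> \<le> (cmod c + 1) * (e / (cmod c + 1))" using e by (intro mult_right_mono) auto
    also have "\<dots> = e" using add_nonneg_pos[OF norm_ge_zero[of c] zero_less_one] by simp
    finally show "Lp_norm \<mu> p (\<lambda>x. lambda_p s (\<lambda>x. c * f x) x - c * f x) \<le> e" .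
  qed
qed

lemma TC_add:
  assumes f: "TC f" and h: "TC h" shows "TC (\<lambda>x. f x + h x)"
  unfolding TC_def
proof (intro conjI allI impI)
  have mem: "Lp_mem \<mu> p f" "Lp_mem \<mu> p h" using f h by (auto simp: TC_def)
  then show "Lp_mem \<mu> p (\<lambda>x. f x + h x)" using p1 by (intro Lp_mem_add)
  fix e :: real assume e: "0 < e"
  have e2: "0 < e / 2" using e by simp
  obtain V where V: "open V" "0 \<in> V" "\<forall>s\<in>V. Lp_norm \<mu> p (\<lambda>x. lambda_p s f x - f x) \<le> e / 2"
    using f e2 unfolding TC_def by blast
  obtain W where W: "open W" "0 \<in> W" "\<forall>s\<in>W. Lp_norm \<mu> p (\<lambda>x. lambda_p s h x - h x) \<le> e / 2"
    using h e2 unfolding TC_def by blast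
  show "\<exists>V. open V \<and> 0 \<in> V \<and> (\<forall>s\<in>V. Lp_norm \<mu> p (\<lambda>x. lambda_p s (\<lambda>x. f x + h x) x - (f x + h x)) \<le> e)"
  proof (intro exI[of _ "V \<inter> W"] conjI ballI)
    fix s assume s: "s \<in> V \<inter> W"
    have eq: "(\<lambda>x. lambda_p s (\<lambda>x. f x + h x) x - (f x + h x)) = (\<lambda>x. (lambda_p s f x - f x) + (lambda_p s h x - h x))"
      by (simp add: lambda_p_def fun_eq_iff)
    have "Lp_norm \<mu> p (\<lambda>x. (lambda_p s f x - f x) + (lambda_p s h x - h x))
        \<le> Lp_norm \<mu> p (\<lambda>x. lambda_p s f x - f x) + Lp_norm \<mu> p (\<lambda>x. lambda_p s h x - h x)"
      using p1 mem by (intro Minkowski Lp_mem_diff Lp_mem_lambda)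
    also have "\<dots> \<le> e / 2 + e / 2" using V(3) W(3) s by (intro add_mono) auto
    finally show "Lp_norm \<mu> p (\<lambda>x. lambda_p s (\<lambda>x. f x + h x) x - (f x + h x)) \<le> e" unfolding eq by simp
  qed (use V W in auto)
qed

lemma TC_sum:
  assumes "finite I" "\<And>i. i \<in> I \<Longrightarrow> TC (f i)" shows "TC (\<lambda>x. \<Sum>i\<in>I. f i x)"
  using assms by (induction I rule: finite_induct) (simp_all add: TC_zero TC_add)

text \<open>A simple function in L_p is a finite combination of indicators of its level sets, and
  those for nonzero values have finite measure.\<close>

lemma TC_simple:
  assumes s: "simple_function \<mu> s" and m: "Lp_mem \<mu> p s" shows "TC s"
proof -
  have T: "TC (\<lambda>x. y * indicator (s -` {y}) x)" for y
  proof (cases "y = 0")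
    case True
    then show ?thesis by (simp add: TC_zero)
  next
    case False
    have A: "s -` {y} \<in> sets \<mu>" using simple_functionD(2)[OF s, of "{y}"] by simp
    have "integrable \<mu> (\<lambda>x. cmod y powr p * indicator (s -` {y}) x :: real)"
    proof (rule Bochner_Integration.integrable_bound[OF Lp_memD(2)[OF m]])
      show "(\<lambda>x. cmod y powr p * indicator (s -` {y}) x :: real) \<in> borel_measurable \<mu>"
        by (intro borel_measurable_times borel_measurable_const borel_measurable_indicator A)
      show "AE x in \<mu>. norm (cmod y powr p * indicator (s -` {y}) x :: real) \<le> norm (cmod (s x) powr p)"
        by (rule AE_I2) (simp add: indicator_def)
    qed
    then have "integrable \<mu> (indicator (s -` {y}) :: 'g \<Rightarrow> real)" using False by simp
    then have "emeasure \<mu> (s -` {y}) < \<infinity>" using A by (simp add: integrable_indicator_iff)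
    then have "TC (indicator (s -` {y}))" using A by (intro TC_indicator) (auto simp: sets_mu)
    then show ?thesis by (rule TC_cmult)
  qed
  have "TC (\<lambda>x. \<Sum>y\<in>range s. y * indicator (s -` {y}) x)"
  proof (rule TC_sum[where f = "\<lambda>y x. y * indicator (s -` {y}) x"])
    show "finite (range s)" using simple_functionD(1)[OF s] by simp
  qed (rule T)
  moreover have "(\<Sum>y\<in>range s. y * indicator (s -` {y}) x) = s x" for x
  proof -
    have "(\<Sum>y\<in>range s. y * indicator (s -` {y}) x) = (\<Sum>y\<in>range s. if y = s x then s x else 0)"
      by (intro sum.cong refl) (auto simp: indicator_def)
    then show ?thesis using simple_functionD(1)[OF s] by simp
  qed
  ultimately show ?thesis by simp
qed

lemma translation_continuous:
  assumes f: "Lp_mem \<mu> p f" shows "TC f"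
  unfolding TC_def
proof (intro conjI f allI impI)
  fix e :: real assume e: "0 < e"
  obtain h where h: "\<And>i. simple_function \<mu> (h i)" "\<And>i. Lp_mem \<mu> p (h i)"
    "(\<lambda>i :: nat. Lp_norm \<mu> p (\<lambda>x. h i x - f x)) \<longlonglongrightarrow> 0"
    by (rule Lp_simple_dense[OF p1(1) f]) (rule that)
  have "\<forall>\<^sub>F i in sequentially. Lp_norm \<mu> p (\<lambda>x. h i x - f x) < e/3" using order_tendstoD(2)[OF h(3), of "e/3"] e by simp
  then obtain i where i: "Lp_norm \<mu> p (\<lambda>x. h i x - f x) < e/3" using eventually_happens by force
  have "0 < e/3" using e by simp
  then obtain V where V: "open V" "0 \<in> V" "\<forall>s\<in>V. Lp_norm \<mu> p (\<lambda>x. lambda_p s (h i) x - h i x) \<le> e / 3"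
    using TC_simple[OF h(1,2)[of i]] unfolding TC_def by blast
  show "\<exists>V. open V \<and> 0 \<in> V \<and> (\<forall>s\<in>V. Lp_norm \<mu> p (\<lambda>x. lambda_p s f x - f x) \<le> e)"
  proof (intro exI[of _ V] conjI V ballI)
    fix s assume s: "s \<in> V"
    note m = f h(2)[of i] Lp_mem_lambda[OF f, of s] Lp_mem_lambda[OF h(2)[of i], of s]
    have 1: "Lp_norm \<mu> p (\<lambda>x. lambda_p s f x - lambda_p s (h i) x) = Lp_norm \<mu> p (\<lambda>x. h i x - f x)"
    proof -
      have "Lp_norm \<mu> p (lambda_p s (\<lambda>x. f x - h i x)) = Lp_norm \<mu> p (\<lambda>x. f x - h i x)"
        using m p1 by (intro Lp_norm_lambda Lp_mem_diff)
      then show ?thesis unfolding lambda_p_def by (simp add: Lp_norm_minus_commute)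
    qed
    have "Lp_norm \<mu> p (\<lambda>x. lambda_p s f x - f x) \<le> Lp_norm \<mu> p (\<lambda>x. lambda_p s f x - lambda_p s (h i) x) + Lp_norm \<mu> p (\<lambda>x. lambda_p s (h i) x - f x)"
      by (rule Lp_norm_triangle_diff) (use m p1 in auto)
    moreover have "Lp_norm \<mu> p (\<lambda>x. lambda_p s (h i) x - f x) \<le> Lp_norm \<mu> p (\<lambda>x. lambda_p s (h i) x - h i x) + Lp_norm \<mu> p (\<lambda>x. h i x - f x)"
      by (rule Lp_norm_triangle_diff) (use m p1 in auto)
    ultimately show "Lp_norm \<mu> p (\<lambda>x. lambda_p s f x - f x) \<le> e" using 1 i V(3)[rule_format, OF s] by linarith
  qed
qed

lemma lambda_add: "lambda_p (s + t) f = lambda_p s (lambda_p t f)"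
proof -
  have "- (s + t) + x = - t + (- s + x)" for x by (simp only: minus_add add.assoc)
  then show ?thesis unfolding lambda_p_def by simp
qed

text \<open>Since lambda(s) f is lambda(s + - t) applied to lambda(t) f, continuity at t reduces to
  continuity of translation at 0 for the function lambda(t) f.\<close>

lemma Lam_isCont:
  assumes g: "Lp_mem \<mu> q g" and f: "Lp_mem \<mu> p f"
  shows "isCont (Lam g f) t"
  unfolding isCont_def
proof (rule tendstoI)
  fix e :: real assume e: "0 < e"
  have fl: "Lp_mem \<mu> p (lambda_p t f)" by (rule Lp_mem_lambda[OF f])
  have N: "0 < Lp_norm \<mu> q g + 1" by (rule add_nonneg_pos) auto
  then have "0 < e / (2 * (Lp_norm \<mu> q g + 1))" using e by simp
  then obtain V where V: "open V" "0 \<in> V"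
    "\<forall>s\<in>V. Lp_norm \<mu> p (\<lambda>x. lambda_p s (lambda_p t f) x - lambda_p t f x) \<le> e / (2 * (Lp_norm \<mu> q g + 1))"
    using translation_continuous[OF fl] unfolding TC_def by blast
  have "((\<lambda>s. s + - t) \<longlongrightarrow> t + - t) (at t)" by (intro tendsto_intros)
  then have "\<forall>\<^sub>F s in at t. s + - t \<in> V" by (rule topological_tendstoD) (use V in auto)
  then show "\<forall>\<^sub>F s in at t. dist (Lam g f s) (Lam g f t) < e"
  proof (rule eventually_mono)
    fix s assume s: "s + - t \<in> V"
    have ls: "lambda_p s f = lambda_p (s + - t) (lambda_p t f)"
      unfolding lambda_add[symmetric] by (simp add: add.assoc)
    have "Lam g f s - Lam g f t = pairing \<mu> g (\<lambda>x. lambda_p s f x - lambda_p t f x)"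
      unfolding Lam_def using pairing_add_right[OF pq g Lp_mem_lambda[OF f] fl, of s "-1"] by simp
    then have eq: "dist (Lam g f s) (Lam g f t) = cmod (pairing \<mu> g (\<lambda>x. lambda_p s f x - lambda_p t f x))" by (simp add: dist_norm)
    have "cmod (pairing \<mu> g (\<lambda>x. lambda_p s f x - lambda_p t f x)) \<le> Lp_norm \<mu> q g * Lp_norm \<mu> p (\<lambda>x. lambda_p s f x - lambda_p t f x)"
      using p1 by (intro Holder_pairing[OF pq g] Lp_mem_diff Lp_mem_lambda f)
    also have "\<dots> \<le> Lp_norm \<mu> q g * (e / (2 * (Lp_norm \<mu> q g + 1)))"
      unfolding ls using V(3) s by (intro mult_left_mono) auto
    also have "\<dots> \<le> (Lp_norm \<mu> q g + 1) * (e / (2 * (Lp_norm \<mu> q g + 1)))" using e N by (intro mult_right_mono) auto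
    also have "\<dots> = e / 2" using N by (simp only: times_divide_eq_right mult.commute[of 2] mult_divide_mult_cancel_left_if) simp
    also have "\<dots> < e" using e by simp
    finally show "dist (Lam g f s) (Lam g f t) < e" unfolding eq .
  qed
qed

text \<open>The defining series converges uniformly by the Weierstrass test, with the products of
  norms as majorants.\<close>

lemma Ap_continuous:
  assumes "a \<in> Ap \<mu> p" shows "continuous_on UNIV a"
proof -
  obtain gs fs where r: "Ap_rep \<mu> p a gs fs" using assms unfolding Ap_def by blast
  note pt = Ap_rep_ptensor[OF r, unfolded ptensor_iff]
  have mem: "Lp_mem \<mu> q (gs n)" "Lp_mem \<mu> p (fs n)" for n using pt by auto
  have "uniform_limit UNIV (\<lambda>n s. \<Sum>i<n. Lam (gs i) (fs i) s) (\<lambda>s. \<Sum>i. Lam (gs i) (fs i) s) sequentially"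
    by (rule Weierstrass_m_test) (use pt Lam_bound[OF mem] in auto)
  moreover have "\<forall>\<^sub>F n in sequentially. continuous_on UNIV (\<lambda>s. \<Sum>i<n. Lam (gs i) (fs i) s)"
  proof (rule always_eventually, rule allI, rule continuous_on_sum)
    fix i show "continuous_on UNIV (Lam (gs i) (fs i))"
      unfolding continuous_on_eq_continuous_at[OF open_UNIV] by (intro ballI Lam_isCont mem)
  qed
  ultimately have "continuous_on UNIV (\<lambda>s. \<Sum>i. Lam (gs i) (fs i) s)"
    by (intro uniform_limit_theorem[OF _ _ sequentially_bot])
  moreover have "a = (\<lambda>s. \<Sum>i. Lam (gs i) (fs i) s)" by (rule ext) (rule Ap_rep_eq[OF r])
  ultimately show ?thesis by simp
qed

lemma nbhd_finite_measure:
  "\<exists>W. open W \<and> 0 \<in> W \<and> W \<in> sets borel \<and> emeasure \<mu> W < \<infinity>"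
proof -
  obtain U K where UK: "openin euclidean U" "compactin euclidean K" "(0::'g) \<in> U" "U \<subseteq> K"
    using lc unfolding locally_compact_space_def by (metis UNIV_I topspace_euclidean)
  then have U: "open U" "compact K" by auto
  have "emeasure \<mu> U \<le> emeasure \<mu> K" by (rule emeasure_mono) (use UK compact_sets[OF U(2)] in \<open>auto simp: sets_mu\<close>)
  then show ?thesis using compact_finite[OF U(2)] U UK(3) by (intro exI[of _ U]) (auto intro: le_less_trans)
qed

lemma open_measure_pos:
  assumes "open W" "0 \<in> W" "emeasure \<mu> W < \<infinity>" shows "0 < measure \<mu> W"
proof -
  have "0 < emeasure \<mu> W" using haar assms(1,2) unfolding left_haar_measure_def by blast
  then show ?thesis using assms(3) by (simp add: emeasure_eq_ennreal_measure less_top)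
qed

lemma Lp_mem_scaled_indicator:
  assumes "W \<in> sets borel" "emeasure \<mu> W < \<infinity>" "0 < r"
  shows "Lp_mem \<mu> r (\<lambda>x. c * indicator W x)" "Lp_norm \<mu> r (\<lambda>x. c * indicator W x) = cmod c * measure \<mu> W powr (1 / r)"
proof -
  have 1: "cmod (indicator W x) powr r = indicator W x" for x by (simp add: indicator_def)
  have "Lp_mem \<mu> r (indicator W)" unfolding Lp_mem_def 1 using assms by (simp add: sets_mu)
  then show "Lp_mem \<mu> r (\<lambda>x. c * indicator W x)" by (rule Lp_mem_cmult)
  have "Lp_norm \<mu> r (indicator W) = measure \<mu> W powr (1 / r)" unfolding Lp_norm_def 1 using assms by (simp add: sets_mu)
  then show "Lp_norm \<mu> r (\<lambda>x. c * indicator W x) = cmod c * measure \<mu> W powr (1 / r)" using assms(3) by (simp add: Lp_norm_cmult)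
qed

lemma pairing_lambda:
  assumes "Lp_mem \<mu> q g" "Lp_mem \<mu> p f"
  shows "pairing \<mu> (lambda_p s g) (lambda_p s f) = pairing \<mu> g f"
proof -
  have "(\<lambda>x. g x * f x) \<in> borel_measurable \<mu>" using Lp_memD(1)[OF assms(1)] Lp_memD(1)[OF assms(2)] by measurable
  then show ?thesis unfolding pairing_def lambda_p_def by (rule integral_shift)
qed

lemma pairing_indicator:
  assumes "W \<in> sets borel" "emeasure \<mu> W < \<infinity>"
  shows "pairing \<mu> (\<lambda>x. c * indicator W x) (\<lambda>x. d * indicator W x) = c * d * of_real (measure \<mu> W)"
proof -
  have "(\<lambda>x. c * indicator W x * (d * indicator W x)) = (\<lambda>x. c * d * of_real (indicator W x))"
    by (auto simp: indicator_def fun_eq_iff)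
  then show ?thesis unfolding pairing_def using assms by (simp add: sets_mu)
qed

text \<open>Near s0, u is the quotient of the continuous functions u a and a, once a in A_p is
  chosen with a(s0) nonzero.\<close>

lemma Mcb_continuous:
  assumes u: "\<And>a. a \<in> Ap \<mu> p \<Longrightarrow> (\<lambda>s. u s * a s) \<in> Ap \<mu> p"
  shows "continuous_on UNIV u"
proof -
  obtain W where W: "open W" "0 \<in> W" "W \<in> sets borel" "emeasure \<mu> W < \<infinity>" using nbhd_finite_measure by (elim exE conjE)
  have "isCont u s0" for s0
  proof -
    define \<phi> where "\<phi> = (\<lambda>x. 1 * indicator W x :: complex)"
    have \<phi>: "Lp_mem \<mu> p \<phi>" "Lp_mem \<mu> q \<phi>" unfolding \<phi>_def by (rule Lp_mem_scaled_indicator(1)[OF W(3,4)], rule p1)+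
    \<comment> \<open>By left invariance the value of this coefficient at s0 is the measure of W,
      which is positive. W has finite measure thanks to local compactness.\<close>
    define a where "a = Lam (lambda_p s0 \<phi>) \<phi>"
    have a: "a \<in> Ap \<mu> p" unfolding a_def by (intro Lam_in_Ap Lp_mem_lambda \<phi>)
    have "a s0 = 1 * 1 * of_real (measure \<mu> W)"
      unfolding a_def Lam_def pairing_lambda[OF \<phi>(2,1)] unfolding \<phi>_def by (rule pairing_indicator[OF W(3,4)])
    then have a0: "a s0 \<noteq> 0" using open_measure_pos[OF W(1,2,4)] by simp
    have ca: "isCont a s0" "isCont (\<lambda>s. u s * a s) s0"
      using Ap_continuous[OF a] Ap_continuous[OF u[OF a]] by (auto simp: continuous_on_eq_continuous_at)
    have "isCont (\<lambda>s. u s * a s / a s) s0" by (rule isCont_divide[OF ca(2,1) a0])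
    moreover have "\<forall>\<^sub>F s in nhds s0. u s * a s / a s = u s"
    proof -
      have "(a \<longlongrightarrow> a s0) (nhds s0)" using ca(1) unfolding isCont_def tendsto_at_iff_tendsto_nhds .
      then have "\<forall>\<^sub>F s in nhds s0. a s \<noteq> 0" by (rule tendsto_imp_eventually_ne[OF _ a0])
      then show ?thesis by (rule eventually_mono) simp
    qed
    ultimately show "isCont u s0" using isCont_cong[of "\<lambda>s. u s * a s / a s" u s0] by simp
  qed
  then show ?thesis by (simp add: continuous_on_eq_continuous_at)
qed

end

section \<open>From completely bounded multipliers to Schur bounds\<close>

text \<open>Decodes the double index (i,k) stored as i m + k in the scalar matrices of
  \<open>Ap_mat_norm\<close>.\<close>

lemma sum_div_mod:
  fixes h :: "nat \<Rightarrow> nat \<Rightarrow> 'a::comm_monoid_add"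
  assumes "0 < m"
  shows "(\<Sum>a<n*m. h (a div m) (a mod m)) = (\<Sum>i<n. \<Sum>k<m. h i k)"
proof -
  have "(\<Sum>a<n*m. h (a div m) (a mod m)) = (\<Sum>i<n. \<Sum>a\<in>{i*m..<i*m+m}. h (a div m) (a mod m))"
    by (rule sum.nat_group[symmetric])
  also have "\<dots> = (\<Sum>i<n. \<Sum>k<m. h i k)"
  proof (rule sum.cong[OF refl])
    fix i
    have "(\<Sum>a\<in>{i*m..<i*m+m}. h (a div m) (a mod m)) = (\<Sum>k\<in>{0..<m}. h ((i*m+k) div m) ((i*m+k) mod m))"
      by (subst sum.atLeastLessThan_shift_0) simp
    also have "\<dots> = (\<Sum>k<m. h i k)" using assms by (intro sum.cong) auto
    finally show "(\<Sum>a\<in>{i*m..<i*m+m}. h (a div m) (a mod m)) = (\<Sum>k<m. h i k)" .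
  qed
  finally show ?thesis .
qed

lemma sum_extend:
  assumes "finite I" "\<alpha> ` I' \<subseteq> I" "inj_on \<alpha> I'" "\<And>i. i \<in> I \<Longrightarrow> i \<notin> \<alpha> ` I' \<Longrightarrow> h i = 0"
  shows "sum h I = (\<Sum>i\<in>I'. h (\<alpha> i))"
proof -
  have "sum h I = sum h (\<alpha> ` I')" by (rule sum.mono_neutral_right) (use assms in auto)
  also have "\<dots> = (\<Sum>i\<in>I'. h (\<alpha> i))" using sum.reindex[OF assms(3), of h] by simp
  finally show ?thesis .
qed

text \<open>Passing to a submatrix along injective index maps: extend the test vectors by zero.
  Apart from genuine restriction it also serves to relabel index sets.\<close>

lemma bilinear_bound_inject:
  assumes B: "bilinear_bound p q I J B C" and fin: "finite I" "finite J" and pq: "0 < p" "0 < q"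
    and \<alpha>: "\<alpha> ` I' \<subseteq> I" "inj_on \<alpha> I'" and \<beta>: "\<beta> ` J' \<subseteq> J" "inj_on \<beta> J'"
  shows "bilinear_bound p q I' J' (\<lambda>i j. B (\<alpha> i) (\<beta> j)) C"
  unfolding bilinear_bound_def
proof (intro allI)
  fix x y :: "_ \<Rightarrow> complex"
  define x' where "x' j = (if j \<in> \<beta> ` J' then x (inv_into J' \<beta> j) else 0)" for j
  define y' where "y' i = (if i \<in> \<alpha> ` I' then y (inv_into I' \<alpha> i) else 0)" for i
  have x': "x' (\<beta> j) = x j" if "j \<in> J'" for j using that \<beta>(2) by (simp add: x'_def)
  have y': "y' (\<alpha> i) = y i" if "i \<in> I'" for i using that \<alpha>(2) by (simp add: y'_def)
  have "(\<Sum>i\<in>I. \<Sum>j\<in>J. B i j * x' j * y' i) = (\<Sum>i\<in>I'. \<Sum>j\<in>J. B (\<alpha> i) j * x' j * y' (\<alpha> i))"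
    by (rule sum_extend[OF fin(1) \<alpha>]) (simp add: y'_def)
  also have "\<dots> = (\<Sum>i\<in>I'. \<Sum>j\<in>J'. B (\<alpha> i) (\<beta> j) * x' (\<beta> j) * y' (\<alpha> i))"
    by (intro sum.cong refl sum_extend[OF fin(2) \<beta>]) (simp add: x'_def)
  also have "\<dots> = (\<Sum>i\<in>I'. \<Sum>j\<in>J'. B (\<alpha> i) (\<beta> j) * x j * y i)" by (intro sum.cong refl) (simp add: x' y')
  finally have e: "(\<Sum>i\<in>I. \<Sum>j\<in>J. B i j * x' j * y' i) = (\<Sum>i\<in>I'. \<Sum>j\<in>J'. B (\<alpha> i) (\<beta> j) * x j * y i)" .
  have "(\<Sum>j\<in>J. cmod (x' j) powr p) = (\<Sum>j\<in>J'. cmod (x' (\<beta> j)) powr p)"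
    by (rule sum_extend[OF fin(2) \<beta>]) (use pq in \<open>simp add: x'_def\<close>)
  then have nx: "fin_norm p J x' = fin_norm p J' x" unfolding fin_norm_def by (simp add: x')
  have "(\<Sum>i\<in>I. cmod (y' i) powr q) = (\<Sum>i\<in>I'. cmod (y' (\<alpha> i)) powr q)"
    by (rule sum_extend[OF fin(1) \<alpha>]) (use pq in \<open>simp add: y'_def\<close>)
  then have ny: "fin_norm q I y' = fin_norm q I' y" unfolding fin_norm_def by (simp add: y')
  show "cmod (\<Sum>i\<in>I'. \<Sum>j\<in>J'. B (\<alpha> i) (\<beta> j) * x j * y i) \<le> C * fin_norm p J' x * fin_norm q I' y"
    using bilinear_boundD[OF B, of x' y'] unfolding e nx ny .
qed

lemma bilinear_bound_cong:
  assumes "\<And>i j. i \<in> I \<Longrightarrow> j \<in> J \<Longrightarrow> A i j = B i j"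
  shows "bilinear_bound p q I J A C \<longleftrightarrow> bilinear_bound p q I J B C"
proof -
  have "(\<Sum>i\<in>I. \<Sum>j\<in>J. A i j * x j * y i) = (\<Sum>i\<in>I. \<Sum>j\<in>J. B i j * x j * y i)" for x y
    using assms by (intro sum.cong refl) auto
  then show ?thesis by (simp add: bilinear_bound_def)
qed

lemma fin_norm_le_1: "0 < p \<Longrightarrow> fin_norm p F x \<le> 1 \<longleftrightarrow> (\<Sum>i\<in>F. cmod (x i) powr p) \<le> 1"
proof
  assume p: "0 < p" and "fin_norm p F x \<le> 1"
  then have "fin_norm p F x powr p \<le> 1 powr p" by (intro powr_mono2) auto
  then show "(\<Sum>i\<in>F. cmod (x i) powr p) \<le> 1" using p by (simp add: fin_norm_powr)
next
  assume p: "0 < p" and "(\<Sum>i\<in>F. cmod (x i) powr p) \<le> 1"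
  then have "fin_norm p F x \<le> 1 powr (1/p)" unfolding fin_norm_def by (intro powr_mono2 sum_nonneg) auto
  then show "fin_norm p F x \<le> 1" by simp
qed

lemma scal_mat_norm_leI:
  assumes "bilinear_bound p q {..<N} {..<N} A C" "conj_pair p q" "0 \<le> C"
  shows "scal_mat_norm p N A \<le> ereal C"
  unfolding scal_mat_norm_def
proof (rule Sup_least)
  fix z assume "z \<in> {ereal ((\<Sum>a<N. (cmod (\<Sum>b<N. A a b * x b)) powr p) powr (1 / p))
      | x. (\<Sum>b<N. (cmod (x b)) powr p) \<le> 1}"
  then obtain x where z: "z = ereal (fin_norm p {..<N} (\<lambda>a. \<Sum>b<N. A a b * x b))" and x: "(\<Sum>b<N. (cmod (x b)) powr p) \<le> 1"
    unfolding fin_norm_def by blast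
  have "fin_norm p {..<N} (\<lambda>a. \<Sum>b<N. A a b * x b) \<le> C * fin_norm p {..<N} x"
    using assms by (simp add: bilinear_bound_iff)
  also have "\<dots> \<le> C * 1" by (intro mult_left_mono) (use x assms conj_pairD[OF assms(2)] in \<open>auto simp: fin_norm_le_1\<close>)
  finally show "z \<le> ereal C" unfolding z by simp
qed

lemma scal_mat_norm_leD:
  assumes n: "scal_mat_norm p N A \<le> ereal C" and pq: "conj_pair p q" and C: "0 \<le> C"
  shows "bilinear_bound p q {..<N} {..<N} A C"
proof -
  note p = conj_pairD[OF pq]
  have "fin_norm p {..<N} (\<lambda>a. \<Sum>b<N. A a b * x b) \<le> C * fin_norm p {..<N} x" for x
  proof (rule le_mult_by_approx[OF _ C])
    fix e :: real assume e: "0 < e"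
    define c where "c = inverse (fin_norm p {..<N} x + e)"
    have P: "0 < fin_norm p {..<N} x + e" by (rule add_nonneg_pos[OF _ e]) simp
    then have c: "0 < c" by (simp add: c_def)
    have "fin_norm p {..<N} (\<lambda>b. of_real c * x b) = c * fin_norm p {..<N} x" using c p by (simp add: fin_norm_cmult)
    also have "\<dots> \<le> c * (fin_norm p {..<N} x + e)" using c e by (intro mult_left_mono) auto
    also have "\<dots> = 1" unfolding c_def using P by simp
    finally have "(\<Sum>b<N. (cmod (of_real c * x b)) powr p) \<le> 1" using p by (simp add: fin_norm_le_1)
    then have "ereal (fin_norm p {..<N} (\<lambda>a. \<Sum>b<N. A a b * (of_real c * x b))) \<le> scal_mat_norm p N A"
      unfolding scal_mat_norm_def fin_norm_def
      by (rule_tac Sup_upper, rule_tac CollectI, rule_tac exI[of _ "\<lambda>b. of_real c * x b"]) simp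
    then have "ereal (fin_norm p {..<N} (\<lambda>a. \<Sum>b<N. A a b * (of_real c * x b))) \<le> ereal C" using n by (rule order_trans)
    moreover have "fin_norm p {..<N} (\<lambda>a. \<Sum>b<N. A a b * (of_real c * x b)) = c * fin_norm p {..<N} (\<lambda>a. \<Sum>b<N. A a b * x b)"
    proof -
      have "(\<lambda>a. \<Sum>b<N. A a b * (of_real c * x b)) = (\<lambda>a. of_real c * (\<Sum>b<N. A a b * x b))"
        by (simp add: sum_distrib_left mult_ac)
      then show ?thesis using c p by (simp add: fin_norm_cmult)
    qed
    ultimately have "c * fin_norm p {..<N} (\<lambda>a. \<Sum>b<N. A a b * x b) \<le> C" by simp
    then have "(fin_norm p {..<N} x + e) * (c * fin_norm p {..<N} (\<lambda>a. \<Sum>b<N. A a b * x b)) \<le> (fin_norm p {..<N} x + e) * C"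
      using P by (intro mult_left_mono) auto
    then show "fin_norm p {..<N} (\<lambda>a. \<Sum>b<N. A a b * x b) \<le> C * (fin_norm p {..<N} x + e)"
      unfolding c_def using P by (simp add: mult.assoc[symmetric] mult.commute[of C])
  qed
  then show ?thesis using C by (simp add: bilinear_bound_iff[OF _ pq])
qed

lemma norm_sum_disjoint:
  fixes z :: "'i \<Rightarrow> complex"
  assumes "finite I" "\<And>i j. i \<in> I \<Longrightarrow> j \<in> I \<Longrightarrow> i \<noteq> j \<Longrightarrow> z i = 0 \<or> z j = 0" "0 < r"
  shows "cmod (sum z I) powr r = (\<Sum>i\<in>I. cmod (z i) powr r)"
proof (cases "\<exists>i\<in>I. z i \<noteq> 0")
  case True
  then obtain i where i: "i \<in> I" "z i \<noteq> 0" by blast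
  have 0: "z j = 0" if "j \<in> I - {i}" for j using assms(2)[of i j] i that by auto
  have "sum z I = z i" using sum.mono_neutral_right[of I "{i}" z] assms(1) i 0 by simp
  moreover have "(\<Sum>i\<in>I. cmod (z i) powr r) = cmod (z i) powr r"
    using sum.mono_neutral_right[of I "{i}" "\<lambda>i. cmod (z i) powr r"] assms(1,3) i 0 by simp
  ultimately show ?thesis by simp
next
  case False
  then show ?thesis using assms(3) by simp
qed

lemma
  assumes F: "\<And>l. l < m \<Longrightarrow> Lp_mem M r (F l)" and r: "0 < r"
  shows Lp_mem_fin_norm: "Lp_mem M r (\<lambda>x. of_real (fin_norm r {..<m} (\<lambda>l. F l x)))"
    and Lp_norm_fin_norm: "Lp_norm M r (\<lambda>x. of_real (fin_norm r {..<m} (\<lambda>l. F l x))) = vec_norm M r m F"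
proof -
  have i: "integrable M (\<lambda>x. cmod (F l x) powr r)" if "l < m" for l using F[OF that] by (rule Lp_memD)
  have I: "integrable M (\<lambda>x. \<Sum>l<m. cmod (F l x) powr r)" using i by auto
  note [measurable] = borel_measurable_integrable[OF I]
  have e: "cmod (of_real (fin_norm r {..<m} (\<lambda>l. F l x))) powr r = (\<Sum>l<m. cmod (F l x) powr r)" for x
    using r by (simp add: fin_norm_powr)
  have "(\<lambda>x. complex_of_real (fin_norm r {..<m} (\<lambda>l. F l x))) \<in> borel_measurable M"
    unfolding fin_norm_def by measurable
  then show "Lp_mem M r (\<lambda>x. of_real (fin_norm r {..<m} (\<lambda>l. F l x)))" unfolding Lp_mem_def e using I by simp
  have "(\<integral>x. (\<Sum>l<m. cmod (F l x) powr r) \<partial>M) = (\<Sum>l<m. Lp_norm M r (F l) powr r)"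
    using i r by (simp add: Bochner_Integration.integral_sum Lp_norm_powr)
  then show "Lp_norm M r (\<lambda>x. of_real (fin_norm r {..<m} (\<lambda>l. F l x))) = vec_norm M r m F"
    unfolding Lp_norm_def[of M r "\<lambda>x. of_real (fin_norm r {..<m} (\<lambda>l. F l x))"] e vec_norm_def by simp
qed

context haar_group
begin

definition lam_op :: "complex \<Rightarrow> 'g \<Rightarrow> ('g \<Rightarrow> complex) \<Rightarrow> ('g \<Rightarrow> complex)" where
  "lam_op c x = (\<lambda>f t. c * lambda_p x f t)"

lemma lam_op_span: "lam_op c x = (\<lambda>f t. \<Sum>j<(Suc 0). c * lambda_p x f t)" by (simp add: lam_op_def)

lemma lam_op_bdd: "Lp_bdd_op \<mu> p (lam_op c x)"
  unfolding Lp_bdd_op_def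
proof (intro conjI allI impI; (elim conjE)?)
  show "Lp_mem \<mu> p (lam_op c x f)" if "Lp_mem \<mu> p f" for f unfolding lam_op_def by (intro Lp_mem_cmult Lp_mem_lambda that)
  show "AE t in \<mu>. lam_op c x f t = lam_op c x g t" if "AE x in \<mu>. f x = g x" for f g
    using AE_shift[OF that, of "- x"] unfolding lam_op_def lambda_p_def by (rule AE_mp) (rule AE_I2, simp)
  show "AE t in \<mu>. lam_op c x (\<lambda>y. f y + d * g y) t = lam_op c x f t + d * lam_op c x g t" for f g d
    by (rule AE_I2) (simp add: lam_op_def lambda_p_def algebra_simps)
  show "\<exists>C. \<forall>f. Lp_mem \<mu> p f \<longrightarrow> Lp_norm \<mu> p (lam_op c x f) \<le> C * Lp_norm \<mu> p f"
    unfolding lam_op_def by (intro exI[of _ "cmod c"] allI impI) (simp add: Lp_norm_cmult[OF p1(3)] Lp_norm_lambda)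
qed

lemma lam_op_in_span: "lam_op c x \<in> lambda_span"
  unfolding lambda_span_def lam_op_span
  by (rule CollectI, rule exI[of _ "Suc 0"], rule exI[of _ "\<lambda>_. c"], rule exI[of _ "\<lambda>_. x"]) simp

lemma lam_op_PMp: "lam_op c x \<in> PMp \<mu> p"
  unfolding PMp_def
proof (intro CollectI conjI allI impI lam_op_bdd)
  fix k :: nat and gs fs :: "nat \<Rightarrow> nat \<Rightarrow> 'g \<Rightarrow> complex" and e :: real
  assume "(\<forall>i<k. ptensor \<mu> p (gs i) (fs i)) \<and> 0 < e"
  then show "\<exists>S\<in>lambda_span. \<forall>i<k. cmod (tfun \<mu> (gs i) (fs i) S - tfun \<mu> (gs i) (fs i) (lam_op c x)) < e"
    by (intro bexI[of _ "lam_op c x"] lam_op_in_span) simp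
qed

lemma pm_pair_lam_op:
  assumes "a \<in> Ap \<mu> p" shows "pm_pair \<mu> p (lam_op c x) a = c * a x"
proof -
  obtain gs fs where r: "Ap_rep \<mu> p a gs fs" using assms unfolding Ap_def by blast
  have "pm_pair \<mu> p (lam_op c x) a = tfun \<mu> gs fs (lam_op c x)" by (rule pm_pair_eq[OF lam_op_PMp r])
  also have "\<dots> = (\<Sum>j<(Suc 0). c * (\<Sum>n. Lam (gs n) (fs n) x))" unfolding lam_op_span by (rule tfun_span[OF Ap_rep_ptensor[OF r]])
  finally show ?thesis using Ap_rep_eq[OF r, of x] by simp
qed

text \<open>lambda(s_k + - s_l) is lambda(s_k) followed after lambda(- s_l), so the matrix is the
  scalar matrix t conjugated by diagonal isometries. After translating g_k and f_l by - s_k and -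
  s_l, t acts pointwise in x and its bound integrates by Hoelder.\<close>

lemma lam_op_mat_norm:
  assumes t: "bilinear_bound p q {..<m} {..<m} t 1"
  shows "Lp_mat_norm \<mu> p m (\<lambda>k l. lam_op (t k l) (s k + - s l)) \<le> 1"
proof (rule Lp_mat_norm_le_1I[OF lam_op_bdd])
  fix g f assume gf: "\<And>k. k < m \<Longrightarrow> Lp_mem \<mu> q (g k) \<and> Lp_mem \<mu> p (f k)"
  define G where "G k = lambda_p (- s k) (g k)" for k
  define F where "F k = lambda_p (- s k) (f k)" for k
  have G: "Lp_mem \<mu> q (G k)" "Lp_norm \<mu> q (G k) = Lp_norm \<mu> q (g k)"
    and F: "Lp_mem \<mu> p (F k)" "Lp_norm \<mu> p (F k) = Lp_norm \<mu> p (f k)" if "k < m" for k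
    using gf[OF that] unfolding G_def F_def by (auto intro: Lp_mem_lambda Lp_norm_lambda)
  have I: "integrable \<mu> (\<lambda>x. t k l * F l x * G k x)" if "k < m" "l < m" for k l
    using integrable_mult_right[OF Holder_integrable[OF pq G(1)[OF that(1)] F(1)[OF that(2)]], of "t k l"] by (simp add: mult_ac)
  have eq: "pairing \<mu> (g k) (lam_op (t k l) (s k + - s l) (f l)) = (\<integral>x. t k l * F l x * G k x \<partial>\<mu>)" if "k < m" "l < m" for k l
  proof -
    have fl: "Lp_mem \<mu> p (lambda_p (s k + - s l) (f l))" using gf[OF that(2)] by (intro Lp_mem_lambda) simp
    have "pairing \<mu> (g k) (lambda_p (s k + - s l) (f l)) = pairing \<mu> (lambda_p (- s k) (g k)) (lambda_p (- s k) (lambda_p (s k + - s l) (f l)))"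
      by (rule pairing_lambda[symmetric]) (use gf[OF that(1)] fl in auto)
    also have "lambda_p (- s k) (lambda_p (s k + - s l) (f l)) = F l"
      unfolding F_def lambda_add[symmetric] by (simp only: add.assoc[symmetric] left_minus add_0_left)
    finally have "pairing \<mu> (g k) (lambda_p (s k + - s l) (f l)) = pairing \<mu> (G k) (F l)" unfolding G_def .
    moreover have "pairing \<mu> (g k) (lam_op (t k l) (s k + - s l) (f l)) = t k l * pairing \<mu> (g k) (lambda_p (s k + - s l) (f l))"
      unfolding lam_op_def by (rule pairing_cmult_right)
    ultimately have "pairing \<mu> (g k) (lam_op (t k l) (s k + - s l) (f l)) = (\<integral>x. t k l * (G k x * F l x) \<partial>\<mu>)"
      by (simp add: pairing_def)
    then show ?thesis by (simp only: mult_ac)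
  qed
  define NF where "NF x = fin_norm p {..<m} (\<lambda>l. F l x)" for x
  define NG where "NG x = fin_norm q {..<m} (\<lambda>l. G l x)" for x
  have mF: "Lp_mem \<mu> p (\<lambda>x. of_real (NF x))" "Lp_norm \<mu> p (\<lambda>x. of_real (NF x)) = vec_norm \<mu> p m f"
    unfolding NF_def using Lp_mem_fin_norm[OF F(1) p1(3)] Lp_norm_fin_norm[OF F(1) p1(3)] F(2) by (auto simp: vec_norm_def)
  have mG: "Lp_mem \<mu> q (\<lambda>x. of_real (NG x))" "Lp_norm \<mu> q (\<lambda>x. of_real (NG x)) = vec_norm \<mu> q m g"
    unfolding NG_def using Lp_mem_fin_norm[OF G(1) p1(4)] Lp_norm_fin_norm[OF G(1) p1(4)] G(2) by (auto simp: vec_norm_def)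
  have "(\<Sum>k<m. \<Sum>l<m. pairing \<mu> (g k) (lam_op (t k l) (s k + - s l) (f l))) = (\<Sum>k<m. \<Sum>l<m. (\<integral>x. t k l * F l x * G k x \<partial>\<mu>))"
    using eq by simp
  also have "\<dots> = (\<Sum>k<m. (\<integral>x. (\<Sum>l<m. t k l * F l x * G k x) \<partial>\<mu>))"
    by (intro sum.cong refl Bochner_Integration.integral_sum[symmetric] I) auto
  also have "\<dots> = (\<integral>x. (\<Sum>k<m. \<Sum>l<m. t k l * F l x * G k x) \<partial>\<mu>)"
    by (intro Bochner_Integration.integral_sum[symmetric] Bochner_Integration.integrable_sum I) auto
  finally have e: "(\<Sum>k<m. \<Sum>l<m. pairing \<mu> (g k) (lam_op (t k l) (s k + - s l) (f l))) = (\<integral>x. (\<Sum>k<m. \<Sum>l<m. t k l * F l x * G k x) \<partial>\<mu>)" .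
  have "cmod (\<integral>x. (\<Sum>k<m. \<Sum>l<m. t k l * F l x * G k x) \<partial>\<mu>) \<le> (\<integral>x. cmod (of_real (NG x) * of_real (NF x)) \<partial>\<mu>)"
  proof (rule order_trans[OF integral_norm_bound], rule integral_mono)
    show "integrable \<mu> (\<lambda>x. cmod (\<Sum>k<m. \<Sum>l<m. t k l * F l x * G k x))"
      by (intro integrable_norm Bochner_Integration.integrable_sum I) auto
    show "integrable \<mu> (\<lambda>x. cmod (of_real (NG x) * of_real (NF x)))"
      by (rule integrable_norm[OF Holder_integrable[OF pq mG(1) mF(1)]])
    show "cmod (\<Sum>k<m. \<Sum>l<m. t k l * F l x * G k x) \<le> cmod (of_real (NG x) * of_real (NF x))" for x
      using bilinear_boundD[OF t, of "\<lambda>l. F l x" "\<lambda>k. G k x"] by (simp add: NF_def NG_def norm_mult mult.commute)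
  qed
  also have "\<dots> \<le> vec_norm \<mu> q m g * vec_norm \<mu> p m f"
    using Holder_norm_integral[OF pq mG(1) mF(1)] unfolding mF(2) mG(2) .
  finally show "cmod (\<Sum>k<m. \<Sum>l<m. pairing \<mu> (g k) (lam_op (t k l) (s k + - s l) (f l))) \<le> vec_norm \<mu> q m g * vec_norm \<mu> p m f"
    unfolding e .
qed

lemma pairing_op_sum:
  assumes T: "Lp_bdd_op \<mu> p T" and g: "Lp_mem \<mu> q g" and f: "\<And>j. Lp_mem \<mu> p (f j)"
  shows "pairing \<mu> g (T (\<lambda>x. \<Sum>j<n::nat. c j * f j x)) = (\<Sum>j<n. c j * pairing \<mu> g (T (f j)))"
proof (induction n)
  case 0
  have "AE x in \<mu>. T (\<lambda>y. 0 + 1 * 0) x = T (\<lambda>y. 0) x + 1 * T (\<lambda>y. 0) x"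
    by (rule bdd_op_lin[OF T]) auto
  then have "AE x in \<mu>. T (\<lambda>y. 0) x = 0" by (rule AE_mp) (rule AE_I2, simp)
  then have "pairing \<mu> g (T (\<lambda>y. 0)) = pairing \<mu> g (\<lambda>y. 0)"
    by (rule pairing_cong_AE) (use bdd_op_mem[OF T] g in auto)
  then show ?case by (simp add: pairing_def)
next
  case (Suc n)
  have S: "Lp_mem \<mu> p (\<lambda>x. \<Sum>j<n. c j * f j x)" using f p1 by (intro Lp_mem_sum Lp_mem_cmult)
  have "AE x in \<mu>. T (\<lambda>x. (\<Sum>j<n. c j * f j x) + c n * f n x) x = T (\<lambda>x. \<Sum>j<n. c j * f j x) x + c n * T (f n) x"
    by (rule bdd_op_lin[OF T S f])
  then have "pairing \<mu> g (T (\<lambda>x. (\<Sum>j<n. c j * f j x) + c n * f n x)) = pairing \<mu> g (\<lambda>x. T (\<lambda>x. \<Sum>j<n. c j * f j x) x + c n * T (f n) x)"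
    by (rule pairing_cong_AE) (intro bdd_op_mem[OF T] Lp_mem_add Lp_mem_cmult S f p1 g)+
  also have "\<dots> = pairing \<mu> g (T (\<lambda>x. \<Sum>j<n. c j * f j x)) + c n * pairing \<mu> g (T (f n))"
    by (rule pairing_add_right[OF pq g bdd_op_mem[OF T S] bdd_op_mem[OF T f]])
  finally show ?case using Suc by simp
qed

lemma Lp_norm_disjoint:
  assumes r: "0 < r" and mem: "\<And>j. Lp_mem \<mu> r (f j)" and nrm: "\<And>j. Lp_norm \<mu> r (f j) = 1"
    and dj: "\<And>i j x. i < n \<Longrightarrow> j < n \<Longrightarrow> i \<noteq> j \<Longrightarrow> f i x = 0 \<or> f j x = 0"
  shows "Lp_norm \<mu> r (\<lambda>x. \<Sum>j<n::nat. c j * f j x) powr r = (\<Sum>j<n. cmod (c j) powr r)"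
proof -
  have m: "Lp_mem \<mu> r (\<lambda>x. c j * f j x)" for j by (rule Lp_mem_cmult[OF mem])
  have "Lp_norm \<mu> r (\<lambda>x. \<Sum>j<n. c j * f j x) powr r = (\<integral>x. cmod (\<Sum>j<n. c j * f j x) powr r \<partial>\<mu>)"
    using r by (simp add: Lp_norm_powr)
  also have "\<dots> = (\<integral>x. (\<Sum>j<n. cmod (c j * f j x) powr r) \<partial>\<mu>)"
    by (intro Bochner_Integration.integral_cong refl norm_sum_disjoint r) (use dj in auto)
  also have "\<dots> = (\<Sum>j<n. (\<integral>x. cmod (c j * f j x) powr r \<partial>\<mu>))"
    by (rule Bochner_Integration.integral_sum) (rule Lp_memD(2)[OF m])
  also have "\<dots> = (\<Sum>j<n. Lp_norm \<mu> r (\<lambda>x. c j * f j x) powr r)" using r by (simp add: Lp_norm_powr)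
  also have "\<dots> = (\<Sum>j<n. cmod (c j) powr r)" using nrm r by (simp add: Lp_norm_cmult)
  finally show ?thesis .
qed

text \<open>For each pair of distinct points the Hausdorff property gives a neighbourhood of 0 with
  disjoint translates; intersect these finitely many with one of finite measure.\<close>

lemma separating_nbhd:
  fixes s :: "nat \<Rightarrow> 'g"
  assumes s: "inj_on s {..<n}"
  shows "\<exists>W. open W \<and> 0 \<in> W \<and> W \<in> sets borel \<and> emeasure \<mu> W < \<infinity> \<and>
    (\<forall>i<n. \<forall>j<n. i \<noteq> j \<longrightarrow> (\<forall>x. \<not> (- s i + x \<in> W \<and> - s j + x \<in> W)))"
proof -
  have ex: "\<exists>W. open W \<and> 0 \<in> W \<and> (fst z < n \<and> snd z < n \<and> fst z \<noteq> snd z \<longrightarrow> (\<forall>x. \<not> (- s (fst z) + x \<in> W \<and> - s (snd z) + x \<in> W)))" for z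
  proof (cases "fst z < n \<and> snd z < n \<and> fst z \<noteq> snd z")
    case True
    then have "s (fst z) \<noteq> s (snd z)" using s by (auto simp: inj_on_def)
    then obtain U V where UV: "open U" "open V" "s (fst z) \<in> U" "s (snd z) \<in> V" "U \<inter> V = {}" using hausdorff by metis
    have "open ((\<lambda>w. s (fst z) + w) -` U \<inter> (\<lambda>w. s (snd z) + w) -` V)"
      by (intro open_Int open_vimage UV continuous_intros)
    then show ?thesis
      by (rule_tac exI[of _ "(\<lambda>w. s (fst z) + w) -` U \<inter> (\<lambda>w. s (snd z) + w) -` V"]) (use UV in \<open>auto simp: add.assoc[symmetric]\<close>)
  next
    case False
    then show ?thesis by (intro exI[of _ UNIV]) auto
  qed
  from choice[OF allI[OF ex]] obtain W where W: "\<forall>z. open (W z) \<and> 0 \<in> W z \<and> (fst z < n \<and> snd z < n \<and> fst z \<noteq> snd z \<longrightarrow> (\<forall>x. \<not> (- s (fst z) + x \<in> W z \<and> - s (snd z) + x \<in> W z)))" ..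
  obtain W0 where W0: "open W0" "0 \<in> W0" "W0 \<in> sets borel" "emeasure \<mu> W0 < \<infinity>" using nbhd_finite_measure by (elim exE conjE)
  define V where "V = W0 \<inter> (\<Inter>z\<in>{..<n} \<times> {..<n}. W z)"
  have oV: "open V" unfolding V_def using W W0 by (intro open_Int open_INT) auto
  show ?thesis
  proof (intro exI[of _ V] conjI allI impI oV)
    show "0 \<in> V" unfolding V_def using W W0 by auto
    show "V \<in> sets borel" using oV by simp
    have "emeasure \<mu> V \<le> emeasure \<mu> W0" by (rule emeasure_mono) (use W0(3) in \<open>auto simp: V_def sets_mu\<close>)
    then show "emeasure \<mu> V < \<infinity>" using W0(4) by (rule le_less_trans)
    fix i j x assume ij: "i < n" "j < n" "i \<noteq> j"
    have "V \<subseteq> W (i, j)" unfolding V_def using ij by auto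
    then show "\<not> (- s i + x \<in> V \<and> - s j + x \<in> V)" using W[THEN spec, of "(i, j)"] ij by auto
  qed
qed

text \<open>Test the multiplier on coefficients of normalised indicators of disjoint translates of a
  small set, against scalar multiples of translation operators; the Schur product u(s_i + - s_j)
  t_ij appears as a submatrix of the resulting n^2 by n^2 matrix.\<close>

lemma Mcb_imp_bilinear_bound:
  fixes s :: "nat \<Rightarrow> 'g"
  assumes u: "\<And>a. a \<in> Ap \<mu> p \<Longrightarrow> (\<lambda>s. u s * a s) \<in> Ap \<mu> p" and nu: "Mcb_norm \<mu> p u \<le> ereal C" and C: "0 \<le> C"
    and s: "inj_on s {..<n}" and n: "0 < n" and t: "bilinear_bound p q {..<n} {..<n} t 1"
  shows "bilinear_bound p q {..<n} {..<n} (\<lambda>i j. u (s i + - s j) * t i j) C"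
proof -
  obtain W where W: "open W" "0 \<in> W" "W \<in> sets borel" "emeasure \<mu> W < \<infinity>"
    and dj: "\<forall>i<n. \<forall>j<n. i \<noteq> j \<longrightarrow> (\<forall>x. \<not> (- s i + x \<in> W \<and> - s j + x \<in> W))"
    using separating_nbhd[OF s] by (elim exE conjE)
  define w where "w = measure \<mu> W"
  have w: "0 < w" unfolding w_def by (rule open_measure_pos[OF W(1,2,4)])
  \<comment> \<open>The two scalings make \<phi> and \<gamma> unit vectors in L_p and L_q; since 1/p
    + 1/q = 1 their pairing is exactly 1.\<close>
  define \<phi> :: "'g \<Rightarrow> complex" where "\<phi> x = of_real (w powr (- (1 / p))) * indicator W x" for x :: 'g
  define \<gamma> :: "'g \<Rightarrow> complex" where "\<gamma> x = of_real (w powr (- (1 / q))) * indicator W x" for x :: 'g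
  have \<phi>: "Lp_mem \<mu> p \<phi>" "Lp_norm \<mu> p \<phi> = 1"
    using Lp_mem_scaled_indicator[OF W(3,4) p1(3), of "of_real (w powr (- (1 / p)))"] w
    unfolding \<phi>_def w_def[symmetric] by (auto simp: powr_add[symmetric])
  have \<gamma>: "Lp_mem \<mu> q \<gamma>" "Lp_norm \<mu> q \<gamma> = 1"
    using Lp_mem_scaled_indicator[OF W(3,4) p1(4), of "of_real (w powr (- (1 / q)))"] w
    unfolding \<gamma>_def w_def[symmetric] by (auto simp: powr_add[symmetric])
  have "pairing \<mu> \<gamma> \<phi> = of_real (w powr (- (1 / q)) * w powr (- (1 / p)) * w)"
    unfolding \<phi>_def \<gamma>_def pairing_indicator[OF W(3,4)] w_def[symmetric] by simp
  also have "w powr (- (1 / q)) * w powr (- (1 / p)) * w = w powr (- (1 / q)) * w powr (- (1 / p)) * w powr 1"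
    using w by simp
  also have "\<dots> = w powr (- (1 / q) + - (1 / p) + 1)" by (simp only: powr_add)
  also have "- (1 / q) + - (1 / p) + 1 = 0" using conj_pair_eqs(1)[OF pq] by simp
  also have "w powr 0 = 1" using w by simp
  finally have \<gamma>\<phi>: "pairing \<mu> \<gamma> \<phi> = 1" by simp
  define g where "g i = lambda_p (s i) \<gamma>" for i
  define f where "f i = lambda_p (s i) \<phi>" for i
  have g: "Lp_mem \<mu> q (g i)" "Lp_norm \<mu> q (g i) = 1" and f: "Lp_mem \<mu> p (f i)" "Lp_norm \<mu> p (f i) = 1" for i
    using \<gamma> \<phi> by (auto simp: g_def f_def Lp_mem_lambda Lp_norm_lambda)
  have djf: "f i x = 0 \<or> f j x = 0" and djg: "g i x = 0 \<or> g j x = 0" if "i < n" "j < n" "i \<noteq> j" for i j x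
    using dj that by (auto simp: f_def g_def lambda_p_def \<phi>_def \<gamma>_def indicator_def)
  define \<tau> where "\<tau> i j = Lam (g i) (f j)" for i j
  have \<tau>: "\<tau> i j \<in> Ap \<mu> p" for i j unfolding \<tau>_def by (rule Lam_in_Ap[OF g(1) f(1)])
  \<comment> \<open>lambda(s_i + - s_j) carries f_j to lambda(s_i) \<phi>, whose pairing with g_i is
    that of \<gamma> and \<phi>.\<close>
  have \<tau>1: "\<tau> i j (s i + - s j) = 1" for i j
  proof -
    have "lambda_p (s i + - s j) (f j) = lambda_p (s i) \<phi>"
      unfolding f_def lambda_add[symmetric] by (simp add: add.assoc)
    then show ?thesis unfolding \<tau>_def Lam_def g_def using pairing_lambda[OF \<gamma>(1) \<phi>(1)] \<gamma>\<phi> by simp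
  qed
  \<comment> \<open>Normalised functions with disjoint supports span an isometric copy of l_p^n, so
    the scalar matrix of pairings is a compression of T and inherits its norm bound.\<close>
  have nt: "Ap_mat_norm \<mu> p n \<tau> \<le> 1"
    unfolding Ap_mat_norm_def
  proof (rule Sup_least, elim CollectE exE conjE)
    fix z m T assume z: "z = scal_mat_norm p (n * m)
        (\<lambda>a b. pm_pair \<mu> p (T (a mod m) (b mod m)) (\<tau> (a div m) (b div m)))"
      and m: "0 < m" and T: "\<forall>k<m. \<forall>l<m. T k l \<in> PMp \<mu> p" and T1: "Lp_mat_norm \<mu> p m T \<le> 1"
    have Tb: "Lp_bdd_op \<mu> p (T k l)" if "k < m" "l < m" for k l using T that by (intro PMp_bdd) simp
    have pp: "pm_pair \<mu> p (T k l) (\<tau> i j) = pairing \<mu> (g i) (T k l (f j))" if "k < m" "l < m" for k l i j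
    proof -
      have "T k l \<in> PMp \<mu> p" using T that by simp
      from pm_pair_eq[OF this Ap_rep_single(1)[OF g(1) f(1), of i j]] show ?thesis unfolding \<tau>_def Ap_rep_single(2)[OF g(1) f(1)] .
    qed
    have "bilinear_bound p q {..<n * m} {..<n * m} (\<lambda>a b. pm_pair \<mu> p (T (a mod m) (b mod m)) (\<tau> (a div m) (b div m))) 1"
      unfolding bilinear_bound_def
    proof (intro allI)
      fix x y :: "nat \<Rightarrow> complex"
      \<comment> \<open>The vector x with double index (j,l) is carried into the L_p space, one
        component for each l; Y does the same for y in L_q.\<close>
      define X where "X l = (\<lambda>t. \<Sum>j<n. x (j * m + l) * f j t)" for l
      define Y where "Y k = (\<lambda>t. \<Sum>i<n. y (i * m + k) * g i t)" for k
      have XY: "Lp_mem \<mu> q (Y k) \<and> Lp_mem \<mu> p (X k)" for k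
        unfolding X_def Y_def using f g p1 by (intro conjI Lp_mem_sum Lp_mem_cmult)
      have nX: "vec_norm \<mu> p m X = fin_norm p {..<n * m} x"
      proof -
        have "(\<Sum>l<m. Lp_norm \<mu> p (X l) powr p) = (\<Sum>l<m. \<Sum>j<n. cmod (x (j * m + l)) powr p)"
          unfolding X_def by (intro sum.cong refl Lp_norm_disjoint[OF p1(3) f djf])
        also have "\<dots> = (\<Sum>j<n. \<Sum>l<m. cmod (x (j * m + l)) powr p)" by (rule sum.swap)
        also have "\<dots> = (\<Sum>a<n * m. cmod (x ((a div m) * m + a mod m)) powr p)" by (rule sum_div_mod[OF m, symmetric])
        finally show ?thesis unfolding vec_norm_def fin_norm_def by simp
      qed
      have nY: "vec_norm \<mu> q m Y = fin_norm q {..<n * m} y"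
      proof -
        have "(\<Sum>l<m. Lp_norm \<mu> q (Y l) powr q) = (\<Sum>l<m. \<Sum>j<n. cmod (y (j * m + l)) powr q)"
          unfolding Y_def by (intro sum.cong refl Lp_norm_disjoint[OF p1(4) g djg])
        also have "\<dots> = (\<Sum>j<n. \<Sum>l<m. cmod (y (j * m + l)) powr q)" by (rule sum.swap)
        also have "\<dots> = (\<Sum>a<n * m. cmod (y ((a div m) * m + a mod m)) powr q)" by (rule sum_div_mod[OF m, symmetric])
        finally show ?thesis unfolding vec_norm_def fin_norm_def by simp
      qed
      have pYX: "pairing \<mu> (Y k) (T k l (X l)) = (\<Sum>i<n. \<Sum>j<n. pm_pair \<mu> p (T k l) (\<tau> i j) * x (j * m + l) * y (i * m + k))"
        if kl: "k < m" "l < m" for k l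
      proof -
        have mT: "Lp_mem \<mu> p (T k l (X l))" by (rule bdd_op_mem[OF Tb[OF kl]]) (use XY in simp)
        have "pairing \<mu> (Y k) (T k l (X l)) = pairing \<mu> (T k l (X l)) (Y k)" by (rule pairing_commute)
        also have "\<dots> = (\<Sum>i<n. pairing \<mu> (T k l (X l)) (\<lambda>t. y (i * m + k) * g i t))"
          unfolding Y_def by (rule pairing_sum_right[OF qp mT]) (intro Lp_mem_cmult g)
        also have "\<dots> = (\<Sum>i<n. y (i * m + k) * pairing \<mu> (g i) (T k l (X l)))"
          unfolding pairing_cmult_right pairing_commute[of \<mu> "T k l (X l)"] ..
        also have "\<dots> = (\<Sum>i<n. y (i * m + k) * (\<Sum>j<n. x (j * m + l) * pairing \<mu> (g i) (T k l (f j))))"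
          unfolding X_def pairing_op_sum[OF Tb[OF kl] g(1) f(1)] ..
        also have "\<dots> = (\<Sum>i<n. \<Sum>j<n. pm_pair \<mu> p (T k l) (\<tau> i j) * x (j * m + l) * y (i * m + k))"
          unfolding pp[OF kl] sum_distrib_left by (simp only: mult_ac)
        finally show ?thesis .
      qed
      let ?H = "\<lambda>i k j l. pm_pair \<mu> p (T k l) (\<tau> i j) * x (j * m + l) * y (i * m + k)"
      have "(\<Sum>a<n * m. \<Sum>b<n * m. pm_pair \<mu> p (T (a mod m) (b mod m)) (\<tau> (a div m) (b div m)) * x b * y a)
        = (\<Sum>a<n * m. \<Sum>b<n * m. ?H (a div m) (a mod m) (b div m) (b mod m))" by simp
      also have "\<dots> = (\<Sum>a<n * m. \<Sum>j<n. \<Sum>l<m. ?H (a div m) (a mod m) j l)"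
        by (rule sum.cong[OF refl]) (rule sum_div_mod[OF m])
      also have "\<dots> = (\<Sum>i<n. \<Sum>k<m. \<Sum>j<n. \<Sum>l<m. ?H i k j l)"
        by (rule sum_div_mod[OF m, where h = "\<lambda>i k. \<Sum>j<n. \<Sum>l<m. ?H i k j l"])
      also have "\<dots> = (\<Sum>k<m. \<Sum>i<n. \<Sum>j<n. \<Sum>l<m. ?H i k j l)" by (rule sum.swap)
      also have "\<dots> = (\<Sum>k<m. \<Sum>i<n. \<Sum>l<m. \<Sum>j<n. ?H i k j l)" by (intro sum.cong refl sum.swap)
      also have "\<dots> = (\<Sum>k<m. \<Sum>l<m. \<Sum>i<n. \<Sum>j<n. ?H i k j l)" by (intro sum.cong refl sum.swap)
      also have "\<dots> = (\<Sum>k<m. \<Sum>l<m. pairing \<mu> (Y k) (T k l (X l)))" using pYX by simp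
      finally have e: "(\<Sum>a<n * m. \<Sum>b<n * m. pm_pair \<mu> p (T (a mod m) (b mod m)) (\<tau> (a div m) (b div m)) * x b * y a)
        = (\<Sum>k<m. \<Sum>l<m. pairing \<mu> (Y k) (T k l (X l)))" .
      have "cmod (\<Sum>k<m. \<Sum>l<m. pairing \<mu> (Y k) (T k l (X l))) \<le> vec_norm \<mu> q m Y * vec_norm \<mu> p m X"
        by (rule Lp_mat_norm_le_1D[OF Tb T1 XY])
      then show "cmod (\<Sum>a<n * m. \<Sum>b<n * m. pm_pair \<mu> p (T (a mod m) (b mod m)) (\<tau> (a div m) (b div m)) * x b * y a)
        \<le> 1 * fin_norm p {..<n * m} x * fin_norm q {..<n * m} y"
        unfolding e nX nY by (simp only: mult.commute mult_1)
    qed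
    from scal_mat_norm_leI[OF this pq] show "z \<le> 1" unfolding z by (simp add: one_ereal_def)
  qed
  \<comment> \<open>The size of T is taken equal to n, with the same points s, so that the two pairs
    of indices can be matched.\<close>
  define T where "T = (\<lambda>k l. lam_op (t k l) (s k + - s l))"
  have T: "T k l \<in> PMp \<mu> p" "Lp_mat_norm \<mu> p n T \<le> 1" for k l
    unfolding T_def by (rule lam_op_PMp, rule lam_op_mat_norm[OF t])
  let ?A = "\<lambda>a b. pm_pair \<mu> p (T (a mod n) (b mod n)) (\<lambda>s. u s * \<tau> (a div n) (b div n) s)"
  have a1: "Ap_mat_norm \<mu> p n (\<lambda>i j s. u s * \<tau> i j s) \<le> Mcb_norm \<mu> p u"
    unfolding Mcb_norm_def by (rule Sup_upper, rule CollectI, rule exI[of _ n], rule exI[of _ \<tau>]) (use n \<tau> nt in auto)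
  have a2: "scal_mat_norm p (n * n) ?A
     \<le> Ap_mat_norm \<mu> p n (\<lambda>i j s. u s * \<tau> i j s)"
    unfolding Ap_mat_norm_def
    by (rule Sup_upper, rule CollectI, rule exI[of _ n], rule exI[of _ T])
       (use n T in auto)
  have "scal_mat_norm p (n * n) ?A \<le> ereal C"
    by (rule order_trans[OF order_trans[OF a2 a1] nu])
  from scal_mat_norm_leD[OF this pq C]
  have bb: "bilinear_bound p q {..<n*n} {..<n*n} ?A C" .
  \<comment> \<open>The position i n + i encodes the double index (i,i); restricting rows and
    columns to these positions pairs T i j with tau i j only.\<close>
  have im: "(\<lambda>i. i * n + i) ` {..<n} \<subseteq> {..<n*n}"
  proof (intro image_subsetI)
    fix i assume "i \<in> {..<n}"
    then have "i * n + i < i * n + n" "Suc i \<le> n" by auto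
    then have "i * n + i < Suc i * n" "Suc i * n \<le> n * n" by (simp, intro mult_le_mono1)
    then show "i * n + i \<in> {..<n*n}" by simp
  qed
  have inj: "inj_on (\<lambda>i. i * n + i) {..<n}"
  proof (rule inj_onI)
    fix i j assume "i * n + i = j * n + j"
    then have "Suc n * i = Suc n * j" by (simp add: mult.commute)
    then show "i = j" by (simp only: nat_mult_eq_cancel_disj) simp
  qed
  have "bilinear_bound p q {..<n} {..<n} (\<lambda>i j. pm_pair \<mu> p (T ((i * n + i) mod n) ((j * n + j) mod n)) (\<lambda>s. u s * \<tau> ((i * n + i) div n) ((j * n + j) div n) s)) C"
    by (rule bilinear_bound_inject[OF bb _ _ p1(3,4) im inj im inj]) auto
  moreover have "pm_pair \<mu> p (T ((i * n + i) mod n) ((j * n + j) mod n)) (\<lambda>s. u s * \<tau> ((i * n + i) div n) ((j * n + j) div n) s)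
     = u (s i + - s j) * t i j" if "i \<in> {..<n}" "j \<in> {..<n}" for i j
  proof -
    have "(i * n + i) mod n = i" "(i * n + i) div n = i" "(j * n + j) mod n = j" "(j * n + j) div n = j" using that by auto
    then show ?thesis using pm_pair_lam_op[OF u[OF \<tau>[of i j]], of "t i j" "s i + - s j"] by (simp add: T_def \<tau>1[simplified] mult.commute)
  qed
  ultimately show ?thesis by (rule iffD1[OF bilinear_bound_cong, rotated])
qed

text \<open>Enumerate F by natural numbers, apply the previous estimate and relabel back.\<close>

theorem Mcb_imp_schur_bd:
  assumes u: "\<And>a. a \<in> Ap \<mu> p \<Longrightarrow> (\<lambda>s. u s * a s) \<in> Ap \<mu> p" and nu: "Mcb_norm \<mu> p u \<le> ereal C" and C: "0 \<le> C"
  shows "schur_bd p q C (\<lambda>(s, t). u (s + - t))"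
  unfolding schur_bd_def
proof (intro allI impI, elim conjE)
  fix F :: "'g set" and T assume F: "finite F" and T: "bilinear_bound p q F F T 1"
  show "bilinear_bound p q F F (\<lambda>i j. (case (i, j) of (s, t) \<Rightarrow> u (s + - t)) * T i j) C"
  proof (cases "F = {}")
    case True
    then show ?thesis using C by (simp add: bilinear_bound_def)
  next
    case False
    define n where "n = card F"
    have n: "0 < n" using False F by (simp add: n_def card_gt_0_iff)
    obtain s where s: "bij_betw s {..<n} F" using ex_bij_betw_nat_finite[OF F] by (auto simp: n_def atLeast0LessThan)
    have si: "inj_on s {..<n}" and sF: "s ` {..<n} = F" using s by (auto simp: bij_betw_def)
    have "bilinear_bound p q {..<n} {..<n} (\<lambda>i j. T (s i) (s j)) 1"
      by (rule bilinear_bound_inject[OF T F F p1(3,4) _ si _ si]) (use sF in auto)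
    from Mcb_imp_bilinear_bound[OF u nu C si n this]
    have b: "bilinear_bound p q {..<n} {..<n} (\<lambda>i j. u (s i + - s j) * T (s i) (s j)) C" .
    let ?r = "inv_into {..<n} s"
    have ri: "inj_on ?r F" and rF: "?r ` F \<subseteq> {..<n}" proof -
      show "inj_on ?r F" by (rule inj_on_inv_into) (simp add: sF)
      show "?r ` F \<subseteq> {..<n}" by (rule image_subsetI, rule inv_into_into) (simp add: sF)
    qed
    have "bilinear_bound p q F F (\<lambda>i j. u (s (?r i) + - s (?r j)) * T (s (?r i)) (s (?r j))) C"
      by (rule bilinear_bound_inject[OF b _ _ p1(3,4) rF ri rF ri]) auto
    moreover have "u (s (?r i) + - s (?r j)) * T (s (?r i)) (s (?r j)) = (case (i, j) of (s, t) \<Rightarrow> u (s + - t)) * T i j"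
      if "i \<in> F" "j \<in> F" for i j
      using that sF by (simp add: f_inv_into_f)
    ultimately show ?thesis by (rule iffD1[OF bilinear_bound_cong, rotated])
  qed
qed

end

section \<open>Operators on l_p over an arbitrary index set and their matrices\<close>

lemma lp_norm_nonneg [simp]: "0 \<le> lp_norm p x"
  by (simp add: lp_norm_def)

lemma fin_norm_le_lp_norm:
  assumes "lp_mem p x" "finite F" "0 < p" shows "fin_norm p F x \<le> lp_norm p x"
  unfolding fin_norm_def lp_norm_def
  by (intro powr_mono2 finite_sum_le_infsum sum_nonneg) (use assms in \<open>auto simp: lp_mem_def\<close>)

text \<open>The l_p norm is the supremum of its finite sections. All infinite statements below are
  reduced to finite ones in this way.\<close>

lemma
  assumes "\<And>F. finite F \<Longrightarrow> fin_norm p F x \<le> D" "0 < p" "0 \<le> D"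
  shows lp_mem_fin_norm_le: "lp_mem p x" and lp_norm_fin_norm_le: "lp_norm p x \<le> D"
proof -
  have le: "(\<Sum>i\<in>F. cmod (x i) powr p) \<le> D powr p" if "finite F" for F
  proof -
    have "fin_norm p F x powr p \<le> D powr p" using assms that by (intro powr_mono2) auto
    then show ?thesis using assms by (simp add: fin_norm_powr)
  qed
  have s: "(\<lambda>i. cmod (x i) powr p) summable_on UNIV"
    by (rule nonneg_bdd_above_summable_on) (use le in \<open>auto intro!: bdd_aboveI[of _ "D powr p"]\<close>)
  then show "lp_mem p x" by (simp add: lp_mem_def)
  have "(\<Sum>\<^sub>\<infinity>i. cmod (x i) powr p) \<le> D powr p" by (rule infsum_le_finite_sums[OF s]) (use le in auto)
  then have "lp_norm p x \<le> (D powr p) powr (1 / p)" unfolding lp_norm_def using assms by (intro powr_mono2 infsum_nonneg) auto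
  then show "lp_norm p x \<le> D" using assms by (simp add: powr_powr)
qed

lemma
  assumes "finite F" "\<And>i. i \<notin> F \<Longrightarrow> x i = 0" "0 < p"
  shows lp_mem_finite_support: "lp_mem p x" and lp_norm_finite_support: "lp_norm p x = fin_norm p F x"
proof -
  have "(\<lambda>i. cmod (x i) powr p) summable_on UNIV \<longleftrightarrow> (\<lambda>i. cmod (x i) powr p) summable_on F"
    by (rule summable_on_cong_neutral) (use assms in auto)
  then show "lp_mem p x" unfolding lp_mem_def using assms(1) by simp
  have "(\<Sum>\<^sub>\<infinity>i. cmod (x i) powr p) = infsum (\<lambda>i. cmod (x i) powr p) F"
    by (rule infsum_cong_neutral) (use assms in auto)
  then show "lp_norm p x = fin_norm p F x" unfolding lp_norm_def fin_norm_def using assms(1) by simp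
qed

lemma lp_mem_zero [simp]: "0 < p \<Longrightarrow> lp_mem p (\<lambda>i. 0)"
  and lp_norm_zero [simp]: "0 < p \<Longrightarrow> lp_norm p (\<lambda>i. 0) = 0"
  using lp_mem_finite_support[of "{}" "\<lambda>i. 0" p] lp_norm_finite_support[of "{}" "\<lambda>i. 0" p] by (auto simp: fin_norm_def)

lemma lp_mem_delta: "0 < p \<Longrightarrow> lp_mem p (delta j)"
  by (rule lp_mem_finite_support[of "{j}"]) (auto simp: delta_def)

lemma
  assumes "lp_mem p x" "0 < p"
  shows lp_mem_cmult: "lp_mem p (\<lambda>i. c * x i)" and lp_norm_cmult: "lp_norm p (\<lambda>i. c * x i) = cmod c * lp_norm p x"
proof -
  have e: "cmod (c * x i) powr p = cmod c powr p * cmod (x i) powr p" for i by (simp add: norm_mult powr_mult)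
  show "lp_mem p (\<lambda>i. c * x i)" using assms unfolding lp_mem_def e by (intro summable_on_cmult_right)
  show "lp_norm p (\<lambda>i. c * x i) = cmod c * lp_norm p x"
    unfolding lp_norm_def e infsum_cmult_right' using assms(2) by (simp add: powr_mult powr_powr infsum_nonneg)
qed

lemma lp_mem_add:
  assumes "lp_mem p x" "lp_mem p y" "1 < p" shows "lp_mem p (\<lambda>i. x i + y i)"
proof (rule lp_mem_fin_norm_le)
  fix F :: "'a set" assume F: "finite F"
  show "fin_norm p F (\<lambda>i. x i + y i) \<le> lp_norm p x + lp_norm p y"
    using fin_norm_add[OF F assms(3), of x y] fin_norm_le_lp_norm[OF assms(1) F] fin_norm_le_lp_norm[OF assms(2) F] assms(3) by simp
qed (use assms in \<open>auto intro: add_nonneg_nonneg\<close>)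

definition cut :: "'i set \<Rightarrow> ('i \<Rightarrow> complex) \<Rightarrow> 'i \<Rightarrow> complex" where
  "cut F x = (\<lambda>j. if j \<in> F then x j else 0)"

lemma
  assumes "finite F" "0 < p"
  shows lp_mem_cut: "lp_mem p (cut F x)" and lp_norm_cut: "lp_norm p (cut F x) = fin_norm p F x"
proof -
  show "lp_mem p (cut F x)" by (rule lp_mem_finite_support[OF assms(1) _ assms(2)]) (simp add: cut_def)
  have "lp_norm p (cut F x) = fin_norm p F (cut F x)" by (rule lp_norm_finite_support[OF assms(1) _ assms(2)]) (simp add: cut_def)
  also have "\<dots> = fin_norm p F x" by (rule fin_norm_cong) (simp add: cut_def)
  finally show "lp_norm p (cut F x) = fin_norm p F x" .
qed

lemma lp_tail:
  assumes x: "lp_mem p x" and p: "0 < p"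
  shows "((\<lambda>F. lp_norm p (\<lambda>i. x i - cut F x i)) \<longlongrightarrow> 0) (finite_subsets_at_top UNIV)"
proof -
  let ?f = "\<lambda>i. cmod (x i) powr p"
  let ?S = "\<Sum>\<^sub>\<infinity>i. ?f i"
  have s: "?f summable_on UNIV" using x by (simp add: lp_mem_def)
  have e: "lp_norm p (\<lambda>i. x i - cut F x i) = (?S - sum ?f F) powr (1 / p)" if "finite F" for F
  proof -
    have "(\<Sum>\<^sub>\<infinity>i. cmod (x i - cut F x i) powr p) = infsum ?f (UNIV - F)"
      by (rule infsum_cong_neutral) (use p in \<open>auto simp: cut_def\<close>)
    also have "\<dots> = ?S - infsum ?f F" by (rule infsum_Diff) (use s that in auto)
    finally show ?thesis unfolding lp_norm_def using that by simp
  qed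
  have "((\<lambda>F. ?S - sum ?f F) \<longlongrightarrow> ?S - ?S) (finite_subsets_at_top UNIV)"
    by (intro tendsto_diff tendsto_const) (use has_sum_infsum[OF s] in \<open>simp add: has_sum_def\<close>)
  moreover have nn: "\<forall>\<^sub>F F in finite_subsets_at_top UNIV. 0 \<le> ?S - sum ?f F"
    by (rule eventually_finite_subsets_at_top_weakI) (use finite_sum_le_infsum[OF s] in simp)
  ultimately have "((\<lambda>F. (?S - sum ?f F) powr (1 / p)) \<longlongrightarrow> (?S - ?S) powr (1 / p)) (finite_subsets_at_top UNIV)"
    by (intro tendsto_powr' tendsto_const) (use p in auto)
  then have l: "((\<lambda>F. (?S - sum ?f F) powr (1 / p)) \<longlongrightarrow> 0) (finite_subsets_at_top UNIV)" by simp
  show ?thesis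
  proof (rule Lim_transform_eventually[OF l])
    show "\<forall>\<^sub>F F in finite_subsets_at_top UNIV. (?S - sum ?f F) powr (1 / p) = lp_norm p (\<lambda>i. x i - cut F x i)"
      by (rule eventually_finite_subsets_at_top_weakI) (use e in simp)
  qed
qed

lemma bilinear_bound_matrix:
  assumes bd: "\<And>F. finite F \<Longrightarrow> bilinear_bound p q F F a D" and pq: "conj_pair p q" and D: "0 \<le> D" and fin: "finite I" "finite J"
  shows "fin_norm p I (\<lambda>i. \<Sum>j\<in>J. a i j * x j) \<le> D * fin_norm p J x"
proof -
  have "bilinear_bound p q I J (\<lambda>i j. a (id i) (id j)) D"
    by (rule bilinear_bound_inject[OF bd[of "I \<union> J"]]) (use fin conj_pairD[OF pq] in auto)
  then show ?thesis using fin D by (simp add: bilinear_bound_iff[OF _ pq])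
qed

text \<open>The operator with a prescribed matrix. \<open>infsum\<close> has value 0 on divergent
  rows, so summability is established separately from uniform bounds on finite sections.\<close>

definition mat_op :: "('i \<Rightarrow> 'j \<Rightarrow> complex) \<Rightarrow> ('j \<Rightarrow> complex) \<Rightarrow> 'i \<Rightarrow> complex" where
  "mat_op a x i = (\<Sum>\<^sub>\<infinity>j. a i j * x j)"

lemma cnj_sgn_mult: "cnj (sgn w) * w = of_real (cmod w)"
proof (cases "w = 0")
  case False
  have "cnj (sgn w) * w = w * cnj w / of_real (cmod w)" by (simp add: sgn_eq)
  also have "\<dots> = of_real ((cmod w)\<^sup>2) / of_real (cmod w)" by (simp only: complex_norm_square)
  also have "\<dots> = of_real (cmod w)" using False by (simp add: power2_eq_square)
  finally show ?thesis .
qed simp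

lemma mat_op_summable:
  assumes bd: "\<And>F. finite F \<Longrightarrow> bilinear_bound p q F F a D" and pq: "conj_pair p q" and D: "0 \<le> D" and x: "lp_mem p x"
  shows "(\<lambda>j. a i j * x j) summable_on UNIV"
proof -
  note p = conj_pairD[OF pq]
  have "(\<lambda>j. norm (a i j * x j)) summable_on UNIV"
  proof (rule nonneg_bdd_above_summable_on)
    show "bdd_above (sum (\<lambda>j. norm (a i j * x j)) ` {F. F \<subseteq> UNIV \<and> finite F})"
    proof (rule bdd_aboveI[of _ "D * lp_norm p x"], safe)
      fix F :: "'a set" assume F: "finite F"
      \<comment> \<open>Adjusting the phases of x turns the i-th row sum into a sum of absolute
        values without increasing |x j|, so the finite bound yields absolute summability.\<close>
      define z where "z j = cnj (sgn (a i j * x j)) * x j" for j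
      have "(\<Sum>j\<in>F. a i j * z j) = (\<Sum>j\<in>F. of_real (norm (a i j * x j)))"
        unfolding z_def by (intro sum.cong refl) (simp only: cnj_sgn_mult[symmetric] mult_ac)
      then have "norm (\<Sum>j\<in>F. a i j * z j) = norm (complex_of_real (\<Sum>j\<in>F. norm (a i j * x j)))" by simp
      also have "\<dots> = (\<Sum>j\<in>F. norm (a i j * x j))" by (simp only: norm_of_real) (simp add: sum_nonneg)
      finally have "(\<Sum>j\<in>F. norm (a i j * x j)) = fin_norm p {i} (\<lambda>i. \<Sum>j\<in>F. a i j * z j)"
        using p by (simp add: fin_norm_def powr_powr sum_nonneg)
      also have "\<dots> \<le> D * fin_norm p F z" by (rule bilinear_bound_matrix[OF bd pq D]) (use F in auto)
      also have "\<dots> \<le> D * fin_norm p F x"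
      proof (intro mult_left_mono D fin_norm_mono p)
        fix j show "cmod (z j) \<le> cmod (x j)" by (cases "a i j * x j = 0") (auto simp: z_def norm_mult norm_sgn)
      qed
      also have "\<dots> \<le> D * lp_norm p x" by (intro mult_left_mono D fin_norm_le_lp_norm x F p)
      finally show "(\<Sum>j\<in>F. norm (a i j * x j)) \<le> D * lp_norm p x" .
    qed
  qed simp
  then show ?thesis by (rule abs_summable_summable)
qed

lemma
  assumes bd: "\<And>F. finite F \<Longrightarrow> bilinear_bound p q F F a D" and pq: "conj_pair p q" and D: "0 \<le> D" and x: "lp_mem p x"
  shows lp_mem_mat_op: "lp_mem p (mat_op a x)" and lp_norm_mat_op: "lp_norm p (mat_op a x) \<le> D * lp_norm p x"
proof -
  note p = conj_pairD[OF pq]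
  have le: "fin_norm p I (mat_op a x) \<le> D * lp_norm p x" if I: "finite I" for I
  proof (rule tendsto_upperbound)
    have 1: "((\<lambda>J. \<Sum>j\<in>J. a i j * x j) \<longlongrightarrow> mat_op a x i) (finite_subsets_at_top UNIV)" for i
      using has_sum_infsum[OF mat_op_summable[OF bd pq D x, of i]] by (simp add: has_sum_def mat_op_def)
    have "((\<lambda>J. \<Sum>i\<in>I. cmod (\<Sum>j\<in>J. a i j * x j) powr p) \<longlongrightarrow> (\<Sum>i\<in>I. cmod (mat_op a x i) powr p)) (finite_subsets_at_top UNIV)"
      by (intro tendsto_sum tendsto_powr' tendsto_const tendsto_norm 1) (use p in auto)
    then show "((\<lambda>J. fin_norm p I (\<lambda>i. \<Sum>j\<in>J. a i j * x j)) \<longlongrightarrow> fin_norm p I (mat_op a x)) (finite_subsets_at_top UNIV)"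
      unfolding fin_norm_def by (intro tendsto_powr' tendsto_const) (use p in \<open>auto intro!: always_eventually sum_nonneg\<close>)
    show "\<forall>\<^sub>F J in finite_subsets_at_top UNIV. fin_norm p I (\<lambda>i. \<Sum>j\<in>J. a i j * x j) \<le> D * lp_norm p x"
    proof (rule eventually_finite_subsets_at_top_weakI)
      fix J :: "'a set" assume J: "finite J"
      have "fin_norm p I (\<lambda>i. \<Sum>j\<in>J. a i j * x j) \<le> D * fin_norm p J x" by (rule bilinear_bound_matrix[OF bd pq D I J])
      also have "\<dots> \<le> D * lp_norm p x" by (intro mult_left_mono D fin_norm_le_lp_norm x J p)
      finally show "fin_norm p I (\<lambda>i. \<Sum>j\<in>J. a i j * x j) \<le> D * lp_norm p x" .
    qed
  qed simp
  have D0: "0 \<le> D * lp_norm p x" using D by simp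
  show "lp_mem p (mat_op a x)" by (rule lp_mem_fin_norm_le[OF le p(3) D0])
  show "lp_norm p (mat_op a x) \<le> D * lp_norm p x" by (rule lp_norm_fin_norm_le[OF le p(3) D0])
qed

lemma lp_bdd_mat_op:
  assumes bd: "\<And>F. finite F \<Longrightarrow> bilinear_bound p q F F a D" and pq: "conj_pair p q" and D: "0 \<le> D"
  shows "lp_bdd_op p (mat_op a)"
  unfolding lp_bdd_op_def
proof (intro conjI allI impI; (elim conjE)?)
  show "lp_mem p (mat_op a x)" if "lp_mem p x" for x by (rule lp_mem_mat_op[OF bd pq D that])
  show "\<exists>C. \<forall>x. lp_mem p x \<longrightarrow> lp_norm p (mat_op a x) \<le> C * lp_norm p x"
    using lp_norm_mat_op[OF bd pq D] by blast
  fix x y :: "'a \<Rightarrow> complex" and c assume xy: "lp_mem p x" "lp_mem p y"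
  show "mat_op a (\<lambda>i. x i + c * y i) = (\<lambda>i. mat_op a x i + c * mat_op a y i)"
  proof
    fix i
    have s: "(\<lambda>j. a i j * x j) summable_on UNIV" "(\<lambda>j. a i j * y j) summable_on UNIV" 
      using mat_op_summable[OF bd pq D xy(1), of i] mat_op_summable[OF bd pq D xy(2), of i] by simp_all
    have "mat_op a (\<lambda>i. x i + c * y i) i = (\<Sum>\<^sub>\<infinity>j. a i j * x j + c * (a i j * y j))"
      unfolding mat_op_def by (simp only: distrib_left mult_ac)
    also have "\<dots> = (\<Sum>\<^sub>\<infinity>j. a i j * x j) + (\<Sum>\<^sub>\<infinity>j. c * (a i j * y j))" by (rule infsum_add[OF s(1) summable_on_cmult_right[OF s(2)]])
    also have "(\<Sum>\<^sub>\<infinity>j. c * (a i j * y j)) = c * (\<Sum>\<^sub>\<infinity>j. a i j * y j)" by (rule infsum_cmult_right') 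
    finally show "mat_op a (\<lambda>i. x i + c * y i) i = mat_op a x i + c * mat_op a y i" unfolding mat_op_def .
  qed
qed

lemma mat_op_delta: "mat_op a (delta j) i = a i j"
proof -
  have "(\<Sum>\<^sub>\<infinity>k. a i k * delta j k) = infsum (\<lambda>k. a i k * delta j k) {j}"
    by (rule infsum_cong_neutral) (auto simp: delta_def)
  then show ?thesis by (simp add: mat_op_def delta_def)
qed

lemma
  assumes T: "lp_bdd_op p T" and p: "1 < p"
  shows lp_op_zero: "T (\<lambda>i. 0) = (\<lambda>i. 0)"
    and lp_op_cmult: "\<And>x c. lp_mem p x \<Longrightarrow> T (\<lambda>i. c * x i) = (\<lambda>i. c * T x i)"
    and lp_op_add: "\<And>x y. lp_mem p x \<Longrightarrow> lp_mem p y \<Longrightarrow> T (\<lambda>i. x i + y i) = (\<lambda>i. T x i + T y i)"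
    and lp_op_diff: "\<And>x y. lp_mem p x \<Longrightarrow> lp_mem p y \<Longrightarrow> T (\<lambda>i. x i - y i) = (\<lambda>i. T x i - T y i)"
proof -
  have lin: "T (\<lambda>i. x i + c * y i) = (\<lambda>i. T x i + c * T y i)" if "lp_mem p x" "lp_mem p y" for x y c
    using T that unfolding lp_bdd_op_def by blast
  have z: "lp_mem p (\<lambda>i. 0)" using p by simp
  show 0: "T (\<lambda>i. 0) = (\<lambda>i. 0)" using lin[OF z z, of "-1"] by simp
  show "T (\<lambda>i. c * x i) = (\<lambda>i. c * T x i)" if "lp_mem p x" for x c using lin[OF z that, of c] 0 by simp
  show "T (\<lambda>i. x i + y i) = (\<lambda>i. T x i + T y i)" if "lp_mem p x" "lp_mem p y" for x y using lin[OF that, of 1] by simp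
  show "T (\<lambda>i. x i - y i) = (\<lambda>i. T x i - T y i)" if "lp_mem p x" "lp_mem p y" for x y using lin[OF that, of "-1"] by simp
qed

lemma lp_op_cut:
  assumes T: "lp_bdd_op p T" and p: "1 < p" and F: "finite F"
  shows "T (cut F x) i = (\<Sum>j\<in>F. T (delta j) i * x j)"
  using F
proof (induction F rule: finite_induct)
  case empty
  then show ?case using lp_op_zero[OF T p] by (simp add: cut_def)
next
  case (insert k F)
  have m: "lp_mem p (cut F x)" "lp_mem p (\<lambda>i. x k * delta k i)" "lp_mem p (delta k)"
    using insert p by (auto intro!: lp_mem_cut lp_mem_cmult lp_mem_delta)
  have "cut (insert k F) x = (\<lambda>i. cut F x i + x k * delta k i)" using insert by (auto simp: cut_def delta_def fun_eq_iff)
  then have "T (cut (insert k F) x) i = T (cut F x) i + x k * T (delta k) i"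
    by (simp add: lp_op_add[OF T p m(1,2)] lp_op_cmult[OF T p m(3)])
  then show ?case using insert by simp
qed

lemma cmod_le_lp_norm:
  assumes "lp_mem p x" "0 < p" shows "cmod (x i) \<le> lp_norm p x"
  using fin_norm_le_lp_norm[OF assms(1) _ assms(2), of "{i}"] assms(2) by (simp add: fin_norm_def powr_powr)

text \<open>Truncations of x converge to x in norm and T is bounded, so T x is the sum of its
  columns. Hence an operator is determined on l_p by its matrix, and any choice of Schur product
  satisfies the same estimates.\<close>

lemma lp_op_eq_mat_op:
  assumes T: "lp_bdd_op p T" and p: "1 < p" and x: "lp_mem p x"
  shows "T x = mat_op (\<lambda>i j. T (delta j) i) x"
proof
  fix i
  obtain C where C: "\<And>x. lp_mem p x \<Longrightarrow> lp_norm p (T x) \<le> C * lp_norm p x" using T unfolding lp_bdd_op_def by blast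
  have Tm: "\<And>x. lp_mem p x \<Longrightarrow> lp_mem p (T x)" using T unfolding lp_bdd_op_def by blast
  have p0: "0 < p" using p by simp
  have "((\<lambda>F. T (cut F x) i - T x i) \<longlongrightarrow> 0) (finite_subsets_at_top UNIV)"
  proof (rule Lim_null_comparison)
    show "((\<lambda>F. C * lp_norm p (\<lambda>i. x i - cut F x i)) \<longlongrightarrow> 0) (finite_subsets_at_top UNIV)"
      by (rule tendsto_mult_right_zero[OF lp_tail[OF x p0]])
    show "\<forall>\<^sub>F F in finite_subsets_at_top UNIV. norm (T (cut F x) i - T x i) \<le> C * lp_norm p (\<lambda>i. x i - cut F x i)"
    proof (rule eventually_finite_subsets_at_top_weakI)
      fix F :: "'a set" assume F: "finite F"
      have cm: "lp_mem p (cut F x)" by (rule lp_mem_cut[OF F p0])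
      have m: "lp_mem p (\<lambda>i. x i - cut F x i)"
        using lp_mem_add[OF x lp_mem_cmult[OF cm p0, of "-1"] p] by simp
      have "norm (T (cut F x) i - T x i) = cmod (T (\<lambda>i. x i - cut F x i) i)"
        unfolding lp_op_diff[OF T p x cm] by (rule norm_minus_commute)
      also have "\<dots> \<le> lp_norm p (T (\<lambda>i. x i - cut F x i))" by (rule cmod_le_lp_norm[OF Tm[OF m] p0])
      also have "\<dots> \<le> C * lp_norm p (\<lambda>i. x i - cut F x i)" by (rule C[OF m])
      finally show "norm (T (cut F x) i - T x i) \<le> C * lp_norm p (\<lambda>i. x i - cut F x i)" .
    qed
  qed
  then have l: "((\<lambda>F. T (cut F x) i) \<longlongrightarrow> T x i) (finite_subsets_at_top UNIV)" by (rule LIM_zero_cancel)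
  have "((\<lambda>F. \<Sum>j\<in>F. T (delta j) i * x j) \<longlongrightarrow> T x i) (finite_subsets_at_top UNIV)"
  proof (rule Lim_transform_eventually[OF l])
    show "\<forall>\<^sub>F F in finite_subsets_at_top UNIV. T (cut F x) i = (\<Sum>j\<in>F. T (delta j) i * x j)"
      by (rule eventually_finite_subsets_at_top_weakI) (rule lp_op_cut[OF T p])
  qed
  then have "((\<lambda>j. T (delta j) i * x j) has_sum T x i) UNIV" by (simp add: has_sum_def)
  then show "T x i = mat_op (\<lambda>i j. T (delta j) i) x i" unfolding mat_op_def by (simp add: infsumI)
qed

lemma lp_op_bilinear_bound:
  assumes T: "lp_bdd_op p T" and pq: "conj_pair p q" and B: "0 \<le> B" "\<And>x. lp_mem p x \<Longrightarrow> lp_norm p (T x) \<le> B * lp_norm p x"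
    and F: "finite F"
  shows "bilinear_bound p q F F (\<lambda>i j. T (delta j) i) B"
  unfolding bilinear_bound_iff[OF F pq B(1)]
proof
  fix x
  note p = conj_pairD[OF pq]
  have cm: "lp_mem p (cut F x)" by (rule lp_mem_cut[OF F p(3)])
  have Tm: "lp_mem p (T (cut F x))" using T cm unfolding lp_bdd_op_def by blast
  have "fin_norm p F (\<lambda>i. \<Sum>j\<in>F. T (delta j) i * x j) = fin_norm p F (T (cut F x))"
    by (rule fin_norm_cong) (simp add: lp_op_cut[OF T p(1) F])
  also have "\<dots> \<le> lp_norm p (T (cut F x))" by (rule fin_norm_le_lp_norm[OF Tm F p(3)])
  also have "\<dots> \<le> B * lp_norm p (cut F x)" by (rule B(2)[OF cm])
  also have "\<dots> = B * fin_norm p F x" by (simp add: lp_norm_cut[OF F p(3)])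
  finally show "fin_norm p F (\<lambda>i. \<Sum>j\<in>F. T (delta j) i * x j) \<le> B * fin_norm p F x" .
qed

lemma lp_opnorm_leI:
  assumes "\<And>x. lp_mem p x \<Longrightarrow> lp_norm p (T x) \<le> B * lp_norm p x" "0 \<le> B"
  shows "lp_opnorm p T \<le> ereal B"
  unfolding lp_opnorm_def
proof (rule Sup_least, elim CollectE exE conjE)
  fix z x assume z: "z = ereal (lp_norm p (T x))" and x: "lp_mem p x" "lp_norm p x \<le> 1"
  have "lp_norm p (T x) \<le> B * lp_norm p x" by (rule assms(1)[OF x(1)])
  also have "\<dots> \<le> B * 1" by (rule mult_left_mono[OF x(2) assms(2)])
  finally show "z \<le> ereal B" unfolding z by simp
qed

lemma lp_opnorm_leD:
  assumes T: "lp_bdd_op p T" and p: "1 < p" and n: "lp_opnorm p T \<le> ereal B" and B: "0 \<le> B" and x: "lp_mem p x"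
  shows "lp_norm p (T x) \<le> B * lp_norm p x"
proof (rule le_mult_by_approx[OF _ B])
  fix e :: real assume e: "0 < e"
  define c where "c = inverse (lp_norm p x + e)"
  have P: "0 < lp_norm p x + e" by (rule add_nonneg_pos[OF _ e]) simp
  then have c: "0 < c" by (simp add: c_def)
  have p0: "0 < p" using p by simp
  have Tx: "lp_mem p (T x)" using T x unfolding lp_bdd_op_def by blast
  have "lp_norm p (\<lambda>i. of_real c * x i) = c * lp_norm p x" using c by (simp add: lp_norm_cmult[OF x p0])
  also have "\<dots> \<le> c * (lp_norm p x + e)" using c e by (intro mult_left_mono) auto
  also have "\<dots> = 1" unfolding c_def using P by simp
  finally have "lp_norm p (\<lambda>i. of_real c * x i) \<le> 1" .
  then have "ereal (lp_norm p (T (\<lambda>i. of_real c * x i))) \<le> lp_opnorm p T"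
    unfolding lp_opnorm_def using lp_mem_cmult[OF x p0] by (rule_tac Sup_upper, rule_tac CollectI, rule_tac exI[of _ "\<lambda>i. of_real c * x i"]) simp
  then have "ereal (lp_norm p (T (\<lambda>i. of_real c * x i))) \<le> ereal B" using n by (rule order_trans)
  then have "c * lp_norm p (T x) \<le> B" unfolding lp_op_cmult[OF T p x] using c by (simp add: lp_norm_cmult[OF Tx p0])
  then have "(lp_norm p x + e) * (c * lp_norm p (T x)) \<le> (lp_norm p x + e) * B" using P by (intro mult_left_mono) auto
  then show "lp_norm p (T x) \<le> B * (lp_norm p x + e)" unfolding c_def using P by (simp add: mult.assoc[symmetric] mult.commute[of B])
qed

section \<open>Schur bounds and the norm of V_p\<close>

lemma schur_bd_apply:
  assumes S: "schur_bd p q C \<psi>" and F: "finite F" and T: "bilinear_bound p q F F T B" and B: "0 < B"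
  shows "bilinear_bound p q F F (\<lambda>i j. \<psi> (i, j) * T i j) (C * B)"
proof -
  have "bilinear_bound p q F F (\<lambda>i j. of_real (inverse B) * T i j) (inverse B * B)"
    by (rule bilinear_bound_scale[OF T]) (use B in simp)
  then have "bilinear_bound p q F F (\<lambda>i j. of_real (inverse B) * T i j) 1" using B by simp
  from S[unfolded schur_bd_def, rule_format, OF conjI[OF F this]]
  have "bilinear_bound p q F F (\<lambda>i j. of_real B * (\<psi> (i, j) * (of_real (inverse B) * T i j))) (B * C)"
    by (rule bilinear_bound_scale) (use B in simp)
  moreover have "of_real B * (\<psi> (i, j) * (of_real (inverse B) * T i j)) = \<psi> (i, j) * T i j" for i j using B by simp
  ultimately show ?thesis by (simp only: mult.commute[of B C])
qed

lemma schur_bd_mono: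
  assumes "schur_bd p q C \<psi>" "C \<le> D" shows "schur_bd p q D \<psi>"
  unfolding schur_bd_def bilinear_bound_def[of _ _ _ _ _ D]
proof (intro allI impI, elim conjE)
  fix F :: "'a set" and T :: "'a \<Rightarrow> 'a \<Rightarrow> complex" and x y :: "'a \<Rightarrow> complex" assume FT: "finite F" "bilinear_bound p q F F T 1"
  have "cmod (\<Sum>i\<in>F. \<Sum>j\<in>F. \<psi> (i, j) * T i j * x j * y i) \<le> C * fin_norm p F x * fin_norm q F y"
    by (rule bilinear_boundD[OF assms(1)[unfolded schur_bd_def, rule_format, OF conjI[OF FT]]])
  also have "\<dots> \<le> D * fin_norm p F x * fin_norm q F y" by (intro mult_right_mono assms) auto
  finally show "cmod (\<Sum>i\<in>F. \<Sum>j\<in>F. \<psi> (i, j) * T i j * x j * y i) \<le> D * fin_norm p F x * fin_norm q F y" .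
qed

text \<open>All finite sections of the Schur product are bounded by C times a bound for T, so the
  product matrix defines a bounded operator; its norm is then read off from the sections.\<close>

lemma schur_bd_imp_Vp:
  assumes S: "schur_bd p q C \<psi>" and pq: "conj_pair p q" and C: "0 \<le> C"
  shows "Vp_discrete p \<psi>" "Vp_norm p \<psi> \<le> ereal C"
proof -
  note p = conj_pairD[OF pq]
  show V: "Vp_discrete p \<psi>"
    unfolding Vp_discrete_def
  proof (intro allI impI)
    fix T :: "('a \<Rightarrow> complex) \<Rightarrow> 'a \<Rightarrow> complex" assume T: "lp_bdd_op p T"
    obtain B0 where B0: "\<And>x. lp_mem p x \<Longrightarrow> lp_norm p (T x) \<le> B0 * lp_norm p x" using T unfolding lp_bdd_op_def by blast
    define B where "B = max B0 1"
    have B: "0 < B" by (simp add: B_def)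
    have le: "lp_norm p (T x) \<le> B * lp_norm p x" if "lp_mem p x" for x
      by (rule order_trans[OF B0[OF that]]) (auto intro: mult_right_mono simp: B_def)
    have b: "bilinear_bound p q F F (\<lambda>i j. \<psi> (i, j) * T (delta j) i) (C * B)" if F: "finite F" for F
      by (rule schur_bd_apply[OF S F lp_op_bilinear_bound[OF T pq _ le F] B]) (use B in auto)
    have "lp_bdd_op p (mat_op (\<lambda>i j. \<psi> (i, j) * T (delta j) i))"
      by (rule lp_bdd_mat_op[OF b pq]) (use B C in auto)
    then show "\<exists>S. schur_op p \<psi> T S" unfolding schur_op_def
      by (intro exI[of _ "mat_op (\<lambda>i j. \<psi> (i, j) * T (delta j) i)"]) (simp add: mat_op_delta)
  qed
  show "Vp_norm p \<psi> \<le> ereal C"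
    unfolding Vp_norm_def
  proof (rule Sup_least, elim CollectE exE conjE)
    fix z and T :: "('a \<Rightarrow> complex) \<Rightarrow> 'a \<Rightarrow> complex" assume z: "z = lp_opnorm p (SOME S. schur_op p \<psi> T S)" and T: "lp_bdd_op p T" "lp_opnorm p T \<le> 1"
    \<comment> \<open>The operator chosen in \<open>Vp_norm\<close> need not be the
      \<open>mat_op\<close> constructed above, but it has the same matrix and so agrees with it on
      l_p.\<close>
    define S0 where "S0 = (SOME S. schur_op p \<psi> T S)"
    have "schur_op p \<psi> T S0" unfolding S0_def by (rule someI_ex[OF V[unfolded Vp_discrete_def, rule_format, OF T(1)]])
    then have S0: "lp_bdd_op p S0" "\<And>i j. S0 (delta j) i = \<psi> (i, j) * T (delta j) i" unfolding schur_op_def by auto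
    have t1: "bilinear_bound p q F F (\<lambda>i j. T (delta j) i) 1" if F: "finite F" for F
      by (rule lp_op_bilinear_bound[OF T(1) pq _ lp_opnorm_leD[OF T(1) p(1)] F]) (use T(2) in \<open>auto simp: one_ereal_def\<close>)
    have b: "bilinear_bound p q F F (\<lambda>i j. \<psi> (i, j) * T (delta j) i) C" if F: "finite F" for F
      using schur_bd_apply[OF S F t1[OF F]] by simp
    have "lp_norm p (S0 x) \<le> C * lp_norm p x" if x: "lp_mem p x" for x
      unfolding lp_op_eq_mat_op[OF S0(1) p(1) x] S0(2) by (rule lp_norm_mat_op[OF b pq C x])
    then show "z \<le> ereal C" unfolding z S0_def[symmetric] by (rule lp_opnorm_leI[OF _ C])
  qed
qed

text \<open>The zero operator is admissible in the supremum. Nonnegativity rules out the value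
  -\<infinity>, so a norm bounded by a real number is itself \<open>ereal c\<close> with 0 \<le>
  c.\<close>

lemma Vp_norm_nonneg:
  assumes "1 < p" shows "0 \<le> Vp_norm p \<psi>"
proof -
  have p0: "0 < p" using assms by simp
  let ?T = "\<lambda>x i. 0 :: complex"
  have T: "lp_bdd_op p ?T" unfolding lp_bdd_op_def using p0 by (auto intro: exI[of _ 0])
  have n: "lp_opnorm p ?T \<le> ereal 1" by (rule lp_opnorm_leI) (use p0 in auto)
  let ?S = "SOME S. schur_op p \<psi> ?T S"
  have "0 \<le> ereal (lp_norm p (?S (\<lambda>i. 0)))" by simp
  also have "\<dots> \<le> lp_opnorm p ?S" unfolding lp_opnorm_def
    by (rule Sup_upper, rule CollectI, rule exI[of _ "\<lambda>i. 0"]) (use p0 in simp)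
  also have "\<dots> \<le> Vp_norm p \<psi>" unfolding Vp_norm_def
    by (rule Sup_upper, rule CollectI, rule exI[of _ ?T]) (use T n in \<open>simp add: one_ereal_def\<close>)
  finally show ?thesis .
qed

lemma bilinear_bound_mono:
  assumes "bilinear_bound p q I J T C" "C \<le> D" shows "bilinear_bound p q I J T D"
  unfolding bilinear_bound_def
proof (intro allI)
  fix x y
  have "C * fin_norm p J x * fin_norm q I y \<le> D * fin_norm p J x * fin_norm q I y" by (intro mult_right_mono assms) auto
  with bilinear_boundD[OF assms(1)] show "cmod (\<Sum>i\<in>I. \<Sum>j\<in>J. T i j * x j * y i) \<le> D * fin_norm p J x * fin_norm q I y"
    by (rule order_trans)
qed

lemma bilinear_bound_extend:
  assumes T: "bilinear_bound p q E E T 1" and E: "finite E" and F: "finite F" and p: "0 < p" "0 < q"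
  shows "bilinear_bound p q F F (\<lambda>i j. if i \<in> E \<and> j \<in> E then T i j else 0) 1"
  unfolding bilinear_bound_def
proof (intro allI)
  fix x y :: "'a \<Rightarrow> complex"
  let ?t = "\<lambda>i j. if i \<in> E \<and> j \<in> E then T i j else 0"
  have "(\<Sum>i\<in>F. \<Sum>j\<in>F. ?t i j * x j * y i) = (\<Sum>i\<in>F \<inter> E. \<Sum>j\<in>F. ?t i j * x j * y i)"
    by (rule sum.mono_neutral_right) (use F in auto)
  also have "\<dots> = (\<Sum>i\<in>F \<inter> E. \<Sum>j\<in>F \<inter> E. ?t i j * x j * y i)"
    by (intro sum.cong refl sum.mono_neutral_right) (use F in auto)
  also have "\<dots> = (\<Sum>i\<in>F \<inter> E. \<Sum>j\<in>F \<inter> E. T i j * x j * y i)" by (intro sum.cong refl) auto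
  finally have e: "(\<Sum>i\<in>F. \<Sum>j\<in>F. ?t i j * x j * y i) = (\<Sum>i\<in>F \<inter> E. \<Sum>j\<in>F \<inter> E. T i j * x j * y i)" .
  have "bilinear_bound p q (F \<inter> E) (F \<inter> E) (\<lambda>i j. T (id i) (id j)) 1"
    by (rule bilinear_bound_inject[OF T E E p]) auto
  then have le: "cmod (\<Sum>i\<in>F \<inter> E. \<Sum>j\<in>F \<inter> E. T i j * x j * y i) \<le> 1 * fin_norm p (F \<inter> E) x * fin_norm q (F \<inter> E) y"
    using bilinear_boundD[of p q "F \<inter> E" "F \<inter> E" T 1 x y] by simp
  have mono: "fin_norm r (F \<inter> E) z \<le> fin_norm r F z" if "0 < r" for r and z :: "'a \<Rightarrow> complex"
    unfolding fin_norm_def by (rule powr_mono2) (use that F in \<open>auto intro: sum_mono2 sum_nonneg\<close>)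
  have "1 * fin_norm p (F \<inter> E) x * fin_norm q (F \<inter> E) y \<le> 1 * fin_norm p F x * fin_norm q F y"
    using mono[OF p(1)] mono[OF p(2)] by (intro mult_mono) auto
  with le show "cmod (\<Sum>i\<in>F. \<Sum>j\<in>F. ?t i j * x j * y i) \<le> 1 * fin_norm p F x * fin_norm q F y"
    unfolding e by (rule order_trans)
qed

text \<open>A finite contraction extended by zero is a contraction on all of l_p, and the finite
  section of its Schur product is what has to be bounded. This recovers \<open>schur_bd\<close> with
  the exact norm as constant.\<close>

lemma Vp_norm_imp_schur_bd:
  assumes V: "Vp_discrete p \<psi>" and n: "Vp_norm p \<psi> \<le> ereal C" and pq: "conj_pair p q" and C: "0 \<le> C"
  shows "schur_bd p q C \<psi>"
  unfolding schur_bd_def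
proof (intro allI impI, elim conjE)
  fix F :: "'a set" and T :: "'a \<Rightarrow> 'a \<Rightarrow> complex" assume F: "finite F" and T: "bilinear_bound p q F F T 1"
  note p = conj_pairD[OF pq]
  define t where "t i j = (if i \<in> F \<and> j \<in> F then T i j else 0)" for i j
  have b: "bilinear_bound p q E E t 1" if "finite E" for E
    unfolding t_def by (rule bilinear_bound_extend[OF T F that p(3,4)])
  have tb: "lp_bdd_op p (mat_op t)" by (rule lp_bdd_mat_op[OF b pq]) auto
  have tn: "lp_opnorm p (mat_op t) \<le> ereal 1" by (rule lp_opnorm_leI[OF lp_norm_mat_op[OF b pq]]) auto
  define S0 where "S0 = (SOME S. schur_op p \<psi> (mat_op t) S)"
  have "schur_op p \<psi> (mat_op t) S0" unfolding S0_def by (rule someI_ex[OF V[unfolded Vp_discrete_def, rule_format, OF tb]])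
  then have S0: "lp_bdd_op p S0" "\<And>i j. S0 (delta j) i = \<psi> (i, j) * t i j" unfolding schur_op_def by (auto simp: mat_op_delta)
  have "lp_opnorm p S0 \<le> Vp_norm p \<psi>" unfolding Vp_norm_def S0_def
    by (rule Sup_upper, rule CollectI, rule exI[of _ "mat_op t"]) (use tb tn in \<open>simp add: one_ereal_def\<close>)
  then have "lp_opnorm p S0 \<le> ereal C" using n by (rule order_trans)
  then have "bilinear_bound p q F F (\<lambda>i j. S0 (delta j) i) C"
    by (intro lp_op_bilinear_bound[OF S0(1) pq C _ F] lp_opnorm_leD[OF S0(1) p(1) _ C])
  then show "bilinear_bound p q F F (\<lambda>i j. \<psi> (i, j) * T i j) C"
    by (rule iffD1[OF bilinear_bound_cong, rotated]) (simp add: S0(2) t_def)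
qed

section \<open>A uniform Schur bound from translation invariance\<close>

lemma sum_cut_powr_le:
  assumes "finite J" "\<And>N. N \<in> J \<Longrightarrow> i \<in> E N \<Longrightarrow> N = N0" "0 < p"
  shows "(\<Sum>N\<in>J. cmod (cut (E N) x i) powr p) \<le> cmod (x i) powr p"
proof -
  have "(\<Sum>N\<in>J. cmod (cut (E N) x i) powr p) \<le> (\<Sum>N\<in>J. if N = N0 then cmod (x i) powr p else 0)"
    by (rule sum_mono) (use assms in \<open>auto simp: cut_def\<close>)
  also have "\<dots> \<le> cmod (x i) powr p" using assms(1) by simp
  finally show ?thesis .
qed

text \<open>Blocks over disjoint sets E N act on disjoint pieces of the two vectors; Hoelder over
  the blocks, with exponents q and p, shows that the norm of the sum is the largest block norm. The
  function \<open>idx\<close> names the block containing an index.\<close>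

lemma bilinear_bound_block_diagonal:
  fixes T :: "nat \<Rightarrow> 'a \<Rightarrow> 'a \<Rightarrow> complex"
  assumes E: "\<And>N. finite (E N)" and idx: "\<And>N i. i \<in> E N \<Longrightarrow> idx i = N"
    and T: "\<And>N. bilinear_bound p q (E N) (E N) (T N) 1" and F: "finite F" and pq: "conj_pair p q"
  shows "bilinear_bound p q F F (\<lambda>i j. if i \<in> E (idx i) \<and> j \<in> E (idx i) then T (idx i) i j else 0) 1"
  unfolding bilinear_bound_def
proof (intro allI)
  fix x y :: "'a \<Rightarrow> complex"
  note p = conj_pairD[OF pq]
  let ?t = "\<lambda>N i j. if i \<in> E N \<and> j \<in> E N then T N i j else 0"
  define J where "J = idx ` F"
  have J: "finite J" using F by (simp add: J_def)
  have t: "?t (idx i) i j = (\<Sum>N\<in>J. ?t N i j)" if "i \<in> F" for i j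
  proof -
    have "(\<Sum>N\<in>J. ?t N i j) = (\<Sum>N\<in>{idx i}. ?t N i j)"
      by (rule sum.mono_neutral_right[OF J]) (use that idx in \<open>auto simp: J_def\<close>)
    then show ?thesis by simp
  qed
  have "(\<Sum>i\<in>F. \<Sum>j\<in>F. ?t (idx i) i j * x j * y i) = (\<Sum>i\<in>F. \<Sum>j\<in>F. \<Sum>N\<in>J. ?t N i j * x j * y i)"
    by (intro sum.cong refl) (simp only: t sum_distrib_right)
  also have "\<dots> = (\<Sum>i\<in>F. \<Sum>N\<in>J. \<Sum>j\<in>F. ?t N i j * x j * y i)" by (intro sum.cong refl sum.swap)
  also have "\<dots> = (\<Sum>N\<in>J. \<Sum>i\<in>F. \<Sum>j\<in>F. ?t N i j * x j * y i)" by (rule sum.swap)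
  also have "\<dots> = (\<Sum>N\<in>J. \<Sum>i\<in>F. \<Sum>j\<in>F. ?t N i j * cut (E N) x j * cut (E N) y i)"
    by (intro sum.cong refl) (simp add: cut_def)
  finally have e: "(\<Sum>i\<in>F. \<Sum>j\<in>F. ?t (idx i) i j * x j * y i) = (\<Sum>N\<in>J. \<Sum>i\<in>F. \<Sum>j\<in>F. ?t N i j * cut (E N) x j * cut (E N) y i)" .
  have Nb: "(\<Sum>N\<in>J. fin_norm r F (cut (E N) z) powr r) powr (1 / r) \<le> fin_norm r F z" if r: "0 < r" for r and z :: "'a \<Rightarrow> complex"
  proof -
    have "(\<Sum>N\<in>J. fin_norm r F (cut (E N) z) powr r) = (\<Sum>N\<in>J. \<Sum>i\<in>F. cmod (cut (E N) z i) powr r)"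
      using r by (simp add: fin_norm_powr)
    also have "\<dots> = (\<Sum>i\<in>F. \<Sum>N\<in>J. cmod (cut (E N) z i) powr r)" by (rule sum.swap)
    also have "\<dots> \<le> (\<Sum>i\<in>F. cmod (z i) powr r)"
      by (intro sum_mono, rule_tac sum_cut_powr_le[OF J _ r], erule idx[symmetric])
    finally show ?thesis unfolding fin_norm_def[of r F z] using r by (intro powr_mono2 sum_nonneg) auto
  qed
  have "cmod (\<Sum>N\<in>J. \<Sum>i\<in>F. \<Sum>j\<in>F. ?t N i j * cut (E N) x j * cut (E N) y i) \<le> (\<Sum>N\<in>J. fin_norm q F (cut (E N) y) * fin_norm p F (cut (E N) x))"
  proof (rule sum_norm_le)
    fix N
    show "cmod (\<Sum>i\<in>F. \<Sum>j\<in>F. ?t N i j * cut (E N) x j * cut (E N) y i) \<le> fin_norm q F (cut (E N) y) * fin_norm p F (cut (E N) x)"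
      using bilinear_boundD[OF bilinear_bound_extend[OF T[of N] E F p(3,4)], of "cut (E N) x" "cut (E N) y"] by (simp only: mult_1 mult.commute)
  qed
  also have "\<dots> \<le> (\<Sum>N\<in>J. fin_norm q F (cut (E N) y) powr q) powr (1/q) * (\<Sum>N\<in>J. fin_norm p F (cut (E N) x) powr p) powr (1/p)"
    by (rule Holder_fin_real[OF J pq]) auto
  also have "\<dots> \<le> fin_norm q F y * fin_norm p F x" by (intro mult_mono Nb p) auto
  finally show "cmod (\<Sum>i\<in>F. \<Sum>j\<in>F. ?t (idx i) i j * x j * y i) \<le> 1 * fin_norm p F x * fin_norm q F y"
    unfolding e by (simp only: mult_1 mult.commute)
qed

text \<open>Every entry of a contraction is bounded by 1, so over a finite index type the sum of all
  |\<psi>| serves as a crude constant. This settles finite groups, where disjoint translates run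
  out.\<close>

lemma schur_bd_finite_type:
  fixes \<psi> :: "'a \<times> 'a \<Rightarrow> complex"
  assumes fin: "finite (UNIV :: 'a set)" and p: "0 < p" "0 < q"
  shows "schur_bd p q (\<Sum>z\<in>UNIV. cmod (\<psi> z)) \<psi>"
  unfolding schur_bd_def bilinear_bound_def[of _ _ _ _ _ "\<Sum>z\<in>UNIV. cmod (\<psi> z)"]
proof (intro allI impI, elim conjE)
  fix F :: "'a set" and T :: "'a \<Rightarrow> 'a \<Rightarrow> complex" and x y :: "'a \<Rightarrow> complex"
  assume F: "finite F" and T: "bilinear_bound p q F F T 1"
  let ?N = "fin_norm p F x * fin_norm q F y"
  have entry: "cmod (T i j * x j * y i) \<le> ?N" if "i \<in> F" "j \<in> F" for i j
  proof -
    have "(\<Sum>a\<in>F. \<Sum>b\<in>F. T a b * cut {j} x b * cut {i} y a) = (\<Sum>a\<in>F. if a = i then (\<Sum>b\<in>F. if b = j then T i j * x j * y i else 0) else 0)"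
      by (intro sum.cong refl) (auto simp: cut_def intro!: sum.cong sum.neutral)
    also have "\<dots> = T i j * x j * y i" using F that by simp
    finally have "cmod (T i j * x j * y i) \<le> 1 * fin_norm p F (cut {j} x) * fin_norm q F (cut {i} y)"
      using bilinear_boundD[OF T, of "cut {j} x" "cut {i} y"] by simp
    also have "\<dots> \<le> 1 * fin_norm p F x * fin_norm q F y"
      using p by (intro mult_mono fin_norm_mono) (auto simp: cut_def)
    finally show ?thesis by simp
  qed
  have "cmod (\<Sum>i\<in>F. \<Sum>j\<in>F. \<psi> (i, j) * T i j * x j * y i) \<le> (\<Sum>i\<in>F. \<Sum>j\<in>F. cmod (\<psi> (i, j)) * ?N)"
  proof (intro sum_norm_le)
    fix i j assume ij: "i \<in> F" "j \<in> F"
    have "cmod (\<psi> (i, j) * T i j * x j * y i) = cmod (\<psi> (i, j)) * cmod (T i j * x j * y i)" by (simp add: norm_mult)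
    also have "\<dots> \<le> cmod (\<psi> (i, j)) * ?N" by (rule mult_left_mono[OF entry[OF ij]]) simp
    finally show "cmod (\<psi> (i, j) * T i j * x j * y i) \<le> cmod (\<psi> (i, j)) * ?N" .
  qed
  also have "\<dots> = (\<Sum>z\<in>F \<times> F. cmod (\<psi> z)) * ?N"
    by (simp add: sum.cartesian_product sum_distrib_right split_def)
  also have "\<dots> \<le> (\<Sum>z\<in>UNIV. cmod (\<psi> z)) * ?N"
    by (intro mult_right_mono sum_mono2) (use finite_Prod_UNIV[OF fin fin] in auto)
  finally show "cmod (\<Sum>i\<in>F. \<Sum>j\<in>F. \<psi> (i, j) * T i j * x j * y i) \<le> (\<Sum>z\<in>UNIV. cmod (\<psi> z)) * fin_norm p F x * fin_norm q F y"
    by (simp only: mult.assoc)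
qed

lemma Vp_discrete_bound:
  assumes V: "Vp_discrete p \<psi>" and pq: "conj_pair p q" and t: "\<And>F. finite F \<Longrightarrow> bilinear_bound p q F F t 1"
  shows "\<exists>K. \<forall>F. finite F \<longrightarrow> bilinear_bound p q F F (\<lambda>i j. \<psi> (i, j) * t i j) K"
proof -
  have tb: "lp_bdd_op p (mat_op t)" by (rule lp_bdd_mat_op[OF t pq]) auto
  obtain S where "schur_op p \<psi> (mat_op t) S" using V tb unfolding Vp_discrete_def by blast
  then have S: "lp_bdd_op p S" "\<And>i j. S (delta j) i = \<psi> (i, j) * t i j" unfolding schur_op_def by (auto simp: mat_op_delta)
  obtain K where K: "\<And>x. lp_mem p x \<Longrightarrow> lp_norm p (S x) \<le> K * lp_norm p x" using S(1) unfolding lp_bdd_op_def by blast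
  have le: "lp_norm p (S x) \<le> max K 0 * lp_norm p x" if "lp_mem p x" for x
    by (rule order_trans[OF K[OF that]]) (auto intro: mult_right_mono)
  show ?thesis
  proof (intro exI[of _ "max K 0"] allI impI)
    fix F :: "'a set" assume F: "finite F"
    have "bilinear_bound p q F F (\<lambda>i j. S (delta j) i) (max K 0)"
      by (rule lp_op_bilinear_bound[OF S(1) pq _ le F]) auto
    then show "bilinear_bound p q F F (\<lambda>i j. \<psi> (i, j) * t i j) (max K 0)" unfolding S(2) .
  qed
qed

text \<open>Greedy choice in an infinite group: at each step only finitely many right translations
  make the next finite set meet those already placed.\<close>

lemma disjoint_translates:
  fixes F :: "nat \<Rightarrow> 'g::group_add set"
  assumes inf: "infinite (UNIV :: 'g set)" and F: "\<And>n. finite (F n)"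
  shows "\<exists>r. \<forall>m n. m < n \<longrightarrow> (\<lambda>x. x + r m) ` F m \<inter> (\<lambda>x. x + r n) ` F n = {}"
proof -
  define P where "P n z \<longleftrightarrow> finite (snd z) \<and> (\<lambda>x. x + fst z) ` F n \<subseteq> snd z" for n and z :: "'g \<times> 'g set"
  define Q where "Q n z z' \<longleftrightarrow> snd z \<subseteq> snd z' \<and> (\<lambda>x. x + fst z') ` F (Suc n) \<inter> snd z = {}" for n and z z' :: "'g \<times> 'g set"
  have "\<exists>f. \<forall>n. P n (f n) \<and> Q n (f n) (f (Suc n))"
  proof (rule dependent_nat_choice)
    show "\<exists>z. P 0 z" by (rule exI[of _ "(0, F 0)"]) (use F in \<open>simp add: P_def\<close>)
    fix z n assume z: "P n z"
    have "finite ((\<lambda>(a, b). - a + b) ` (F (Suc n) \<times> snd z))" using F z by (simp add: P_def)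
    \<comment> \<open>A collision a + r = b would mean r = - a + b, so r is taken outside this
      finite set.\<close>
    then obtain r where r: "r \<notin> (\<lambda>(a, b). - a + b) ` (F (Suc n) \<times> snd z)" using ex_new_if_finite[OF inf] by blast
    have "a + r \<notin> snd z" if "a \<in> F (Suc n)" for a
    proof
      assume "a + r \<in> snd z"
      then have "- a + (a + r) \<in> (\<lambda>(a, b). - a + b) ` (F (Suc n) \<times> snd z)" using that by force
      then show False using r by (simp add: add.assoc[symmetric])
    qed
    then show "\<exists>z'. P (Suc n) z' \<and> Q n z z'"
      using z F by (intro exI[of _ "(r, snd z \<union> (\<lambda>x. x + r) ` F (Suc n))"]) (auto simp: P_def Q_def)
  qed
  then obtain f where f: "\<forall>n. P n (f n) \<and> Q n (f n) (f (Suc n))" ..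
  have mono: "snd (f m) \<subseteq> snd (f n)" if "m \<le> n" for m n
    using that by (rule lift_Suc_mono_le[rotated]) (use f in \<open>auto simp: Q_def\<close>)
  show ?thesis
  proof (intro exI[of _ "\<lambda>n. fst (f n)"] allI impI)
    fix m n :: nat assume mn: "m < n"
    then obtain k where k: "n = Suc k" "m \<le> k" by (cases n) auto
    have "(\<lambda>x. x + fst (f m)) ` F m \<subseteq> snd (f k)" using f[THEN spec, of m] mono[OF k(2)] by (auto simp: P_def)
    moreover have "(\<lambda>x. x + fst (f n)) ` F n \<inter> snd (f k) = {}" using f[THEN spec, of k] k(1) by (simp add: Q_def)
    ultimately show "(\<lambda>x. x + fst (f m)) ` F m \<inter> (\<lambda>x. x + fst (f n)) ` F n = {}" by blast
  qed
qed

text \<open>Gliding hump. Without a uniform constant there are, for every N, finite contractions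
  whose Schur product exceeds N; moved to disjoint right translates, where \<psi> takes the same
  values, they form one contraction whose Schur product would have to be bounded.\<close>

lemma translation_invariant_schur_bd:
  fixes \<psi> :: "'g::group_add \<times> 'g \<Rightarrow> complex"
  assumes V: "Vp_discrete p \<psi>" and inv: "\<And>s t r. \<psi> (s + r, t + r) = \<psi> (s, t)" and pq: "conj_pair p q"
  shows "\<exists>C\<ge>0. schur_bd p q C \<psi>"
proof (cases "finite (UNIV :: 'g set)")
  case True
  then show ?thesis using schur_bd_finite_type[OF True] conj_pairD[OF pq] 
    by (intro exI[of _ "\<Sum>z\<in>UNIV. cmod (\<psi> z)"] conjI sum_nonneg) auto
next
  case False
  show ?thesis
  proof (rule ccontr)
    note p = conj_pairD[OF pq]
    assume neg: "\<not> (\<exists>C\<ge>0. schur_bd p q C \<psi>)"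
    \<comment> \<open>The pair z consists of a finite set and a contraction on it whose Schur
      product violates the bound N.\<close>
    have "\<exists>z. finite (fst z) \<and> bilinear_bound p q (fst z) (fst z) (snd z) 1 \<and> \<not> bilinear_bound p q (fst z) (fst z) (\<lambda>i j. \<psi> (i, j) * snd z i j) (real N)" for N
    proof -
      have "\<not> schur_bd p q (real N) \<psi>" using neg by auto
      then obtain F T where "finite F" "bilinear_bound p q F F T 1" "\<not> bilinear_bound p q F F (\<lambda>i j. \<psi> (i, j) * T i j) (real N)"
        unfolding schur_bd_def by blast
      then show ?thesis by (intro exI[of _ "(F, T)"]) simp
    qed
    from choice[OF allI[OF this]] obtain z where z: "\<forall>N. finite (fst (z N)) \<and> bilinear_bound p q (fst (z N)) (fst (z N)) (snd (z N)) 1 \<and>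
       \<not> bilinear_bound p q (fst (z N)) (fst (z N)) (\<lambda>i j. \<psi> (i, j) * snd (z N) i j) (real N)" ..
    define F where "F N = fst (z N)" for N
    define T where "T N = snd (z N)" for N
    have FT: "finite (F N)" "bilinear_bound p q (F N) (F N) (T N) 1"
      "\<not> bilinear_bound p q (F N) (F N) (\<lambda>i j. \<psi> (i, j) * T N i j) (real N)" for N
      using z by (auto simp: F_def T_def)
    obtain r where r: "\<forall>m n. m < n \<longrightarrow> (\<lambda>x. x + r m) ` F m \<inter> (\<lambda>x. x + r n) ` F n = {}"
      using disjoint_translates[OF False FT(1)] ..
    define E where "E N = (\<lambda>x. x + r N) ` F N" for N
    have dj: "m = n" if "i \<in> E m" "i \<in> E n" for i m n
      using r[THEN spec, THEN spec, of m n] r[THEN spec, THEN spec, of n m] that unfolding E_def by (cases m n rule: linorder_cases) blast+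
    define idx where "idx i = (SOME N. i \<in> E N)" for i
    have idx: "idx i = N" if "i \<in> E N" for i N
      unfolding idx_def by (rule some_equality) (use that dj in auto)
    define T' where "T' N i j = T N (i + - r N) (j + - r N)" for N i j
    have E: "finite (E N)" for N unfolding E_def using FT(1) by simp
    have cancel: "x + a + - a = x" for x a :: 'g by (simp add: add.assoc)
    have T': "bilinear_bound p q (E N) (E N) (T' N) 1" for N
      unfolding T'_def by (rule bilinear_bound_inject[OF FT(2) FT(1) FT(1) p(3,4)]) (auto simp: E_def cancel inj_on_def)
    \<comment> \<open>All translated blocks together. Outside the union of the blocks
      \<open>idx\<close> is arbitrary, but the membership conditions then make the entry 0.\<close>
    define t where "t i j = (if i \<in> E (idx i) \<and> j \<in> E (idx i) then T' (idx i) i j else 0)" for i j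
    have "bilinear_bound p q G G t 1" if G: "finite G" for G
      unfolding t_def by (rule bilinear_bound_block_diagonal[OF E idx T' G pq])
    from Vp_discrete_bound[OF V pq this] obtain K where K: "\<forall>G. finite G \<longrightarrow> bilinear_bound p q G G (\<lambda>i j. \<psi> (i, j) * t i j) K" ..
    \<comment> \<open>The single constant K for the combined matrix, restricted to the N-th block
      and translated back, contradicts the choice of that block.\<close>
    obtain N :: nat where N: "K \<le> real N" using real_arch_simple by blast
    have "bilinear_bound p q (F N) (F N) (\<lambda>i j. \<psi> (i + r N, j + r N) * t (i + r N) (j + r N)) K"
      by (rule bilinear_bound_inject[OF K[rule_format, OF E[of N]] E E p(3,4)]) (auto simp: E_def inj_on_def)
    moreover have "\<psi> (i + r N, j + r N) * t (i + r N) (j + r N) = \<psi> (i, j) * T N i j" if "i \<in> F N" "j \<in> F N" for i j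
    proof -
      have m: "i + r N \<in> E N" "j + r N \<in> E N" using that by (auto simp: E_def)
      show ?thesis unfolding t_def idx[OF m(1)] T'_def inv cancel using m by simp
    qed
    ultimately have "bilinear_bound p q (F N) (F N) (\<lambda>i j. \<psi> (i, j) * T N i j) K"
      by (rule iffD1[OF bilinear_bound_cong, rotated])
    then show False using bilinear_bound_mono[OF _ N] FT(3)[of N] by blast
  qed
qed

section \<open>The two inclusions and equality of norms\<close>

context haar_group
begin

text \<open>The zero matrix of functions and the zero operator are admissible in the suprema, so the
  norm is never -\<infinity> and a finite value is a nonnegative real.\<close>

lemma Mcb_norm_nonneg: "0 \<le> Mcb_norm \<mu> p u"
proof -
  have zero: "bilinear_bound p q I J (\<lambda>i j. 0) 1" for I J :: "nat set" by (simp add: bilinear_bound_def)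
  have L0: "Lam (\<lambda>x. 0) (\<lambda>x. 0) = (\<lambda>s. 0)" by (simp add: Lam_def pairing_def fun_eq_iff)
  have rep: "Ap_rep \<mu> p (\<lambda>s. 0) (\<lambda>n x. 0) (\<lambda>n x. 0)"
    using Ap_rep_single(1)[of "\<lambda>x. 0" "\<lambda>x. 0"] unfolding L0 by simp
  have pp: "pm_pair \<mu> p T (\<lambda>s. 0) = 0" if "T \<in> PMp \<mu> p" for T
    unfolding pm_pair_eq[OF that rep] by (simp add: tfun_def pairing_def)
  have Ap0: "(\<lambda>s. 0) \<in> Ap \<mu> p" unfolding Ap_def using rep by blast
  have nt: "Ap_mat_norm \<mu> p 1 (\<lambda>i j s. 0) \<le> 1"
    unfolding Ap_mat_norm_def
  proof (rule Sup_least, elim CollectE exE conjE)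
    fix z m T assume z: "z = scal_mat_norm p (1 * m) (\<lambda>a b. pm_pair \<mu> p (T (a mod m) (b mod m)) (\<lambda>s. 0))"
      and m: "0 < m" and T: "\<forall>k<m. \<forall>l<m. T k l \<in> PMp \<mu> p"
    have e: "pm_pair \<mu> p (T (a mod m) (b mod m)) (\<lambda>s. 0) = 0" for a b by (rule pp) (use T m in simp)
    have "scal_mat_norm p (1 * m) (\<lambda>a b. 0) \<le> ereal 1" by (rule scal_mat_norm_leI[OF zero pq]) simp
    then show "z \<le> 1" unfolding z e by (simp only: one_ereal_def)
  qed
  have T1: "Lp_mat_norm \<mu> p 1 (\<lambda>k l. lam_op 0 (0 + - 0)) \<le> 1"
    by (rule lam_op_mat_norm[OF zero])
  have "0 \<le> scal_mat_norm p (1 * 1) (\<lambda>a b. pm_pair \<mu> p (lam_op 0 (0 + - 0)) (\<lambda>s. u s * 0))"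
  proof -
    have "0 \<le> ereal ((\<Sum>a<1*1::nat. (cmod (\<Sum>b<1*1::nat. pm_pair \<mu> p (lam_op 0 (0 + - 0)) (\<lambda>s. u s * 0) * (0::complex))) powr p) powr (1 / p))"
      by simp
    also have "\<dots> \<le> scal_mat_norm p (1 * 1) (\<lambda>a b. pm_pair \<mu> p (lam_op 0 (0 + - 0)) (\<lambda>s. u s * 0))"
      unfolding scal_mat_norm_def by (rule Sup_upper, rule CollectI, rule exI[of _ "\<lambda>b. 0"]) simp
    finally show ?thesis .
  qed
  also have "\<dots> \<le> Ap_mat_norm \<mu> p 1 (\<lambda>i j s. u s * 0)"
    unfolding Ap_mat_norm_def
    by (rule Sup_upper, rule CollectI, rule exI[of _ 1], rule exI[of _ "\<lambda>k l. lam_op 0 (0 + - 0)"])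
       (use T1 lam_op_PMp in simp)
  also have "\<dots> \<le> Mcb_norm \<mu> p u"
    unfolding Mcb_norm_def
    by (rule Sup_upper, rule CollectI, rule exI[of _ 1], rule exI[of _ "\<lambda>i j s. 0"]) (use nt Ap0 in simp)
  finally show ?thesis .
qed

text \<open>The gliding hump gives some constant, hence a finite V_p norm c;
  \<open>Vp_norm_imp_schur_bd\<close> then replaces the crude constant by c itself, which is what
  makes the norms agree.\<close>

lemma FSp_imp_Mcb:
  assumes "u \<in> FSp p"
  shows "u \<in> Mcb \<mu> p" "Mcb_norm \<mu> p u \<le> FSp_norm p u"
proof -
  let ?\<psi> = "\<lambda>(s, t). u (s + - t)"
  have V: "Vp_discrete p ?\<psi>" and cont: "continuous_on UNIV ?\<psi>" using assms by (auto simp: FSp_def Vp_group_def)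
  have "continuous_on UNIV (\<lambda>s. ?\<psi> (s, 0))"
    by (rule continuous_on_compose2[OF cont]) (auto intro!: continuous_intros)
  then have u: "continuous_on UNIV u" by simp
  have inv: "?\<psi> (s + r, t + r) = ?\<psi> (s, t)" for s t r by (simp add: add.assoc[symmetric] diff_conv_add_uminus minus_add del: add_uminus_conv_diff) (simp add: add.assoc)
  obtain C0 where C0: "0 \<le> C0" "schur_bd p q C0 ?\<psi>" using translation_invariant_schur_bd[OF V inv pq] by blast
  have "Vp_norm p ?\<psi> \<le> ereal C0" by (rule schur_bd_imp_Vp(2)[OF C0(2) pq C0(1)])
  then obtain c where c: "Vp_norm p ?\<psi> = ereal c" "0 \<le> c" using Vp_norm_nonneg[OF p1(1), of ?\<psi>] by (cases "Vp_norm p ?\<psi>") auto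
  have S: "schur_bd p q c ?\<psi>" by (rule Vp_norm_imp_schur_bd[OF V eq_refl[OF c(1)] pq c(2)])
  \<comment> \<open>c may be 0 whereas the multiplier theorem rescales by a positive constant, so c
    + e is used and e is sent to 0.\<close>
  have le: "Mcb_norm \<mu> p u \<le> ereal (c + e)" and mem: "u \<in> Mcb \<mu> p" if "0 < e" for e
    using schur_bd_imp_Mcb[OF u schur_bd_mono[OF S, of "c + e"]] that c(2) by auto
  show "u \<in> Mcb \<mu> p" by (rule mem[of 1]) simp
  have "Mcb_norm \<mu> p u \<le> ereal c"
    by (rule ereal_le_epsilon2) (use le in simp)
  then show "Mcb_norm \<mu> p u \<le> FSp_norm p u" unfolding FSp_norm_def c(1) .
qed

text \<open>Continuity of u makes the kernel jointly continuous, and the multiplier norm is directly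
  a Schur constant.\<close>

lemma Mcb_imp_FSp:
  assumes "u \<in> Mcb \<mu> p"
  shows "u \<in> FSp p" "FSp_norm p u \<le> Mcb_norm \<mu> p u"
proof -
  let ?\<psi> = "\<lambda>(s, t). u (s + - t)"
  have m: "\<And>a. a \<in> Ap \<mu> p \<Longrightarrow> (\<lambda>s. u s * a s) \<in> Ap \<mu> p" and fin: "Mcb_norm \<mu> p u < \<infinity>" using assms by (auto simp: Mcb_def)
  obtain c where c: "Mcb_norm \<mu> p u = ereal c" "0 \<le> c" using fin Mcb_norm_nonneg[of u] by (cases "Mcb_norm \<mu> p u") auto
  have u: "continuous_on UNIV u" by (rule Mcb_continuous[OF m])
  have "continuous_on UNIV (\<lambda>z. u (fst z + - snd z))"
    by (rule continuous_on_compose2[OF u]) (auto intro!: continuous_intros)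
  then have cont: "continuous_on UNIV ?\<psi>" by (simp add: split_def)
  have S: "schur_bd p q c ?\<psi>" by (rule Mcb_imp_schur_bd[OF m _ c(2)]) (simp_all add: c(1))
  show "u \<in> FSp p" using cont schur_bd_imp_Vp(1)[OF S pq c(2)] by (simp add: FSp_def Vp_group_def)
  show "FSp_norm p u \<le> Mcb_norm \<mu> p u" unfolding FSp_norm_def c(1) by (rule schur_bd_imp_Vp(2)[OF S pq c(2)])
qed

end

theorem theorem7p6:
  fixes \<mu> :: "'g::{topological_group_add, t2_space} measure" and p :: real
  assumes "locally_compact_space (euclidean :: 'g topology)"
    and "left_haar_measure \<mu>"
    and "1 < p"
  shows "FSp p = Mcb \<mu> p \<and> (\<forall>u\<in>FSp p. FSp_norm p u = Mcb_norm \<mu> p u)"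
proof -
  interpret haar_group \<mu> p "conj_exp p"
    by (rule haar_group.intro) (use assms conj_pair_conj_exp in auto)
  show ?thesis using FSp_imp_Mcb Mcb_imp_FSp by (blast intro: antisym)
qed

end
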